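(* Let $k_1,k_2\in\mathrm{Supp}_{BV}(Q)$, let $F,G\in\mathcal S(L_2(Q))$ with corresponding measures $f,g\in\mathcal M(L_2(Q))$, and let $\mathcal H=\{h_1,\dots,h_n\}$ be a finite sequence of functions in $\mathrm{Supp}_{BV}(Q)$. Let $\mathbf s(\mathcal H)\in\mathrm{Supp}_{BV}(Q)$ satisfy $\mathbf s(\mathcal H)^2=h_1^2+\cdots+h_n^2$ $m_L^2$-a.e. on $Q$, and assume that $\mathbf s(\mathcal H)^2=k_1k_2$ $m_L^2$-a.e. on $Q$. For $j\in\{1,2\}$ let $\mathbf s(\mathcal H,k_j)\in\mathrm{Supp}_{BV}(Q)$ satisfy $\mathbf s(\mathcal H,k_j)^2=h_1^2+\cdots+h_n^2+k_j^2$ $m_L^2$-a.e. on $Q$. Then, for all nonzero real $q$, $$\begin{aligned}&\Big(T_{q,k_1/\sqrt2}^{(1)}\big(T_{q,h_n/\sqrt2}^{(1)}(\cdots(T_{q,h_2/\sqrt2}^{(1)}(T_{q,h_1/\sqrt2}^{(1)}(F)))\cdots)\big)*T_{q,k_2/\sqrt2}^{(1)}\big(T_{q,h_n/\sqrt2}^{(1)}(\cdots(T_{q,h_2/\sqrt2}^{(1)}(T_{q,h_1/\sqrt2}^{(1)}(G)))\cdots)\big)\Big)_{-q}^{(k_1,k_2)}(y)\\&=\Big(T_{q,\mathbf s(\mathcal H,k_1)/\sqrt2}^{(1)}(F)*T_{q,\mathbf s(\mathcal H,k_2)/\sqrt2}^{(1)}(G)\Big)_{-q}^{(k_1,k_2)}(y)\\&=T_{q,\mathbf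 s(\mathcal H)}^{(1)}\Big(F\Big(\frac{\cdot}{\sqrt2}\Big)G\Big(\frac{\cdot}{\sqrt2}\Big)\Big)(y)\end{aligned}$$ for s-a.e. $y\in C_0(Q)$.
   Context: Fix $S,T>0$, let $Q=[0,S]\times[0,T]$, $m_L^2$ = Lebesgue measure on $Q$, and $L_2(Q)$ the real Hilbert space with inner product $(\cdot,\cdot)_2$ and norm $\|\cdot\|_2$. $C_0(Q)$ is the space of real continuous $x$ on $Q$ with $x(s,0)=x(0,t)=0$, with (completed) Yeh--Wiener measure $m_{\mathrm y}$, i.e. the centered Gaussian measure with $\int x(s,t)x(s',t')\,dm_{\mathrm y}(x)=\min(s,s')\min(t,t')$. A set $E$ is scale-invariant measurable if $\rho E$ is measurable for every $\rho>0$, a scale-invariant measurable set $N$ is scale-invariant null if $m_{\mathrm y}(\rho N)=0$ for every $\rho>0$; "s-a.e." means off a scale-invariant null set. A functional $F$ is scale-invariant measurable if it is defined on a scale-invariant measurable set and $F(\rho\,\cdot)$ is measurable for every $\rho>0$. PWZ integral: fix a complete orthonormal set $\{\phi_n\}$ of $L_2(Q)$ consisting of functions of bounded variation (Hardy--Krause sense); for $v\in L_2(Q)$, $\langle v,x\rangle=\lim_{n}\int_Q\sum_{j=1}^n(v,\phi_j)_2\phi_j\,dx$ where the limit exists (it exists for s-a.e. $x$ and is essentially independent of $\{\phi_n\}$). $\mathrm{Supp}_{BV}(Q)$ is the set of real functions $h$ on $Q$ of bounded variation (Hardy--Krause sense) with $h\neq0$ $m_L^2$-a.e. For such $h$, $\mathcal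 Y_h(x;s,t)=\langle\chi_{[0,s]\times[0,t]}h,x\rangle$; its sample paths $\mathcal Y_h(x;\cdot,\cdot)$ lie in $C_0(Q)$. $\mathcal M(L_2(Q))$ is the space of complex countably additive Borel measures on $L_2(Q)$. $\mathcal S(L_2(Q))$ is the set of functionals $F$ on $C_0(Q)$ of the form $F(x)=\int_{L_2(Q)}\exp\{i\langle u,x\rangle\}df(u)$ for s-a.e. $x$, for some $f\in\mathcal M(L_2(Q))$. Evaluation along Gaussian paths uses this formula together with $\langle u,\mathcal Y_h(x;\cdot,\cdot)\rangle=\langle uh,x\rangle$, i.e. for real $b,c$, $F(by+c\mathcal Y_h(x;\cdot,\cdot))=\int\exp\{ib\langle u,y\rangle+ic\langle uh,x\rangle\}df(u)$. $F(\cdot/\sqrt2)G(\cdot/\sqrt2)$ denotes the functional $x\mapsto F(x/\sqrt2)G(x/\sqrt2)$. Transform: let $\mathbb C_+=\{\mathrm{Re}\,\lambda>0\}$ and $h\in\mathrm{Supp}_{BV}(Q)$. $T_{\lambda,h}(F)(y)$, $\lambda\in\mathbb C_+$, is the analytic continuation to $\mathbb C_+$ (if it exists) of $\lambda\mapsto\int_{C_0(Q)}F(y+\lambda^{-1/2}\mathcal Y_h(x;\cdot,\cdot))dm_{\mathrm y}(x)$, $\lambda>0$. For real $q\ne0$, $T_{q,h}^{(1)}(F)(y)=\lim_{\lambda\to-iq,\,\lambda\in\mathbb C_+}T_{\lambda,h}(F)(y)$ for s-a.e. $y$, whenever this limit exists. For $F\in\mathcal S(L_2(Q))$ it exists and belongs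 to $\mathcal S(L_2(Q))$. Convolution product: for $k_1,k_2\in\mathrm{Supp}_{BV}(Q)$ and real $q\neq0$, $(F*G)_q^{(k_1,k_2)}(y)$ is the limit as $\lambda\to-iq$, $\lambda\in\mathbb C_+$, of the analytic continuation to $\mathbb C_+$ of $$\lambda\mapsto\int_{C_0(Q)}F\Big(\tfrac{y+\lambda^{-1/2}\mathcal Y_{k_1}(x;\cdot,\cdot)}{\sqrt2}\Big)G\Big(\tfrac{y-\lambda^{-1/2}\mathcal Y_{k_2}(x;\cdot,\cdot)}{\sqrt2}\Big)dm_{\mathrm y}(x),\quad\lambda>0,$$ if it exists. For $F,G\in\mathcal S(L_2(Q))$ this product exists for s-a.e. $y$ and belongs to $\mathcal S(L_2(Q))$. *)

theory Defs
  imports "HOL-Probability.Probability"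
begin

type_synonym plane_fun = "real \<times> real \<Rightarrow> real"

definition rect :: "real \<Rightarrow> real \<Rightarrow> (real \<times> real) set" where
  "rect S T = {0..S} \<times> {0..T}"

text \<open>
  As usual in HOL, the elements of \<open>L\<^sub>2(Q)\<close> are represented by functions rather than classes
  (values outside the rectangle are irrelevant), and \<open>l2_norm\<close> is a seminorm whose null space
  consists of the functions vanishing a.e.  Sets that are open for the seminorm are unions of
  a.e.-classes, so \<open>borel_L2\<close> is the pull-back of the Borel sigma-algebra of the Hilbert space
  \<open>L\<^sub>2(Q)\<close>, and complex measures on the two sigma-algebras correspond bijectively.
\<close>

definition L2 :: "real \<Rightarrow> real \<Rightarrow> plane_fun set" where
  "L2 S T = {u \<in> borel_measurable (lebesgue_on (rect S T)).
               integrable (lebesgue_on (rect S T)) (\<lambda>p. (u p)\<^sup>2)}"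

definition l2_inner :: "real \<Rightarrow> real \<Rightarrow> plane_fun \<Rightarrow> plane_fun \<Rightarrow> real" where
  "l2_inner S T u v = (LINT p|lebesgue_on (rect S T). u p * v p)"

definition l2_norm :: "real \<Rightarrow> real \<Rightarrow> plane_fun \<Rightarrow> real" where
  "l2_norm S T u = sqrt (l2_inner S T u u)"

definition borel_L2 :: "real \<Rightarrow> real \<Rightarrow> plane_fun measure" where
  "borel_L2 S T = sigma (L2 S T)
     {U. U \<subseteq> L2 S T \<and>
         (\<forall>u\<in>U. \<exists>e>0. \<forall>v\<in>L2 S T. l2_norm S T (\<lambda>p. v p - u p) < e \<longrightarrow> v \<in> U)}"

text \<open>
  A complex measure on the sigma-algebra of \<open>M\<close> (only \<open>sets M\<close> matters) is a countably additive
  set function; \<open>f {} = 0\<close> follows by taking all \<open>A n\<close> empty.  Integrals are defined through the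
  Jordan decompositions of the real and imaginary parts.
\<close>

definition complex_measure :: "'a measure \<Rightarrow> ('a set \<Rightarrow> complex) \<Rightarrow> bool" where
  "complex_measure M f \<longleftrightarrow>
     (\<forall>A :: nat \<Rightarrow> 'a set. range A \<subseteq> sets M \<longrightarrow> disjoint_family A \<longrightarrow>
        (\<lambda>n. f (A n)) sums f (\<Union>n. A n))"

definition positive_variation :: "'a measure \<Rightarrow> ('a set \<Rightarrow> real) \<Rightarrow> 'a measure" where
  "positive_variation M \<nu> =
     measure_of (space M) (sets M) (\<lambda>E. SUP A\<in>{A \<in> sets M. A \<subseteq> E}. ennreal (\<nu> A))"

definition signed_integral ::
    "'a measure \<Rightarrow> ('a set \<Rightarrow> real) \<Rightarrow> ('a \<Rightarrow> complex) \<Rightarrow> complex" where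
  "signed_integral M \<nu> g =
     (LINT u|positive_variation M \<nu>. g u) - (LINT u|positive_variation M (\<lambda>A. - \<nu> A). g u)"

definition complex_integral ::
    "'a measure \<Rightarrow> ('a set \<Rightarrow> complex) \<Rightarrow> ('a \<Rightarrow> complex) \<Rightarrow> complex" where
  "complex_integral M f g =
     signed_integral M (\<lambda>A. Re (f A)) g + \<i> * signed_integral M (\<lambda>A. Im (f A)) g"

definition partition :: "real \<Rightarrow> nat \<Rightarrow> (nat \<Rightarrow> real) \<Rightarrow> bool" where
  "partition L m s \<longleftrightarrow> s 0 = 0 \<and> s m = L \<and> (\<forall>i<m. s i < s (Suc i))"

definition rect_diff :: "plane_fun \<Rightarrow> real \<Rightarrow> real \<Rightarrow> real \<Rightarrow> real \<Rightarrow> real" where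
  "rect_diff g a b c d = g (b, d) - g (a, d) - g (b, c) + g (a, c)"

definition bv_1d :: "real \<Rightarrow> (real \<Rightarrow> real) \<Rightarrow> bool" where
  "bv_1d L g \<longleftrightarrow>
     (\<exists>K. \<forall>m s. partition L m s \<longrightarrow> (\<Sum>i<m. \<bar>g (s (Suc i)) - g (s i)\<bar>) \<le> K)"

definition bv_vitali :: "real \<Rightarrow> real \<Rightarrow> plane_fun \<Rightarrow> bool" where
  "bv_vitali S T g \<longleftrightarrow>
     (\<exists>K. \<forall>m n s t. partition S m s \<longrightarrow> partition T n t \<longrightarrow>
        (\<Sum>i<m. \<Sum>j<n. \<bar>rect_diff g (s i) (s (Suc i)) (t j) (t (Suc j))\<bar>) \<le> K)"

text \<open>
  Given finite Vitali variation, bounded variation of one section in each direction implies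
  bounded variation of all of them, with a uniform bound.
\<close>

definition bv_hardy_krause :: "real \<Rightarrow> real \<Rightarrow> plane_fun \<Rightarrow> bool" where
  "bv_hardy_krause S T g \<longleftrightarrow>
     bv_vitali S T g \<and>
     (\<exists>t\<in>{0..T}. bv_1d S (\<lambda>s. g (s, t))) \<and>
     (\<exists>s\<in>{0..S}. bv_1d T (\<lambda>t. g (s, t)))"

definition Supp_BV :: "real \<Rightarrow> real \<Rightarrow> plane_fun set" where
  "Supp_BV S T = {h. bv_hardy_krause S T h \<and> (AE p in lebesgue_on (rect S T). h p \<noteq> 0)}"

text \<open>Paths are extended by zero outside the rectangle, so that they are determined by their
  values on it and pointwise linear combinations of paths are paths.\<close>

definition C0 :: "real \<Rightarrow> real \<Rightarrow> plane_fun set" where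
  "C0 S T = {x. continuous_on (rect S T) x \<and>
                (\<forall>s\<in>{0..S}. x (s, 0) = 0) \<and> (\<forall>t\<in>{0..T}. x (0, t) = 0) \<and>
                (\<forall>p. p \<notin> rect S T \<longrightarrow> x p = 0)}"

text \<open>
  \<open>yeh_wiener S T W\<close> characterizes the completed Yeh--Wiener measure: before completion it lives
  on the sigma-algebra generated by the evaluations, every finite linear combination of
  evaluations is centered normal (possibly degenerate, \<open>\<sigma> = 0\<close>), and the covariance is
  \<open>min s s' * min t t'\<close>.
\<close>

definition yeh_wiener :: "real \<Rightarrow> real \<Rightarrow> plane_fun measure \<Rightarrow> bool" where
  "yeh_wiener S T W \<longleftrightarrow>
     (\<exists>W0. W = completion W0 \<and> prob_space W0 \<and>
        sets W0 = sets (restrict_space (Pi\<^sub>M UNIV (\<lambda>_. borel)) (C0 S T)) \<and>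
        (\<forall>I a. finite I \<longrightarrow> I \<subseteq> rect S T \<longrightarrow>
           (\<exists>\<sigma>\<ge>0. distr W0 borel (\<lambda>x. \<Sum>p\<in>I. a p * x p) =
                   distr std_normal_distribution borel (\<lambda>z. \<sigma> * z))) \<and>
        (\<forall>s\<in>{0..S}. \<forall>s'\<in>{0..S}. \<forall>t\<in>{0..T}. \<forall>t'\<in>{0..T}.
           (LINT x|W0. x (s, t) * x (s', t')) = min s s' * min t t'))"

definition scale_null :: "plane_fun measure \<Rightarrow> plane_fun set \<Rightarrow> bool" where
  "scale_null W N \<longleftrightarrow> N \<subseteq> space W \<and> (\<forall>\<rho>>0. (\<lambda>x p. \<rho> * x p) ` N \<in> null_sets W)"

definition s_ae :: "plane_fun measure \<Rightarrow> (plane_fun \<Rightarrow> bool) \<Rightarrow> bool" where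
  "s_ae W P \<longleftrightarrow> (\<exists>N. scale_null W N \<and> (\<forall>x\<in>space W - N. P x))"

text \<open>
  Riemann--Stieltjes integral of \<open>g\<close> against \<open>x\<close> over the rectangle.  The tags form a grid
  \<open>(\<xi> i, \<eta> j)\<close>: if each cell could choose its tag independently, the limit would fail to
  exist for continuous \<open>x\<close> already when \<open>g\<close> is the indicator of a half-plane.
\<close>

definition has_rs_integral :: "real \<Rightarrow> real \<Rightarrow> plane_fun \<Rightarrow> plane_fun \<Rightarrow> real \<Rightarrow> bool" where
  "has_rs_integral S T g x I \<longleftrightarrow>
     (\<forall>e>0. \<exists>d>0. \<forall>m n s t \<xi> \<eta>.
        partition S m s \<longrightarrow> partition T n t \<longrightarrow>
        (\<forall>i<m. s (Suc i) - s i < d \<and> \<xi> i \<in> {s i..s (Suc i)}) \<longrightarrow>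
        (\<forall>j<n. t (Suc j) - t j < d \<and> \<eta> j \<in> {t j..t (Suc j)}) \<longrightarrow>
        \<bar>(\<Sum>i<m. \<Sum>j<n. g (\<xi> i, \<eta> j) * rect_diff x (s i) (s (Suc i)) (t j) (t (Suc j))) - I\<bar> < e)"

definition rs_integral :: "real \<Rightarrow> real \<Rightarrow> plane_fun \<Rightarrow> plane_fun \<Rightarrow> real" where
  "rs_integral S T g x = (THE I. has_rs_integral S T g x I)"

definition bv_orthonormal_basis :: "real \<Rightarrow> real \<Rightarrow> (nat \<Rightarrow> plane_fun) \<Rightarrow> bool" where
  "bv_orthonormal_basis S T \<phi> \<longleftrightarrow>
     (\<forall>n. \<phi> n \<in> L2 S T \<and> bv_hardy_krause S T (\<phi> n)) \<and>
     (\<forall>m n. l2_inner S T (\<phi> m) (\<phi> n) = (if m = n then 1 else 0)) \<and>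
     (\<forall>u\<in>L2 S T. (\<forall>n. l2_inner S T u (\<phi> n) = 0) \<longrightarrow>
        (AE p in lebesgue_on (rect S T). u p = 0))"

text \<open>The Paley--Wiener--Zygmund integral \<open>\<langle>v, x\<rangle>\<close> relative to the basis \<open>\<phi>\<close>; the value is
  meaningful only where the limit exists.\<close>

definition pwz :: "real \<Rightarrow> real \<Rightarrow> (nat \<Rightarrow> plane_fun) \<Rightarrow> plane_fun \<Rightarrow> plane_fun \<Rightarrow> real" where
  "pwz S T \<phi> v x =
     lim (\<lambda>n. rs_integral S T (\<lambda>p. \<Sum>j<n. l2_inner S T v (\<phi> j) * \<phi> j p) x)"

definition gauss_path ::
    "real \<Rightarrow> real \<Rightarrow> (nat \<Rightarrow> plane_fun) \<Rightarrow> plane_fun \<Rightarrow> plane_fun \<Rightarrow> plane_fun" where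
  "gauss_path S T \<phi> h x = (\<lambda>(s, t).
     if (s, t) \<in> rect S T
     then pwz S T \<phi> (\<lambda>p. indicator ({0..s} \<times> {0..t}) p * h p) x else 0)"

text \<open>\<open>F\<close> has corresponding measure \<open>f\<close>.\<close>

definition corresponds ::
    "real \<Rightarrow> real \<Rightarrow> (nat \<Rightarrow> plane_fun) \<Rightarrow> plane_fun measure \<Rightarrow>
     (plane_fun \<Rightarrow> complex) \<Rightarrow> (plane_fun set \<Rightarrow> complex) \<Rightarrow> bool" where
  "corresponds S T \<phi> W F f \<longleftrightarrow>
     complex_measure (borel_L2 S T) f \<and>
     s_ae W (\<lambda>x. F x =
       complex_integral (borel_L2 S T) f (\<lambda>u. exp (\<i> * complex_of_real (pwz S T \<phi> u x))))"

definition SL2 ::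
    "real \<Rightarrow> real \<Rightarrow> (nat \<Rightarrow> plane_fun) \<Rightarrow> plane_fun measure \<Rightarrow> (plane_fun \<Rightarrow> complex) set" where
  "SL2 S T \<phi> W = {F. \<exists>f. corresponds S T \<phi> W F f}"

text \<open>
  The value \<open>F(b y + c \<Y>\<^sub>h(x))\<close>.  A member of the class \<open>SL2\<close> is specified only s-a.e., and the
  law of the process \<open>\<Y>\<^sub>h\<close> may be carried by a scale-invariant null set, so pointwise evaluation
  of \<open>F\<close> along \<open>\<Y>\<^sub>h\<close> would depend on the choice of a representative.  By convention such a value
  is given by the corresponding measure together with \<open>\<langle>u, \<Y>\<^sub>h(x)\<rangle> = \<langle>u h, x\<rangle>\<close>; its
  values on the sigma-algebra are unique, by injectivity of the Fourier transform, and those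
  elsewhere are irrelevant.  Other functionals are evaluated pointwise.
\<close>

definition path_eval ::
    "real \<Rightarrow> real \<Rightarrow> (nat \<Rightarrow> plane_fun) \<Rightarrow> plane_fun measure \<Rightarrow>
     (plane_fun \<Rightarrow> complex) \<Rightarrow> real \<Rightarrow> plane_fun \<Rightarrow> real \<Rightarrow> plane_fun \<Rightarrow> plane_fun \<Rightarrow> complex" where
  "path_eval S T \<phi> W F b y c h x =
     (if F \<in> SL2 S T \<phi> W
      then complex_integral (borel_L2 S T) (SOME f. corresponds S T \<phi> W F f)
             (\<lambda>u. exp (\<i> * complex_of_real
                (b * pwz S T \<phi> u y + c * pwz S T \<phi> (\<lambda>p. u p * h p) x)))
      else F (\<lambda>p. b * y p + c * gauss_path S T \<phi> h x p))"

text \<open>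
  \<open>has_analytic_limit W q \<Phi> c\<close>: the function \<open>\<lambda> \<mapsto> \<integral> \<Phi> \<lambda> x dW(x)\<close>, \<open>\<lambda> > 0\<close>, exists, has an
  analytic continuation \<open>A\<close> to the right half-plane, and \<open>A\<close> tends to \<open>c\<close> as \<open>\<lambda> \<rightarrow> -iq\<close> there.
\<close>

definition has_analytic_limit ::
    "plane_fun measure \<Rightarrow> real \<Rightarrow> (real \<Rightarrow> plane_fun \<Rightarrow> complex) \<Rightarrow> complex \<Rightarrow> bool" where
  "has_analytic_limit W q \<Phi> c \<longleftrightarrow>
     (\<exists>A. A holomorphic_on {z. Re z > 0} \<and>
          (\<forall>r>0. integrable W (\<Phi> r) \<and> A (complex_of_real r) = (LINT x|W. \<Phi> r x)) \<and>
          (A \<longlongrightarrow> c) (at (- \<i> * complex_of_real q) within {z. Re z > 0}))"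

definition has_transform ::
    "real \<Rightarrow> real \<Rightarrow> (nat \<Rightarrow> plane_fun) \<Rightarrow> plane_fun measure \<Rightarrow> real \<Rightarrow> plane_fun \<Rightarrow>
     (plane_fun \<Rightarrow> complex) \<Rightarrow> plane_fun \<Rightarrow> complex \<Rightarrow> bool" where
  "has_transform S T \<phi> W q h F y c \<longleftrightarrow>
     has_analytic_limit W q (\<lambda>r x. path_eval S T \<phi> W F 1 y (1 / sqrt r) h x) c"

definition transform ::
    "real \<Rightarrow> real \<Rightarrow> (nat \<Rightarrow> plane_fun) \<Rightarrow> plane_fun measure \<Rightarrow> real \<Rightarrow> plane_fun \<Rightarrow>
     (plane_fun \<Rightarrow> complex) \<Rightarrow> plane_fun \<Rightarrow> complex" where
  "transform S T \<phi> W q h F y = (THE c. has_transform S T \<phi> W q h F y c)"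

definition has_convolution ::
    "real \<Rightarrow> real \<Rightarrow> (nat \<Rightarrow> plane_fun) \<Rightarrow> plane_fun measure \<Rightarrow> real \<Rightarrow> plane_fun \<Rightarrow> plane_fun \<Rightarrow>
     (plane_fun \<Rightarrow> complex) \<Rightarrow> (plane_fun \<Rightarrow> complex) \<Rightarrow> plane_fun \<Rightarrow> complex \<Rightarrow> bool" where
  "has_convolution S T \<phi> W q k1 k2 F G y c \<longleftrightarrow>
     has_analytic_limit W q
       (\<lambda>r x. path_eval S T \<phi> W F (1 / sqrt 2) y (1 / sqrt r / sqrt 2) k1 x *
              path_eval S T \<phi> W G (1 / sqrt 2) y (- (1 / sqrt r / sqrt 2)) k2 x) c"

abbreviation over_sqrt2 :: "plane_fun \<Rightarrow> plane_fun" where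
  "over_sqrt2 h \<equiv> \<lambda>p. h p / sqrt 2"

text \<open>\<open>T\<^sub>q\<^sub>,\<^sub>h\<^sub>n(\<dots>(T\<^sub>q\<^sub>,\<^sub>h\<^sub>1(F))\<dots>)\<close> for \<open>hs = [h\<^sub>1, \<dots>, h\<^sub>n]\<close>.\<close>

definition iterated_transform ::
    "real \<Rightarrow> real \<Rightarrow> (nat \<Rightarrow> plane_fun) \<Rightarrow> plane_fun measure \<Rightarrow> real \<Rightarrow> plane_fun list \<Rightarrow>
     (plane_fun \<Rightarrow> complex) \<Rightarrow> plane_fun \<Rightarrow> complex" where
  "iterated_transform S T \<phi> W q hs F = fold (\<lambda>h E. transform S T \<phi> W q h E) hs F"

end

theory Submission
  imports Defs "HOL-Complex_Analysis.Complex_Analysis"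
begin

text \<open>
  A member of \<open>SL2\<close> is an average \<open>\<integral> exp (\<i> \<langle>\<theta> \<omega>, x\<rangle>) D \<omega> d\<Omega>\<close> of plane waves.  For fixed \<open>u\<close>, the variable
  \<open>\<langle>u, x\<rangle>\<close> is centered normal with variance \<open>\<parallel>u\<parallel>\<^sup>2\<close>, being a series of independent normal variables,
  so by Fubini's theorem the analytically continued averages are explicit: a transform multiplies \<open>D\<close>
  by the phase \<open>exp (- \<i> \<parallel>u h\<parallel>\<^sup>2 / (2 q))\<close>, and the convolution at \<open>- q\<close> integrates over pairs \<open>(u, v)\<close> with
  the phase \<open>exp (\<i> \<parallel>u k\<^sub>1 - v k\<^sub>2\<parallel>\<^sup>2 / (4 q))\<close>.  The theorem is then the identity
  \<open>\<integral> u\<^sup>2 (s\<^sup>2 + k\<^sub>1\<^sup>2) + \<integral> v\<^sup>2 (s\<^sup>2 + k\<^sub>2\<^sup>2) - \<integral> (u k\<^sub>1 - v k\<^sub>2)\<^sup>2 = \<integral> s\<^sup>2 (u + v)\<^sup>2\<close> for \<open>s\<^sup>2 = k\<^sub>1 k\<^sub>2\<close>.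
  Evaluation along Gaussian paths refers to the representing measure, so its uniqueness is needed:
  a measure whose Fourier transform vanishes s-a.e. integrates all functions
  \<open>exp (- \<tau> \<parallel>u\<parallel>\<^sup>2 / 2 + (u, w))\<close> to zero, and these are closed under products and separate points.
\<close>

subsection \<open>Complex measures\<close>

text \<open>The obstacle is pointwise. \<open>pwz S T \<phi> u x\<close> is a limit that may fail to
  exist on an exceptional set of \<open>x\<close> depending on \<open>u\<close>, and without
  convergence it obeys no law, so convergence of the series in mean would not suffice. Almost sure
  convergence comes from Kolmogorov's inequality. Independence is available only through joint
  characteristic functions, from which the required orthogonality is extracted by a monotone class
  argument for complex densities; the same argument serves again for uniqueness of the representing
  measure. Fubini's theorem replaces the exceptional sets by one set of \<open>x\<close>, off which
  the series converges for almost every \<open>u\<close>. Riemann--Stieltjes integrals are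
  homogeneous in the path, so this set is invariant under dilations, and an invariant null set is
  scale-invariant null. Dilations also drive the uniqueness proof: multiplying two of the test
  functions adds their parameters \<tau>, so vanishing is needed at every scale
  \<open>\<rho> = sqrt \<tau>\<close>, and an s-a.e. identity supplies exactly that.\<close>

definition charge :: "'a measure \<Rightarrow> ('a set \<Rightarrow> real) \<Rightarrow> bool" where
  "charge M \<nu> \<longleftrightarrow>
     (\<forall>A :: nat \<Rightarrow> 'a set. range A \<subseteq> sets M \<longrightarrow> disjoint_family A \<longrightarrow>
        (\<lambda>n. \<nu> (A n)) sums \<nu> (\<Union>n. A n))"

text \<open>The positive part of \<open>\<nu>\<close> in its Jordan decomposition, taken over the
  reals. The supremum in \<open>positive_variation\<close> is formed in \<open>ennreal\<close>,
  where negative values become 0; the two agree because the empty set contributes 0 to both.\<close>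

definition upper_variation :: "'a measure \<Rightarrow> ('a set \<Rightarrow> real) \<Rightarrow> 'a set \<Rightarrow> real" where
  "upper_variation M \<nu> E = (SUP A\<in>{A \<in> sets M. A \<subseteq> E}. \<nu> A)"

context
  fixes M :: "'a measure" and \<nu> :: "'a set \<Rightarrow> real"
  assumes charge: "charge M \<nu>"
begin

lemma charge_sums:
  "range A \<subseteq> sets M \<Longrightarrow> disjoint_family A \<Longrightarrow> (\<lambda>n. \<nu> (A n)) sums \<nu> (\<Union>n::nat. A n)"
  using charge unfolding charge_def by blast

lemma charge_empty: "\<nu> {} = 0"
proof -
  have "(\<lambda>n::nat. \<nu> {}) sums \<nu> {}"
    using charge_sums[of "\<lambda>_. {}"] by (simp add: disjoint_family_on_def)
  then show ?thesis
    using sums_summable summable_const_iff by blast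
qed

lemma charge_Un:
  assumes "A \<in> sets M" "B \<in> sets M" "A \<inter> B = {}"
  shows "\<nu> (A \<union> B) = \<nu> A + \<nu> B"
proof -
  have "(\<lambda>n. \<nu> (binaryset A B n)) sums \<nu> (\<Union>n. binaryset A B n)"
    using assms by (intro charge_sums)
      (auto simp: binaryset_def disjoint_family_on_def)
  moreover have "(\<lambda>n. \<nu> (binaryset A B n)) sums (\<nu> A + \<nu> B)"
    using charge_empty by (rule binaryset_sums)
  ultimately show ?thesis
    by (simp add: UN_binaryset_eq sums_unique2)
qed

lemma charge_Diff:
  assumes "A \<in> sets M" "E \<in> sets M" "A \<subseteq> E"
  shows "\<nu> (E - A) = \<nu> E - \<nu> A"
  using charge_Un[of A "E - A"] assms by (simp add: Un_absorb1)

text \<open>Telescoping over the disjoint differences \<open>E n - E (Suc n)\<close> takes the place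
  of monotonicity, which a signed set function does not have.\<close>

lemma charge_decreasing:
  assumes E: "\<And>n. E n \<in> sets M" "\<And>n::nat. E (Suc n) \<subseteq> E n"
  shows "(\<lambda>n. \<nu> (E n)) \<longlonglongrightarrow> \<nu> (\<Inter>n. E n)"
proof -
  have dec: "E m \<subseteq> E n" if "n \<le> m" for m n
    using lift_Suc_antimono_le[of E n m] E(2) that by blast
  define A where "A n = E n - E (Suc n)" for n
  have "disjoint_family A"
    unfolding disjoint_family_on_def A_def
  proof safe
    fix m n x assume "m \<noteq> n" "x \<in> E m" "x \<notin> E (Suc m)" "x \<in> E n" "x \<notin> E (Suc n)"
    then show "x \<in> {}"
      using dec[of "Suc m" n] dec[of "Suc n" m] by (cases "m < n") auto
  qed
  then have sums: "(\<lambda>n. \<nu> (A n)) sums \<nu> (\<Union>n. A n)"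
    using E(1) by (intro charge_sums) (auto simp: A_def[abs_def])
  have un: "(\<Union>n. A n) = E 0 - (\<Inter>n. E n)"
  proof (intro equalityI subsetI)
    fix x assume "x \<in> (\<Union>n. A n)"
    then obtain n where "x \<in> E n" "x \<notin> E (Suc n)" by (auto simp: A_def)
    then show "x \<in> E 0 - (\<Inter>n. E n)" using dec[of 0 n] by auto
  next
    fix x assume "x \<in> E 0 - (\<Inter>n. E n)"
    then obtain m where x: "x \<in> E 0" "x \<notin> E m" by auto
    define k where "k = (LEAST m. x \<notin> E m)"
    have k: "x \<notin> E k" using x(2) unfolding k_def by (rule LeastI)
    with x(1) obtain l where l: "k = Suc l" by (cases k) auto
    have "x \<in> E l" using not_less_Least[of l "\<lambda>m. x \<notin> E m"] l unfolding k_def by auto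
    with k l show "x \<in> (\<Union>n. A n)" by (auto simp: A_def)
  qed
  have "(\<Sum>i<n. \<nu> (A i)) = \<nu> (E 0) - \<nu> (E n)" for n
    by (induct n) (auto simp: A_def charge_Diff E)
  then have "(\<lambda>n. \<nu> (E 0) - \<nu> (E n)) \<longlonglongrightarrow> \<nu> (E 0 - (\<Inter>n. E n))"
    using sums unfolding un sums_def by simp
  also have "\<nu> (E 0 - (\<Inter>n. E n)) = \<nu> (E 0) - \<nu> (\<Inter>n. E n)"
    using E by (intro charge_Diff) auto
  finally show ?thesis
    using tendsto_diff[OF tendsto_const[of "\<nu> (E 0)"]] by fastforce
qed

text \<open>If \<open>\<nu>\<close> were unbounded above, nested sets could be chosen on each of
  which it is still unbounded above, with values at least \<open>n\<close> in modulus; this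
  contradicts convergence of \<open>\<nu>\<close> along decreasing sequences.\<close>

lemma charge_bounded: "\<exists>B. \<forall>A\<in>sets M. \<nu> A \<le> B"
proof (rule ccontr)
  define bad where "bad E \<longleftrightarrow> E \<in> sets M \<and> (\<forall>B. \<exists>A\<in>sets M. A \<subseteq> E \<and> \<nu> A > B)" for E
  assume "\<not> ?thesis"
  then have bad0: "bad (space M)"
    unfolding bad_def not_less[symmetric] by (metis sets.sets_into_space sets.top)
  have step: "\<exists>E'. bad E' \<and> E' \<subseteq> E \<and> \<bar>\<nu> E'\<bar> \<ge> c" if "bad E" for E c
  proof -
    have E: "E \<in> sets M" using that by (simp add: bad_def)
    \<comment> \<open>A surplus over \<open>\<bar>c\<bar> + \<bar>\<nu> E\<bar>\<close> makes both
      \<open>\<nu> A\<close> and \<open>\<nu> (E - A) = \<nu> E - \<nu> A\<close> at least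
      \<open>c\<close> in modulus, so either of the two pieces may turn out to be the bad
      one.\<close>
    obtain A where A: "A \<in> sets M" "A \<subseteq> E" "\<nu> A > \<bar>c\<bar> + \<bar>\<nu> E\<bar>"
      using \<open>bad E\<close> unfolding bad_def by blast
    have "bad A \<or> bad (E - A)"
    proof (rule ccontr)
      assume "\<not> (bad A \<or> bad (E - A))"
      then obtain B1 B2 where
        B: "\<And>C. C \<in> sets M \<Longrightarrow> C \<subseteq> A \<Longrightarrow> \<nu> C \<le> B1"
           "\<And>C. C \<in> sets M \<Longrightarrow> C \<subseteq> E - A \<Longrightarrow> \<nu> C \<le> B2"
        using A(1) sets.Diff[OF E A(1)] unfolding bad_def not_less[symmetric] by metis
      obtain C where C: "C \<in> sets M" "C \<subseteq> E" "\<nu> C > B1 + B2"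
        using \<open>bad E\<close> unfolding bad_def by blast
      have "\<nu> C = \<nu> (C \<inter> A) + \<nu> (C - A)"
        using charge_Un[of "C \<inter> A" "C - A"] C A by (simp add: Int_Diff_disjoint Int_Diff_Un)
      also have "\<dots> \<le> B1 + B2"
        using B(1)[of "C \<inter> A"] B(2)[of "C - A"] A C by (intro add_mono) auto
      finally show False using C by simp
    qed
    moreover have "\<bar>\<nu> A\<bar> \<ge> c" "\<bar>\<nu> (E - A)\<bar> \<ge> c"
      using A charge_Diff[of A E] E by auto
    ultimately show ?thesis using A(2) by blast
  qed
  have "\<exists>E. \<forall>n. bad (E n) \<and> (E (Suc n) \<subseteq> E n \<and> \<bar>\<nu> (E (Suc n))\<bar> \<ge> real n)"
    by (rule dependent_nat_choice) (use bad0 step in blast)+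
  then obtain E where E: "\<And>n. bad (E n)" "\<And>n. E (Suc n) \<subseteq> E n"
     "\<And>n. \<bar>\<nu> (E (Suc n))\<bar> \<ge> real n" by auto
  have "(\<lambda>n. \<nu> (E n)) \<longlonglongrightarrow> \<nu> (\<Inter>n. E n)"
    using E by (intro charge_decreasing) (auto simp: bad_def)
  then have "Bseq (\<lambda>n. \<nu> (E n))"
    by (intro convergent_imp_Bseq convergentI)
  then obtain K where K: "\<And>n. \<bar>\<nu> (E n)\<bar> \<le> K"
    by (auto simp: Bseq_def)
  obtain n where "real n > K" using reals_Archimedean2 by blast
  with K[of "Suc n"] E(3)[of n] show False by simp
qed

lemma upper_variation_ge: "A \<in> sets M \<Longrightarrow> A \<subseteq> E \<Longrightarrow> \<nu> A \<le> upper_variation M \<nu> E"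
  unfolding upper_variation_def using charge_bounded
  by (intro cSUP_upper) (force simp: bdd_above_def)+

lemma upper_variation_le:
  "(\<And>A. A \<in> sets M \<Longrightarrow> A \<subseteq> E \<Longrightarrow> \<nu> A \<le> B) \<Longrightarrow> upper_variation M \<nu> E \<le> B"
  unfolding upper_variation_def by (intro cSUP_least) (auto intro: exI[of _ "{}"])

lemma upper_variation_nonneg: "0 \<le> upper_variation M \<nu> E"
  using upper_variation_ge[of "{}" E] charge_empty by simp

lemma upper_variation_mono: "E \<subseteq> E' \<Longrightarrow> upper_variation M \<nu> E \<le> upper_variation M \<nu> E'"
  by (intro upper_variation_le upper_variation_ge) auto

lemma upper_variation_Un:
  assumes "A \<in> sets M" "B \<in> sets M" "A \<inter> B = {}"
  shows "upper_variation M \<nu> A + upper_variation M \<nu> B \<le> upper_variation M \<nu> (A \<union> B)"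
proof -
  have "\<nu> X \<le> upper_variation M \<nu> (A \<union> B) - upper_variation M \<nu> B"
    if X: "X \<in> sets M" "X \<subseteq> A" for X
  proof -
    have "\<nu> Y \<le> upper_variation M \<nu> (A \<union> B) - \<nu> X" if Y: "Y \<in> sets M" "Y \<subseteq> B" for Y
      using charge_Un[of X Y] X Y assms upper_variation_ge[of "X \<union> Y" "A \<union> B"] by fastforce
    then show ?thesis using upper_variation_le[of B] by fastforce
  qed
  then show ?thesis using upper_variation_le[of A] by fastforce
qed

text \<open>Superadditivity on disjoint sets bounds the partial sums from above. Conversely a set
  \<open>B\<close> inside the union is cut into the pieces \<open>B \<inter> A i\<close>, over which
  \<open>\<nu>\<close> itself is countably additive.\<close>

lemma charge_upper_variation: "charge M (upper_variation M \<nu>)"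
  unfolding charge_def
proof (intro allI impI)
  fix A :: "nat \<Rightarrow> 'a set" assume A: "range A \<subseteq> sets M" "disjoint_family A"
  let ?V = "upper_variation M \<nu>"
  have part: "(\<Sum>i<n. ?V (A i)) \<le> ?V (\<Union>i<n. A i)" for n
  proof (induct n)
    case (Suc n)
    have "(\<Sum>i<Suc n. ?V (A i)) \<le> ?V (\<Union>i<n. A i) + ?V (A n)" using Suc by simp
    also have "\<dots> \<le> ?V ((\<Union>i<n. A i) \<union> A n)"
    proof (rule upper_variation_Un)
      show "(\<Union>i<n. A i) \<inter> A n = {}"
        using disjoint_family_onD[OF A(2), of _ n] by fastforce
    qed (use A in auto)
    finally show ?case by (simp add: lessThan_Suc Un_commute)
  qed (simp add: upper_variation_nonneg)
  have part': "(\<Sum>i<n. ?V (A i)) \<le> ?V (\<Union>i. A i)" for n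
    using part[of n] upper_variation_mono[of "\<Union>i<n. A i" "\<Union>i. A i"] by fastforce
  have sm: "summable (\<lambda>i. ?V (A i))"
    using part' by (intro summableI_nonneg_bounded) (auto simp: upper_variation_nonneg)
  have "?V (\<Union>i. A i) \<le> (\<Sum>i. ?V (A i))"
  proof (rule upper_variation_le)
    fix B assume B: "B \<in> sets M" "B \<subseteq> (\<Union>i. A i)"
    have "(\<lambda>i. \<nu> (B \<inter> A i)) sums \<nu> (\<Union>i. B \<inter> A i)"
      using A B by (intro charge_sums) (auto simp: disjoint_family_on_def)
    also have "(\<Union>i. B \<inter> A i) = B" using B by auto
    finally show "\<nu> B \<le> (\<Sum>i. ?V (A i))"
      using A B by (intro sums_le[OF _ _ summable_sums[OF sm]]) (auto intro!: upper_variation_ge)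
  qed
  moreover have "(\<Sum>i. ?V (A i)) \<le> ?V (\<Union>i. A i)"
    using part' by (intro suminf_le_const sm)
  ultimately show "(\<lambda>i. ?V (A i)) sums ?V (\<Union>i. A i)"
    using sm by (metis antisym summable_sums)
qed

end

lemma charge_uminus: "charge M \<nu> \<Longrightarrow> charge M (\<lambda>A. - \<nu> A)"
  unfolding charge_def by (auto intro: sums_minus)

text \<open>Jordan decomposition. Passing from a subset \<open>A\<close> to \<open>E - A\<close>
  exchanges the two suprema, since \<open>\<nu> A = \<nu> E - \<nu> (E - A)\<close>.\<close>

lemma upper_variation_diff:
  assumes "charge M \<nu>" "E \<in> sets M"
  shows "\<nu> E = upper_variation M \<nu> E - upper_variation M (\<lambda>A. - \<nu> A) E"
proof -
  note c' = charge_uminus[OF assms(1)]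
  have "upper_variation M \<nu> E \<le> \<nu> E + upper_variation M (\<lambda>A. - \<nu> A) E"
  proof (rule upper_variation_le[OF assms(1)])
    fix A assume "A \<in> sets M" "A \<subseteq> E"
    then show "\<nu> A \<le> \<nu> E + upper_variation M (\<lambda>A. - \<nu> A) E"
      using upper_variation_ge[OF c', of "E - A" E] charge_Diff[OF assms(1)] assms(2) by fastforce
  qed
  moreover have "upper_variation M (\<lambda>A. - \<nu> A) E \<le> upper_variation M \<nu> E - \<nu> E"
  proof (rule upper_variation_le[OF c'])
    fix A assume "A \<in> sets M" "A \<subseteq> E"
    then show "- \<nu> A \<le> upper_variation M \<nu> E - \<nu> E"
      using upper_variation_ge[OF assms(1), of "E - A" E] charge_Diff[OF assms(1)] assms(2) by fastforce
  qed
  ultimately show ?thesis by simp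
qed

lemma
  assumes ch: "charge M \<nu>"
  shows sets_positive_variation: "sets (positive_variation M \<nu>) = sets M"
    and space_positive_variation: "space (positive_variation M \<nu>) = space M"
    and emeasure_positive_variation:
      "E \<in> sets M \<Longrightarrow> emeasure (positive_variation M \<nu>) E = ennreal (upper_variation M \<nu> E)"
    and finite_measure_positive_variation: "finite_measure (positive_variation M \<nu>)"
proof -
  show s: "sets (positive_variation M \<nu>) = sets M"
    and sp: "space (positive_variation M \<nu>) = space M"
    by (simp_all add: positive_variation_def sets.space_closed)
  let ?\<mu> = "\<lambda>E. SUP A\<in>{A \<in> sets M. A \<subseteq> E}. ennreal (\<nu> A)"
  have eq: "?\<mu> E = ennreal (upper_variation M \<nu> E)" for E
  proof (rule antisym)
    show "?\<mu> E \<le> ennreal (upper_variation M \<nu> E)"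
      by (intro SUP_least ennreal_leI upper_variation_ge ch) auto
    show "ennreal (upper_variation M \<nu> E) \<le> ?\<mu> E"
    proof (rule ennreal_le_epsilon)
      fix e :: real assume "e > 0"
      then have "\<not> upper_variation M \<nu> E \<le> upper_variation M \<nu> E - e" by simp
      then obtain A where A: "A \<in> sets M" "A \<subseteq> E" "\<nu> A > upper_variation M \<nu> E - e"
        using upper_variation_le[OF ch] by (meson linorder_not_le)
      \<comment> \<open>\<open>ennreal\<close> sends negative numbers to 0, so
        \<open>\<nu> A\<close> is replaced by its positive part before the sum is split.\<close>
      have "ennreal (upper_variation M \<nu> E) \<le> ennreal (max 0 (\<nu> A) + e)"
        using A by (intro ennreal_leI) auto
      also have "\<dots> = ennreal (\<nu> A) + ennreal e"
        using \<open>e > 0\<close> by (auto simp: max_def ennreal_plus ennreal_neg)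
      also have "\<dots> \<le> ?\<mu> E + ennreal e"
        using A by (intro add_right_mono SUP_upper) auto
      finally show "ennreal (upper_variation M \<nu> E) \<le> ?\<mu> E + ennreal e" .
    qed
  qed
  have em: "emeasure (positive_variation M \<nu>) E = ?\<mu> E" if "E \<in> sets M" for E
  proof (rule emeasure_measure_of[OF positive_variation_def])
    show "positive (sets (positive_variation M \<nu>)) ?\<mu>"
      unfolding eq positive_def
      using charge_empty[OF charge_upper_variation[OF ch]] by simp
    show "countably_additive (sets (positive_variation M \<nu>)) ?\<mu>"
      unfolding s eq countably_additive_def
    proof (intro allI impI)
      fix A :: "nat \<Rightarrow> 'a set" assume "range A \<subseteq> sets M" "disjoint_family A"
      then have "(\<lambda>i. upper_variation M \<nu> (A i)) sums upper_variation M \<nu> (\<Union>i. A i)"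
        by (rule charge_sums[OF charge_upper_variation[OF ch]])
      then show "(\<Sum>i. ennreal (upper_variation M \<nu> (A i))) = ennreal (upper_variation M \<nu> (\<Union> (range A)))"
        by (intro suminf_ennreal_eq upper_variation_nonneg ch)
    qed
  qed (use that s sets.space_closed in auto)
  have e2: "emeasure (positive_variation M \<nu>) E = ennreal (upper_variation M \<nu> E)" if "E \<in> sets M" for E
    using em[OF that] by (simp add: eq)
  then show "E \<in> sets M \<Longrightarrow> emeasure (positive_variation M \<nu>) E = ennreal (upper_variation M \<nu> E)" .
  show "finite_measure (positive_variation M \<nu>)"
    using e2[OF sets.top] by (intro finite_measureI) (simp add: sp)
qed

lemma measure_positive_variation:
  "charge M \<nu> \<Longrightarrow> E \<in> sets M \<Longrightarrow> measure (positive_variation M \<nu>) E = upper_variation M \<nu> E"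
  by (simp add: measure_def emeasure_positive_variation upper_variation_nonneg)

text \<open>An identity \<open>P1 - Q1 = Q2 - P2\<close> between signed measures is written as an
  identity of sums, which survives in \<open>ennreal\<close>, where subtraction is
  truncated.\<close>

lemma nn_integral_add_measures:
  assumes [measurable_cong, simp]: "sets P1 = sets M" "sets P2 = sets M" "sets Q1 = sets M" "sets Q2 = sets M"
    and eq: "\<And>A. A \<in> sets M \<Longrightarrow> emeasure P1 A + emeasure P2 A = emeasure Q1 A + emeasure Q2 A"
    and u: "u \<in> borel_measurable M"
  shows "(\<integral>\<^sup>+x. u x \<partial>P1) + (\<integral>\<^sup>+x. u x \<partial>P2) = (\<integral>\<^sup>+x. u x \<partial>Q1) + (\<integral>\<^sup>+x. u x \<partial>Q2)"
  using u
proof (induct rule: borel_measurable_induct)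
  case (cong f g)
  have "(\<integral>\<^sup>+x. f x \<partial>P) = (\<integral>\<^sup>+x. g x \<partial>P)" if "sets P = sets M" for P
    using cong(3) sets_eq_imp_space_eq[OF that] by (intro nn_integral_cong) auto
  with cong show ?case by simp
next
  case (set A)
  then show ?case by (simp add: eq)
next
  case (mult u c)
  then show ?case by (simp add: nn_integral_cmult distrib_left[symmetric])
next
  case (add u v)
  then show ?case by (simp add: nn_integral_add ac_simps)
next
  case (seq U)
  have *: "(\<integral>\<^sup>+x. (SUP i. U i) x \<partial>P) = (SUP i. \<integral>\<^sup>+x. U i x \<partial>P)" "incseq (\<lambda>i. \<integral>\<^sup>+x. U i x \<partial>P)"
    if P: "sets P = sets M" for P
  proof -
    have "U i \<in> borel_measurable P" for i
      using seq(1) by (simp add: measurable_cong_sets[OF P refl])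
    then show "(\<integral>\<^sup>+x. (SUP i. U i) x \<partial>P) = (SUP i. \<integral>\<^sup>+x. U i x \<partial>P)"
      unfolding SUP_apply by (intro nn_integral_monotone_convergence_SUP seq)
    show "incseq (\<lambda>i. \<integral>\<^sup>+x. U i x \<partial>P)"
      using seq(4) by (intro incseq_SucI nn_integral_mono) (auto simp: incseq_Suc_iff le_fun_def)
  qed
  show ?case
    by (simp only: * assms(1-4) ennreal_SUP_add[symmetric] seq(3))
qed

lemma integral_add_measures:
  fixes \<psi> :: "'a \<Rightarrow> complex"
  assumes s[measurable_cong, simp]: "sets P1 = sets M" "sets P2 = sets M" "sets Q1 = sets M" "sets Q2 = sets M"
    and fin: "finite_measure P1" "finite_measure P2" "finite_measure Q1" "finite_measure Q2"
    and eq: "\<And>A. A \<in> sets M \<Longrightarrow> measure P1 A + measure P2 A = measure Q1 A + measure Q2 A"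
    and \<psi>m[measurable]: "\<psi> \<in> borel_measurable M" and bd: "\<And>x. x \<in> space M \<Longrightarrow> norm (\<psi> x) \<le> B"
  shows "(LINT x|P1. \<psi> x) + (LINT x|P2. \<psi> x) = (LINT x|Q1. \<psi> x) + (LINT x|Q2. \<psi> x)"
proof -
  have em: "emeasure P1 A + emeasure P2 A = emeasure Q1 A + emeasure Q2 A" if "A \<in> sets M" for A
    using eq[OF that] by (simp add: fin finite_measure.emeasure_eq_measure ennreal_plus[symmetric] del: ennreal_plus)
  have sp: "space P = space M" if "sets P = sets M" for P
    using that by (rule sets_eq_imp_space_eq)
  have int: "integrable P v" if "sets P = sets M" "finite_measure P" "v \<in> borel_measurable M"
    "\<And>x. x \<in> space M \<Longrightarrow> norm (v x) \<le> C" for P C and v :: "'a \<Rightarrow> 'b::{banach, second_countable_topology}"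
  proof (rule finite_measure.integrable_const_bound[OF that(2)])
    show "AE x in P. norm (v x) \<le> C" using that(4) by (intro AE_I2) (simp add: sp[OF that(1)])
    show "v \<in> borel_measurable P" using that(3) by (simp add: measurable_cong_sets[OF that(1) refl])
  qed
  have pos: "(LINT x|P1. v x) + (LINT x|P2. v x) = (LINT x|Q1. v x) + (LINT x|Q2. v x)"
    if [measurable]: "v \<in> borel_measurable M" and v: "\<And>x. x \<in> space M \<Longrightarrow> 0 \<le> v x \<and> v x \<le> C" for v :: "'a \<Rightarrow> real" and C
  proof -
    have e: "(\<integral>\<^sup>+x. ennreal (v x) \<partial>P) = ennreal (LINT x|P. v x)" "0 \<le> (LINT x|P. v x)"
      if P: "sets P = sets M" "finite_measure P" for P
    proof -
      have i: "integrable P v" using v by (intro int[OF P, of _ C]) auto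
      have n: "AE x in P. 0 \<le> v x" using v by (intro AE_I2) (simp add: sp[OF P(1)])
      show "(\<integral>\<^sup>+x. ennreal (v x) \<partial>P) = ennreal (LINT x|P. v x)" "0 \<le> (LINT x|P. v x)"
        using nn_integral_eq_integral[OF i n] integral_nonneg_AE[OF n] by auto
    qed
    have "(\<integral>\<^sup>+x. ennreal (v x) \<partial>P1) + (\<integral>\<^sup>+x. ennreal (v x) \<partial>P2) = (\<integral>\<^sup>+x. ennreal (v x) \<partial>Q1) + (\<integral>\<^sup>+x. ennreal (v x) \<partial>Q2)"
      by (intro nn_integral_add_measures[OF s em]) auto
    then show ?thesis
      by (simp add: e s fin ennreal_plus[symmetric] del: ennreal_plus)
  qed
  have re: "(LINT x|P1. v x) + (LINT x|P2. v x) = (LINT x|Q1. v x) + (LINT x|Q2. v x)"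
    if vm[measurable]: "v \<in> borel_measurable M" and v: "\<And>x. x \<in> space M \<Longrightarrow> norm (v x) \<le> C" for v :: "'a \<Rightarrow> real" and C
  proof -
    \<comment> \<open>Adding the bound \<open>C\<close> makes \<open>v\<close> nonnegative; the
      extra terms cancel because the total masses satisfy the same identity.\<close>
    have "(LINT x|P1. v x + C) + (LINT x|P2. v x + C) = (LINT x|Q1. v x + C) + (LINT x|Q2. v x + C)"
    proof (rule pos)
      fix x assume "x \<in> space M" from v[OF this] show "0 \<le> v x + C \<and> v x + C \<le> 2 * C" by auto
    qed simp
    moreover have "(LINT x|P. v x + C) = (LINT x|P. v x) + C * measure P (space M)"
      if P: "sets P = sets M" "finite_measure P" for P
      by (subst Bochner_Integration.integral_add[OF int[OF P vm v] finite_measure.integrable_const[OF P(2)]])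
        (simp_all add: sp[OF P(1)])
    ultimately show ?thesis
      using arg_cong[OF eq[OF sets.top], of "\<lambda>r. C * r"] by (simp add: s fin distrib_left)
  qed
  have I: "integrable P \<psi>" if "sets P = sets M" "finite_measure P" for P
    by (rule int[OF that \<psi>m bd])
  have "(LINT x|P1. Re (\<psi> x)) + (LINT x|P2. Re (\<psi> x)) = (LINT x|Q1. Re (\<psi> x)) + (LINT x|Q2. Re (\<psi> x))"
  proof (rule re)
    show "norm (Re (\<psi> x)) \<le> B" if "x \<in> space M" for x
      using abs_Re_le_cmod[of "\<psi> x"] bd[OF that] by simp
  qed measurable
  moreover have "(LINT x|P1. Im (\<psi> x)) + (LINT x|P2. Im (\<psi> x)) = (LINT x|Q1. Im (\<psi> x)) + (LINT x|Q2. Im (\<psi> x))"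
  proof (rule re)
    show "norm (Im (\<psi> x)) \<le> B" if "x \<in> space M" for x
      using abs_Im_le_cmod[of "\<psi> x"] bd[OF that] by simp
  qed measurable
  ultimately show ?thesis
    by (simp add: complex_eq_iff I s fin)
qed

text \<open>The definition integrates against the Jordan decomposition. Two decompositions of
  \<open>\<nu>\<close> into finite measures agree after crosswise addition, so any of them yields
  the same value and the one at hand may be used.\<close>

lemma signed_integral_eq:
  fixes \<psi> :: "'a \<Rightarrow> complex"
  assumes ch: "charge M \<nu>"
    and s[simp]: "sets P = sets M" "sets N = sets M" and fin: "finite_measure P" "finite_measure N"
    and eq: "\<And>A. A \<in> sets M \<Longrightarrow> \<nu> A = measure P A - measure N A"
    and m: "\<psi> \<in> borel_measurable M" and bd: "\<And>x. x \<in> space M \<Longrightarrow> norm (\<psi> x) \<le> B"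
  shows "signed_integral M \<nu> \<psi> = (LINT x|P. \<psi> x) - (LINT x|N. \<psi> x)"
proof -
  note ch' = charge_uminus[OF ch]
  have "(LINT u|positive_variation M \<nu>. \<psi> u) + (LINT x|N. \<psi> x) =
        (LINT x|P. \<psi> x) + (LINT u|positive_variation M (\<lambda>A. - \<nu> A). \<psi> u)"
  proof (rule integral_add_measures[where M=M and B=B])
    fix A assume A: "A \<in> sets M"
    show "measure (positive_variation M \<nu>) A + measure N A =
        measure P A + measure (positive_variation M (\<lambda>A. - \<nu> A)) A"
      using eq[OF A] upper_variation_diff[OF ch A]
      by (simp add: measure_positive_variation ch ch' A)
  qed (use assms in \<open>auto simp: sets_positive_variation ch ch' finite_measure_positive_variation\<close>)
  then show ?thesis
    unfolding signed_integral_def by (simp add: algebra_simps)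
qed

text \<open>The transformation \<open>\<theta>\<close> makes products and images of complex measures instances of the same notion.\<close>

definition represents ::
    "'a measure \<Rightarrow> ('a set \<Rightarrow> complex) \<Rightarrow> 'b measure \<Rightarrow> ('b \<Rightarrow> 'a) \<Rightarrow> ('b \<Rightarrow> complex) \<Rightarrow> bool" where
  "represents M f \<Omega> \<theta> D \<longleftrightarrow>
     finite_measure \<Omega> \<and> \<theta> \<in> \<Omega> \<rightarrow>\<^sub>M M \<and> integrable \<Omega> D \<and>
     (\<forall>A\<in>sets M. f A = (LINT \<omega>|\<Omega>. indicator A (\<theta> \<omega>) * D \<omega>))"

lemma max_zero_diff: "max 0 x - max 0 (- x) = (x::real)"
  by auto

text \<open>\<open>P\<close> and \<open>N\<close> are the images of the positive and the negative
  part of the density. They need not be mutually singular, since \<open>\<theta>\<close> may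
  identify points where \<open>D\<close> has different signs; hence the need for
  \<open>signed_integral_eq\<close>.\<close>

lemma represents_charge:
  fixes D :: "'b \<Rightarrow> real"
  assumes [measurable]: "\<theta> \<in> \<Omega> \<rightarrow>\<^sub>M M" and D: "integrable \<Omega> D"
    and \<nu>: "\<And>A. A \<in> sets M \<Longrightarrow> \<nu> A = (LINT \<omega>|\<Omega>. indicator A (\<theta> \<omega>) * D \<omega>)"
  defines "P \<equiv> distr (density \<Omega> (\<lambda>\<omega>. ennreal (max 0 (D \<omega>)))) M \<theta>"
    and "N \<equiv> distr (density \<Omega> (\<lambda>\<omega>. ennreal (max 0 (- D \<omega>)))) M \<theta>"
  shows "finite_measure P" "finite_measure N"
    "\<And>A. A \<in> sets M \<Longrightarrow> \<nu> A = measure P A - measure N A"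
proof -
  have [measurable]: "D \<in> borel_measurable \<Omega>" using D by auto
  have em: "emeasure (distr (density \<Omega> (\<lambda>\<omega>. ennreal (E \<omega>))) M \<theta>) A =
      ennreal (LINT \<omega>|\<Omega>. indicator A (\<theta> \<omega>) * E \<omega>)" (is ?a)
     "integrable \<Omega> (\<lambda>\<omega>. indicator A (\<theta> \<omega>) * E \<omega>)" (is ?b)
    if E: "integrable \<Omega> E" "\<And>\<omega>. 0 \<le> E \<omega>" and A[measurable]: "A \<in> sets M" for E A
  proof -
    have [measurable]: "E \<in> borel_measurable \<Omega>" using E by auto
    show ?b
      by (rule Bochner_Integration.integrable_bound[OF E(1)]) (auto simp: indicator_def)
    then show ?a using E(2)
      by (subst nn_integral_eq_integral[symmetric])
         (auto simp: emeasure_distr emeasure_density indicator_def intro!: nn_integral_cong)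
  qed
  have i: "integrable \<Omega> (\<lambda>\<omega>. max 0 (D \<omega>))" "integrable \<Omega> (\<lambda>\<omega>. max 0 (- D \<omega>))"
    using D by auto
  have nn: "0 \<le> (LINT \<omega>|\<Omega>. indicator A (\<theta> \<omega>) * max 0 (E \<omega>))" for A and E :: "'b \<Rightarrow> real"
    by (intro integral_nonneg_AE AE_I2) auto
  show "finite_measure P" "finite_measure N"
    unfolding P_def N_def
    using em(1)[OF i(1) _ sets.top[of M]] em(1)[OF i(2) _ sets.top[of M]]
    by (intro finite_measureI; simp)+
  fix A assume A: "A \<in> sets M"
  have mu: "measure P A = (LINT \<omega>|\<Omega>. indicator A (\<theta> \<omega>) * max 0 (D \<omega>))"
    "measure N A = (LINT \<omega>|\<Omega>. indicator A (\<theta> \<omega>) * max 0 (- D \<omega>))"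
    unfolding P_def N_def measure_def
    by (subst em(1); simp add: i A nn enn2real_ennreal)+
  show "\<nu> A = measure P A - measure N A"
    unfolding \<nu>[OF A] mu
      Bochner_Integration.integral_diff[OF em(2)[OF i(1) max.cobounded1 A] em(2)[OF i(2) max.cobounded1 A], symmetric]
      right_diff_distrib[symmetric]
    by (simp add: max_zero_diff)
qed

lemma charge_diff_measures:
  assumes "sets P = sets M" "sets N = sets M" "finite_measure P" "finite_measure N"
    and eq: "\<And>A. A \<in> sets M \<Longrightarrow> \<nu> A = measure P A - measure N A"
  shows "charge M \<nu>"
  unfolding charge_def
proof (intro allI impI)
  fix A :: "nat \<Rightarrow> 'a set" assume A: "range A \<subseteq> sets M" "disjoint_family A"
  have "(\<lambda>n. measure P (A n) - measure N (A n)) sums (measure P (\<Union>n. A n) - measure N (\<Union>n. A n))"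
    using assms A by (intro sums_diff finite_measure.finite_measure_UNION) auto
  then show "(\<lambda>n. \<nu> (A n)) sums \<nu> (\<Union>n. A n)"
    using A eq by (subst eq) (auto simp: eq subset_eq cong: sums_cong)
qed

lemma represents_Re_Im:
  assumes "represents M f \<Omega> \<theta> D" "A \<in> sets M"
  shows "Re (f A) = (LINT \<omega>|\<Omega>. indicator A (\<theta> \<omega>) * Re (D \<omega>))"
    "Im (f A) = (LINT \<omega>|\<Omega>. indicator A (\<theta> \<omega>) * Im (D \<omega>))"
proof -
  have [measurable]: "\<theta> \<in> \<Omega> \<rightarrow>\<^sub>M M" "A \<in> sets M" and D: "integrable \<Omega> D"
    and f: "f A = (LINT \<omega>|\<Omega>. indicator A (\<theta> \<omega>) * D \<omega>)"
    using assms by (auto simp: represents_def)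
  have "integrable \<Omega> (\<lambda>\<omega>. indicator A (\<theta> \<omega>) * D \<omega>)"
    using D by (rule Bochner_Integration.integrable_bound) (use D in \<open>auto simp: indicator_def\<close>)
  moreover have "Re (indicator A (\<theta> \<omega>) * D \<omega>) = indicator A (\<theta> \<omega>) * Re (D \<omega>)"
    "Im (indicator A (\<theta> \<omega>) * D \<omega>) = indicator A (\<theta> \<omega>) * Im (D \<omega>)" for \<omega>
    by (auto simp: indicator_def)
  ultimately show "Re (f A) = (LINT \<omega>|\<Omega>. indicator A (\<theta> \<omega>) * Re (D \<omega>))"
    "Im (f A) = (LINT \<omega>|\<Omega>. indicator A (\<theta> \<omega>) * Im (D \<omega>))"
    unfolding f by (simp_all only: integral_Re[symmetric] integral_Im[symmetric])
qed

lemma complex_measure_iff_charge: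
  "complex_measure M f \<longleftrightarrow> charge M (\<lambda>A. Re (f A)) \<and> charge M (\<lambda>A. Im (f A))"
  unfolding complex_measure_def charge_def sums_complex_iff by auto

lemma represents_complex_measure:
  assumes r: "represents M f \<Omega> \<theta> D"
  shows "complex_measure M f"
proof -
  have \<theta>: "\<theta> \<in> \<Omega> \<rightarrow>\<^sub>M M" and D: "integrable \<Omega> D"
    using r by (auto simp: represents_def)
  note 1 = represents_charge[OF \<theta> _ represents_Re_Im(1)[OF r]]
  note 2 = represents_charge[OF \<theta> _ represents_Re_Im(2)[OF r]]
  show ?thesis unfolding complex_measure_iff_charge
    using D by (auto intro!: charge_diff_measures[OF _ _ 1] charge_diff_measures[OF _ _ 2])
qed

text \<open>Change of variables. It turns integrals against a complex measure into Bochner integrals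
  over a finite positive measure, where Fubini's theorem and dominated convergence are
  available.\<close>

lemma represents_complex_integral:
  assumes r: "represents M f \<Omega> \<theta> D"
    and [measurable]: "\<psi> \<in> borel_measurable M" and bd: "\<And>x. x \<in> space M \<Longrightarrow> norm (\<psi> x) \<le> B"
  shows "complex_integral M f \<psi> = (LINT \<omega>|\<Omega>. \<psi> (\<theta> \<omega>) * D \<omega>)"
proof -
  have \<theta>[measurable]: "\<theta> \<in> \<Omega> \<rightarrow>\<^sub>M M" and D: "integrable \<Omega> D"
    using r by (auto simp: represents_def)
  have [measurable]: "D \<in> borel_measurable \<Omega>" using D by auto
  have ch: "charge M (\<lambda>A. Re (f A))" "charge M (\<lambda>A. Im (f A))"
    using represents_complex_measure[OF r] by (auto simp: complex_measure_iff_charge)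
  have iE: "integrable \<Omega> (\<lambda>\<omega>. complex_of_real (E \<omega>) * \<psi> (\<theta> \<omega>))" if "integrable \<Omega> E" for E
  proof (rule Bochner_Integration.integrable_bound)
    show "integrable \<Omega> (\<lambda>\<omega>. B * E \<omega>)" using that by auto
    have "norm (\<psi> (\<theta> \<omega>)) \<le> \<bar>B\<bar>" if "\<omega> \<in> space \<Omega>" for \<omega>
      using bd[OF measurable_space[OF \<theta> that]] by simp
    then show "AE \<omega> in \<Omega>. norm (complex_of_real (E \<omega>) * \<psi> (\<theta> \<omega>)) \<le> norm (B * E \<omega>)"
      by (intro AE_I2) (simp add: norm_mult abs_mult mult.commute[of "\<bar>B\<bar>"] mult_left_mono)
    show "(\<lambda>\<omega>. complex_of_real (E \<omega>) * \<psi> (\<theta> \<omega>)) \<in> borel_measurable \<Omega>"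
      using that by (auto dest: borel_measurable_integrable)
  qed
  have one: "signed_integral M \<nu> \<psi> = (LINT \<omega>|\<Omega>. complex_of_real (E \<omega>) * \<psi> (\<theta> \<omega>))"
    if E: "integrable \<Omega> E" and ch: "charge M \<nu>"
     and \<nu>: "\<And>A. A \<in> sets M \<Longrightarrow> \<nu> A = (LINT \<omega>|\<Omega>. indicator A (\<theta> \<omega>) * E \<omega>)" for E \<nu>
  proof -
    have [measurable]: "E \<in> borel_measurable \<Omega>" using E by auto
    note 1 = represents_charge[OF \<theta> E \<nu>]
    have "signed_integral M \<nu> \<psi> =
      (LINT x|distr (density \<Omega> (\<lambda>\<omega>. ennreal (max 0 (E \<omega>)))) M \<theta>. \<psi> x) -
      (LINT x|distr (density \<Omega> (\<lambda>\<omega>. ennreal (max 0 (- E \<omega>)))) M \<theta>. \<psi> x)"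
      by (rule signed_integral_eq[OF ch _ _ 1, of _ B]) (auto intro: bd)
    also have "\<dots> = (LINT \<omega>|\<Omega>. complex_of_real (max 0 (E \<omega>)) * \<psi> (\<theta> \<omega>)) -
       (LINT \<omega>|\<Omega>. complex_of_real (max 0 (- E \<omega>)) * \<psi> (\<theta> \<omega>))"
    proof -
      have "(LINT x|distr (density \<Omega> (\<lambda>\<omega>. ennreal (p \<omega>))) M \<theta>. \<psi> x) =
         (LINT \<omega>|\<Omega>. complex_of_real (p \<omega>) * \<psi> (\<theta> \<omega>))"
        if [measurable]: "p \<in> borel_measurable \<Omega>" and "\<And>\<omega>. 0 \<le> p \<omega>" for p
        using that(2) by (simp add: integral_distr integral_density scaleR_conv_of_real)
      from this[of "\<lambda>\<omega>. max 0 (E \<omega>)"] this[of "\<lambda>\<omega>. max 0 (- E \<omega>)"] show ?thesis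
        by simp
    qed
    also have "\<dots> = (LINT \<omega>|\<Omega>. complex_of_real (E \<omega>) * \<psi> (\<theta> \<omega>))"
    proof -
      have "integrable \<Omega> (\<lambda>\<omega>. max 0 (E \<omega>))" "integrable \<Omega> (\<lambda>\<omega>. max 0 (- E \<omega>))"
        using E by auto
      then show ?thesis
        by (simp only: Bochner_Integration.integral_diff[OF iE iE, symmetric]
          left_diff_distrib[symmetric] of_real_diff[symmetric] max_zero_diff)
    qed
    finally show ?thesis .
  qed
  have "complex_integral M f \<psi> = (LINT \<omega>|\<Omega>. complex_of_real (Re (D \<omega>)) * \<psi> (\<theta> \<omega>)) +
     \<i> * (LINT \<omega>|\<Omega>. complex_of_real (Im (D \<omega>)) * \<psi> (\<theta> \<omega>))"
    unfolding complex_integral_def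
    using D ch represents_Re_Im[OF r] by (subst (1 2) one) auto
  also have "\<dots> = (LINT \<omega>|\<Omega>. complex_of_real (Re (D \<omega>)) * \<psi> (\<theta> \<omega>) +
     \<i> * (complex_of_real (Im (D \<omega>)) * \<psi> (\<theta> \<omega>)))"
    using D iE by (subst Bochner_Integration.integral_add) auto
  also have "\<dots> = (LINT \<omega>|\<Omega>. \<psi> (\<theta> \<omega>) * D \<omega>)"
  proof (rule Bochner_Integration.integral_cong[OF refl])
    fix \<omega>
    show "complex_of_real (Re (D \<omega>)) * \<psi> (\<theta> \<omega>) + \<i> * (complex_of_real (Im (D \<omega>)) * \<psi> (\<theta> \<omega>)) = \<psi> (\<theta> \<omega>) * D \<omega>"
      by (subst (3) complex_eq) (simp add: algebra_simps)
  qed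
  finally show ?thesis .
qed

section \<open>A common dominating measure for several complex measures\<close>

lemma sum_measure_exists:
  assumes I: "finite I" and V: "\<And>i. i \<in> I \<Longrightarrow> sets (V i) = sets M" "\<And>i. i \<in> I \<Longrightarrow> finite_measure (V i)"
  obtains \<Omega> where "finite_measure \<Omega>" "sets \<Omega> = sets M"
    "\<And>A. A \<in> sets M \<Longrightarrow> emeasure \<Omega> A = (\<Sum>i\<in>I. emeasure (V i) A)"
proof
  define \<mu> where "\<mu> A = (\<Sum>i\<in>I. emeasure (V i) A)" for A
  define \<Omega> where "\<Omega> = measure_of (space M) (sets M) \<mu>"
  show s: "sets \<Omega> = sets M" by (simp add: \<Omega>_def sets.space_closed)
  have e: "emeasure \<Omega> A = \<mu> A" if "A \<in> sets M" for A
  proof (rule emeasure_measure_of[OF \<Omega>_def sets.space_closed])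
    show "positive (sets \<Omega>) \<mu>" by (simp add: positive_def \<mu>_def)
    show "countably_additive (sets \<Omega>) \<mu>"
      unfolding countably_additive_def s
    proof (intro allI impI)
      fix A :: "nat \<Rightarrow> 'b set" assume A: "range A \<subseteq> sets M" "disjoint_family A"
      have "(\<Sum>n. \<mu> (A n)) = (\<Sum>i\<in>I. \<Sum>n. emeasure (V i) (A n))"
        unfolding \<mu>_def by (intro suminf_sum summableI)
      also have "\<dots> = \<mu> (\<Union> (range A))"
        unfolding \<mu>_def using A V(1) by (intro sum.cong suminf_emeasure) auto
      finally show "(\<Sum>n. \<mu> (A n)) = \<mu> (\<Union> (range A))" .
    qed
  qed (use that s in auto)
  then show "\<And>A. A \<in> sets M \<Longrightarrow> emeasure \<Omega> A = (\<Sum>i\<in>I. emeasure (V i) A)"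
    by (simp add: \<mu>_def)
  have "\<mu> (space \<Omega>) \<noteq> \<infinity>"
    unfolding \<mu>_def using I V(2) by (auto simp: finite_measure.emeasure_eq_measure)
  then show "finite_measure \<Omega>"
    using e[OF sets.top] sets_eq_imp_space_eq[OF s] by (intro finite_measureI) simp
qed

text \<open>Each member of the family is absolutely continuous with respect to the sum of all, so
  the Radon--Nikodym theorem yields real densities over a single finite measure.\<close>

lemma finite_family_density:
  assumes I: "finite I" and V: "\<And>i. i \<in> I \<Longrightarrow> sets (V i) = sets M" "\<And>i. i \<in> I \<Longrightarrow> finite_measure (V i)"
  shows "\<exists>\<Omega> d. finite_measure \<Omega> \<and> sets \<Omega> = sets M \<and> (\<forall>i\<in>I. integrable \<Omega> (d i) \<and>
    (\<forall>A\<in>sets M. measure (V i) A = (LINT x|\<Omega>. indicator A x * (d i x :: real))))"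
proof -
  obtain \<Omega> where \<Omega>: "finite_measure \<Omega>" and s: "sets \<Omega> = sets M"
    and e: "\<And>A. A \<in> sets M \<Longrightarrow> emeasure \<Omega> A = (\<Sum>i\<in>I. emeasure (V i) A)"
    using sum_measure_exists[of I V M] I V by blast
  interpret finite_measure \<Omega> by fact
  have "\<exists>d. integrable \<Omega> d \<and> (\<forall>A\<in>sets M. measure (V i) A = (LINT x|\<Omega>. indicator A x * (d x :: real)))"
    if i: "i \<in> I" for i
  proof -
    interpret Vi: finite_measure "V i" using V(2)[OF i] .
    have ac: "absolutely_continuous \<Omega> (V i)"
      unfolding absolutely_continuous_def
    proof
      fix A assume A: "A \<in> null_sets \<Omega>"
      then have "(\<Sum>i\<in>I. emeasure (V i) A) = 0" using e[of A] s by (auto simp: null_sets_def)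
      then have "emeasure (V i) A = 0" using I i by (simp add: sum_nonneg_eq_0_iff)
      then show "A \<in> null_sets (V i)" using A V(1)[OF i] s by (auto simp: null_sets_def)
    qed
    have sV: "sets (V i) = sets \<Omega>" using V(1)[OF i] s by simp
    obtain d where d[measurable]: "d \<in> borel_measurable \<Omega>" "AE x in \<Omega>. RN_deriv \<Omega> (V i) x = ennreal (d x)"
      and d0: "\<And>x. 0 \<le> d x"
      using real_RN_deriv[OF Vi.finite_measure_axioms ac sV] by metis
    have em: "emeasure (V i) A = (\<integral>\<^sup>+x. ennreal (indicator A x * d x) \<partial>\<Omega>)" if [measurable]: "A \<in> sets \<Omega>" for A
    proof -
      have "emeasure (V i) A = emeasure (density \<Omega> (RN_deriv \<Omega> (V i))) A"
        using density_RN_deriv[OF ac sV] by simp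
      also have "\<dots> = (\<integral>\<^sup>+x. RN_deriv \<Omega> (V i) x * indicator A x \<partial>\<Omega>)"
        by (simp add: emeasure_density)
      also have "\<dots> = (\<integral>\<^sup>+x. ennreal (indicator A x * d x) \<partial>\<Omega>)"
        using d(2) by (intro nn_integral_cong_AE) (auto elim!: eventually_mono simp: indicator_def)
      finally show ?thesis .
    qed
    have int: "integrable \<Omega> d"
    proof (rule integrableI_nonneg)
      have "(\<integral>\<^sup>+x. ennreal (d x) \<partial>\<Omega>) = (\<integral>\<^sup>+x. ennreal (indicator (space \<Omega>) x * d x) \<partial>\<Omega>)"
        by (intro nn_integral_cong) auto
      also have "\<dots> = emeasure (V i) (space \<Omega>)" using em[OF sets.top] by simp
      finally show "(\<integral>\<^sup>+x. ennreal (d x) \<partial>\<Omega>) < \<infinity>"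
        using Vi.emeasure_finite by (simp add: less_top[symmetric])
    qed (use d0 in auto)
    have "measure (V i) A = (LINT x|\<Omega>. indicator A x * d x)" if A: "A \<in> sets \<Omega>" for A
      unfolding measure_def em[OF A] using d0 A
      by (subst integral_eq_nn_integral) auto
    with int s show ?thesis by auto
  qed
  then show ?thesis using \<Omega> s by metis
qed

text \<open>Two measures are put over one \<open>\<Omega>\<close> so that they can be compared
  through the difference of their densities.\<close>

lemma complex_measure_represents:
  assumes "complex_measure M f1" "complex_measure M f2"
  obtains \<Omega> D1 D2 where "space \<Omega> = space M" "sets \<Omega> = sets M"
    "represents M f1 \<Omega> (\<lambda>x. x) D1" "represents M f2 \<Omega> (\<lambda>x. x) D2"
proof -
  define \<nu> where "\<nu> i = (if i = 0 then (\<lambda>A. Re (f1 A)) else if i = 1 then (\<lambda>A. Im (f1 A))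
     else if i = 2 then (\<lambda>A. Re (f2 A)) else (\<lambda>A. Im (f2 A)))" for i :: nat
  have ch: "charge M (\<nu> i)" for i
    using assms by (auto simp: complex_measure_iff_charge \<nu>_def)
  note ch' = charge_uminus[OF ch]
  \<comment> \<open>Indices 0 to 3 carry the positive variations of the real and imaginary parts of
    \<open>f1\<close> and \<open>f2\<close>, and index \<open>i + 4\<close> the negative variation
    belonging to \<open>i\<close>; hence \<open>\<nu> i\<close> has density
    \<open>d i - d (i + 4)\<close>.\<close>
  define V where "V i = (if i < 4 then positive_variation M (\<nu> i) else positive_variation M (\<lambda>A. - \<nu> (i - 4) A))" for i :: nat
  have V: "sets (V i) = sets M" "finite_measure (V i)" for i
    by (simp_all add: V_def sets_positive_variation finite_measure_positive_variation ch ch')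
  have "\<exists>\<Omega> d. finite_measure \<Omega> \<and> sets \<Omega> = sets M \<and> (\<forall>i\<in>{..<8::nat}. integrable \<Omega> (d i) \<and>
    (\<forall>A\<in>sets M. measure (V i) A = (LINT x|\<Omega>. indicator A x * (d i x :: real))))"
    by (rule finite_family_density) (simp_all add: V)
  then obtain \<Omega> and d :: "nat \<Rightarrow> 'a \<Rightarrow> real" where \<Omega>: "finite_measure \<Omega>" and s: "sets \<Omega> = sets M" and
    d8: "\<forall>i\<in>{..<8::nat}. integrable \<Omega> (d i) \<and> (\<forall>A\<in>sets M. measure (V i) A = (LINT x|\<Omega>. indicator A x * d i x))"
    by blast
  have d: "\<And>i. i < 8 \<Longrightarrow> integrable \<Omega> (d i)"
    "\<And>i A. i < 8 \<Longrightarrow> A \<in> sets M \<Longrightarrow> measure (V i) A = (LINT x|\<Omega>. indicator A x * d i x)"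
    using d8 by blast+
  define e where "e i x = d i x - d (i + 4) x" for i x
  have e: "integrable \<Omega> (e i)" if "i < 4" for i
    unfolding e_def using d(1)[of i] d(1)[of "i + 4"] that by auto
  have ind: "integrable \<Omega> (\<lambda>x. indicator A x * k x)" if "A \<in> sets M" "integrable \<Omega> k" for A and k :: "'a \<Rightarrow> real"
    using that s by (intro Bochner_Integration.integrable_bound[OF that(2)]) (auto simp: indicator_def)
  have nu: "\<nu> i A = (LINT x|\<Omega>. indicator A x * e i x)" if i: "i < 4" and A: "A \<in> sets M" for i A
  proof -
    have "\<nu> i A = measure (V i) A - measure (V (i + 4)) A"
      using i upper_variation_diff[OF ch A] by (simp add: V_def measure_positive_variation ch ch' A)
    also have "\<dots> = (LINT x|\<Omega>. indicator A x * e i x)"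
      using i A d ind by (simp add: e_def right_diff_distrib)
    finally show ?thesis .
  qed
  have rep: "represents M f \<Omega> (\<lambda>x. x) (\<lambda>x. Complex (e i x) (e j x))"
    if ij: "i < 4" "j < 4" "\<nu> i = (\<lambda>A. Re (f A))" "\<nu> j = (\<lambda>A. Im (f A))" for f i j
    unfolding represents_def
  proof (intro conjI ballI)
    show "(\<lambda>x. x) \<in> \<Omega> \<rightarrow>\<^sub>M M" using measurable_ident_sets[OF s] by simp
    have C: "Complex (e i x) (e j x) = complex_of_real (e i x) + \<i> * complex_of_real (e j x)" for x
      by (simp add: complex_eq_iff)
    show "integrable \<Omega> (\<lambda>x. Complex (e i x) (e j x))"
      unfolding C using e ij by auto
    fix A assume A: "A \<in> sets M"
    have "(LINT x|\<Omega>. indicator A x * Complex (e i x) (e j x)) =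
      (LINT x|\<Omega>. complex_of_real (indicator A x * e i x) + \<i> * complex_of_real (indicator A x * e j x))"
      unfolding C by (intro Bochner_Integration.integral_cong) (auto simp: indicator_def)
    also have "\<dots> = complex_of_real (LINT x|\<Omega>. indicator A x * e i x) + \<i> * complex_of_real (LINT x|\<Omega>. indicator A x * e j x)"
      using ind[OF A e[OF ij(1)]] ind[OF A e[OF ij(2)]]
      by (subst Bochner_Integration.integral_add) (auto simp del: of_real_mult)
    also have "\<dots> = f A"
      using nu[OF ij(1) A] nu[OF ij(2) A] ij(3,4) by (simp add: complex_eq_iff)
    finally show "f A = (LINT x|\<Omega>. indicator A x * Complex (e i x) (e j x))" by simp
  qed fact
  show ?thesis
    by (rule that[OF sets_eq_imp_space_eq[OF s] s rep[of 0 1] rep[of 2 3]]) (auto simp: \<nu>_def)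
qed

subsection \<open>Complex densities with vanishing integrals\<close>

text \<open>A multiplicative class theorem for a complex density, to which uniqueness of positive
  measures does not apply. The admissible multipliers \<open>Z\<close> grow from the constant 1 to
  polynomials in \<open>g\<close>, to continuous functions of \<open>g\<close> and, by bounded
  limits, to indicators of \<open>{g > a}\<close>. The sets whose indicators preserve
  \<open>Z\<close> form a sigma-algebra outright, and this is \<open>N\<close>.\<close>

lemma monotone_class_vanishing:
  fixes D :: "'a \<Rightarrow> complex" and G :: "('a \<Rightarrow> real) set"
  assumes D: "integrable M D"
    and G: "\<And>g. g \<in> G \<Longrightarrow> g \<in> borel_measurable M"
           "\<And>g x. g \<in> G \<Longrightarrow> x \<in> space M \<Longrightarrow> g x \<in> {0..1}"
    and zero: "\<And>gs. set gs \<subseteq> G \<Longrightarrow> (LINT x|M. complex_of_real (\<Prod>g\<leftarrow>gs. g x) * D x) = 0"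
  shows "\<exists>N. space N = space M \<and> sets N \<subseteq> sets M \<and> (\<forall>g\<in>G. g \<in> borel_measurable N) \<and>
     (\<forall>A\<in>sets N. (LINT x|M. indicator A x * D x) = 0)"
proof -
  have [measurable]: "D \<in> borel_measurable M" using D by auto
  define bm where "bm = {\<psi> \<in> borel_measurable M. \<exists>B. \<forall>x\<in>space M. \<bar>\<psi> x\<bar> \<le> (B::real)}"
  define I where "I \<psi> = (LINT x|M. complex_of_real (\<psi> x) * D x)" for \<psi>
  \<comment> \<open>Quantifying over all products of members of \<open>G\<close> makes
    \<open>Z\<close> closed under multiplication by each \<open>g\<close> at once; the empty product
    gives the vanishing of \<open>I \<psi>\<close> itself.\<close>
  define Z where "Z = {\<psi> \<in> bm. \<forall>gs. set gs \<subseteq> G \<longrightarrow> I (\<lambda>x. \<psi> x * (\<Prod>g\<leftarrow>gs. g x)) = 0}"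
  have bm_D: "integrable M (\<lambda>x. complex_of_real (\<psi> x) * D x)" if b: "\<psi> \<in> bm" for \<psi>
  proof -
    obtain B where B: "\<forall>x\<in>space M. \<bar>\<psi> x\<bar> \<le> B" and [measurable]: "\<psi> \<in> borel_measurable M"
      using b unfolding bm_def by blast
    show ?thesis
    proof (rule Bochner_Integration.integrable_bound)
      show "integrable M (\<lambda>x. B * norm (D x))" using D by auto
      show "AE x in M. norm (complex_of_real (\<psi> x) * D x) \<le> norm (B * norm (D x))"
      proof (rule AE_I2)
        fix x assume "x \<in> space M"
        with B have "\<bar>\<psi> x\<bar> \<le> \<bar>B\<bar>" by fastforce
        then show "norm (complex_of_real (\<psi> x) * D x) \<le> norm (B * norm (D x))"
          by (simp add: norm_mult abs_mult mult_right_mono)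
      qed
    qed measurable
  qed
  have bm_mult: "(\<lambda>x. \<psi> x * \<phi> x) \<in> bm" if b: "\<psi> \<in> bm" "\<phi> \<in> bm" for \<psi> \<phi>
  proof -
    obtain B C where "\<forall>x\<in>space M. \<bar>\<psi> x\<bar> \<le> B" "\<forall>x\<in>space M. \<bar>\<phi> x\<bar> \<le> C"
      using b unfolding bm_def by blast
    then have "\<forall>x\<in>space M. \<bar>\<psi> x * \<phi> x\<bar> \<le> B * C"
      unfolding abs_mult by (meson mult_mono abs_ge_zero order_trans)
    then show ?thesis using that unfolding bm_def by (blast intro: borel_measurable_times)
  qed
  have bm_add: "(\<lambda>x. \<psi> x + \<phi> x) \<in> bm" if b: "\<psi> \<in> bm" "\<phi> \<in> bm" for \<psi> \<phi>
  proof -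
    obtain B C where "\<forall>x\<in>space M. \<bar>\<psi> x\<bar> \<le> B" "\<forall>x\<in>space M. \<bar>\<phi> x\<bar> \<le> C"
      using b unfolding bm_def by blast
    then have "\<forall>x\<in>space M. \<bar>\<psi> x + \<phi> x\<bar> \<le> B + C"
      by (meson abs_triangle_ineq add_mono order_trans)
    then show ?thesis using that unfolding bm_def by (blast intro: borel_measurable_add)
  qed
  have bm_const: "(\<lambda>x. c) \<in> bm" for c unfolding bm_def by (auto intro: exI[of _ "\<bar>c\<bar>"])
  have bm_prod: "(\<lambda>x. \<Prod>g\<leftarrow>gs. g x) \<in> bm" if "set gs \<subseteq> G" for gs
    using that
  proof (induct gs)
    case (Cons g gs)
    then have g: "g \<in> G" by simp
    have "\<forall>x\<in>space M. \<bar>g x\<bar> \<le> 1" using G(2)[OF g] by (auto simp: abs_le_iff)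
    then have "g \<in> bm" using G(1)[OF g] unfolding bm_def by blast
    with Cons show ?case by (auto intro: bm_mult)
  qed (use bm_const in auto)
  have ZI: "I (\<lambda>x. \<psi> x * (\<Prod>g\<leftarrow>gs. g x)) = 0" if "\<psi> \<in> Z" "set gs \<subseteq> G" for \<psi> gs
    using that by (auto simp: Z_def)
  have Z_bm: "\<psi> \<in> bm" if "\<psi> \<in> Z" for \<psi> using that by (auto simp: Z_def)
  have Z_1: "(\<lambda>x. 1) \<in> Z" using zero bm_const by (auto simp: Z_def I_def)
  have Z_add: "(\<lambda>x. \<psi> x + \<phi> x) \<in> Z" if "\<psi> \<in> Z" "\<phi> \<in> Z" for \<psi> \<phi>
  proof -
    have "I (\<lambda>x. (\<psi> x + \<phi> x) * (\<Prod>g\<leftarrow>gs. g x)) = 0" if gs: "set gs \<subseteq> G" for gs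
    proof -
      have "I (\<lambda>x. (\<psi> x + \<phi> x) * (\<Prod>g\<leftarrow>gs. g x)) = I (\<lambda>x. \<psi> x * (\<Prod>g\<leftarrow>gs. g x)) + I (\<lambda>x. \<phi> x * (\<Prod>g\<leftarrow>gs. g x))"
        unfolding I_def
        using bm_D[OF bm_mult[OF Z_bm[OF \<open>\<psi> \<in> Z\<close>] bm_prod[OF gs]]] bm_D[OF bm_mult[OF Z_bm[OF \<open>\<phi> \<in> Z\<close>] bm_prod[OF gs]]]
        by (subst Bochner_Integration.integral_add[symmetric]) (auto simp: algebra_simps)
      then show ?thesis using ZI[OF \<open>\<psi> \<in> Z\<close> gs] ZI[OF \<open>\<phi> \<in> Z\<close> gs] by simp
    qed
    then show ?thesis using that bm_add[of \<psi> \<phi>] by (auto simp: Z_def)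
  qed
  have Z_cmult: "(\<lambda>x. c * \<psi> x) \<in> Z" if "\<psi> \<in> Z" for \<psi> c
  proof -
    have "I (\<lambda>x. c * \<psi> x * (\<Prod>g\<leftarrow>gs. g x)) = c * I (\<lambda>x. \<psi> x * (\<Prod>g\<leftarrow>gs. g x))" for gs
      unfolding I_def by (simp add: mult.assoc)
    then show ?thesis using that bm_mult[OF bm_const[of c], of \<psi>] by (auto simp: Z_def)
  qed
  have Z_G: "(\<lambda>x. \<psi> x * g x) \<in> Z" if "\<psi> \<in> Z" "g \<in> G" for \<psi> g
  proof -
    have "I (\<lambda>x. \<psi> x * g x * (\<Prod>g\<leftarrow>gs. g x)) = 0" if "set gs \<subseteq> G" for gs
      using ZI[OF \<open>\<psi> \<in> Z\<close>, of "g # gs"] that \<open>g \<in> G\<close> by (simp add: mult.assoc)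
    then show ?thesis using that bm_mult[OF Z_bm bm_prod[of "[g]"]] by (auto simp: Z_def)
  qed
  have Z_sum: "(\<lambda>x. \<Sum>k\<in>K. F k x) \<in> Z" if "finite K" "\<And>k. k \<in> K \<Longrightarrow> F k \<in> Z" for K :: "nat set" and F
    using that
  proof (induct K)
    case empty
    then show ?case using Z_cmult[OF Z_1, of 0] by simp
  next
    case (insert k K)
    then show ?case using Z_add[of "F k" "\<lambda>x. \<Sum>k\<in>K. F k x"] by simp
  qed
  have Z_lim: "\<psi> \<in> Z"
    if F: "\<And>n. F n \<in> Z" and B: "\<And>n x. x \<in> space M \<Longrightarrow> \<bar>F n x\<bar> \<le> B"
     and L: "\<And>x. x \<in> space M \<Longrightarrow> (\<lambda>n. F n x) \<longlonglongrightarrow> \<psi> x" for F \<psi> B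
  proof -
    have Fm[measurable]: "F n \<in> borel_measurable M" for n using Z_bm[OF F] by (auto simp: bm_def)
    have \<psi>m[measurable]: "\<psi> \<in> borel_measurable M" by (rule borel_measurable_LIMSEQ_real[OF L Fm])
    have \<psi>B: "\<bar>\<psi> x\<bar> \<le> B" if "x \<in> space M" for x
      by (rule LIMSEQ_le_const2[OF tendsto_rabs[OF L[OF that]]]) (use B[OF that] in auto)
    have "I (\<lambda>x. \<psi> x * (\<Prod>g\<leftarrow>gs. g x)) = 0" if gs: "set gs \<subseteq> G" for gs
    proof -
      have [measurable]: "(\<lambda>x. \<Prod>g\<leftarrow>gs. g x) \<in> borel_measurable M"
        using bm_prod[OF gs] by (auto simp: bm_def)
      obtain C where C: "\<And>x. x \<in> space M \<Longrightarrow> \<bar>\<Prod>g\<leftarrow>gs. g x\<bar> \<le> C"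
        using bm_prod[OF gs] unfolding bm_def by blast
      have "(\<lambda>n. I (\<lambda>x. F n x * (\<Prod>g\<leftarrow>gs. g x))) \<longlonglongrightarrow> I (\<lambda>x. \<psi> x * (\<Prod>g\<leftarrow>gs. g x))"
        unfolding I_def
      proof (rule integral_dominated_convergence[where w="\<lambda>x. B * C * norm (D x)"])
        show "integrable M (\<lambda>x. B * C * norm (D x))" using D by auto
        show "AE x in M. (\<lambda>n. complex_of_real (F n x * (\<Prod>g\<leftarrow>gs. g x)) * D x)
          \<longlonglongrightarrow> complex_of_real (\<psi> x * (\<Prod>g\<leftarrow>gs. g x)) * D x"
          using L by (intro AE_I2 tendsto_intros) auto
        show "AE x in M. norm (complex_of_real (F n x * (\<Prod>g\<leftarrow>gs. g x)) * D x) \<le> B * C * norm (D x)" for n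
        proof (rule AE_I2)
          fix x assume x: "x \<in> space M"
          have "\<bar>F n x\<bar> * \<bar>\<Prod>g\<leftarrow>gs. g x\<bar> \<le> B * C"
            by (rule mult_mono[OF B[OF x, of n] C[OF x] order_trans[OF abs_ge_zero B[OF x, of n]] abs_ge_zero])
          then show "norm (complex_of_real (F n x * (\<Prod>g\<leftarrow>gs. g x)) * D x) \<le> B * C * norm (D x)"
            by (simp add: norm_mult abs_mult mult_right_mono)
        qed
      qed measurable
      then show ?thesis using ZI[OF F gs] by (simp add: LIMSEQ_const_iff)
    qed
    moreover have "\<psi> \<in> bm" using \<psi>B \<psi>m unfolding bm_def by blast
    ultimately show ?thesis by (auto simp: Z_def)
  qed
  have Z_pow: "(\<lambda>x. \<psi> x * g x ^ k) \<in> Z" if "\<psi> \<in> Z" "g \<in> G" for \<psi> g k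
  proof (induct k)
    case (Suc k)
    from Z_G[OF this that(2)] show ?case by (simp add: mult_ac)
  qed (use that in simp)
  \<comment> \<open>Members of \<open>G\<close> take values in the unit interval, where Bernstein
    polynomials approximate continuous functions uniformly.\<close>
  have Z_bern: "(\<lambda>x. \<psi> x * Bernstein n k (g x)) \<in> Z" if "\<psi> \<in> Z" "g \<in> G" "k \<le> n" for \<psi> g n k
  proof -
    have "(\<lambda>x. \<psi> x * g x ^ k * (1 - g x) ^ l) \<in> Z" for l
    proof (induct l)
      case (Suc l)
      from Z_add[OF this Z_cmult[OF Z_G[OF this that(2)], of "-1"]]
      show ?case by (simp add: algebra_simps)
    qed (use Z_pow that in simp)
    from Z_cmult[OF this, of "real (n choose k)" "n - k"]
    show ?thesis by (simp add: Bernstein_def mult_ac)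
  qed
  have Z_cont: "(\<lambda>x. \<psi> x * h (g x)) \<in> Z" if \<psi>: "\<psi> \<in> Z" and g: "g \<in> G" and h: "continuous_on {0..1} h" for \<psi> g h
  proof -
    define P where "P n t = (\<Sum>k\<le>n. h (real k / real n) * Bernstein n k t)" for n t
    obtain N where N: "\<And>m n t. N m \<le> n \<Longrightarrow> t \<in> {0..1} \<Longrightarrow> \<bar>h t - P n t\<bar> < 1 / real (Suc m)"
    proof -
      have "\<exists>N. \<forall>n x. N \<le> n \<and> x \<in> {0..1} \<longrightarrow> \<bar>h x - P n x\<bar> < 1 / real (Suc m)" for m
        unfolding P_def by (rule Bernstein_Weierstrass[OF h]) simp
      then obtain N where "\<And>m. \<forall>n x. N m \<le> n \<and> x \<in> {0..1} \<longrightarrow> \<bar>h x - P n x\<bar> < 1 / real (Suc m)" by metis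
      then show ?thesis using that by blast
    qed
    have PZ: "(\<lambda>x. \<psi> x * P n (g x)) \<in> Z" for n
    proof -
      have "(\<lambda>x. \<Sum>k\<le>n. h (real k / real n) * (\<psi> x * Bernstein n k (g x))) \<in> Z"
        by (intro Z_sum Z_cmult Z_bern \<psi> g) auto
      then show ?thesis by (simp add: P_def sum_distrib_left mult_ac)
    qed
    obtain H where H: "\<And>t. t \<in> {0..1} \<Longrightarrow> \<bar>h t\<bar> \<le> H"
      using compact_imp_bounded[OF compact_continuous_image[OF h compact_Icc]]
      unfolding bounded_iff real_norm_def by blast
    obtain B where B: "\<And>x. x \<in> space M \<Longrightarrow> \<bar>\<psi> x\<bar> \<le> B" using Z_bm[OF \<psi>] unfolding bm_def by blast
    show ?thesis
    proof (rule Z_lim[where F="\<lambda>m x. \<psi> x * P (N m) (g x)" and B="B * (H + 1)"])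
      fix x assume x: "x \<in> space M"
      have gx: "g x \<in> {0..1}" using G(2)[OF g x] .
      have "(\<lambda>m. h (g x) - P (N m) (g x)) \<longlonglongrightarrow> 0"
      proof (rule Lim_null_comparison[where g="\<lambda>m. 1 / real (Suc m)"])
        show "\<forall>\<^sub>F m in sequentially. norm (h (g x) - P (N m) (g x)) \<le> 1 / real (Suc m)"
          using N[OF order_refl gx] by (auto intro!: always_eventually less_imp_le)
        show "(\<lambda>m. 1 / real (Suc m)) \<longlonglongrightarrow> 0" by (rule LIMSEQ_Suc[OF lim_1_over_n])
      qed
      then have "(\<lambda>m. P (N m) (g x)) \<longlonglongrightarrow> h (g x)"
        using tendsto_diff[OF tendsto_const[of "h (g x)"]] by fastforce
      then show "(\<lambda>m. \<psi> x * P (N m) (g x)) \<longlonglongrightarrow> \<psi> x * h (g x)" by (intro tendsto_intros)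
      fix m
      have "1 / real (Suc m) \<le> 1" by simp
      then have "\<bar>P (N m) (g x)\<bar> \<le> H + 1"
        using N[OF order_refl gx, of m] H[OF gx] by linarith
      then show "\<bar>\<psi> x * P (N m) (g x)\<bar> \<le> B * (H + 1)"
        unfolding abs_mult
        by (intro mult_mono[OF B[OF x] _ order_trans[OF abs_ge_zero B[OF x]] abs_ge_zero])
    qed (rule PZ)
  qed
  define A where "A = {E \<in> sets M. \<forall>\<psi>\<in>Z. (\<lambda>x. \<psi> x * indicator E x) \<in> Z}"
  have A_Int: "E \<inter> E' \<in> A" if "E \<in> A" "E' \<in> A" for E E'
  proof -
    have "(\<lambda>x. \<psi> x * indicator (E \<inter> E') x) \<in> Z" if "\<psi> \<in> Z" for \<psi>
    proof -
      have "(\<lambda>x. (\<psi> x * indicator E x) * indicator E' x) \<in> Z"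
        using \<open>E \<in> A\<close> \<open>E' \<in> A\<close> that by (auto simp: A_def)
      then show ?thesis by (simp add: indicator_inter_arith mult.assoc)
    qed
    then show ?thesis using that by (auto simp: A_def)
  qed
  \<comment> \<open>Functions matter only on \<open>space M\<close>; a constant sequence in
    \<open>Z_lim\<close> absorbs any change outside it.\<close>
  have Z_cong: "\<phi> \<in> Z" if z: "\<psi> \<in> Z" "\<And>x. x \<in> space M \<Longrightarrow> \<phi> x = \<psi> x" for \<psi> \<phi>
  proof -
    obtain B where "\<And>x. x \<in> space M \<Longrightarrow> \<bar>\<psi> x\<bar> \<le> B" using Z_bm[OF z(1)] unfolding bm_def by blast
    then show ?thesis
      by (rule Z_lim[OF z(1)]) (simp_all add: z(2))
  qed
  have A_compl: "space M - E \<in> A" if "E \<in> A" for E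
  proof -
    have "(\<lambda>x. \<psi> x * indicator (space M - E) x) \<in> Z" if "\<psi> \<in> Z" for \<psi>
    proof (rule Z_cong)
      show "(\<lambda>x. \<psi> x + - 1 * (\<psi> x * indicator E x)) \<in> Z"
        using \<open>E \<in> A\<close> that by (intro Z_add Z_cmult) (auto simp: A_def)
    qed (auto simp: indicator_def)
    then show ?thesis using that by (auto simp: A_def)
  qed
  have sub: "A \<subseteq> Pow (space M)" using sets.sets_into_space by (auto simp: A_def)
  have A_empty: "{} \<in> A" using Z_cmult[OF Z_1, of 0] by (simp add: A_def)
  have A_Un: "E \<union> E' \<in> A" if "E \<in> A" "E' \<in> A" for E E'
  proof -
    have "E \<union> E' = space M - ((space M - E) \<inter> (space M - E'))" using that sub by blast
    then show ?thesis using A_compl A_Int that by simp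
  qed
  have sig: "sigma_algebra (space M) A"
    unfolding sigma_algebra_iff2
  proof (intro conjI allI impI ballI sub A_empty A_compl)
    fix E :: "nat \<Rightarrow> 'a set" assume E: "range E \<subseteq> A"
    have U: "(\<Union>i<n. E i) \<in> A" for n
      using E by (induct n) (auto simp: lessThan_Suc A_empty intro: A_Un)
    have "(\<lambda>x. \<psi> x * indicator (\<Union>i. E i) x) \<in> Z" if \<psi>: "\<psi> \<in> Z" for \<psi>
    proof -
      obtain B where B: "\<And>x. x \<in> space M \<Longrightarrow> \<bar>\<psi> x\<bar> \<le> B" using Z_bm[OF \<psi>] unfolding bm_def by blast
      show ?thesis
      proof (rule Z_lim[where F="\<lambda>n x. \<psi> x * indicator (\<Union>i<n. E i) x" and B=B])
        show "(\<lambda>x. \<psi> x * indicator (\<Union>i<n. E i) x) \<in> Z" for n using U[of n] \<psi> by (auto simp: A_def)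
        show "\<bar>\<psi> x * indicator (\<Union>i<n. E i) x\<bar> \<le> B" if "x \<in> space M" for n x
          using B[OF that] by (auto simp: indicator_def)
        show "(\<lambda>n. \<psi> x * indicator (\<Union>i<n. E i) x) \<longlonglongrightarrow> \<psi> x * indicator (\<Union>i. E i) x" for x
          by (intro tendsto_intros LIMSEQ_indicator_UN)
      qed
    qed
    then show "(\<Union>i. E i) \<in> A" using E by (auto simp: A_def)
  qed
  define N where "N = sigma (space M) A"
  have sN: "sets N = A" "space N = space M"
    unfolding N_def using sub sigma_algebra.sigma_sets_eq[OF sig] by (auto simp: sets_measure_of)
  have "g \<in> borel_measurable N" if g: "g \<in> G" for g
    unfolding borel_measurable_iff_greater sN
  proof
    fix a
    have "(\<lambda>x. \<psi> x * indicator {w \<in> space M. a < g w} x) \<in> Z" if \<psi>: "\<psi> \<in> Z" for \<psi>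
    proof -
      obtain B where B: "\<And>x. x \<in> space M \<Longrightarrow> \<bar>\<psi> x\<bar> \<le> B" using Z_bm[OF \<psi>] unfolding bm_def by blast
      \<comment> \<open>Continuous ramps rising from 0 at \<open>a\<close> to 1 at
        \<open>a + 1 / n\<close>; they tend pointwise to the indicator of the half-line above
        \<open>a\<close>.\<close>
      define h where "h n t = min 1 (max 0 (real n * (t - a)))" for n t
      show ?thesis
      proof (rule Z_lim[where F="\<lambda>n x. \<psi> x * h n (g x)" and B=B])
        show "(\<lambda>x. \<psi> x * h n (g x)) \<in> Z" for n
          unfolding h_def by (intro Z_cont \<psi> g continuous_intros)
        fix x assume x: "x \<in> space M"
        have h: "0 \<le> h n t" "h n t \<le> 1" for n t by (auto simp: h_def)
        show "\<bar>\<psi> x * h n (g x)\<bar> \<le> B" for n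
          using B[OF x] h[of n "g x"] mult_mono[of "\<bar>\<psi> x\<bar>" B "h n (g x)" 1]
          by (auto simp: abs_mult)
        have "(\<lambda>n. h n (g x)) \<longlonglongrightarrow> indicator {w \<in> space M. a < g w} x"
        proof (cases "a < g x")
          case True
          obtain n0 where n0: "real n0 * (g x - a) > 1" using True
            by (metis diff_gt_0_iff_gt mult.commute reals_Archimedean3)
          have "h n (g x) = 1" if "n \<ge> n0" for n
          proof -
            have "real n0 * (g x - a) \<le> real n * (g x - a)" using True that by (intro mult_right_mono) auto
            then show ?thesis using n0 by (auto simp: h_def)
          qed
          then show ?thesis using True x
            by (intro tendsto_eventually eventually_sequentiallyI[of n0]) auto
        next
          case False
          then have "h n (g x) = 0" for n by (auto simp: h_def mult_nonneg_nonpos)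
          then show ?thesis using False by simp
        qed
        then show "(\<lambda>n. \<psi> x * h n (g x)) \<longlonglongrightarrow> \<psi> x * indicator {w \<in> space M. a < g w} x"
          by (intro tendsto_intros)
      qed
    qed
    then show "{w \<in> space M. a < g w} \<in> A" using G(1)[OF g] by (auto simp: A_def)
  qed
  moreover have "(LINT x|M. indicator E x * D x) = 0" if "E \<in> A" for E
  proof -
    have "(\<lambda>x. 1 * indicator E x) \<in> Z" using that Z_1 by (auto simp: A_def)
    from ZI[OF this, of "[]"] show ?thesis
      by (simp add: I_def indicator_def of_bool_def if_distrib[of complex_of_real] cong: if_cong)
  qed
  ultimately show ?thesis
    using sN by (intro exI[of _ N]) (auto simp: A_def)
qed

subsection \<open>Functions of bounded variation\<close>

text \<open>Points may repeat and need not reach the ends of the interval. Thus the tags of a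
  partition qualify, and so does a grid with one possibly degenerate cell.\<close>

definition weak_seq :: "real \<Rightarrow> nat \<Rightarrow> (nat \<Rightarrow> real) \<Rightarrow> bool" where
  "weak_seq L m s \<longleftrightarrow> 0 \<le> s 0 \<and> s m \<le> L \<and> (\<forall>i<m. s i \<le> s (Suc i))"

text \<open>Repeated points let a chain for \<open>a\<close> be prolonged to one for every
  \<open>a' \<ge> a\<close>, equality included, by appending a point.\<close>

definition chain :: "real \<Rightarrow> nat \<Rightarrow> (nat \<Rightarrow> real) \<Rightarrow> bool" where
  "chain L m s \<longleftrightarrow> s 0 = 0 \<and> s m = L \<and> (\<forall>i<m. s i \<le> s (Suc i))"

text \<open>The Hardy--Krause variation of \<open>g\<close> over \<open>[0, s] \<times> [0, t]\<close> is such a \<open>w\<close>; it serves in place of a Jordan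
  decomposition of \<open>g\<close>.\<close>

definition majorant :: "real \<Rightarrow> real \<Rightarrow> plane_fun \<Rightarrow> plane_fun \<Rightarrow> bool" where
  "majorant S T g w \<longleftrightarrow> (\<forall>a a' b b'. 0 \<le> a \<longrightarrow> a \<le> a' \<longrightarrow> a' \<le> S \<longrightarrow> 0 \<le> b \<longrightarrow> b \<le> b' \<longrightarrow> b' \<le> T \<longrightarrow>
     \<bar>g (a', b') - g (a, b)\<bar> \<le> w (a', b') - w (a, b))"

definition vitali_bound :: "real \<Rightarrow> real \<Rightarrow> plane_fun \<Rightarrow> real \<Rightarrow> bool" where
  "vitali_bound S T g K \<longleftrightarrow> (\<forall>m s n t. weak_seq S m s \<longrightarrow> weak_seq T n t \<longrightarrow>
     (\<Sum>i<m. \<Sum>j<n. \<bar>rect_diff g (s i) (s (Suc i)) (t j) (t (Suc j))\<bar>) \<le> K)"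

lemma weak_seq_mono:
  assumes "weak_seq L m s" "i \<le> j" "j \<le> m"
  shows "s i \<le> s j"
  using assms(2,3)
proof (induct j)
  case (Suc j)
  then show ?case using assms(1) unfolding weak_seq_def
    by (cases "i = Suc j") (auto intro: order_trans simp: le_Suc_eq)
qed simp

lemma weak_seq_range: "weak_seq L m s \<Longrightarrow> i \<le> m \<Longrightarrow> 0 \<le> s i \<and> s i \<le> L"
  using weak_seq_mono[of L m s 0 i] weak_seq_mono[of L m s i m] by (auto simp: weak_seq_def)

lemma chain_weak_seq: "chain a m s \<Longrightarrow> a \<le> L \<Longrightarrow> weak_seq L m s"
  by (auto simp: chain_def weak_seq_def)

lemma partition_weak_seq: "partition L m s \<Longrightarrow> weak_seq L m s"
  by (auto simp: partition_def weak_seq_def less_imp_le)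

lemma chain_append: "chain a m s \<Longrightarrow> a \<le> a' \<Longrightarrow> chain a' (Suc m) (s(Suc m := a'))"
  by (auto simp: chain_def less_Suc_eq)

lemma sum_append:
  fixes \<psi> :: "real \<Rightarrow> real \<Rightarrow> 'a::comm_monoid_add"
  shows "(\<Sum>i<Suc m. \<psi> ((s(Suc m := a)) i) ((s(Suc m := a)) (Suc i))) = (\<Sum>i<m. \<psi> (s i) (s (Suc i))) + \<psi> (s m) a"
proof -
  have "(\<Sum>i<m. \<psi> ((s(Suc m := a)) i) ((s(Suc m := a)) (Suc i))) = (\<Sum>i<m. \<psi> (s i) (s (Suc i)))"
    by (intro sum.cong) auto
  then show ?thesis by simp
qed

text \<open>Removing repetitions and adding the end points 0 and \<open>L\<close> cannot lower a sum
  of nonnegative terms that vanish on the diagonal. One refinement serves every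
  \<open>\<psi>\<close>, so for a grid the sum over the other direction can be hidden inside
  \<open>\<psi>\<close>.\<close>

lemma strict_refinement:
  assumes L: "L > 0" and s: "weak_seq L m s"
  shows "\<exists>m' s'. partition L m' s' \<and> (\<forall>\<psi> :: real \<Rightarrow> real \<Rightarrow> real. (\<forall>a b. 0 \<le> \<psi> a b) \<longrightarrow> (\<forall>a. \<psi> a a = 0) \<longrightarrow>
    (\<Sum>i<m. \<psi> (s i) (s (Suc i))) \<le> (\<Sum>i<m'. \<psi> (s' i) (s' (Suc i))))"
proof -
  \<comment> \<open>\<open>\<Sigma>\<close> is the sum accounted for so far, kept as a functional of
    \<open>\<psi>\<close> so that the choice of \<open>m'\<close> and \<open>s'\<close> precedes
    that of \<open>\<psi>\<close>.\<close>
  define P where "P a \<Sigma> m' s' \<longleftrightarrow> s' 0 = 0 \<and> s' m' = a \<and> (\<forall>i<m'. s' i < s' (Suc i)) \<and>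
    (\<forall>\<psi> :: real \<Rightarrow> real \<Rightarrow> real. (\<forall>a b. 0 \<le> \<psi> a b) \<longrightarrow> (\<forall>a. \<psi> a a = 0) \<longrightarrow>
      \<Sigma> \<psi> \<le> (\<Sum>i<m'. \<psi> (s' i) (s' (Suc i))))" for a :: real and \<Sigma> :: "(real \<Rightarrow> real \<Rightarrow> real) \<Rightarrow> real" and m' :: nat and s'
  have step: "\<exists>m'' s''. P b (\<lambda>\<psi>. \<Sigma> \<psi> + \<psi> a b) m'' s''" if P: "P a \<Sigma> m' s'" and ab: "a \<le> b" for a b \<Sigma> m' s'
  proof (cases "a = b")
    case True
    then have "P b (\<lambda>\<psi>. \<Sigma> \<psi> + \<psi> a b) m' s'" using P by (simp add: P_def)
    then show ?thesis by blast
  next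
    case False
    with ab have lt: "a < b" by simp
    have "P b (\<lambda>\<psi>. \<Sigma> \<psi> + \<psi> a b) (Suc m') (s'(Suc m' := b))"
      unfolding P_def
    proof (intro conjI allI impI)
      fix \<psi> :: "real \<Rightarrow> real \<Rightarrow> real" assume \<psi>: "\<forall>a b. 0 \<le> \<psi> a b" "\<forall>a. \<psi> a a = 0"
      show "\<Sigma> \<psi> + \<psi> a b \<le> (\<Sum>i<Suc m'. \<psi> ((s'(Suc m' := b)) i) ((s'(Suc m' := b)) (Suc i)))"
        unfolding sum_append using P \<psi> by (auto simp: P_def)
    qed (use P lt in \<open>auto simp: P_def less_Suc_eq\<close>)
    then show ?thesis by blast
  qed
  have P_mono: "P a \<Sigma>' m' s'" if "P a \<Sigma> m' s'" "\<And>\<psi>. \<forall>a b. 0 \<le> \<psi> a b \<Longrightarrow> \<Sigma>' \<psi> \<le> \<Sigma> \<psi>" for a \<Sigma> \<Sigma>' m' s'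
    using that unfolding P_def by (meson order_trans)
  have "\<exists>m' s'. P (s k) (\<lambda>\<psi>. \<Sum>i<k. \<psi> (s i) (s (Suc i))) m' s'" if "k \<le> m" for k
    using that
  proof (induct k)
    case 0
    have "P 0 (\<lambda>\<psi>. 0) 0 (\<lambda>_. 0)" by (auto simp: P_def)
    from step[OF this, of "s 0"] obtain m' s' where "P (s 0) (\<lambda>\<psi>. 0 + \<psi> 0 (s 0)) m' s'"
      using s by (auto simp: weak_seq_def)
    then have "P (s 0) (\<lambda>\<psi>. 0) m' s'" by (rule P_mono) simp
    then show ?case by auto
  next
    case (Suc k)
    then obtain m' s' where "P (s k) (\<lambda>\<psi>. \<Sum>i<k. \<psi> (s i) (s (Suc i))) m' s'" by auto
    from step[OF this, of "s (Suc k)"] show ?case using s Suc by (auto simp: weak_seq_def)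
  qed
  from this[of m] obtain m' s' where "P (s m) (\<lambda>\<psi>. \<Sum>i<m. \<psi> (s i) (s (Suc i))) m' s'" by auto
  from step[OF this, of L] obtain m'' s'' where
    P: "P L (\<lambda>\<psi>. (\<Sum>i<m. \<psi> (s i) (s (Suc i))) + \<psi> (s m) L) m'' s''"
    using s by (auto simp: weak_seq_def)
  show ?thesis
  proof (intro exI conjI allI impI)
    show "partition L m'' s''" using P by (auto simp: P_def partition_def)
    fix \<psi> :: "real \<Rightarrow> real \<Rightarrow> real" assume \<psi>: "\<forall>a b. 0 \<le> \<psi> a b" "\<forall>a. \<psi> a a = 0"
    then have "(\<Sum>i<m. \<psi> (s i) (s (Suc i))) + \<psi> (s m) L \<le> (\<Sum>i<m''. \<psi> (s'' i) (s'' (Suc i)))"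
      using P unfolding P_def by blast
    then show "(\<Sum>i<m. \<psi> (s i) (s (Suc i))) \<le> (\<Sum>i<m''. \<psi> (s'' i) (s'' (Suc i)))"
      using \<psi>(1) by (smt (verit))
  qed
qed

lemma bv_1d_weak:
  assumes "L > 0" "bv_1d L h"
  shows "\<exists>K. \<forall>m s. weak_seq L m s \<longrightarrow> (\<Sum>i<m. \<bar>h (s (Suc i)) - h (s i)\<bar>) \<le> K"
proof -
  obtain K where K: "\<And>m s. partition L m s \<Longrightarrow> (\<Sum>i<m. \<bar>h (s (Suc i)) - h (s i)\<bar>) \<le> K"
    using assms(2) unfolding bv_1d_def by blast
  have "(\<Sum>i<m. \<bar>h (s (Suc i)) - h (s i)\<bar>) \<le> K" if s: "weak_seq L m s" for m s
  proof -
    obtain m' s' where p: "partition L m' s'" and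
      "\<forall>\<psi> :: real \<Rightarrow> real \<Rightarrow> real. (\<forall>a b. 0 \<le> \<psi> a b) \<longrightarrow> (\<forall>a. \<psi> a a = 0) \<longrightarrow>
      (\<Sum>i<m. \<psi> (s i) (s (Suc i))) \<le> (\<Sum>i<m'. \<psi> (s' i) (s' (Suc i)))"
      using strict_refinement[OF assms(1) s] by blast
    from this(2)[rule_format, of "\<lambda>a b. \<bar>h b - h a\<bar>"] K[OF p] show ?thesis by simp
  qed
  then show ?thesis by blast
qed

lemma rect_diff_same [simp]: "rect_diff g a a c d = 0" "rect_diff g a b c c = 0"
  by (simp_all add: rect_diff_def)

lemma bv_vitali_weak:
  assumes S: "S > 0" and T: "T > 0" and bv: "bv_vitali S T g"
  shows "\<exists>K. vitali_bound S T g K"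
proof -
  obtain K where K: "\<And>m n s t. partition S m s \<Longrightarrow> partition T n t \<Longrightarrow>
        (\<Sum>i<m. \<Sum>j<n. \<bar>rect_diff g (s i) (s (Suc i)) (t j) (t (Suc j))\<bar>) \<le> K"
    using bv unfolding bv_vitali_def by blast
  have "(\<Sum>i<m. \<Sum>j<n. \<bar>rect_diff g (s i) (s (Suc i)) (t j) (t (Suc j))\<bar>) \<le> K"
    if s: "weak_seq S m s" and t: "weak_seq T n t" for m s n t
  proof -
    obtain m' s' where p: "partition S m' s'" and s':
      "\<forall>\<psi> :: real \<Rightarrow> real \<Rightarrow> real. (\<forall>a b. 0 \<le> \<psi> a b) \<longrightarrow> (\<forall>a. \<psi> a a = 0) \<longrightarrow>
      (\<Sum>i<m. \<psi> (s i) (s (Suc i))) \<le> (\<Sum>i<m'. \<psi> (s' i) (s' (Suc i)))"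
      using strict_refinement[OF S s] by blast
    obtain n' t' where q: "partition T n' t'" and t':
      "\<forall>\<psi> :: real \<Rightarrow> real \<Rightarrow> real. (\<forall>a b. 0 \<le> \<psi> a b) \<longrightarrow> (\<forall>a. \<psi> a a = 0) \<longrightarrow>
      (\<Sum>i<n. \<psi> (t i) (t (Suc i))) \<le> (\<Sum>i<n'. \<psi> (t' i) (t' (Suc i)))"
      using strict_refinement[OF T t] by blast
    have "(\<Sum>i<m. \<Sum>j<n. \<bar>rect_diff g (s i) (s (Suc i)) (t j) (t (Suc j))\<bar>)
       \<le> (\<Sum>i<m'. \<Sum>j<n. \<bar>rect_diff g (s' i) (s' (Suc i)) (t j) (t (Suc j))\<bar>)"
      by (rule s'[rule_format]) (auto intro: sum_nonneg)
    also have "\<dots> = (\<Sum>j<n. \<Sum>i<m'. \<bar>rect_diff g (s' i) (s' (Suc i)) (t j) (t (Suc j))\<bar>)"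
      by (rule sum.swap)
    also have "\<dots> \<le> (\<Sum>j<n'. \<Sum>i<m'. \<bar>rect_diff g (s' i) (s' (Suc i)) (t' j) (t' (Suc j))\<bar>)"
      by (rule t'[rule_format, of "\<lambda>a b. \<Sum>i<m'. \<bar>rect_diff g (s' i) (s' (Suc i)) a b\<bar>"]) (auto intro: sum_nonneg)
    also have "\<dots> = (\<Sum>i<m'. \<Sum>j<n'. \<bar>rect_diff g (s' i) (s' (Suc i)) (t' j) (t' (Suc j))\<bar>)"
      by (rule sum.swap)
    also have "\<dots> \<le> K" by (rule K[OF p q])
    finally show ?thesis .
  qed
  then show ?thesis unfolding vitali_bound_def by blast
qed

text \<open>\<open>v a\<close> is the total variation over [0, a]: a chain for \<open>a\<close>
  followed by the step to \<open>a'\<close> is a chain for \<open>a'\<close>.\<close>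

lemma variation_function_1d:
  assumes K: "\<And>m s. weak_seq L m s \<Longrightarrow> (\<Sum>i<m. \<bar>h (s (Suc i)) - h (s i)\<bar>) \<le> (K::real)"
  shows "\<exists>v. \<forall>a a'. 0 \<le> a \<longrightarrow> a \<le> a' \<longrightarrow> a' \<le> L \<longrightarrow> \<bar>h a' - h a\<bar> \<le> v a' - v a"
proof -
  define Q where "Q a = {(m, s). chain a m s}" for a
  define \<Sigma> where "\<Sigma> = (\<lambda>(m, s). \<Sum>i<m. \<bar>h (s (Suc i)) - h (s i)\<bar>)"
  define v where "v a = (SUP q\<in>Q a. \<Sigma> q)" for a
  have "\<bar>h a' - h a\<bar> \<le> v a' - v a" if a: "0 \<le> a" "a \<le> a'" "a' \<le> L" for a a'
  proof -
    have "v a \<le> v a' - \<bar>h a' - h a\<bar>"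
      unfolding v_def[of a]
    proof (rule cSUP_least)
      have "(1, \<lambda>i. if i = 0 then 0 else a) \<in> Q a" using a by (auto simp: Q_def chain_def)
      then show "Q a \<noteq> {}" by blast
      fix q assume "q \<in> Q a"
      then obtain m s where q: "q = (m, s)" "chain a m s" by (auto simp: Q_def)
      have sm: "s m = a" using q by (simp add: chain_def)
      have "\<Sigma> q + \<bar>h a' - h a\<bar> = \<Sigma> (Suc m, s(Suc m := a'))"
        unfolding \<Sigma>_def q prod.case using sum_append[of "\<lambda>a b. \<bar>h b - h a\<bar>" s m a'] sm by simp
      also have "\<dots> \<le> v a'"
        unfolding v_def
      proof (rule cSUP_upper)
        show "(Suc m, s(Suc m := a')) \<in> Q a'" using chain_append[OF q(2) a(2)] by (simp add: Q_def)
        show "bdd_above (\<Sigma> ` Q a')"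
          using K chain_weak_seq a(3) by (intro bdd_aboveI2[of _ _ K]) (auto simp: Q_def \<Sigma>_def)
      qed
      finally show "\<Sigma> q \<le> v a' - \<bar>h a' - h a\<bar>" by simp
    qed
    then show ?thesis by simp
  qed
  then show ?thesis by blast
qed

lemma sum_rect_diff_telescope:
  "(\<Sum>j<n. rect_diff g a b (t j) (t (Suc j))) = rect_diff g a b (t 0) (t n)"
  "(\<Sum>i<n. rect_diff g (t i) (t (Suc i)) a b) = rect_diff g (t 0) (t n) a b"
  by (induct n) (auto simp: rect_diff_def)

text \<open>\<open>v a b\<close> is the Vitali variation over [0, a] x [0, b]. What the larger
  rectangle adds is cut into [a, a'] x [0, b'] and [0, a] x [b, b'], and the increment over either
  strip is at most the sum of the absolute increments over its subdivision.\<close>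

lemma variation_function_2d:
  assumes K: "vitali_bound S T g K"
  shows "\<exists>v. \<forall>a a' b b'. 0 \<le> a \<longrightarrow> a \<le> a' \<longrightarrow> a' \<le> S \<longrightarrow> 0 \<le> b \<longrightarrow> b \<le> b' \<longrightarrow> b' \<le> T \<longrightarrow>
     \<bar>rect_diff g a a' 0 b'\<bar> + \<bar>rect_diff g 0 a b b'\<bar> \<le> v a' b' - v a b"
proof -
  define Q where "Q a b = {((m, s), (n, t)). chain a m s \<and> chain b n t}" for a b
  define \<Sigma> where "\<Sigma> = (\<lambda>((m, s), (n, t)). \<Sum>i<m. \<Sum>j<n. \<bar>rect_diff g (s i) (s (Suc i)) (t j) (t (Suc j))\<bar>)"
  define v where "v a b = (SUP q\<in>Q a b. \<Sigma> q)" for a b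
  have ne: "Q a b \<noteq> {}" if a: "0 \<le> a" "0 \<le> b" for a b
  proof -
    have "((1, \<lambda>i. if i = 0 then 0 else a), (1, \<lambda>i. if i = 0 then 0 else b)) \<in> Q a b"
      using a by (auto simp: Q_def chain_def)
    then show ?thesis by blast
  qed
  have up: "\<Sigma> q \<le> v a b" if "q \<in> Q a b" "a \<le> S" "b \<le> T" for q a b
    unfolding v_def using K chain_weak_seq that
    by (intro cSUP_upper bdd_aboveI2[of _ _ K]) (auto simp: Q_def \<Sigma>_def vitali_bound_def)
  have 1: "v a b + \<bar>rect_diff g a a' 0 b\<bar> \<le> v a' b" if a: "0 \<le> a" "a \<le> a'" "a' \<le> S" "0 \<le> b" "b \<le> T" for a a' b
  proof -
    have "v a b \<le> v a' b - \<bar>rect_diff g a a' 0 b\<bar>"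
      unfolding v_def[of a b]
    proof (rule cSUP_least[OF ne[OF a(1,4)]])
      fix q assume "q \<in> Q a b"
      then obtain m s n t where q: "q = ((m, s), (n, t))" "chain a m s" "chain b n t" by (auto simp: Q_def)
      have e: "s m = a" "t 0 = 0" "t n = b" using q by (auto simp: chain_def)
      have "\<bar>rect_diff g a a' 0 b\<bar> \<le> (\<Sum>j<n. \<bar>rect_diff g a a' (t j) (t (Suc j))\<bar>)"
        using sum_abs[of "\<lambda>j. rect_diff g a a' (t j) (t (Suc j))" "{..<n}"] unfolding sum_rect_diff_telescope e .
      then have "\<Sigma> q + \<bar>rect_diff g a a' 0 b\<bar> \<le> \<Sigma> ((Suc m, s(Suc m := a')), (n, t))"
        unfolding \<Sigma>_def q prod.case sum_append[of "\<lambda>a b. \<Sum>j<n. \<bar>rect_diff g a b (t j) (t (Suc j))\<bar>"] e by simp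
      also have "\<dots> \<le> v a' b"
        using chain_append[OF q(2) a(2)] q(3) a by (intro up) (auto simp: Q_def)
      finally show "\<Sigma> q \<le> v a' b - \<bar>rect_diff g a a' 0 b\<bar>" by simp
    qed
    then show ?thesis by simp
  qed
  have 2: "v a b + \<bar>rect_diff g 0 a b b'\<bar> \<le> v a b'" if a: "0 \<le> a" "a \<le> S" "0 \<le> b" "b \<le> b'" "b' \<le> T" for a b b'
  proof -
    have "v a b \<le> v a b' - \<bar>rect_diff g 0 a b b'\<bar>"
      unfolding v_def[of a b]
    proof (rule cSUP_least[OF ne[OF a(1,3)]])
      fix q assume "q \<in> Q a b"
      then obtain m s n t where q: "q = ((m, s), (n, t))" "chain a m s" "chain b n t" by (auto simp: Q_def)
      have e: "s m = a" "s 0 = 0" "t n = b" using q by (auto simp: chain_def)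
      have "\<bar>rect_diff g 0 a b b'\<bar> \<le> (\<Sum>i<m. \<bar>rect_diff g (s i) (s (Suc i)) b b'\<bar>)"
        using sum_abs[of "\<lambda>i. rect_diff g (s i) (s (Suc i)) b b'" "{..<m}"] unfolding sum_rect_diff_telescope e .
      then have "\<Sigma> q + \<bar>rect_diff g 0 a b b'\<bar> \<le> \<Sigma> ((m, s), (Suc n, t(Suc n := b')))"
        unfolding \<Sigma>_def q prod.case sum_append[of "\<lambda>c d. \<bar>rect_diff g _ _ c d\<bar>"] e sum.distrib by simp
      also have "\<dots> \<le> v a b'"
        using chain_append[OF q(3) a(4)] q(2) a by (intro up) (auto simp: Q_def)
      finally show "\<Sigma> q \<le> v a b' - \<bar>rect_diff g 0 a b b'\<bar>" by simp
    qed
    then show ?thesis by simp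
  qed
  show ?thesis
  proof (intro exI[of _ v] allI impI)
    fix a a' b b' assume a: "0 \<le> a" "a \<le> a'" "a' \<le> S" "0 \<le> b" "b \<le> b'" "b' \<le> T"
    show "\<bar>rect_diff g a a' 0 b'\<bar> + \<bar>rect_diff g 0 a b b'\<bar> \<le> v a' b' - v a b"
      using 1[of a a' b'] 2[of a b b'] a by simp
  qed
qed

lemma bv_hardy_krause_majorant:
  assumes S: "S > 0" and T: "T > 0" and bv: "bv_hardy_krause S T g"
  obtains w K where "majorant S T g w" "vitali_bound S T g K"
proof -
  obtain K where K: "vitali_bound S T g K"
    using bv_vitali_weak[OF S T] bv unfolding bv_hardy_krause_def by blast
  obtain v where v: "\<And>a a' b b'. 0 \<le> a \<Longrightarrow> a \<le> a' \<Longrightarrow> a' \<le> S \<Longrightarrow> 0 \<le> b \<Longrightarrow> b \<le> b' \<Longrightarrow> b' \<le> T \<Longrightarrow>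
     \<bar>rect_diff g a a' 0 b'\<bar> + \<bar>rect_diff g 0 a b b'\<bar> \<le> v a' b' - v a b"
    using variation_function_2d[OF K] by metis
  obtain t0 s0 where t0: "t0 \<in> {0..T}" "bv_1d S (\<lambda>s. g (s, t0))" and s0: "s0 \<in> {0..S}" "bv_1d T (\<lambda>t. g (s0, t))"
    using bv unfolding bv_hardy_krause_def by blast
  obtain K1 where K1: "\<And>m s. weak_seq S m s \<Longrightarrow> (\<Sum>i<m. \<bar>g (s (Suc i), t0) - g (s i, t0)\<bar>) \<le> K1"
    using bv_1d_weak[OF S t0(2)] by blast
  obtain K2 where K2: "\<And>m s. weak_seq T m s \<Longrightarrow> (\<Sum>i<m. \<bar>g (s0, s (Suc i)) - g (s0, s i)\<bar>) \<le> K2"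
    using bv_1d_weak[OF T s0(2)] by blast
  \<comment> \<open>The section known to have bounded variation lies at height \<open>t0\<close>;
    moving it to height 0 costs at most the Vitali variation of the strip in between.\<close>
  have "\<exists>v. \<forall>a a'. 0 \<le> a \<longrightarrow> a \<le> a' \<longrightarrow> a' \<le> S \<longrightarrow> \<bar>g (a', 0) - g (a, 0)\<bar> \<le> v a' - v a"
  proof (rule variation_function_1d)
    fix m s assume s: "weak_seq S m s"
    have "(\<Sum>i<m. \<bar>g (s (Suc i), 0) - g (s i, 0)\<bar>) \<le>
      (\<Sum>i<m. \<bar>g (s (Suc i), t0) - g (s i, t0)\<bar> + \<bar>rect_diff g (s i) (s (Suc i)) 0 t0\<bar>)"
      by (intro sum_mono) (auto simp: rect_diff_def)
    \<comment> \<open>The second sum becomes a grid sum with a single row of cells from height 0 to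
      \<open>t0\<close>, the form in which \<open>K\<close> bounds it.\<close>
    also have "\<dots> = (\<Sum>i<m. \<bar>g (s (Suc i), t0) - g (s i, t0)\<bar>) + (\<Sum>i<m. \<Sum>j<1::nat. \<bar>rect_diff g (s i) (s (Suc i))
        ((\<lambda>j. if j = 0 then 0 else t0) j) ((\<lambda>j. if j = 0 then 0 else t0) (Suc j))\<bar>)"
      by (simp add: sum.distrib)
    also have "\<dots> \<le> K1 + K"
      using t0(1) K unfolding vitali_bound_def
      by (intro add_mono K1 s K[unfolded vitali_bound_def, rule_format]) (auto simp: weak_seq_def)
    finally show "(\<Sum>i<m. \<bar>g (s (Suc i), 0) - g (s i, 0)\<bar>) \<le> K1 + K" .
  qed
  then obtain v1 where v1: "\<And>a a'. 0 \<le> a \<Longrightarrow> a \<le> a' \<Longrightarrow> a' \<le> S \<Longrightarrow> \<bar>g (a', 0) - g (a, 0)\<bar> \<le> v1 a' - v1 a" by metis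
  have "\<exists>v. \<forall>a a'. 0 \<le> a \<longrightarrow> a \<le> a' \<longrightarrow> a' \<le> T \<longrightarrow> \<bar>g (0, a') - g (0, a)\<bar> \<le> v a' - v a"
  proof (rule variation_function_1d)
    fix m s assume s: "weak_seq T m s"
    have "(\<Sum>i<m. \<bar>g (0, s (Suc i)) - g (0, s i)\<bar>) \<le>
      (\<Sum>i<m. \<bar>g (s0, s (Suc i)) - g (s0, s i)\<bar> + \<bar>rect_diff g 0 s0 (s i) (s (Suc i))\<bar>)"
      by (intro sum_mono) (auto simp: rect_diff_def)
    also have "\<dots> = (\<Sum>i<m. \<bar>g (s0, s (Suc i)) - g (s0, s i)\<bar>) + (\<Sum>j<1::nat. \<Sum>i<m. \<bar>rect_diff g
        ((\<lambda>j. if j = 0 then 0 else s0) j) ((\<lambda>j. if j = 0 then 0 else s0) (Suc j)) (s i) (s (Suc i))\<bar>)"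
      by (simp add: sum.distrib)
    also have "\<dots> \<le> K2 + K"
      using s0(1) by (intro add_mono K2 s K[unfolded vitali_bound_def, rule_format]) (auto simp: weak_seq_def)
    finally show "(\<Sum>i<m. \<bar>g (0, s (Suc i)) - g (0, s i)\<bar>) \<le> K2 + K" .
  qed
  then obtain v2 where v2: "\<And>a a'. 0 \<le> a \<Longrightarrow> a \<le> a' \<Longrightarrow> a' \<le> T \<Longrightarrow> \<bar>g (0, a') - g (0, a)\<bar> \<le> v2 a' - v2 a" by metis
  have "majorant S T g (\<lambda>(s, t). v1 s + v2 t + v s t)"
    unfolding majorant_def prod.case
  proof (intro allI impI)
    fix a a' b b' assume a: "0 \<le> a" "a \<le> a'" "a' \<le> S" "0 \<le> b" "b \<le> b'" "b' \<le> T"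
    \<comment> \<open>Increments along the two axes, plus two rectangles that together form the
      L-shaped difference of [0, a'] x [0, b'] and [0, a] x [0, b].\<close>
    have "g (a', b') - g (a, b) = (g (a', 0) - g (a, 0)) + (g (0, b') - g (0, b)) + rect_diff g a a' 0 b' + rect_diff g 0 a b b'"
      by (simp add: rect_diff_def)
    then show "\<bar>g (a', b') - g (a, b)\<bar> \<le> v1 a' + v2 b' + v a' b' - (v1 a + v2 b + v a b)"
      using v1[of a a'] v2[of b b'] v[OF a] a by (smt (verit))
  qed
  then show ?thesis using K that by blast
qed

lemma majorant_mono:
  "majorant S T g w \<Longrightarrow> 0 \<le> a \<Longrightarrow> a \<le> a' \<Longrightarrow> a' \<le> S \<Longrightarrow> 0 \<le> b \<Longrightarrow> b \<le> b' \<Longrightarrow> b' \<le> T \<Longrightarrow> w (a, b) \<le> w (a', b')"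
  unfolding majorant_def by (smt (verit))

lemma majorantD:
  "majorant S T g w \<Longrightarrow> 0 \<le> a \<Longrightarrow> a \<le> a' \<Longrightarrow> a' \<le> S \<Longrightarrow> 0 \<le> b \<Longrightarrow> b \<le> b' \<Longrightarrow> b' \<le> T \<Longrightarrow>
   \<bar>g (a', b') - g (a, b)\<bar> \<le> w (a', b') - w (a, b)"
  unfolding majorant_def by blast

lemma majorant_bounded:
  assumes "majorant S T g w" "p \<in> rect S T"
  shows "\<bar>g p\<bar> \<le> \<bar>g (0, 0)\<bar> + (w (S, T) - w (0, 0))"
proof -
  obtain s t where p: "p = (s, t)" "0 \<le> s" "s \<le> S" "0 \<le> t" "t \<le> T"
    using assms(2) by (auto simp: rect_def)
  show ?thesis
    using majorantD[OF assms(1), of 0 s 0 t] majorant_mono[OF assms(1), of s S t T] p by auto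
qed

section \<open>Riemann sums and measurability of functions with a majorant\<close>

lemma sum_indicator_cells:
  fixes s :: "nat \<Rightarrow> real"
  shows "(\<And>i. i < m \<Longrightarrow> s i \<le> s (Suc i)) \<Longrightarrow>
    (\<Sum>i<m. indicator {s i..<s (Suc i)} x) = (indicator {s 0..<s m} x :: real)"
proof (induct m)
  case (Suc m)
  note le = Suc(2)
  have "s 0 \<le> s k" if "k \<le> m" for k
    using that
  proof (induct k)
    case (Suc k)
    then show ?case using le[of k] by simp
  qed simp
  from this[of m] have "s 0 \<le> s m" by simp
  with Suc show ?case by (auto simp: indicator_def split: if_splits) (meson lessI not_le order.trans)+
qed simp

text \<open>The increment of \<open>w\<close> over a cell splits into a horizontal and a vertical
  part. Horizontal parts telescope along a row to at most \<open>w (S, T) - w (0, 0)\<close>, the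
  heights of the rows add up to \<open>T\<close>, and the remaining side is at most
  \<open>d\<close>; vertical parts are treated likewise.\<close>

lemma mesh_sum:
  assumes w: "majorant S T g w" and s: "partition S m s" and t: "partition T n t" and d: "0 \<le> d"
    and ds: "\<And>i. i < m \<Longrightarrow> s (Suc i) - s i \<le> d" and dt: "\<And>j. j < n \<Longrightarrow> t (Suc j) - t j \<le> d"
  shows "(\<Sum>i<m. \<Sum>j<n. (w (s (Suc i), t (Suc j)) - w (s i, t j)) * ((s (Suc i) - s i) * (t (Suc j) - t j)))
     \<le> d * (S + T) * (w (S, T) - w (0, 0))"
proof -
  define W where "W = w (S, T) - w (0, 0)"
  note ws = partition_weak_seq[OF s] and wt = partition_weak_seq[OF t]
  have s': "0 \<le> s i" "s i \<le> S" if "i \<le> m" for i using weak_seq_range[OF ws that] by auto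
  have t': "0 \<le> t i" "t i \<le> T" if "i \<le> n" for i using weak_seq_range[OF wt that] by auto
  have sS: "s i \<le> s (Suc i)" if "i < m" for i using s that by (auto simp: partition_def less_imp_le)
  have tS: "t i \<le> t (Suc i)" if "i < n" for i using t that by (auto simp: partition_def less_imp_le)
  have e: "s 0 = 0" "s m = S" "t 0 = 0" "t n = T" using s t by (auto simp: partition_def)
  have ST: "0 \<le> S" "0 \<le> T" using s'[of 0] t'[of 0] by auto
  note wm = majorant_mono[OF w]
  have "(\<Sum>i<m. \<Sum>j<n. (w (s (Suc i), t (Suc j)) - w (s i, t j)) * ((s (Suc i) - s i) * (t (Suc j) - t j)))
    \<le> (\<Sum>i<m. \<Sum>j<n. d * ((t (Suc j) - t j) * (w (s (Suc i), t (Suc j)) - w (s i, t (Suc j)))) +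
         d * ((s (Suc i) - s i) * (w (s i, t (Suc j)) - w (s i, t j))))"
  proof (intro sum_mono)
    fix i j assume i: "i \<in> {..<m}" and j: "j \<in> {..<n}"
    have a: "0 \<le> w (s (Suc i), t (Suc j)) - w (s i, t (Suc j))" "0 \<le> w (s i, t (Suc j)) - w (s i, t j)"
      using wm[of "s i" "s (Suc i)" "t (Suc j)" "t (Suc j)"] wm[of "s i" "s i" "t j" "t (Suc j)"] i j s' t' sS tS by auto
    have b: "0 \<le> s (Suc i) - s i" "s (Suc i) - s i \<le> d" "0 \<le> t (Suc j) - t j" "t (Suc j) - t j \<le> d"
      using i j sS tS ds dt by auto
    have "(w (s (Suc i), t (Suc j)) - w (s i, t j)) * ((s (Suc i) - s i) * (t (Suc j) - t j)) =
      (s (Suc i) - s i) * ((t (Suc j) - t j) * (w (s (Suc i), t (Suc j)) - w (s i, t (Suc j)))) +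
      (t (Suc j) - t j) * ((s (Suc i) - s i) * (w (s i, t (Suc j)) - w (s i, t j)))"
      by (simp add: algebra_simps)
    also have "\<dots> \<le> d * ((t (Suc j) - t j) * (w (s (Suc i), t (Suc j)) - w (s i, t (Suc j)))) +
         d * ((s (Suc i) - s i) * (w (s i, t (Suc j)) - w (s i, t j)))"
      using a b by (intro add_mono mult_right_mono mult_nonneg_nonneg) auto
    finally show "(w (s (Suc i), t (Suc j)) - w (s i, t j)) * ((s (Suc i) - s i) * (t (Suc j) - t j)) \<le>
      d * ((t (Suc j) - t j) * (w (s (Suc i), t (Suc j)) - w (s i, t (Suc j)))) +
         d * ((s (Suc i) - s i) * (w (s i, t (Suc j)) - w (s i, t j)))" .
  qed
  also have "\<dots> = d * (\<Sum>j<n. (t (Suc j) - t j) * (\<Sum>i<m. w (s (Suc i), t (Suc j)) - w (s i, t (Suc j))))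
     + d * (\<Sum>i<m. (s (Suc i) - s i) * (\<Sum>j<n. w (s i, t (Suc j)) - w (s i, t j)))"
    unfolding sum.distrib
    by (subst sum.swap) (simp add: sum_distrib_left)
  also have "\<dots> = d * (\<Sum>j<n. (t (Suc j) - t j) * (w (S, t (Suc j)) - w (0, t (Suc j))))
     + d * (\<Sum>i<m. (s (Suc i) - s i) * (w (s i, T) - w (s i, 0)))"
    using sum_lessThan_telescope[of "\<lambda>i. w (s i, _)" m] sum_lessThan_telescope[of "\<lambda>j. w (_, t j)" n] e by simp
  also have "\<dots> \<le> d * (\<Sum>j<n. (t (Suc j) - t j) * W) + d * (\<Sum>i<m. (s (Suc i) - s i) * W)"
  proof (intro add_mono mult_left_mono sum_mono d)
    fix j assume j: "j \<in> {..<n}"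
    show "w (S, t (Suc j)) - w (0, t (Suc j)) \<le> W"
      using wm[of S S "t (Suc j)" T] wm[of 0 0 0 "t (Suc j)"] j t'[of "Suc j"] ST by (auto simp: W_def)
    show "0 \<le> t (Suc j) - t j" using tS j by auto
  next
    fix i assume i: "i \<in> {..<m}"
    show "w (s i, T) - w (s i, 0) \<le> W"
      using wm[of "s i" S T T] wm[of 0 "s i" 0 0] i s'[of i] ST by (auto simp: W_def)
    show "0 \<le> s (Suc i) - s i" using sS i by auto
  qed
  also have "\<dots> = d * (S + T) * W"
    unfolding sum_distrib_right[symmetric] sum_lessThan_telescope e by (simp add: algebra_simps)
  finally show ?thesis by (simp add: W_def)
qed

abbreviation area :: "real \<Rightarrow> real \<Rightarrow> (real \<times> real) measure" where
  "area S T \<equiv> lebesgue_on (rect S T)"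

lemma sets_halfopen_Times [measurable]: "{a..<b} \<times> {c..<d} \<in> sets (borel :: (real \<times> real) measure)"
  unfolding borel_prod[symmetric] by (rule pair_measureI) auto

lemma rect_cbox: "rect S T = cbox (0, 0) (S, T)"
  by (simp add: rect_def cbox_Pair_eq)

lemma sets_rect [measurable]: "rect S T \<in> sets borel" "rect S T \<in> sets lebesgue"
  by (auto simp: rect_cbox)

lemma space_area [simp]: "space (area S T) = rect S T"
  by simp

lemma finite_measure_area: "finite_measure (area S T)"
  by (rule finite_measureI) (simp add: emeasure_restrict_space rect_cbox emeasure_lborel_cbox_eq)

lemma borel_measurable_area: "f \<in> borel_measurable borel \<Longrightarrow> f \<in> borel_measurable (area S T)"
  by (intro measurable_restrict_space1 measurable_completion) simp

text \<open>The half-open cells of a grid miss the upper and the right edge of the rectangle, which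
  are null.\<close>

lemma AE_area_less: "AE p in area S T. fst p < S \<and> snd p < T"
proof -
  have n: "cbox (S, 0) (S, T) \<in> null_sets lborel" "cbox (0, T) (S, T) \<in> null_sets lborel"
    by (auto simp: null_sets_def emeasure_lborel_cbox_eq Basis_prod_def)
  have "AE p in lebesgue. p \<in> rect S T \<longrightarrow> fst p < S \<and> snd p < T"
    using AE_completion[OF AE_not_in[OF n(1)]] AE_completion[OF AE_not_in[OF n(2)]]
    by eventually_elim (auto simp: rect_def cbox_Pair_eq)
  then show ?thesis by (subst AE_restrict_space_iff) (assumption | simp)+
qed

lemma integral_area:
  fixes f :: "real \<times> real \<Rightarrow> real"
  assumes [measurable]: "f \<in> borel_measurable borel"
  shows "(LINT p|area S T. f p) = (LINT p|lborel. indicator (rect S T) p * f p)"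
  by (subst integral_restrict_space) (auto simp: integral_completion)

text \<open>By Fubini and the fundamental theorem of calculus the weight of a cell is the
  rectangular increment of the product of \<alpha> and \<beta>. Riemann--Stieltjes sums against such
  a product thereby become Riemann sums against a continuous density.\<close>

lemma cell_integral:
  assumes \<alpha>: "\<And>x. (\<alpha> has_real_derivative \<alpha>' x) (at x)" "continuous_on UNIV \<alpha>'"
    and \<beta>: "\<And>x. (\<beta> has_real_derivative \<beta>' x) (at x)" "continuous_on UNIV \<beta>'"
    and ab: "0 \<le> a" "a \<le> b" "b \<le> S" "0 \<le> c" "c \<le> d" "d \<le> T"
  shows "(LINT p|area S T. indicator ({a..<b} \<times> {c..<d}) p * (\<alpha>' (fst p) * \<beta>' (snd p))) = (\<alpha> b - \<alpha> a) * (\<beta> d - \<beta> c)"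
proof -
  have m[measurable]: "\<alpha>' \<in> borel_measurable borel" "\<beta>' \<in> borel_measurable borel"
    using \<alpha> \<beta> by (auto intro: borel_measurable_continuous_onI)
  have one: "has_bochner_integral lborel (\<lambda>x. indicator {a..<b} x * f' x) (f b - f a)"
    if f: "\<And>x. (f has_real_derivative f' x) (at x)" "continuous_on UNIV f'" and ab: "a \<le> b" for f f' and a b :: real
  proof -
    have [measurable]: "f' \<in> borel_measurable borel" using f by (auto intro: borel_measurable_continuous_onI)
    have "has_bochner_integral lborel (\<lambda>x. f' x * indicator {a..b} x) (f b - f a)"
      using f ab by (intro has_bochner_integral_FTC_Icc_real) (auto simp: continuous_on_eq_continuous_at)
    moreover have "AE x in lborel. f' x * indicator {a..b} x = indicator {a..<b} x * f' x"
      using AE_lborel_singleton[of b] by eventually_elim (auto simp: indicator_def)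
    ultimately show ?thesis by (subst (asm) has_bochner_integral_cong_AE) auto
  qed
  note A = one[OF \<alpha> ab(2)] and B = one[OF \<beta> ab(5)]
  have mk: "(\<lambda>p. indicator ({a..<b} \<times> {c..<d}) p * (\<alpha>' (fst p) * \<beta>' (snd p))) \<in> borel_measurable borel"
    by (intro borel_measurable_times borel_measurable_indicator sets_halfopen_Times
      measurable_compose[OF borel_measurable_continuous_onI m(1)] measurable_compose[OF borel_measurable_continuous_onI m(2)]
      continuous_intros)
  define F where "F x = indicator {a..<b} x * \<alpha>' x" for x
  define G where "G x = indicator {c..<d} x * \<beta>' x" for x
  have [measurable]: "F \<in> borel_measurable borel" "G \<in> borel_measurable borel"
    by (auto simp: F_def[abs_def] G_def[abs_def])
  have FG: "integrable lborel F" "integral\<^sup>L lborel F = \<alpha> b - \<alpha> a" "integrable lborel G" "integral\<^sup>L lborel G = \<beta> d - \<beta> c"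
    using A B by (auto simp: has_bochner_integral_iff F_def[abs_def] G_def[abs_def])
  have "(LINT p|area S T. indicator ({a..<b} \<times> {c..<d}) p * (\<alpha>' (fst p) * \<beta>' (snd p))) =
    (LINT p|lborel. F (fst p) * G (snd p))"
    using ab mk by (subst integral_area)
      (auto intro!: Bochner_Integration.integral_cong simp: F_def G_def indicator_def rect_def)
  also have "\<dots> = (LINT p|(lborel \<Otimes>\<^sub>M lborel). F (fst p) * G (snd p))"
    by (simp add: lborel_prod)
  also have "\<dots> = (LINT x|lborel. LINT y|lborel. F x * G y)"
  proof -
    have "integrable (lborel \<Otimes>\<^sub>M lborel) (\<lambda>(x, y). F x * G y)"
      using FG(1,3) by (intro lborel_pair.Fubini_integrable) (auto simp: abs_mult)
    from lborel_pair.integral_fst'[OF this] show ?thesis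
      by (simp add: case_prod_unfold)
  qed
  also have "\<dots> = (\<alpha> b - \<alpha> a) * (\<beta> d - \<beta> c)" using FG by simp
  finally show ?thesis .
qed

lemma cell_area:
  assumes "0 \<le> a" "a \<le> b" "b \<le> S" "0 \<le> c" "c \<le> d" "d \<le> T"
  shows "(LINT p|area S T. indicator ({a..<b} \<times> {c..<d}) p) = (b - a) * (d - c)"
  using cell_integral[OF _ _ _ _ assms, of "\<lambda>x. x" "\<lambda>_. 1" "\<lambda>x. x" "\<lambda>_. 1"] by (auto intro!: derivative_eq_intros)

definition grid_cell :: "(nat \<Rightarrow> real) \<Rightarrow> (nat \<Rightarrow> real) \<Rightarrow> nat \<Rightarrow> nat \<Rightarrow> (real \<times> real) set" where
  "grid_cell s t i j = {s i..<s (Suc i)} \<times> {t j..<t (Suc j)}"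

context
  fixes S T :: real and g w :: plane_fun and m n :: nat and s t :: "nat \<Rightarrow> real" and d :: real
    and \<xi> \<eta> :: "nat \<Rightarrow> real"
  assumes w: "majorant S T g w" and s: "partition S m s" and t: "partition T n t" and d: "0 \<le> d"
    and ds: "\<And>i. i < m \<Longrightarrow> s (Suc i) - s i \<le> d \<and> \<xi> i \<in> {s i..s (Suc i)}"
    and dt: "\<And>j. j < n \<Longrightarrow> t (Suc j) - t j \<le> d \<and> \<eta> j \<in> {t j..t (Suc j)}"
begin

text \<open>Both \<open>p\<close> and the tag of its cell are compared with the lower left corner of
  the cell, whence the factor 2.\<close>

definition step_error :: "real \<times> real \<Rightarrow> real" where
  "step_error p = (\<Sum>i<m. \<Sum>j<n. 2 * (w (s (Suc i), t (Suc j)) - w (s i, t j)) * indicator (grid_cell s t i j) p)"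

definition step_fun :: "real \<times> real \<Rightarrow> real" where
  "step_fun p = (\<Sum>i<m. \<Sum>j<n. g (\<xi> i, \<eta> j) * indicator (grid_cell s t i j) p)"

lemma sets_cell [measurable]: "grid_cell s t i j \<in> sets borel"
  unfolding grid_cell_def by (rule sets_halfopen_Times)

lemma step_measurable [measurable]: "step_error \<in> borel_measurable borel" "step_fun \<in> borel_measurable borel"
  unfolding step_error_def[abs_def] step_fun_def[abs_def] by measurable

lemma part_facts:
  "i < m \<Longrightarrow> 0 \<le> s i \<and> s i \<le> s (Suc i) \<and> s (Suc i) \<le> S"
  "j < n \<Longrightarrow> 0 \<le> t j \<and> t j \<le> t (Suc j) \<and> t (Suc j) \<le> T"
  using weak_seq_range[OF partition_weak_seq[OF s]] weak_seq_range[OF partition_weak_seq[OF t]] s t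
  by (auto simp: partition_def less_imp_le)

lemma step_error_bound:
  assumes p: "p \<in> {0..<S} \<times> {0..<T}"
  shows "\<bar>g p - step_fun p\<bar> \<le> step_error p"
proof -
  have one: "(\<Sum>i<m. \<Sum>j<n. indicator (grid_cell s t i j) p) = (1::real)"
  proof -
    have "(\<Sum>i<m. \<Sum>j<n. indicator (grid_cell s t i j) p :: real) =
      (\<Sum>i<m. indicator {s i..<s (Suc i)} (fst p)) * (\<Sum>j<n. indicator {t j..<t (Suc j)} (snd p))"
      by (simp add: sum_product grid_cell_def indicator_times)
    also have "\<dots> = indicator {0..<S} (fst p) * indicator {0..<T} (snd p)"
      using s t by (subst (1 2) sum_indicator_cells) (auto simp: partition_def less_imp_le)
    finally show ?thesis using p by auto
  qed
  have "g p = (\<Sum>i<m. \<Sum>j<n. g p * indicator (grid_cell s t i j) p)"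
    using one by (simp add: sum_distrib_left[symmetric])
  then have "\<bar>g p - step_fun p\<bar> = \<bar>\<Sum>i<m. \<Sum>j<n. (g p - g (\<xi> i, \<eta> j)) * indicator (grid_cell s t i j) p\<bar>"
    by (simp add: step_fun_def left_diff_distrib sum_subtractf)
  also have "\<dots> \<le> step_error p"
    unfolding step_error_def
  proof (rule order_trans[OF sum_abs], intro sum_mono, rule order_trans[OF sum_abs], intro sum_mono)
    fix i j assume i: "i \<in> {..<m}" and j: "j \<in> {..<n}"
    show "\<bar>(g p - g (\<xi> i, \<eta> j)) * indicator (grid_cell s t i j) p\<bar>
      \<le> 2 * (w (s (Suc i), t (Suc j)) - w (s i, t j)) * indicator (grid_cell s t i j) p"
    proof (cases "p \<in> grid_cell s t i j")
      case True
      then obtain x y where p: "p = (x, y)" "s i \<le> x" "x < s (Suc i)" "t j \<le> y" "y < t (Suc j)"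
        by (auto simp: grid_cell_def)
      have "\<bar>g p - g (s i, t j)\<bar> \<le> w (s (Suc i), t (Suc j)) - w (s i, t j)"
        using majorantD[OF w, of "s i" x "t j" y] majorant_mono[OF w, of x "s (Suc i)" y "t (Suc j)"]
          p part_facts(1)[of i] part_facts(2)[of j] i j by auto
      moreover have "\<bar>g (\<xi> i, \<eta> j) - g (s i, t j)\<bar> \<le> w (s (Suc i), t (Suc j)) - w (s i, t j)"
        using majorantD[OF w, of "s i" "\<xi> i" "t j" "\<eta> j"] majorant_mono[OF w, of "\<xi> i" "s (Suc i)" "\<eta> j" "t (Suc j)"]
          ds[of i] dt[of j] part_facts(1)[of i] part_facts(2)[of j] i j by auto
      ultimately show ?thesis using True by simp
    qed simp
  qed
  finally show ?thesis .
qed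

lemma cell_integrable:
  "integrable (area S T) (\<lambda>p. indicator (grid_cell s t i j) p :: real)"
  by (rule finite_measure.integrable_const_bound[OF finite_measure_area, where B=1])
     (auto intro: borel_measurable_area)

lemma step_error_integral:
  "integrable (area S T) step_error"
  "(LINT p|area S T. step_error p) \<le> 2 * (d * (S + T) * (w (S, T) - w (0, 0)))"
proof -
  show "integrable (area S T) step_error"
    unfolding step_error_def[abs_def]
    by (intro Bochner_Integration.integrable_sum Bochner_Integration.integrable_mult_right cell_integrable)
  have "(LINT p|area S T. step_error p) = (\<Sum>i<m. \<Sum>j<n. 2 * (w (s (Suc i), t (Suc j)) - w (s i, t j)) * (LINT p|area S T. indicator (grid_cell s t i j) p))"
    unfolding step_error_def
    by (simp only: Bochner_Integration.integral_sum Bochner_Integration.integrable_sum Bochner_Integration.integrable_mult_right cell_integrable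
      Bochner_Integration.integral_mult_right)
  also have "\<dots> = (\<Sum>i<m. \<Sum>j<n. 2 * (w (s (Suc i), t (Suc j)) - w (s i, t j)) * ((s (Suc i) - s i) * (t (Suc j) - t j)))"
    unfolding grid_cell_def using part_facts by (intro sum.cong refl arg_cong2[where f="(*)"] cell_area) auto
  also have "\<dots> = 2 * (\<Sum>i<m. \<Sum>j<n. (w (s (Suc i), t (Suc j)) - w (s i, t j)) * ((s (Suc i) - s i) * (t (Suc j) - t j)))"
    by (simp only: sum_distrib_left mult.assoc)
  also have "\<dots> \<le> 2 * (d * (S + T) * (w (S, T) - w (0, 0)))"
    using mesh_sum[OF w s t d] ds dt by simp
  finally show "(LINT p|area S T. step_error p) \<le> 2 * (d * (S + T) * (w (S, T) - w (0, 0)))" .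
qed

lemma AE_step_error: "AE p in area S T. \<bar>g p - step_fun p\<bar> \<le> step_error p"
  using AE_area_less AE_space by eventually_elim (rule step_error_bound, auto simp: rect_def mem_Times_iff)

text \<open>The weight \<open>k\<close> is the density of a smooth path when Riemann--Stieltjes
  integrals are constructed, and 1 when a sum of squares is compared with an integral.\<close>

lemma riemann_sum_error:
  assumes [measurable]: "g \<in> borel_measurable (area S T)" "k \<in> borel_measurable (area S T)"
    and B: "\<And>p. p \<in> rect S T \<Longrightarrow> \<bar>k p\<bar> \<le> B"
  shows "\<bar>(LINT p|area S T. g p * k p) - (\<Sum>i<m. \<Sum>j<n. g (\<xi> i, \<eta> j) * (LINT p|area S T. indicator (grid_cell s t i j) p * k p))\<bar>
    \<le> B * (2 * (d * (S + T) * (w (S, T) - w (0, 0))))"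
proof -
  interpret finite_measure "area S T" by (rule finite_measure_area)
  have [measurable]: "step_error \<in> borel_measurable (area S T)" "step_fun \<in> borel_measurable (area S T)"
    by (auto intro: borel_measurable_area)
  have "(0, 0) \<in> rect S T"
    using weak_seq_range[OF partition_weak_seq[OF s], of m] weak_seq_range[OF partition_weak_seq[OF t], of n]
    by (auto simp: rect_def)
  from B[OF this] have B0: "0 \<le> B" by linarith
  have bdd: "integrable (area S T) f" if "f \<in> borel_measurable (area S T)" "\<And>p. p \<in> rect S T \<Longrightarrow> \<bar>f p\<bar> \<le> C" for f :: "real \<times> real \<Rightarrow> real" and C
    using that by (intro integrable_const_bound[of _ C] AE_I2) auto
  have gk: "integrable (area S T) (\<lambda>p. g p * k p)"
  proof (rule bdd)
    fix p assume p: "p \<in> rect S T"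
    show "\<bar>g p * k p\<bar> \<le> (\<bar>g (0, 0)\<bar> + (w (S, T) - w (0, 0))) * B"
      unfolding abs_mult
      by (rule mult_mono[OF majorant_bounded[OF w p] B[OF p] order_trans[OF abs_ge_zero majorant_bounded[OF w p]] abs_ge_zero])
  qed measurable
  have ck: "integrable (area S T) (\<lambda>p. indicator (grid_cell s t i j) p * k p)" for i j
  proof (rule bdd)
    show "(\<lambda>p. indicator (grid_cell s t i j) p * k p) \<in> borel_measurable (area S T)"
      by (intro borel_measurable_times assms(2) borel_measurable_area borel_measurable_indicator sets_cell)
    show "\<bar>indicator (grid_cell s t i j) p * k p\<bar> \<le> B" if "p \<in> rect S T" for p
      using B[OF that] B0 by (auto simp: indicator_def)
  qed
  have "(\<Sum>i<m. \<Sum>j<n. g (\<xi> i, \<eta> j) * (LINT p|area S T. indicator (grid_cell s t i j) p * k p)) =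
     (LINT p|area S T. (\<Sum>i<m. \<Sum>j<n. g (\<xi> i, \<eta> j) * (indicator (grid_cell s t i j) p * k p)))"
    by (simp only: Bochner_Integration.integral_sum Bochner_Integration.integrable_sum Bochner_Integration.integrable_mult_right ck
      Bochner_Integration.integral_mult_right)
  also have "\<dots> = (LINT p|area S T. step_fun p * k p)"
    by (simp only: step_fun_def sum_distrib_right mult.assoc)
  finally have e: "(\<Sum>i<m. \<Sum>j<n. g (\<xi> i, \<eta> j) * (LINT p|area S T. indicator (grid_cell s t i j) p * k p)) = (LINT p|area S T. step_fun p * k p)" .
  have sk: "integrable (area S T) (\<lambda>p. step_fun p * k p)"
  proof -
    have "integrable (area S T) (\<lambda>p. \<Sum>i<m. \<Sum>j<n. g (\<xi> i, \<eta> j) * (indicator (grid_cell s t i j) p * k p))"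
      by (intro Bochner_Integration.integrable_sum Bochner_Integration.integrable_mult_right ck)
    then show ?thesis by (simp only: step_fun_def sum_distrib_right mult.assoc)
  qed
  have "\<bar>(LINT p|area S T. g p * k p) - (LINT p|area S T. step_fun p * k p)\<bar> = \<bar>LINT p|area S T. (g p - step_fun p) * k p\<bar>"
    using gk sk by (simp add: left_diff_distrib)
  also have "\<dots> \<le> (LINT p|area S T. B * step_error p)"
  proof -
    have i: "integrable (area S T) (\<lambda>p. (g p - step_fun p) * k p)" using gk sk by (simp add: left_diff_distrib)
    have "\<bar>LINT p|area S T. (g p - step_fun p) * k p\<bar> \<le> (LINT p|area S T. \<bar>(g p - step_fun p) * k p\<bar>)"
      using integral_norm_bound[of "area S T" "\<lambda>p. (g p - step_fun p) * k p"] by simp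
    also have "\<dots> \<le> (LINT p|area S T. B * step_error p)"
    proof (rule integral_mono_AE)
      show "integrable (area S T) (\<lambda>p. B * step_error p)" using step_error_integral by simp
      show "AE p in area S T. \<bar>(g p - step_fun p) * k p\<bar> \<le> B * step_error p"
        using AE_step_error AE_space
      proof eventually_elim
        case (elim p)
        then have "\<bar>k p\<bar> \<le> B" using B[of p] by simp
        with elim show ?case using B0 mult_mono[of "\<bar>k p\<bar>" B "\<bar>g p - step_fun p\<bar>" "step_error p"]
          by (simp add: abs_mult mult.commute)
      qed
    qed (use i in auto)
    finally show ?thesis .
  qed
  also have "\<dots> \<le> B * (2 * (d * (S + T) * (w (S, T) - w (0, 0))))"
    using step_error_integral B0 by (simp add: mult_left_mono)
  finally show ?thesis unfolding e .
qed

text \<open>The error is dominated by an integrable \<open>U\<close> with small integral rather than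
  integrated itself: this is the input from which measurability of \<open>g\<close> is
  deduced.\<close>

lemma step_approximation:
  "\<exists>f U. f \<in> borel_measurable borel \<and> integrable (area S T) U \<and>
     (AE p in area S T. \<bar>g p - f p\<bar> \<le> U p) \<and>
     (LINT p|area S T. U p) \<le> 2 * (d * (S + T) * (w (S, T) - w (0, 0)))"
  using step_measurable(2) step_error_integral AE_step_error by blast

end

lemma partition_uniform:
  assumes "L > 0"
  shows "partition L (Suc N) (\<lambda>i. real i * L / real (Suc N))"
  using assms by (auto simp: partition_def divide_strict_right_mono)

lemma uniform_mesh:
  "real (Suc i) * L / real (Suc N) - real i * L / real (Suc N) = L / real (Suc N)"
  by (simp only: diff_divide_distrib[symmetric] left_diff_distrib[symmetric]) simp

text \<open>The errors of step functions on uniform grids are dominated by functions with integrals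
  O(1 / N), a subsequence of which tends to 0 almost everywhere. So \<open>g\<close> is almost
  everywhere a limit of Borel functions, and completeness of Lebesgue measure does the rest.\<close>

lemma majorant_measurable:
  assumes S: "S > 0" and T: "T > 0" and w: "majorant S T g w"
  shows "g \<in> borel_measurable (area S T)"
proof -
  define C where "C = 2 * ((S + T) * (S + T) * (w (S, T) - w (0, 0)))"
  define P where "P N f U \<longleftrightarrow> f \<in> borel_measurable borel \<and> integrable (area S T) U \<and>
     (AE p in area S T. \<bar>g p - f p\<bar> \<le> U p) \<and> (LINT p|area S T. U p) \<le> C / real (Suc N)" for N f U
  have "\<exists>f U. P N f U" for N
  proof -
    define \<xi> where "\<xi> L i = real i * L / real (Suc N)" for L i
    have "\<exists>f U. f \<in> borel_measurable borel \<and> integrable (area S T) U \<and>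
     (AE p in area S T. \<bar>g p - f p\<bar> \<le> U p) \<and>
     (LINT p|area S T. U p) \<le> 2 * ((S + T) / real (Suc N) * (S + T) * (w (S, T) - w (0, 0)))"
    proof (rule step_approximation[OF w, of "Suc N" "\<xi> S" "Suc N" "\<xi> T" _ "\<xi> S" "\<xi> T"])
      show "partition S (Suc N) (\<xi> S)" "partition T (Suc N) (\<xi> T)"
        unfolding \<xi>_def using partition_uniform S T by blast+
      show "0 \<le> (S + T) / real (Suc N)" using S T by auto
      fix i
      show "\<xi> S (Suc i) - \<xi> S i \<le> (S + T) / real (Suc N) \<and> \<xi> S i \<in> {\<xi> S i..\<xi> S (Suc i)}"
        "\<xi> T (Suc i) - \<xi> T i \<le> (S + T) / real (Suc N) \<and> \<xi> T i \<in> {\<xi> T i..\<xi> T (Suc i)}"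
        using S T unfolding \<xi>_def uniform_mesh
        by (simp_all add: divide_right_mono mult_right_mono)
    qed
    then show ?thesis unfolding P_def by (simp only: C_def times_divide_eq_left times_divide_eq_right)
  qed
  then obtain f U where fP: "\<And>N. P N (f N) (U N)" by metis
  then have f: "\<And>N. f N \<in> borel_measurable borel" and U: "\<And>N. integrable (area S T) (U N)"
    and fU: "\<And>N. AE p in area S T. \<bar>g p - f N p\<bar> \<le> U N p"
    and UC: "\<And>N. (LINT p|area S T. U N p) \<le> C / real (Suc N)"
    unfolding P_def by blast+
  have "(\<lambda>N. LINT p|area S T. norm (U N p)) \<longlonglongrightarrow> 0"
  proof (rule tendsto_sandwich)
    show "\<forall>\<^sub>F N in sequentially. 0 \<le> (LINT p|area S T. norm (U N p))" by simp
    have "(LINT p|area S T. norm (U N p)) = (LINT p|area S T. U N p)" for N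
      using fU[of N] U[of N] by (intro integral_cong_AE) (auto elim!: eventually_mono)
    then show "\<forall>\<^sub>F N in sequentially. (LINT p|area S T. norm (U N p)) \<le> C / real (Suc N)"
      using UC by simp
    show "(\<lambda>N. C / real (Suc N)) \<longlonglongrightarrow> 0"
      using tendsto_mult[OF tendsto_const[of C] LIMSEQ_Suc[OF lim_1_over_n]] by simp
  qed simp
  from tendsto_L1_AE_subseq[OF U this] obtain r where r: "AE p in area S T. (\<lambda>n. U (r n) p) \<longlonglongrightarrow> 0" by blast
  define h where "h p = lim (\<lambda>n. f (r n) p)" for p
  have [measurable]: "h \<in> borel_measurable borel"
    unfolding h_def[abs_def] using f by measurable
  have "AE p in area S T. \<forall>N. \<bar>g p - f N p\<bar> \<le> U N p" using fU by (simp add: AE_all_countable)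
  with r have ae: "AE p in area S T. h p = g p"
  proof eventually_elim
    case (elim p)
    have "(\<lambda>n. g p - f (r n) p) \<longlonglongrightarrow> 0"
      by (rule Lim_null_comparison[OF _ elim(1)]) (use elim(2) in auto)
    then have "(\<lambda>n. f (r n) p) \<longlonglongrightarrow> g p"
      using tendsto_diff[OF tendsto_const[of "g p"]] by fastforce
    then show ?case unfolding h_def by (rule limI)
  qed
  have "AE p in lebesgue. p \<in> rect S T \<longrightarrow> h p = g p"
    using ae by (subst (asm) AE_restrict_space_iff) auto
  then have "AE p in lebesgue. indicator (rect S T) p *\<^sub>R h p = indicator (rect S T) p *\<^sub>R g p"
    by eventually_elim (auto simp: indicator_def)
  moreover have "(\<lambda>p. indicator (rect S T) p *\<^sub>R h p) \<in> borel_measurable lebesgue"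
    by (intro measurable_completion) simp
  ultimately have "(\<lambda>p. indicator (rect S T) p *\<^sub>R g p) \<in> borel_measurable lebesgue"
    by (rule borel_measurable_AE[rotated])
  then show ?thesis by (subst borel_measurable_restrict_space_iff) auto
qed

subsection \<open>Riemann--Stieltjes integrals\<close>

lemma abel_summation:
  fixes b y :: "nat \<Rightarrow> real"
  shows "(\<Sum>j<Suc n. b j * (y (Suc j) - y j)) = b n * y (Suc n) - b 0 * y 0 - (\<Sum>j<n. (b (Suc j) - b j) * y (Suc j))"
  by (induct n) (simp_all add: algebra_simps)

lemma abel_bound:
  fixes b y :: "nat \<Rightarrow> real"
  assumes y: "\<And>j. j \<le> Suc n \<Longrightarrow> \<bar>y j\<bar> \<le> X"
  shows "\<bar>\<Sum>j<Suc n. b j * (y (Suc j) - y j)\<bar> \<le> 2 * X * (\<bar>b 0\<bar> + (\<Sum>j<n. \<bar>b (Suc j) - b j\<bar>))"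
proof -
  have X0: "0 \<le> X" using y[of 0] by linarith
  have bn: "\<bar>b n\<bar> \<le> \<bar>b 0\<bar> + (\<Sum>j<n. \<bar>b (Suc j) - b j\<bar>)"
    by (induct n) auto
  have "\<bar>\<Sum>j<Suc n. b j * (y (Suc j) - y j)\<bar> \<le> \<bar>b n\<bar> * X + \<bar>b 0\<bar> * X + (\<Sum>j<n. \<bar>b (Suc j) - b j\<bar> * X)"
  proof -
    have "\<bar>b n * y (Suc n)\<bar> \<le> \<bar>b n\<bar> * X" "\<bar>b 0 * y 0\<bar> \<le> \<bar>b 0\<bar> * X"
      using y by (auto simp: abs_mult intro!: mult_left_mono)
    moreover have "\<bar>\<Sum>j<n. (b (Suc j) - b j) * y (Suc j)\<bar> \<le> (\<Sum>j<n. \<bar>b (Suc j) - b j\<bar> * X)"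
      using y by (intro order_trans[OF sum_abs] sum_mono) (auto simp: abs_mult intro!: mult_left_mono)
    ultimately show ?thesis unfolding abel_summation by linarith
  qed
  also have "\<dots> = X * (\<bar>b n\<bar> + \<bar>b 0\<bar> + (\<Sum>j<n. \<bar>b (Suc j) - b j\<bar>))"
    by (simp add: sum_distrib_left algebra_simps)
  also have "\<dots> \<le> X * (2 * (\<bar>b 0\<bar> + (\<Sum>j<n. \<bar>b (Suc j) - b j\<bar>)))"
    using bn X0 by (intro mult_left_mono) auto
  finally show ?thesis by (simp only: mult.assoc mult.left_commute[of X])
qed

text \<open>Summation by parts in both indices moves the differences from \<open>y\<close> to
  \<open>c\<close>. What is left is the bound on \<open>y\<close> times two corner values of
  \<open>c\<close>, its variations along three edges and its variation over the cells.\<close>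

lemma abel_bound_2d:
  fixes c y :: "nat \<Rightarrow> nat \<Rightarrow> real"
  assumes y: "\<And>i j. i \<le> Suc m \<Longrightarrow> j \<le> Suc n \<Longrightarrow> \<bar>y i j\<bar> \<le> X"
  shows "\<bar>\<Sum>i<Suc m. \<Sum>j<Suc n. c i j * (y (Suc i) (Suc j) - y i (Suc j) - y (Suc i) j + y i j)\<bar>
    \<le> 2 * X * ((\<bar>c m 0\<bar> + (\<Sum>j<n. \<bar>c m (Suc j) - c m j\<bar>)) + (\<bar>c 0 0\<bar> + (\<Sum>j<n. \<bar>c 0 (Suc j) - c 0 j\<bar>)) +
       (\<Sum>i<m. \<bar>c (Suc i) 0 - c i 0\<bar>) +
       (\<Sum>i<m. \<Sum>j<n. \<bar>c (Suc i) (Suc j) - c i (Suc j) - c (Suc i) j + c i j\<bar>))"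
proof -
  define D where "D i j = y i (Suc j) - y i j" for i j
  define E where "E i b = (\<Sum>j<Suc n. b j * D i j)" for i b
  have "(\<Sum>i<Suc m. \<Sum>j<Suc n. c i j * (y (Suc i) (Suc j) - y i (Suc j) - y (Suc i) j + y i j)) =
    (\<Sum>j<Suc n. \<Sum>i<Suc m. c i j * (D (Suc i) j - D i j))"
    by (subst sum.swap) (intro sum.cong refl, simp add: D_def)
  also have "\<dots> = (\<Sum>j<Suc n. c m j * D (Suc m) j - c 0 j * D 0 j - (\<Sum>i<m. (c (Suc i) j - c i j) * D (Suc i) j))"
    by (intro sum.cong refl) (rule abel_summation)
  also have "\<dots> = E (Suc m) (c m) - E 0 (c 0) - (\<Sum>i<m. E (Suc i) (\<lambda>j. c (Suc i) j - c i j))"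
    unfolding sum_subtractf E_def by (subst sum.swap) simp
  finally have e: "(\<Sum>i<Suc m. \<Sum>j<Suc n. c i j * (y (Suc i) (Suc j) - y i (Suc j) - y (Suc i) j + y i j)) =
    E (Suc m) (c m) - E 0 (c 0) - (\<Sum>i<m. E (Suc i) (\<lambda>j. c (Suc i) j - c i j))" .
  have E: "\<bar>E i b\<bar> \<le> 2 * X * (\<bar>b 0\<bar> + (\<Sum>j<n. \<bar>b (Suc j) - b j\<bar>))" if "i \<le> Suc m" for i b
    unfolding E_def D_def using y that by (intro abel_bound) auto
  have "\<bar>\<Sum>i<m. E (Suc i) (\<lambda>j. c (Suc i) j - c i j)\<bar> \<le>
    (\<Sum>i<m. 2 * X * (\<bar>c (Suc i) 0 - c i 0\<bar> + (\<Sum>j<n. \<bar>c (Suc i) (Suc j) - c i (Suc j) - (c (Suc i) j - c i j)\<bar>)))"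
  proof (intro order_trans[OF sum_abs] sum_mono)
    fix i assume "i \<in> {..<m}"
    then show "\<bar>E (Suc i) (\<lambda>j. c (Suc i) j - c i j)\<bar> \<le>
      2 * X * (\<bar>c (Suc i) 0 - c i 0\<bar> + (\<Sum>j<n. \<bar>c (Suc i) (Suc j) - c i (Suc j) - (c (Suc i) j - c i j)\<bar>))"
      by (intro E) simp
  qed
  also have "\<dots> = 2 * X * ((\<Sum>i<m. \<bar>c (Suc i) 0 - c i 0\<bar>) +
       (\<Sum>i<m. \<Sum>j<n. \<bar>c (Suc i) (Suc j) - c i (Suc j) - c (Suc i) j + c i j\<bar>))"
    by (simp only: sum_distrib_left[symmetric] sum.distrib diff_diff_eq2 diff_add_eq diff_right_commute)
  finally show ?thesis
    unfolding e using E[of "Suc m" "c m"] E[of 0 "c 0"] by (simp only: distrib_left) linarith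
qed

definition tagged :: "real \<Rightarrow> nat \<Rightarrow> (nat \<Rightarrow> real) \<Rightarrow> (nat \<Rightarrow> real) \<Rightarrow> real \<Rightarrow> bool" where
  "tagged L m s \<xi> d \<longleftrightarrow> partition L m s \<and> (\<forall>i<m. s (Suc i) - s i < d \<and> \<xi> i \<in> {s i..s (Suc i)})"

definition rs_sum :: "plane_fun \<Rightarrow> plane_fun \<Rightarrow> nat \<Rightarrow> nat \<Rightarrow> (nat \<Rightarrow> real) \<Rightarrow> (nat \<Rightarrow> real) \<Rightarrow> (nat \<Rightarrow> real) \<Rightarrow> (nat \<Rightarrow> real) \<Rightarrow> real" where
  "rs_sum g x m n s t \<xi> \<eta> = (\<Sum>i<m. \<Sum>j<n. g (\<xi> i, \<eta> j) * rect_diff x (s i) (s (Suc i)) (t j) (t (Suc j)))"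

lemma has_rs_integral_iff:
  "has_rs_integral S T g x I \<longleftrightarrow> (\<forall>e>0. \<exists>d>0. \<forall>m n s t \<xi> \<eta>. tagged S m s \<xi> d \<longrightarrow> tagged T n t \<eta> d \<longrightarrow>
     \<bar>rs_sum g x m n s t \<xi> \<eta> - I\<bar> < e)"
  unfolding has_rs_integral_def tagged_def rs_sum_def by meson

text \<open>The tags of a partition are a \<open>weak_seq\<close>, so the variation of
  \<open>g\<close> on the grid of tags is under control. The bound is linear in the supremum of the
  path and the same for all partitions, which allows passing to uniform limits of paths.\<close>

lemma rs_sum_bound:
  assumes S: "S > 0" and T: "T > 0" and w: "majorant S T g w" and K: "vitali_bound S T g K"
    and s: "tagged S m s \<xi> d" and t: "tagged T n t \<eta> d" and x: "\<And>p. p \<in> rect S T \<Longrightarrow> \<bar>x p\<bar> \<le> X"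
  shows "\<bar>rs_sum g x m n s t \<xi> \<eta>\<bar> \<le> 2 * X * (2 * \<bar>g (0, 0)\<bar> + 5 * (w (S, T) - w (0, 0)) + K)"
proof -
  define W where "W = w (S, T) - w (0, 0)"
  have ps: "partition S m s" and pt: "partition T n t" using s t by (auto simp: tagged_def)
  note rs = weak_seq_range[OF partition_weak_seq[OF ps]] and rt = weak_seq_range[OF partition_weak_seq[OF pt]]
  obtain m' n' where m: "m = Suc m'" and n: "n = Suc n'"
    using ps pt S T by (cases m; cases n) (auto simp: partition_def)
  have \<xi>w: "weak_seq S m' \<xi>"
    unfolding weak_seq_def
  proof (intro conjI allI impI)
    show "0 \<le> \<xi> 0" using s rs[of 0] m by (auto simp: tagged_def intro: order_trans)
    show "\<xi> m' \<le> S" using s rs[of m] m by (auto simp: tagged_def intro: order_trans)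
    fix i assume "i < m'"
    then have "\<xi> i \<le> s (Suc i)" "s (Suc i) \<le> \<xi> (Suc i)" using s m by (auto simp: tagged_def)
    then show "\<xi> i \<le> \<xi> (Suc i)" by simp
  qed
  have \<eta>w: "weak_seq T n' \<eta>"
    unfolding weak_seq_def
  proof (intro conjI allI impI)
    show "0 \<le> \<eta> 0" using t rt[of 0] n by (auto simp: tagged_def intro: order_trans)
    show "\<eta> n' \<le> T" using t rt[of n] n by (auto simp: tagged_def intro: order_trans)
    fix i assume "i < n'"
    then have "\<eta> i \<le> t (Suc i)" "t (Suc i) \<le> \<eta> (Suc i)" using t n by (auto simp: tagged_def)
    then show "\<eta> i \<le> \<eta> (Suc i)" by simp
  qed
  note r\<xi> = weak_seq_range[OF \<xi>w] and r\<eta> = weak_seq_range[OF \<eta>w]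
  have m\<xi>: "\<xi> i \<le> \<xi> (Suc i)" if "i < m'" for i using \<xi>w that by (auto simp: weak_seq_def)
  have m\<eta>: "\<eta> i \<le> \<eta> (Suc i)" if "i < n'" for i using \<eta>w that by (auto simp: weak_seq_def)
  note wm = majorant_mono[OF w]
  have B: "\<bar>g p\<bar> \<le> \<bar>g (0, 0)\<bar> + W" if "p \<in> rect S T" for p
    using majorant_bounded[OF w that] by (simp add: W_def)
  have v\<eta>: "(\<Sum>j<n'. \<bar>g (a, \<eta> (Suc j)) - g (a, \<eta> j)\<bar>) \<le> W" if a: "0 \<le> a" "a \<le> S" for a
  proof -
    have "(\<Sum>j<n'. \<bar>g (a, \<eta> (Suc j)) - g (a, \<eta> j)\<bar>) \<le> (\<Sum>j<n'. w (a, \<eta> (Suc j)) - w (a, \<eta> j))"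
      using a r\<eta> m\<eta> by (intro sum_mono majorantD[OF w]) auto
    also have "\<dots> = w (a, \<eta> n') - w (a, \<eta> 0)" by (rule sum_lessThan_telescope)
    also have "\<dots> \<le> W"
      using wm[of a S "\<eta> n'" T] wm[of 0 a 0 "\<eta> 0"] a r\<eta>[of 0] r\<eta>[of n'] S T by (auto simp: W_def)
    finally show ?thesis .
  qed
  have v\<xi>: "(\<Sum>j<m'. \<bar>g (\<xi> (Suc j), a) - g (\<xi> j, a)\<bar>) \<le> W" if a: "0 \<le> a" "a \<le> T" for a
  proof -
    have "(\<Sum>j<m'. \<bar>g (\<xi> (Suc j), a) - g (\<xi> j, a)\<bar>) \<le> (\<Sum>j<m'. w (\<xi> (Suc j), a) - w (\<xi> j, a))"
      using a r\<xi> m\<xi> by (intro sum_mono majorantD[OF w]) auto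
    also have "\<dots> = w (\<xi> m', a) - w (\<xi> 0, a)" by (rule sum_lessThan_telescope)
    also have "\<dots> \<le> W"
      using wm[of "\<xi> m'" S a T] wm[of 0 "\<xi> 0" 0 a] a r\<xi>[of 0] r\<xi>[of m'] S T by (auto simp: W_def)
    finally show ?thesis .
  qed
  have vK: "(\<Sum>i<m'. \<Sum>j<n'. \<bar>g (\<xi> (Suc i), \<eta> (Suc j)) - g (\<xi> i, \<eta> (Suc j)) - g (\<xi> (Suc i), \<eta> j) + g (\<xi> i, \<eta> j)\<bar>) \<le> K"
    using K \<xi>w \<eta>w unfolding vitali_bound_def rect_diff_def by blast
  have X0: "0 \<le> X" using x[of "(0,0)"] S T by (auto simp: rect_def)
  have xb: "\<bar>x (s i, t j)\<bar> \<le> X" if "i \<le> Suc m'" "j \<le> Suc n'" for i j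
    using x[of "(s i, t j)"] rs[of i] rt[of j] that m n by (auto simp: rect_def)
  have inr: "(\<xi> i, \<eta> j) \<in> rect S T" if "i \<le> m'" "j \<le> n'" for i j
    using r\<xi>[OF that(1)] r\<eta>[OF that(2)] by (auto simp: rect_def)
  have "\<bar>rs_sum g x m n s t \<xi> \<eta>\<bar> \<le> 2 * X *
    ((\<bar>g (\<xi> m', \<eta> 0)\<bar> + (\<Sum>j<n'. \<bar>g (\<xi> m', \<eta> (Suc j)) - g (\<xi> m', \<eta> j)\<bar>)) +
     (\<bar>g (\<xi> 0, \<eta> 0)\<bar> + (\<Sum>j<n'. \<bar>g (\<xi> 0, \<eta> (Suc j)) - g (\<xi> 0, \<eta> j)\<bar>)) +
     (\<Sum>i<m'. \<bar>g (\<xi> (Suc i), \<eta> 0) - g (\<xi> i, \<eta> 0)\<bar>) +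
     (\<Sum>i<m'. \<Sum>j<n'. \<bar>g (\<xi> (Suc i), \<eta> (Suc j)) - g (\<xi> i, \<eta> (Suc j)) - g (\<xi> (Suc i), \<eta> j) + g (\<xi> i, \<eta> j)\<bar>))"
    unfolding rs_sum_def rect_diff_def m n
    by (rule abel_bound_2d[where c="\<lambda>i j. g (\<xi> i, \<eta> j)" and y="\<lambda>i j. x (s i, t j)"]) (rule xb)
  \<comment> \<open>Two corner values, each at most \<open>\<bar>g (0, 0)\<bar> + W\<close>, and
    three edge variations, each at most \<open>W\<close>, make up the 5 in the constant.\<close>
  also have "\<dots> \<le> 2 * X * (((\<bar>g (0, 0)\<bar> + W) + W) + ((\<bar>g (0, 0)\<bar> + W) + W) + W + K)"
    using X0 r\<xi>[of 0] r\<xi>[of m'] r\<eta>[of 0]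
    by (intro mult_left_mono add_mono B v\<xi> v\<eta> vK inr) auto
  finally show ?thesis by (simp add: W_def algebra_simps)
qed

lemma tagged_uniform:
  assumes "L > 0" "d > 0"
  shows "\<forall>\<^sub>F N in sequentially. tagged L (Suc N) (\<lambda>i. real i * L / real (Suc N)) (\<lambda>i. real i * L / real (Suc N)) d"
proof -
  have "(\<lambda>N. L / real (Suc N)) \<longlonglongrightarrow> 0"
    using tendsto_mult[OF tendsto_const[of L] LIMSEQ_Suc[OF lim_1_over_n]] by simp
  then have "\<forall>\<^sub>F N in sequentially. L / real (Suc N) < d"
    using assms(2) by (rule order_tendstoD)
  then show ?thesis
  proof eventually_elim
    case (elim N)
    then show ?case unfolding tagged_def uniform_mesh
      using partition_uniform[OF assms(1), of N] assms(1) by (simp add: divide_right_mono mult_right_mono)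
  qed
qed

text \<open>One fixed sequence of sums that determines the integral. Each member depends on finitely
  many values of the path, hence is measurable in \<open>x\<close> and Gaussian under the
  Yeh--Wiener measure.\<close>

definition uniform_rs_sum :: "real \<Rightarrow> real \<Rightarrow> plane_fun \<Rightarrow> plane_fun \<Rightarrow> nat \<Rightarrow> real" where
  "uniform_rs_sum S T g x N = rs_sum g x (Suc N) (Suc N) (\<lambda>i. real i * S / real (Suc N)) (\<lambda>i. real i * T / real (Suc N))
     (\<lambda>i. real i * S / real (Suc N)) (\<lambda>i. real i * T / real (Suc N))"

lemma has_rs_integral_limit:
  assumes S: "S > 0" and T: "T > 0" and I: "has_rs_integral S T g x I"
  shows "uniform_rs_sum S T g x \<longlonglongrightarrow> I"
proof (rule tendstoI)
  fix e :: real assume "e > 0"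
  then obtain d where d: "d > 0" "\<forall>m n s t \<xi> \<eta>. tagged S m s \<xi> d \<longrightarrow> tagged T n t \<eta> d \<longrightarrow>
     \<bar>rs_sum g x m n s t \<xi> \<eta> - I\<bar> < e"
    using I unfolding has_rs_integral_iff by blast
  show "\<forall>\<^sub>F N in sequentially. dist (uniform_rs_sum S T g x N) I < e"
    using tagged_uniform[OF S d(1)] tagged_uniform[OF T d(1)]
    by eventually_elim (use d(2) in \<open>auto simp: uniform_rs_sum_def dist_real_def\<close>)
qed

lemma rs_integral_eq:
  assumes "S > 0" "T > 0" "has_rs_integral S T g x I"
  shows "rs_integral S T g x = I"
  unfolding rs_integral_def
  using assms(3) has_rs_integral_limit[OF assms(1,2)] by (blast intro: LIMSEQ_unique)

lemma rs_sum_add: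
  "rs_sum (\<lambda>p. g p + g' p) x m n s t \<xi> \<eta> = rs_sum g x m n s t \<xi> \<eta> + rs_sum g' x m n s t \<xi> \<eta>"
  "rs_sum g (\<lambda>p. x p + x' p) m n s t \<xi> \<eta> = rs_sum g x m n s t \<xi> \<eta> + rs_sum g x' m n s t \<xi> \<eta>"
  "rs_sum g (\<lambda>p. x p - x' p) m n s t \<xi> \<eta> = rs_sum g x m n s t \<xi> \<eta> - rs_sum g x' m n s t \<xi> \<eta>"
  by (simp_all only: rs_sum_def rect_diff_def sum.distrib[symmetric] sum_subtractf[symmetric] algebra_simps)

lemma rs_sum_scale:
  "rs_sum (\<lambda>p. c * g p) x m n s t \<xi> \<eta> = c * rs_sum g x m n s t \<xi> \<eta>"
  "rs_sum g (\<lambda>p. c * x p) m n s t \<xi> \<eta> = c * rs_sum g x m n s t \<xi> \<eta>"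
  by (simp_all only: rs_sum_def rect_diff_def sum_distrib_left algebra_simps)

text \<open>The identity between sums is a hypothesis, so that additivity in the integrand and
  additivity in the path are both instances.\<close>

lemma has_rs_integral_add:
  assumes "has_rs_integral S T g x I" "has_rs_integral S T g' x' I'"
    and eq: "\<And>m n s t \<xi> \<eta>. rs_sum g'' x'' m n s t \<xi> \<eta> = rs_sum g x m n s t \<xi> \<eta> + rs_sum g' x' m n s t \<xi> \<eta>"
  shows "has_rs_integral S T g'' x'' (I + I')"
  unfolding has_rs_integral_iff
proof (intro allI impI)
  fix e :: real assume "e > 0"
  then have e2: "e / 2 > 0" by simp
  obtain d where d: "d > 0" "\<forall>m n s t \<xi> \<eta>. tagged S m s \<xi> d \<longrightarrow> tagged T n t \<eta> d \<longrightarrow> \<bar>rs_sum g x m n s t \<xi> \<eta> - I\<bar> < e / 2"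
    using assms(1) e2 unfolding has_rs_integral_iff by blast
  obtain d' where d': "d' > 0" "\<forall>m n s t \<xi> \<eta>. tagged S m s \<xi> d' \<longrightarrow> tagged T n t \<eta> d' \<longrightarrow> \<bar>rs_sum g' x' m n s t \<xi> \<eta> - I'\<bar> < e / 2"
    using assms(2) e2 unfolding has_rs_integral_iff by blast
  have tg: "tagged L m s \<xi> d \<and> tagged L m s \<xi> d'" if "tagged L m s \<xi> (min d d')" for L m s \<xi>
    using that by (auto simp: tagged_def)
  show "\<exists>d>0. \<forall>m n s t \<xi> \<eta>. tagged S m s \<xi> d \<longrightarrow> tagged T n t \<eta> d \<longrightarrow> \<bar>rs_sum g'' x'' m n s t \<xi> \<eta> - (I + I')\<bar> < e"
  proof (intro exI[of _ "min d d'"] conjI allI impI)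
    fix m n s t \<xi> \<eta> assume "tagged S m s \<xi> (min d d')" "tagged T n t \<eta> (min d d')"
    note tg[OF this(1)] tg[OF this(2)]
    then have "\<bar>rs_sum g x m n s t \<xi> \<eta> - I\<bar> < e / 2" "\<bar>rs_sum g' x' m n s t \<xi> \<eta> - I'\<bar> < e / 2"
      by (intro d(2)[rule_format] d'(2)[rule_format]; simp)+
    then show "\<bar>rs_sum g'' x'' m n s t \<xi> \<eta> - (I + I')\<bar> < e" unfolding eq by linarith
  qed (use d d' in auto)
qed

lemma has_rs_integral_scale:
  assumes "has_rs_integral S T g x I"
    and eq: "\<And>m n s t \<xi> \<eta>. rs_sum g' x' m n s t \<xi> \<eta> = c * rs_sum g x m n s t \<xi> \<eta>"
  shows "has_rs_integral S T g' x' (c * I)"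
  unfolding has_rs_integral_iff
proof (intro allI impI)
  fix e :: real assume "e > 0"
  then have "e / (\<bar>c\<bar> + 1) > 0" by simp
  then obtain d where d: "d > 0" "\<forall>m n s t \<xi> \<eta>. tagged S m s \<xi> d \<longrightarrow> tagged T n t \<eta> d \<longrightarrow> \<bar>rs_sum g x m n s t \<xi> \<eta> - I\<bar> < e / (\<bar>c\<bar> + 1)"
    using assms(1) unfolding has_rs_integral_iff by blast
  show "\<exists>d>0. \<forall>m n s t \<xi> \<eta>. tagged S m s \<xi> d \<longrightarrow> tagged T n t \<eta> d \<longrightarrow> \<bar>rs_sum g' x' m n s t \<xi> \<eta> - c * I\<bar> < e"
  proof (intro exI[of _ d] conjI allI impI)
    fix m n s t \<xi> \<eta> assume "tagged S m s \<xi> d" "tagged T n t \<eta> d"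
    then have "\<bar>rs_sum g x m n s t \<xi> \<eta> - I\<bar> < e / (\<bar>c\<bar> + 1)" using d(2) by blast
    then have l: "(\<bar>c\<bar> + 1) * \<bar>rs_sum g x m n s t \<xi> \<eta> - I\<bar> < e" by (simp add: field_simps)
    have "\<bar>rs_sum g' x' m n s t \<xi> \<eta> - c * I\<bar> = \<bar>c\<bar> * \<bar>rs_sum g x m n s t \<xi> \<eta> - I\<bar>"
      unfolding eq by (simp add: abs_mult[symmetric] algebra_simps)
    also have "\<dots> \<le> (\<bar>c\<bar> + 1) * \<bar>rs_sum g x m n s t \<xi> \<eta> - I\<bar>" by (simp add: mult_right_mono)
    finally show "\<bar>rs_sum g' x' m n s t \<xi> \<eta> - c * I\<bar> < e" using l by simp
  qed fact
qed

section \<open>Paths that are sums of products of C^1 functions, and their uniform limits\<close>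

definition smooth1 :: "(real \<Rightarrow> real) \<Rightarrow> bool" where
  "smooth1 \<alpha> \<longleftrightarrow> (\<exists>\<alpha>'. (\<forall>x. (\<alpha> has_real_derivative \<alpha>' x) (at x)) \<and> continuous_on UNIV \<alpha>')"

lemma smooth1_continuous: "smooth1 \<alpha> \<Longrightarrow> continuous_on A \<alpha>"
  unfolding smooth1_def by (meson DERIV_isCont continuous_at_imp_continuous_on)

lemma smooth1_mult: "smooth1 \<alpha> \<Longrightarrow> smooth1 \<beta> \<Longrightarrow> smooth1 (\<lambda>x. \<alpha> x * \<beta> x)"
proof -
  assume a: "smooth1 \<alpha>" "smooth1 \<beta>"
  obtain \<alpha>' \<beta>' where d: "\<forall>x. (\<alpha> has_real_derivative \<alpha>' x) (at x)" "continuous_on UNIV \<alpha>'"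
    "\<forall>x. (\<beta> has_real_derivative \<beta>' x) (at x)" "continuous_on UNIV \<beta>'"
    using a unfolding smooth1_def by blast
  show ?thesis unfolding smooth1_def
  proof (intro exI[of _ "\<lambda>x. \<alpha>' x * \<beta> x + \<beta>' x * \<alpha> x"] conjI allI)
    show "((\<lambda>x. \<alpha> x * \<beta> x) has_real_derivative \<alpha>' x * \<beta> x + \<beta>' x * \<alpha> x) (at x)" for x
      using d by (intro DERIV_mult) auto
    show "continuous_on UNIV (\<lambda>x. \<alpha>' x * \<beta> x + \<beta>' x * \<alpha> x)"
      using d(2,4) smooth1_continuous[OF a(1)] smooth1_continuous[OF a(2)]
      by (intro continuous_on_add continuous_on_mult)
  qed
qed

lemma smooth1_const: "smooth1 (\<lambda>x. c)"
  unfolding smooth1_def by (intro exI[of _ "\<lambda>x. 0"]) auto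

lemma smooth1_id: "smooth1 (\<lambda>x. x)"
  unfolding smooth1_def by (intro exI[of _ "\<lambda>x. 1"]) auto

text \<open>An algebra to which the Stone--Weierstrass theorem applies; constant multiples are
  absorbed by a factor of each product.\<close>

inductive_set product_sums :: "plane_fun set" where
  prod: "smooth1 \<alpha> \<Longrightarrow> smooth1 \<beta> \<Longrightarrow> (\<lambda>p. \<alpha> (fst p) * \<beta> (snd p)) \<in> product_sums"
| add: "x \<in> product_sums \<Longrightarrow> y \<in> product_sums \<Longrightarrow> (\<lambda>p. x p + y p) \<in> product_sums"

lemma product_sums_mult:
  assumes "x \<in> product_sums" "y \<in> product_sums"
  shows "(\<lambda>p. x p * y p) \<in> product_sums"
  using assms(1)
proof induct
  case (prod \<alpha> \<beta>)
  show ?case using assms(2)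
  proof induct
    case (prod \<alpha>' \<beta>')
    have "(\<lambda>p. (\<alpha> (fst p) * \<alpha>' (fst p)) * (\<beta> (snd p) * \<beta>' (snd p))) \<in> product_sums"
      by (rule product_sums.prod) (intro smooth1_mult prod \<open>smooth1 \<alpha>\<close> \<open>smooth1 \<beta>\<close>)+
    then show ?case by (simp only: mult_ac)
  next
    case (add u v)
    from product_sums.add[OF add(2,4)] show ?case by (simp only: distrib_left)
  qed
next
  case (add u v)
  from product_sums.add[OF add(2,4)] show ?case by (simp only: distrib_right)
qed

lemma product_sums_dense:
  assumes "continuous_on (rect S T) x"
  obtains F where "\<And>n::nat. F n \<in> product_sums" "uniform_limit (rect S T) F x sequentially"
proof -
  interpret function_ring_on product_sums "rect S T"
  proof
    show "compact (rect S T)" by (simp add: rect_cbox)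
    show "continuous_on (rect S T) f" if "f \<in> product_sums" for f
      using that
    proof induct
      case (prod \<alpha> \<beta>)
      have "continuous_on (rect S T) (\<lambda>p. \<alpha> (fst p))"
        by (rule continuous_on_compose2[OF smooth1_continuous[OF prod(1), of UNIV] continuous_on_fst[OF continuous_on_id]]) simp
      moreover have "continuous_on (rect S T) (\<lambda>p. \<beta> (snd p))"
        by (rule continuous_on_compose2[OF smooth1_continuous[OF prod(2), of UNIV] continuous_on_snd[OF continuous_on_id]]) simp
      ultimately show ?case by (rule continuous_on_mult)
    qed (rule continuous_on_add)
    show "(\<lambda>x. f x + g x) \<in> product_sums" "(\<lambda>x. f x * g x) \<in> product_sums"
      if "f \<in> product_sums" "g \<in> product_sums" for f g
      using that by (auto intro: product_sums.add product_sums_mult)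
    show "(\<lambda>_. c) \<in> product_sums" for c
      using product_sums.prod[OF smooth1_const[of c] smooth1_const[of 1]] by simp
    fix p q :: "real \<times> real" assume "p \<noteq> q"
    then have "fst p \<noteq> fst q \<or> snd p \<noteq> snd q" by (auto simp: prod_eq_iff)
    then show "\<exists>f\<in>product_sums. f p \<noteq> f q"
    proof
      assume "fst p \<noteq> fst q"
      then show ?thesis by (intro bexI[OF _ product_sums.prod[OF smooth1_id smooth1_const[of 1]]]) simp
    next
      assume "snd p \<noteq> snd q"
      then show ?thesis by (intro bexI[OF _ product_sums.prod[OF smooth1_const[of 1] smooth1_id]]) simp
    qed
  qed
  from Stone_Weierstrass[OF assms] that show ?thesis by (auto simp: Pi_iff)
qed

text \<open>Along such a path the sum consists of the values of \<open>g\<close> at the tags times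
  integrals of a density over the cells, so the integral is that of \<open>g\<close> against the
  product of the two derivatives.\<close>

lemma has_rs_integral_product:
  assumes S: "S > 0" and T: "T > 0" and w: "majorant S T g w" and sm: "smooth1 \<alpha>" "smooth1 \<beta>"
  shows "\<exists>I. has_rs_integral S T g (\<lambda>p. \<alpha> (fst p) * \<beta> (snd p)) I"
proof -
  obtain \<alpha>' \<beta>' where d: "\<And>x. (\<alpha> has_real_derivative \<alpha>' x) (at x)" "continuous_on UNIV \<alpha>'"
    "\<And>x. (\<beta> has_real_derivative \<beta>' x) (at x)" "continuous_on UNIV \<beta>'"
    using sm unfolding smooth1_def by blast
  define k where "k p = \<alpha>' (fst p) * \<beta>' (snd p)" for p :: "real \<times> real"
  have ck: "continuous_on UNIV k"
    unfolding k_def[abs_def] by (intro continuous_on_mult continuous_on_compose2[OF d(2)] continuous_on_compose2[OF d(4)] continuous_intros) auto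
  have "bounded (k ` rect S T)"
    by (intro compact_imp_bounded compact_continuous_image continuous_on_subset[OF ck]) (auto simp: rect_cbox)
  then obtain B where B: "\<And>p. p \<in> rect S T \<Longrightarrow> \<bar>k p\<bar> \<le> B"
    unfolding bounded_iff by auto
  have B0: "0 \<le> B" using B[of "(0,0)"] S T by (auto simp: rect_def)
  define C where "C = B * (2 * ((S + T) * (w (S, T) - w (0, 0))))"
  have C0: "0 \<le> C"
    unfolding C_def using B0 S T majorant_mono[OF w, of 0 S 0 T] by (intro mult_nonneg_nonneg) auto
  show ?thesis
  proof (intro exI[of _ "LINT p|area S T. g p * k p"], unfold has_rs_integral_iff, intro allI impI)
    fix e :: real assume e: "e > 0"
    define \<delta> where "\<delta> = e / (C + 1)"
    have \<delta>: "\<delta> > 0" "C * \<delta> < e" using e C0 by (auto simp: \<delta>_def field_simps)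
    show "\<exists>d>0. \<forall>m n s t \<xi> \<eta>. tagged S m s \<xi> d \<longrightarrow> tagged T n t \<eta> d \<longrightarrow>
     \<bar>rs_sum g (\<lambda>p. \<alpha> (fst p) * \<beta> (snd p)) m n s t \<xi> \<eta> - (LINT p|area S T. g p * k p)\<bar> < e"
    proof (intro exI[of _ \<delta>] conjI allI impI \<delta>(1))
      fix m n s t \<xi> \<eta> assume tg: "tagged S m s \<xi> \<delta>" "tagged T n t \<eta> \<delta>"
      have p: "partition S m s" "partition T n t" using tg by (auto simp: tagged_def)
      have pr: "0 \<le> s i \<and> s i \<le> s (Suc i) \<and> s (Suc i) \<le> S" if "i < m" for i
        using weak_seq_range[OF partition_weak_seq[OF p(1)], of i] weak_seq_range[OF partition_weak_seq[OF p(1)], of "Suc i"] p(1) that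
        by (auto simp: partition_def less_imp_le)
      have pr': "0 \<le> t i \<and> t i \<le> t (Suc i) \<and> t (Suc i) \<le> T" if "i < n" for i
        using weak_seq_range[OF partition_weak_seq[OF p(2)], of i] weak_seq_range[OF partition_weak_seq[OF p(2)], of "Suc i"] p(2) that
        by (auto simp: partition_def less_imp_le)
      have mesh: "i < m \<Longrightarrow> s (Suc i) - s i \<le> \<delta> \<and> \<xi> i \<in> {s i..s (Suc i)}"
        "j < n \<Longrightarrow> t (Suc j) - t j \<le> \<delta> \<and> \<eta> j \<in> {t j..t (Suc j)}" for i j
        using tg by (auto simp: tagged_def less_imp_le)
      note hyps = w p less_imp_le[OF \<delta>(1)] mesh
      have "rs_sum g (\<lambda>p. \<alpha> (fst p) * \<beta> (snd p)) m n s t \<xi> \<eta> =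
        (\<Sum>i<m. \<Sum>j<n. g (\<xi> i, \<eta> j) * (LINT p|area S T. indicator (grid_cell s t i j) p * k p))"
        unfolding rs_sum_def
      proof (intro sum.cong refl arg_cong2[where f="(*)"])
        fix i j assume "i \<in> {..<m}" "j \<in> {..<n}"
        then have "(LINT p|area S T. indicator (grid_cell s t i j) p * k p) = (\<alpha> (s (Suc i)) - \<alpha> (s i)) * (\<beta> (t (Suc j)) - \<beta> (t j))"
          unfolding grid_cell_def k_def using pr[of i] pr'[of j] by (intro cell_integral d) auto
        then show "rect_diff (\<lambda>p. \<alpha> (fst p) * \<beta> (snd p)) (s i) (s (Suc i)) (t j) (t (Suc j)) =
          (LINT p|area S T. indicator (grid_cell s t i j) p * k p)"
          by (simp add: rect_diff_def algebra_simps)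
      qed
      moreover have "\<bar>(LINT p|area S T. g p * k p) -
        (\<Sum>i<m. \<Sum>j<n. g (\<xi> i, \<eta> j) * (LINT p|area S T. indicator (grid_cell s t i j) p * k p))\<bar> \<le>
          B * (2 * (\<delta> * (S + T) * (w (S, T) - w (0, 0))))"
        by (rule riemann_sum_error[OF hyps majorant_measurable[OF S T w] borel_measurable_area B])
          (auto intro: borel_measurable_continuous_onI ck)
      moreover have "B * (2 * (\<delta> * (S + T) * (w (S, T) - w (0, 0)))) = C * \<delta>"
        by (simp add: C_def)
      ultimately show "\<bar>rs_sum g (\<lambda>p. \<alpha> (fst p) * \<beta> (snd p)) m n s t \<xi> \<eta> - (LINT p|area S T. g p * k p)\<bar> < e"
        using \<delta>(2) by linarith
    qed
  qed
qed

lemma has_rs_integral_product_sums: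
  assumes S: "S > 0" and T: "T > 0" and w: "majorant S T g w" and x: "x \<in> product_sums"
  shows "\<exists>I. has_rs_integral S T g x I"
  using x
proof induct
  case (add x y)
  then show ?case using has_rs_integral_add[of S T g x _ g y _ g "\<lambda>p. x p + y p"] rs_sum_add(2) by blast
qed (rule has_rs_integral_product[OF S T w])

text \<open>The path is approximated uniformly by sums of smooth products. As \<open>rs_sum\<close>
  is linear in the path and at most \<open>C\<close> times its supremum, the integrals of the
  approximants form a Cauchy sequence, whose limit is the integral.\<close>

lemma rs_integrable_continuous:
  assumes S: "S > 0" and T: "T > 0" and bv: "bv_hardy_krause S T g" and x: "continuous_on (rect S T) x"
  shows "\<exists>I. has_rs_integral S T g x I"
proof -
  obtain w K where w: "majorant S T g w" and K: "vitali_bound S T g K"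
    using bv_hardy_krause_majorant[OF S T bv] .
  define C where "C = \<bar>2 * (2 * \<bar>g (0, 0)\<bar> + 5 * (w (S, T) - w (0, 0)) + K)\<bar>"
  have C0: "0 \<le> C" by (simp add: C_def)
  have bound: "\<bar>rs_sum g y m n s t \<xi> \<eta>\<bar> \<le> X * C"
    if "tagged S m s \<xi> d" "tagged T n t \<eta> d" and y: "\<And>p. p \<in> rect S T \<Longrightarrow> \<bar>y p\<bar> \<le> X" for y X m n s t \<xi> \<eta> d
  proof -
    have "0 \<le> X" using y[of "(0,0)"] S T by (auto simp: rect_def)
    then have "X * (2 * (2 * \<bar>g (0, 0)\<bar> + 5 * (w (S, T) - w (0, 0)) + K)) \<le> X * C"
      unfolding C_def by (intro mult_left_mono abs_ge_self)
    moreover have "\<bar>rs_sum g y m n s t \<xi> \<eta>\<bar> \<le> 2 * X * (2 * \<bar>g (0, 0)\<bar> + 5 * (w (S, T) - w (0, 0)) + K)"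
      by (rule rs_sum_bound[OF S T w K that(1,2)]) (rule y)
    ultimately show ?thesis by (simp only: mult.assoc mult.left_commute[of X 2])
  qed
  obtain F where F: "\<And>n::nat. F n \<in> product_sums" and u: "uniform_limit (rect S T) F x sequentially"
    using product_sums_dense[OF x] by blast
  have "\<forall>n. \<exists>I. has_rs_integral S T g (F n) I"
    using has_rs_integral_product_sums[OF S T w F] by blast
  then obtain I where I: "\<And>n. has_rs_integral S T g (F n) (I n)" by metis
  have near: "\<exists>N. \<forall>n\<ge>N. \<forall>p\<in>rect S T. \<bar>F n p - x p\<bar> < e" if "e > 0" for e
    using u that unfolding uniform_limit_sequentially_iff dist_real_def by blast
  have Idiff: "\<bar>I n - I m\<bar> \<le> X * C" if X: "\<And>p. p \<in> rect S T \<Longrightarrow> \<bar>F n p - F m p\<bar> \<le> X" for n m X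
  proof (rule tendsto_upperbound)
    show "(\<lambda>k. \<bar>uniform_rs_sum S T g (F n) k - uniform_rs_sum S T g (F m) k\<bar>) \<longlonglongrightarrow> \<bar>I n - I m\<bar>"
      by (intro tendsto_intros has_rs_integral_limit[OF S T I])
    show "\<forall>\<^sub>F k in sequentially. \<bar>uniform_rs_sum S T g (F n) k - uniform_rs_sum S T g (F m) k\<bar> \<le> X * C"
      using tagged_uniform[OF S zero_less_one] tagged_uniform[OF T zero_less_one]
    proof eventually_elim
      case (elim k)
      from bound[OF elim, of "\<lambda>p. F n p - F m p"] X show ?case
        unfolding uniform_rs_sum_def rs_sum_add(3)[symmetric] by blast
    qed
  qed simp
  have "Cauchy I"
  proof (rule metric_CauchyI)
    fix e :: real assume e: "e > 0"
    then have "e / (2 * (C + 1)) > 0" using C0 by simp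
    from near[OF this] obtain N where N: "\<forall>n\<ge>N. \<forall>p\<in>rect S T. \<bar>F n p - x p\<bar> < e / (2 * (C + 1))" by blast
    show "\<exists>M. \<forall>m\<ge>M. \<forall>n\<ge>M. dist (I m) (I n) < e"
    proof (intro exI[of _ N] allI impI)
      fix m n assume "N \<le> m" "N \<le> n"
      have half: "e / (2 * (C + 1)) + e / (2 * (C + 1)) = e / (C + 1)"
      proof -
        have "e / (2 * (C + 1)) = e / (C + 1) / 2" by (simp add: mult.commute)
        then show ?thesis by (simp only: field_sum_of_halves)
      qed
      have "\<bar>F m p - F n p\<bar> \<le> e / (C + 1)" if "p \<in> rect S T" for p
      proof -
        have "\<bar>F m p - x p\<bar> < e / (2 * (C + 1))" "\<bar>F n p - x p\<bar> < e / (2 * (C + 1))"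
          using N that \<open>N \<le> m\<close> \<open>N \<le> n\<close> by blast+
        then show ?thesis unfolding half[symmetric] using abs_triangle_ineq4[of "F m p - x p" "F n p - x p"] by simp
      qed
      from Idiff[OF this] have "\<bar>I m - I n\<bar> \<le> e / (C + 1) * C" .
      also have "\<dots> < e" using e C0 by (simp add: field_simps)
      finally show "dist (I m) (I n) < e" by (simp add: dist_real_def)
    qed
  qed
  then obtain J where J: "I \<longlonglongrightarrow> J" using convergent_eq_Cauchy by blast
  have "has_rs_integral S T g x J"
    unfolding has_rs_integral_iff
  proof (intro allI impI)
    fix e :: real assume e: "e > 0"
    then have e3: "e / (3 * (C + 1)) > 0" using C0 by simp
    from near[OF this] obtain N where N: "\<forall>n\<ge>N. \<forall>p\<in>rect S T. \<bar>F n p - x p\<bar> < e / (3 * (C + 1))" by blast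
    have "e / 3 > 0" using e by simp
    then obtain N' where N': "\<And>n. n \<ge> N' \<Longrightarrow> \<bar>I n - J\<bar> < e / 3"
      using J unfolding LIMSEQ_def dist_real_def by blast
    define n0 where "n0 = max N N'"
    obtain d where d: "d > 0" "\<forall>m n s t \<xi> \<eta>. tagged S m s \<xi> d \<longrightarrow> tagged T n t \<eta> d \<longrightarrow>
      \<bar>rs_sum g (F n0) m n s t \<xi> \<eta> - I n0\<bar> < e / 3"
      using I[of n0] \<open>e / 3 > 0\<close> unfolding has_rs_integral_iff by blast
    show "\<exists>d>0. \<forall>m n s t \<xi> \<eta>. tagged S m s \<xi> d \<longrightarrow> tagged T n t \<eta> d \<longrightarrow> \<bar>rs_sum g x m n s t \<xi> \<eta> - J\<bar> < e"
    proof (intro exI[of _ d] conjI allI impI d(1))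
      fix m n s t \<xi> \<eta> assume tg: "tagged S m s \<xi> d" "tagged T n t \<eta> d"
      have "\<bar>rs_sum g (\<lambda>p. F n0 p - x p) m n s t \<xi> \<eta>\<bar> \<le> e / (3 * (C + 1)) * C"
        using N by (intro bound[OF tg] less_imp_le) (auto simp: n0_def)
      also have "\<dots> \<le> e / 3" using e C0 by (simp add: field_simps)
      finally have "\<bar>rs_sum g (F n0) m n s t \<xi> \<eta> - rs_sum g x m n s t \<xi> \<eta>\<bar> \<le> e / 3"
        unfolding rs_sum_add(3) .
      moreover have "\<bar>rs_sum g (F n0) m n s t \<xi> \<eta> - I n0\<bar> < e / 3" using d(2) tg by blast
      moreover have "\<bar>I n0 - J\<bar> < e / 3" by (rule N') (simp add: n0_def)
      ultimately show "\<bar>rs_sum g x m n s t \<xi> \<eta> - J\<bar> < e" by linarith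
    qed
  qed
  then show ?thesis by blast
qed

lemma has_rs_integral_rs_integral:
  assumes S: "S > 0" and T: "T > 0" and bv: "bv_hardy_krause S T g" and x: "continuous_on (rect S T) x"
  shows "has_rs_integral S T g x (rs_integral S T g x)"
  using rs_integrable_continuous[OF assms] rs_integral_eq[OF S T] by blast

lemma has_rs_integral_sum:
  fixes \<phi> :: "nat \<Rightarrow> plane_fun" and n :: nat
  assumes S: "S > 0" and T: "T > 0" and bv: "\<And>j. bv_hardy_krause S T (\<phi> j)" and x: "continuous_on (rect S T) x"
  shows "has_rs_integral S T (\<lambda>p. \<Sum>j<n. c j * \<phi> j p) x (\<Sum>j<n. c j * rs_integral S T (\<phi> j) x)"
proof (induct n)
  case 0
  show ?case unfolding has_rs_integral_iff rs_sum_def by (auto intro: exI[of _ 1])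
next
  case (Suc n)
  have "has_rs_integral S T (\<lambda>p. c n * \<phi> n p) x (c n * rs_integral S T (\<phi> n) x)"
    by (rule has_rs_integral_scale[OF has_rs_integral_rs_integral[OF S T bv x]]) (rule rs_sum_scale)
  from has_rs_integral_add[OF Suc this rs_sum_add(1)] show ?case by simp
qed

lemma majorant_add: "majorant S T g w \<Longrightarrow> majorant S T g' w' \<Longrightarrow> majorant S T (\<lambda>p. g p + g' p) (\<lambda>p. w p + w' p)"
  unfolding majorant_def by (smt (verit))

lemma majorant_scale: "majorant S T g w \<Longrightarrow> majorant S T (\<lambda>p. c * g p) (\<lambda>p. \<bar>c\<bar> * w p)"
  unfolding majorant_def
  by (simp add: right_diff_distrib[symmetric] abs_mult mult_left_mono)

lemma majorant_sum:
  fixes \<phi> :: "nat \<Rightarrow> plane_fun" and n :: nat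
  assumes S: "S > 0" and T: "T > 0" and bv: "\<And>j. bv_hardy_krause S T (\<phi> j)"
  shows "\<exists>w. majorant S T (\<lambda>p. \<Sum>j<n. c j * \<phi> j p) w"
proof (induct n)
  case 0
  show ?case by (intro exI[of _ "\<lambda>_. 0"]) (simp add: majorant_def)
next
  case (Suc n)
  then obtain w where w: "majorant S T (\<lambda>p. \<Sum>j<n. c j * \<phi> j p) w" by blast
  obtain v K where "majorant S T (\<phi> n) v" "vitali_bound S T (\<phi> n) K"
    using bv_hardy_krause_majorant[OF S T bv] .
  from majorant_add[OF w majorant_scale[OF this(1)]] show ?case by auto
qed

lemma rs_integral_scale_path:
  assumes S: "S > 0" and T: "T > 0" and bv: "bv_hardy_krause S T g" and x: "continuous_on (rect S T) x"
  shows "rs_integral S T g (\<lambda>p. c * x p) = c * rs_integral S T g x"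
  by (rule rs_integral_eq[OF S T]) (rule has_rs_integral_scale[OF has_rs_integral_rs_integral[OF assms] rs_sum_scale(2)])

text \<open>The left side is the variance of the uniform Riemann--Stieltjes sum of \<open>g\<close>
  under the Yeh--Wiener measure, and the limit is \<open>l2_inner S T g g\<close>.\<close>

lemma riemann_sum_square_limit:
  assumes S: "S > 0" and T: "T > 0" and w: "majorant S T g w"
  shows "(\<lambda>N. \<Sum>i<Suc N. \<Sum>j<Suc N. (g (real i * S / real (Suc N), real j * T / real (Suc N)))\<^sup>2 * (S / real (Suc N) * (T / real (Suc N))))
    \<longlonglongrightarrow> (LINT p|area S T. (g p)\<^sup>2)"
proof -
  define B where "B = \<bar>g (0, 0)\<bar> + (w (S, T) - w (0, 0))"
  \<comment> \<open>Comes from factoring a difference of squares, with \<open>B\<close> bounding the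
    modulus of \<open>g\<close>.\<close>
  define w2 where "w2 p = 2 * B * w p" for p
  have B0: "0 \<le> B" using majorant_mono[OF w, of 0 S 0 T] S T by (simp add: B_def)
  have w2: "majorant S T (\<lambda>p. (g p)\<^sup>2) w2"
    unfolding majorant_def
  proof (intro allI impI)
    fix a a' b b' assume a: "0 \<le> a" "a \<le> a'" "a' \<le> S" "0 \<le> b" "b \<le> b'" "b' \<le> T"
    have "\<bar>g (a', b')\<bar> \<le> B" "\<bar>g (a, b)\<bar> \<le> B"
      unfolding B_def using a by (auto intro!: majorant_bounded[OF w] simp: rect_def)
    then have "\<bar>g (a', b') + g (a, b)\<bar> \<le> 2 * B" by linarith
    then have "\<bar>g (a', b') + g (a, b)\<bar> * \<bar>g (a', b') - g (a, b)\<bar> \<le> 2 * B * (w (a', b') - w (a, b))"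
      using majorantD[OF w a] B0 by (intro mult_mono) auto
    then show "\<bar>(g (a', b'))\<^sup>2 - (g (a, b))\<^sup>2\<bar> \<le> w2 (a', b') - w2 (a, b)"
      by (simp add: w2_def right_diff_distrib abs_mult[symmetric] square_diff_square_factored power2_eq_square)
  qed
  have [measurable]: "(\<lambda>p. (g p)\<^sup>2) \<in> borel_measurable (area S T)"
    using majorant_measurable[OF S T w] by measurable
  define \<xi> where "\<xi> N L i = real i * L / real (Suc N)" for N L i
  define C where "C = 2 * ((S + T) * (S + T) * (w2 (S, T) - w2 (0, 0)))"
  have err: "\<bar>(LINT p|area S T. (g p)\<^sup>2) - (\<Sum>i<Suc N. \<Sum>j<Suc N. (g (\<xi> N S i, \<xi> N T j))\<^sup>2 * (S / real (Suc N) * (T / real (Suc N))))\<bar> \<le> C / real (Suc N)" for N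
  proof -
    have p: "partition S (Suc N) (\<xi> N S)" "partition T (Suc N) (\<xi> N T)"
      unfolding \<xi>_def using partition_uniform S T by blast+
    have d: "0 \<le> (S + T) / real (Suc N)" using S T by auto
    have mesh: "i < Suc N \<Longrightarrow> \<xi> N S (Suc i) - \<xi> N S i \<le> (S + T) / real (Suc N) \<and> \<xi> N S i \<in> {\<xi> N S i..\<xi> N S (Suc i)}"
      "i < Suc N \<Longrightarrow> \<xi> N T (Suc i) - \<xi> N T i \<le> (S + T) / real (Suc N) \<and> \<xi> N T i \<in> {\<xi> N T i..\<xi> N T (Suc i)}" for i
      using S T unfolding \<xi>_def uniform_mesh by (simp_all add: divide_right_mono mult_right_mono)
    note hyps = w2 p d mesh
    have area: "(LINT p|area S T. indicator (grid_cell (\<xi> N S) (\<xi> N T) i j) p * 1) = S / real (Suc N) * (T / real (Suc N))"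
      if ij: "i < Suc N" "j < Suc N" for i j
    proof -
      note r = weak_seq_range[OF partition_weak_seq[OF p(1)], of i] weak_seq_range[OF partition_weak_seq[OF p(1)], of "Suc i"]
        weak_seq_range[OF partition_weak_seq[OF p(2)], of j] weak_seq_range[OF partition_weak_seq[OF p(2)], of "Suc j"]
        mesh(1)[of i] mesh(2)[of j]
      have "(LINT p|area S T. indicator (grid_cell (\<xi> N S) (\<xi> N T) i j) p) =
         (\<xi> N S (Suc i) - \<xi> N S i) * (\<xi> N T (Suc j) - \<xi> N T j)"
        unfolding grid_cell_def using r ij by (intro cell_area) auto
      then show ?thesis unfolding \<xi>_def uniform_mesh by simp
    qed
    have "\<bar>(LINT p|area S T. (g p)\<^sup>2 * 1) - (\<Sum>i<Suc N. \<Sum>j<Suc N. (g (\<xi> N S i, \<xi> N T j))\<^sup>2 * (LINT p|area S T. indicator (grid_cell (\<xi> N S) (\<xi> N T) i j) p * 1))\<bar>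
       \<le> 1 * (2 * ((S + T) / real (Suc N) * (S + T) * (w2 (S, T) - w2 (0, 0))))"
      by (rule riemann_sum_error[OF hyps]) auto
    moreover have "(\<Sum>i<Suc N. \<Sum>j<Suc N. (g (\<xi> N S i, \<xi> N T j))\<^sup>2 * (LINT p|area S T. indicator (grid_cell (\<xi> N S) (\<xi> N T) i j) p * 1))
      = (\<Sum>i<Suc N. \<Sum>j<Suc N. (g (\<xi> N S i, \<xi> N T j))\<^sup>2 * (S / real (Suc N) * (T / real (Suc N))))"
      using area by (intro sum.cong refl) (simp only: lessThan_iff)
    ultimately show ?thesis
      by (simp only: C_def times_divide_eq_left times_divide_eq_right mult_1_left mult_1_right)
  qed
  have "(\<lambda>N. (LINT p|area S T. (g p)\<^sup>2) - (\<Sum>i<Suc N. \<Sum>j<Suc N. (g (\<xi> N S i, \<xi> N T j))\<^sup>2 * (S / real (Suc N) * (T / real (Suc N))))) \<longlonglongrightarrow> 0"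
  proof (rule Lim_null_comparison)
    show "\<forall>\<^sub>F N in sequentially. norm ((LINT p|area S T. (g p)\<^sup>2) - (\<Sum>i<Suc N. \<Sum>j<Suc N. (g (\<xi> N S i, \<xi> N T j))\<^sup>2 * (S / real (Suc N) * (T / real (Suc N))))) \<le> C / real (Suc N)"
      unfolding real_norm_def using err by (rule always_eventually[OF allI])
    show "(\<lambda>N. C / real (Suc N)) \<longlonglongrightarrow> 0"
      using tendsto_mult[OF tendsto_const[of C] LIMSEQ_Suc[OF lim_1_over_n]] by simp
  qed
  from tendsto_diff[OF tendsto_const[of "LINT p|area S T. (g p)\<^sup>2"] this] show ?thesis
    unfolding \<xi>_def by (simp only: diff_diff_eq2 diff_0_right add_diff_cancel_left')
qed

subsection \<open>The space of square-integrable functions\<close>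

context
  fixes S T :: real
begin

abbreviation "ip \<equiv> l2_inner S T"

lemma L2_measurable: "u \<in> L2 S T \<Longrightarrow> u \<in> borel_measurable (area S T)"
  by (simp add: L2_def)

lemma L2_square: "u \<in> L2 S T \<Longrightarrow> integrable (area S T) (\<lambda>p. (u p)\<^sup>2)"
  by (simp add: L2_def)

lemma L2_product:
  assumes "u \<in> L2 S T" "v \<in> L2 S T"
  shows "integrable (area S T) (\<lambda>p. u p * v p)"
proof (rule Bochner_Integration.integrable_bound)
  show "integrable (area S T) (\<lambda>p. (u p)\<^sup>2 + (v p)\<^sup>2)" using assms by (simp add: L2_square)
  show "(\<lambda>p. u p * v p) \<in> borel_measurable (area S T)"
    using assms by (intro borel_measurable_times L2_measurable)
  show "AE p in area S T. norm (u p * v p) \<le> norm ((u p)\<^sup>2 + (v p)\<^sup>2)"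
  proof (rule AE_I2)
    fix p
    have "0 \<le> (\<bar>u p\<bar> - \<bar>v p\<bar>)\<^sup>2" by simp
    then have "2 * \<bar>u p * v p\<bar> \<le> (u p)\<^sup>2 + (v p)\<^sup>2" by (simp add: power2_diff abs_mult)
    then have "\<bar>u p * v p\<bar> \<le> (u p)\<^sup>2 + (v p)\<^sup>2"
      using abs_ge_zero[of "u p * v p"] by linarith
    then show "norm (u p * v p) \<le> norm ((u p)\<^sup>2 + (v p)\<^sup>2)" by simp
  qed
qed

lemma L2_add: "u \<in> L2 S T \<Longrightarrow> v \<in> L2 S T \<Longrightarrow> (\<lambda>p. u p + v p) \<in> L2 S T"
proof -
  assume a: "u \<in> L2 S T" "v \<in> L2 S T"
  have "integrable (area S T) (\<lambda>p. (u p)\<^sup>2 + (v p)\<^sup>2 + 2 * (u p * v p))"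
    using a by (intro Bochner_Integration.integrable_add Bochner_Integration.integrable_mult_right L2_square L2_product)
  moreover have "(\<lambda>p. u p + v p) \<in> borel_measurable (area S T)"
    using a by (intro borel_measurable_add L2_measurable)
  ultimately show ?thesis by (simp add: L2_def power2_sum mult.assoc)
qed

lemma L2_scale: "u \<in> L2 S T \<Longrightarrow> (\<lambda>p. c * u p) \<in> L2 S T"
proof -
  assume u: "u \<in> L2 S T"
  have "(\<lambda>p. c * u p) \<in> borel_measurable (area S T)"
    by (intro borel_measurable_times borel_measurable_const L2_measurable[OF u])
  moreover have "integrable (area S T) (\<lambda>p. (c * u p)\<^sup>2)"
    unfolding power_mult_distrib by (intro Bochner_Integration.integrable_mult_right L2_square[OF u])
  ultimately show ?thesis by (simp add: L2_def)
qed

lemma L2_diff: "u \<in> L2 S T \<Longrightarrow> v \<in> L2 S T \<Longrightarrow> (\<lambda>p. u p - v p) \<in> L2 S T"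
  using L2_add[OF _ L2_scale[of v "-1"], of u] by simp

lemma L2_zero: "(\<lambda>p. 0) \<in> L2 S T"
  by (simp add: L2_def)

lemma L2_sum:
  fixes n :: nat
  shows "(\<And>j. j < n \<Longrightarrow> v j \<in> L2 S T) \<Longrightarrow> (\<lambda>p. \<Sum>j<n. v j p) \<in> L2 S T"
  by (induct n) (auto simp: L2_zero intro: L2_add)

lemma L2_bounded:
  assumes m: "h \<in> borel_measurable (area S T)" and B: "\<And>p. p \<in> rect S T \<Longrightarrow> \<bar>h p\<bar> \<le> B" and u: "u \<in> L2 S T"
  shows "(\<lambda>p. u p * h p) \<in> L2 S T"
proof -
  have "integrable (area S T) (\<lambda>p. (u p * h p)\<^sup>2)"
  proof (rule Bochner_Integration.integrable_bound)
    show "integrable (area S T) (\<lambda>p. B\<^sup>2 * (u p)\<^sup>2)" using L2_square[OF u] by simp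
    show "(\<lambda>p. (u p * h p)\<^sup>2) \<in> borel_measurable (area S T)"
      using m L2_measurable[OF u] by measurable
    show "AE p in area S T. norm ((u p * h p)\<^sup>2) \<le> norm (B\<^sup>2 * (u p)\<^sup>2)"
    proof (rule AE_I2)
      fix p assume "p \<in> space (area S T)"
      then have "(h p)\<^sup>2 \<le> B\<^sup>2" using B[of p] by (simp add: abs_le_square_iff[symmetric])
      then show "norm ((u p * h p)\<^sup>2) \<le> norm (B\<^sup>2 * (u p)\<^sup>2)"
        by (simp add: power_mult_distrib mult.commute mult_right_mono)
    qed
  qed
  moreover have "(\<lambda>p. u p * h p) \<in> borel_measurable (area S T)"
    by (intro borel_measurable_times L2_measurable[OF u] m)
  ultimately show ?thesis by (simp add: L2_def)
qed

lemma L2_one: "(\<lambda>p. 1) \<in> L2 S T"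
  unfolding L2_def power_one using finite_measure.integrable_const[OF finite_measure_area, of S T "1::real"] by auto

lemma ip_commute: "ip u v = ip v u"
  by (simp add: l2_inner_def mult.commute)

lemma ip_add_left: "u \<in> L2 S T \<Longrightarrow> v \<in> L2 S T \<Longrightarrow> z \<in> L2 S T \<Longrightarrow> ip (\<lambda>p. u p + v p) z = ip u z + ip v z"
  unfolding l2_inner_def distrib_right by (intro Bochner_Integration.integral_add L2_product)

lemma ip_diff_left: "u \<in> L2 S T \<Longrightarrow> v \<in> L2 S T \<Longrightarrow> z \<in> L2 S T \<Longrightarrow> ip (\<lambda>p. u p - v p) z = ip u z - ip v z"
  unfolding l2_inner_def left_diff_distrib by (intro Bochner_Integration.integral_diff L2_product)

lemma ip_scale_left: "ip (\<lambda>p. c * u p) z = c * ip u z"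
  by (simp add: l2_inner_def mult.assoc)

lemma ip_sum_left:
  fixes n :: nat
  shows "(\<And>j. j < n \<Longrightarrow> v j \<in> L2 S T) \<Longrightarrow> z \<in> L2 S T \<Longrightarrow> ip (\<lambda>p. \<Sum>j<n. v j p) z = (\<Sum>j<n. ip (v j) z)"
proof (induct n)
  case 0
  show ?case by (simp add: l2_inner_def)
next
  case (Suc n)
  then show ?case by (simp add: ip_add_left L2_sum)
qed

lemma ip_add_right: "u \<in> L2 S T \<Longrightarrow> v \<in> L2 S T \<Longrightarrow> z \<in> L2 S T \<Longrightarrow> ip z (\<lambda>p. u p + v p) = ip z u + ip z v"
  using ip_add_left by (simp add: ip_commute[of z])

lemma ip_diff_right: "u \<in> L2 S T \<Longrightarrow> v \<in> L2 S T \<Longrightarrow> z \<in> L2 S T \<Longrightarrow> ip z (\<lambda>p. u p - v p) = ip z u - ip z v"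
  using ip_diff_left by (simp add: ip_commute[of z])

lemma ip_nonneg: "0 \<le> ip u u"
  unfolding l2_inner_def by (intro integral_nonneg_AE AE_I2) simp

lemma ip_diff_diff:
  "u \<in> L2 S T \<Longrightarrow> v \<in> L2 S T \<Longrightarrow> ip (\<lambda>p. u p - v p) (\<lambda>p. u p - v p) = ip u u - 2 * ip u v + ip v v"
  by (simp add: ip_diff_left ip_diff_right L2_diff ip_commute[of v u])

lemma ip_Cauchy_Schwarz:
  assumes u: "u \<in> L2 S T" and v: "v \<in> L2 S T"
  shows "(ip u v)\<^sup>2 \<le> ip u u * ip v v"
proof -
  have q: "0 \<le> ip u u - 2 * t * ip u v + t\<^sup>2 * ip v v" for t
  proof -
    have "ip (\<lambda>p. u p - t * v p) (\<lambda>p. u p - t * v p) = ip u u - 2 * ip u (\<lambda>p. t * v p) + ip (\<lambda>p. t * v p) (\<lambda>p. t * v p)"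
      by (rule ip_diff_diff[OF u L2_scale[OF v]])
    moreover have "ip u (\<lambda>p. t * v p) = t * ip u v"
      by (simp add: ip_commute[of u] ip_scale_left)
    moreover have "ip (\<lambda>p. t * v p) (\<lambda>p. t * v p) = t\<^sup>2 * ip v v"
      by (simp add: l2_inner_def power2_eq_square mult_ac)
    ultimately show ?thesis using ip_nonneg[of "\<lambda>p. u p - t * v p"] by simp
  qed
  show ?thesis
  proof (cases "ip v v = 0")
    case True
    have "ip u v = 0"
    proof (rule ccontr)
      assume n: "ip u v \<noteq> 0"
      \<comment> \<open>Since \<open>v\<close> is null the quadratic in \<open>t\<close> is affine,
        and this value of \<open>t\<close> makes it -1.\<close>
      have "ip u u - 2 * ((ip u u + 1) / (2 * ip u v)) * ip u v = -1" using n by (simp add: field_simps)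
      with q[of "(ip u u + 1) / (2 * ip u v)"] True show False by simp
    qed
    then show ?thesis using True by simp
  next
    case False
    then have pos: "ip v v > 0" using ip_nonneg[of v] by simp
    have "ip u u - 2 * (ip u v / ip v v) * ip u v + (ip u v / ip v v)\<^sup>2 * ip v v = ip u u - (ip u v)\<^sup>2 / ip v v"
      using pos by (simp add: field_simps power2_eq_square)
    with q[of "ip u v / ip v v"] have "(ip u v)\<^sup>2 / ip v v \<le> ip u u" by simp
    then show ?thesis using pos by (simp add: pos_divide_le_eq)
  qed
qed

lemma ip_abs_le: "u \<in> L2 S T \<Longrightarrow> v \<in> L2 S T \<Longrightarrow> \<bar>ip u v\<bar> \<le> sqrt (ip u u) * sqrt (ip v v)"
  using ip_Cauchy_Schwarz[of u v] by (metis real_sqrt_abs real_sqrt_le_mono real_sqrt_mult)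

lemma L1_le_L2:
  assumes u: "u \<in> L2 S T"
  shows "(LINT p|area S T. \<bar>u p\<bar>) \<le> sqrt (ip u u) * sqrt (measure (area S T) (rect S T))"
proof -
  have a: "(\<lambda>p. \<bar>u p\<bar>) \<in> L2 S T" using u by (auto simp: L2_def)
  have "(LINT p|area S T. \<bar>u p\<bar>) = ip (\<lambda>p. \<bar>u p\<bar>) (\<lambda>p. 1)" by (simp add: l2_inner_def)
  also have "\<dots> \<le> sqrt (ip (\<lambda>p. \<bar>u p\<bar>) (\<lambda>p. \<bar>u p\<bar>)) * sqrt (ip (\<lambda>p. 1) (\<lambda>p. 1))"
    using ip_abs_le[OF a L2_one] by simp
  finally show ?thesis by (simp add: l2_inner_def)
qed

context
  fixes \<phi> :: "nat \<Rightarrow> plane_fun"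
  assumes basis: "bv_orthonormal_basis S T \<phi>"
begin

lemma basis_L2: "\<phi> j \<in> L2 S T"
  and basis_bv: "bv_hardy_krause S T (\<phi> j)"
  and basis_ip: "ip (\<phi> i) (\<phi> j) = (if i = j then 1 else 0)"
  using basis unfolding bv_orthonormal_basis_def by (elim conjE; simp)+

lemma combination_L2: "(\<lambda>p. \<Sum>j<n. c j * \<phi> j p) \<in> L2 S T" for n :: nat
  by (intro L2_sum L2_scale basis_L2)

lemma combination_ip: "u \<in> L2 S T \<Longrightarrow> ip (\<lambda>p. \<Sum>j<n. c j * \<phi> j p) u = (\<Sum>j<n. c j * ip u (\<phi> j))" for n :: nat
proof -
  assume u: "u \<in> L2 S T"
  have "ip (\<lambda>p. \<Sum>j<n. c j * \<phi> j p) u = (\<Sum>j<n. ip (\<lambda>p. c j * \<phi> j p) u)"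
    by (rule ip_sum_left) (intro L2_scale basis_L2 u)+
  also have "\<dots> = (\<Sum>j<n. c j * ip u (\<phi> j))"
    by (intro sum.cong refl) (metis ip_scale_left ip_commute)
  finally show ?thesis .
qed

lemma combination_coeff: "ip (\<lambda>p. \<Sum>j<n. c j * \<phi> j p) (\<phi> i) = (if i < n then c i else 0)" for n :: nat
  unfolding combination_ip[OF basis_L2] basis_ip
  by (simp add: if_distrib[of "\<lambda>x. _ * x"] cong: if_cong)

lemma combination_norm: "ip (\<lambda>p. \<Sum>j<n. c j * \<phi> j p) (\<lambda>p. \<Sum>j<n. c j * \<phi> j p) = (\<Sum>j<n. (c j)\<^sup>2)" for n :: nat
  unfolding combination_ip[OF combination_L2] combination_coeff
  by (intro sum.cong refl) (simp add: power2_eq_square)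

lemma combination_distance:
  fixes n :: nat
  assumes u: "u \<in> L2 S T"
  shows "ip (\<lambda>p. u p - (\<Sum>j<n. c j * \<phi> j p)) (\<lambda>p. u p - (\<Sum>j<n. c j * \<phi> j p)) =
    ip u u - (\<Sum>j<n. (ip u (\<phi> j))\<^sup>2) + (\<Sum>j<n. (ip u (\<phi> j) - c j)\<^sup>2)"
proof -
  have "ip u (\<lambda>p. \<Sum>j<n. c j * \<phi> j p) = (\<Sum>j<n. c j * ip u (\<phi> j))"
    using combination_ip[OF u, of c n] ip_commute[of u "\<lambda>p. \<Sum>j<n. c j * \<phi> j p"] by metis
  moreover have "(\<Sum>j<n. (ip u (\<phi> j) - c j)\<^sup>2) =
    (\<Sum>j<n. (ip u (\<phi> j))\<^sup>2) - 2 * (\<Sum>j<n. c j * ip u (\<phi> j)) + (\<Sum>j<n. (c j)\<^sup>2)"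
  proof (induct n)
    case (Suc n)
    then show ?case by (simp add: power2_diff algebra_simps)
  qed simp
  ultimately show ?thesis
    using ip_diff_diff[OF u combination_L2, of c n] combination_norm[of c n] by simp
qed

text \<open>Completeness of the basis only says that a function orthogonal to all
  \<open>\<phi> n\<close> is null, so a function with the coefficients of \<open>u\<close> has to be
  built as in the Riesz--Fischer theorem. The partial sums are Cauchy in norm, hence in mean, and a
  subsequence converges almost everywhere to some \<open>w\<close>. Its coefficients are those of
  \<open>u\<close>, so \<open>u\<close> and \<open>w\<close> agree almost everywhere, and
  \<open>w\<close> is within the tail of the partial sums.\<close>

lemma parseval:
  assumes u: "u \<in> L2 S T"
  shows "(\<lambda>j. (ip u (\<phi> j))\<^sup>2) sums ip u u"
proof -
  define c where "c j = ip u (\<phi> j)" for j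
  define s where "s n p = (\<Sum>j<n. c j * \<phi> j p)" for n :: nat and p
  have sL: "s n \<in> L2 S T" for n unfolding s_def[abs_def] by (rule combination_L2)
  have le: "(\<Sum>j<n. (c j)\<^sup>2) \<le> ip u u" for n
    using combination_distance[OF u, of c n] ip_nonneg[of "\<lambda>p. u p - (\<Sum>j<n. c j * \<phi> j p)"]
    by (simp add: c_def)
  have sm: "summable (\<lambda>j. (c j)\<^sup>2)"
    using le by (intro summableI_nonneg_bounded) auto
  have sd: "ip (\<lambda>p. s m p - s n p) (\<lambda>p. s m p - s n p) = (\<Sum>j<m. (c j)\<^sup>2) - (\<Sum>j<n. (c j)\<^sup>2)" if "n \<le> m" for m n
  proof -
    have "(\<Sum>j<n. (ip (s m) (\<phi> j))\<^sup>2) = (\<Sum>j<n. (c j)\<^sup>2)" "(\<Sum>j<n. (ip (s m) (\<phi> j) - c j)\<^sup>2) = 0"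
      using that unfolding s_def[abs_def] by (auto simp: combination_coeff)
    then show ?thesis
      using combination_distance[OF sL[of m], of c n] combination_norm[of c m]
      unfolding s_def[symmetric] by simp
  qed
  define B where "B = sqrt (measure (area S T) (rect S T))"
  have Cau: "Cauchy (\<lambda>n. \<Sum>j<n. (c j)\<^sup>2)"
    using sm summable_iff_convergent convergent_Cauchy by blast
  have cs: "\<exists>N. \<forall>i\<ge>N. \<forall>j\<ge>N. (LINT p|area S T. norm (s i p - s j p)) < e" if e: "e > 0" for e
  proof -
    define \<delta> where "\<delta> = (e / (B + 1))\<^sup>2"
    have A0: "0 \<le> B" by (simp add: B_def)
    then have d: "\<delta> > 0" using e by (simp add: \<delta>_def)
    obtain N where N: "\<And>m n. m \<ge> N \<Longrightarrow> n \<ge> N \<Longrightarrow> \<bar>(\<Sum>j<m. (c j)\<^sup>2) - (\<Sum>j<n. (c j)\<^sup>2)\<bar> < \<delta>"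
      using metric_CauchyD[OF Cau d] unfolding dist_real_def by blast
    have one: "(LINT p|area S T. \<bar>s i p - s j p\<bar>) < e" if ij: "j \<le> i" "j \<ge> N" for i j
    proof -
      have "(LINT p|area S T. \<bar>s i p - s j p\<bar>) \<le> sqrt ((\<Sum>j<i. (c j)\<^sup>2) - (\<Sum>j<j. (c j)\<^sup>2)) * B"
        using L1_le_L2[OF L2_diff[OF sL sL], of i j] sd[OF ij(1)] by (simp add: B_def)
      also have "\<dots> \<le> sqrt \<delta> * B"
        using N[of i j] ij A0 by (intro mult_right_mono real_sqrt_le_mono) auto
      also have "\<dots> = e / (B + 1) * B" using e A0 by (simp add: \<delta>_def)
      also have "\<dots> < e" using e A0 by (simp add: field_simps)
      finally show ?thesis .
    qed
    show ?thesis
    proof (intro exI[of _ N] allI impI)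
      fix i j assume ij: "N \<le> i" "N \<le> j"
      show "(LINT p|area S T. norm (s i p - s j p)) < e"
      proof (cases "j \<le> i")
        case True
        then show ?thesis using one ij by simp
      next
        case False
        have "(LINT p|area S T. norm (s i p - s j p)) = (LINT p|area S T. \<bar>s j p - s i p\<bar>)"
          by (simp add: abs_minus_commute)
        then show ?thesis using one[of i j] False ij by simp
      qed
    qed
  qed
  have si: "integrable (area S T) (s n)" for n
    using L2_product[OF sL L2_one] by simp
  obtain r where r: "strict_mono r" "AE p in area S T. Cauchy (\<lambda>i. s (r i) p)"
    using cauchy_L1_AE_cauchy_subseq[OF si cs] by blast
  define w where "w p = lim (\<lambda>i. s (r i) p)" for p
  have sm'[measurable]: "s n \<in> borel_measurable (area S T)" for n using L2_measurable[OF sL] .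
  have wm[measurable]: "w \<in> borel_measurable (area S T)"
    unfolding w_def[abs_def] by measurable
  have wlim: "AE p in area S T. (\<lambda>i. s (r i) p) \<longlonglongrightarrow> w p"
    using r(2) by eventually_elim (simp add: w_def Cauchy_convergent_iff convergent_LIMSEQ_iff)
  define tail where "tail n = (\<Sum>j. (c j)\<^sup>2) - (\<Sum>j<n. (c j)\<^sup>2)" for n
  have tail0: "tail \<longlonglongrightarrow> 0"
    using tendsto_diff[OF tendsto_const[of "\<Sum>j. (c j)\<^sup>2"] summable_LIMSEQ[OF sm]] by (simp add: tail_def[abs_def])
  have tl: "0 \<le> tail n" for n unfolding tail_def using sum_le_suminf[OF sm, of "{..<n}"] by simp
  \<comment> \<open>Fatou's lemma along the subsequence; it also shows that \<open>w - s n\<close>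
    is square-integrable.\<close>
  have nn: "(\<integral>\<^sup>+p. ennreal ((w p - s n p)\<^sup>2) \<partial>area S T) \<le> ennreal (tail n)" for n
  proof -
    have "(\<integral>\<^sup>+p. ennreal ((w p - s n p)\<^sup>2) \<partial>area S T) = (\<integral>\<^sup>+p. liminf (\<lambda>i. ennreal ((s (r i) p - s n p)\<^sup>2)) \<partial>area S T)"
    proof (rule nn_integral_cong_AE)
      show "AE p in area S T. ennreal ((w p - s n p)\<^sup>2) = liminf (\<lambda>i. ennreal ((s (r i) p - s n p)\<^sup>2))"
        using wlim
      proof eventually_elim
        case (elim p)
        have "(\<lambda>i. ennreal ((s (r i) p - s n p)\<^sup>2)) \<longlonglongrightarrow> ennreal ((w p - s n p)\<^sup>2)"
          using elim by (intro tendsto_ennrealI tendsto_intros)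
        then show ?case using lim_imp_Liminf[OF sequentially_bot] by metis
      qed
    qed
    also have "\<dots> \<le> liminf (\<lambda>i. \<integral>\<^sup>+p. ennreal ((s (r i) p - s n p)\<^sup>2) \<partial>area S T)"
      by (rule nn_integral_liminf) measurable
    also have "\<dots> \<le> ennreal (tail n)"
    proof (rule Liminf_le)
      show "\<forall>\<^sub>F i in sequentially. (\<integral>\<^sup>+p. ennreal ((s (r i) p - s n p)\<^sup>2) \<partial>area S T) \<le> ennreal (tail n)"
        using eventually_ge_at_top[of n]
      proof eventually_elim
        case (elim i)
        have ni: "n \<le> r i" using elim seq_suble[OF r(1), of i] by simp
        have "(\<integral>\<^sup>+p. ennreal ((s (r i) p - s n p)\<^sup>2) \<partial>area S T) = ennreal (ip (\<lambda>p. s (r i) p - s n p) (\<lambda>p. s (r i) p - s n p))"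
          using nn_integral_eq_integral[OF L2_square[OF L2_diff[OF sL sL]], of "r i" n]
          by (simp add: l2_inner_def power2_eq_square)
        also have "\<dots> \<le> ennreal (tail n)"
          unfolding sd[OF ni] tail_def using sum_le_suminf[OF sm, of "{..<r i}"] by (intro ennreal_leI) simp
        finally show ?case .
      qed
    qed simp
    finally show ?thesis .
  qed
  have wsL: "(\<lambda>p. w p - s n p) \<in> L2 S T" for n
    unfolding L2_def
  proof (intro CollectI conjI)
    show "integrable (area S T) (\<lambda>p. (w p - s n p)\<^sup>2)"
      using nn[of n] by (intro integrableI_nonneg) (auto simp: less_top[symmetric] top_unique)
  qed measurable
  have wL: "w \<in> L2 S T" using L2_add[OF wsL[of 0] sL[of 0]] by simp
  have wn: "ip (\<lambda>p. w p - s n p) (\<lambda>p. w p - s n p) \<le> tail n" for n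
  proof -
    have "ennreal (ip (\<lambda>p. w p - s n p) (\<lambda>p. w p - s n p)) = (\<integral>\<^sup>+p. ennreal ((w p - s n p)\<^sup>2) \<partial>area S T)"
      using nn_integral_eq_integral[OF L2_square[OF wsL], of n] by (simp add: l2_inner_def power2_eq_square)
    then show ?thesis using nn[of n] tl by (metis ennreal_le_iff)
  qed
  have wc: "ip w (\<phi> j) = c j" for j
  proof -
    have "(\<lambda>n. ip w (\<phi> j) - ip (s n) (\<phi> j)) \<longlonglongrightarrow> 0"
    proof (rule Lim_null_comparison)
      have "\<bar>ip w (\<phi> j) - ip (s n) (\<phi> j)\<bar> \<le> sqrt (tail n)" for n
      proof -
        have "\<bar>ip (\<lambda>p. w p - s n p) (\<phi> j)\<bar> \<le> sqrt (ip (\<lambda>p. w p - s n p) (\<lambda>p. w p - s n p)) * sqrt (ip (\<phi> j) (\<phi> j))"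
          by (rule ip_abs_le[OF wsL basis_L2])
        also have "\<dots> \<le> sqrt (tail n)" using wn[of n] by (simp add: basis_ip)
        finally show ?thesis by (simp add: ip_diff_left wL sL basis_L2)
      qed
      then show "\<forall>\<^sub>F n in sequentially. norm (ip w (\<phi> j) - ip (s n) (\<phi> j)) \<le> sqrt (tail n)" by simp
      show "(\<lambda>n. sqrt (tail n)) \<longlonglongrightarrow> 0" using tendsto_real_sqrt[OF tail0] by simp
    qed
    moreover have "(\<lambda>n. ip w (\<phi> j) - ip (s n) (\<phi> j)) \<longlonglongrightarrow> ip w (\<phi> j) - c j"
    proof (rule tendsto_eventually, rule eventually_sequentiallyI[of "Suc j"])
      fix n assume "Suc j \<le> n"
      then show "ip w (\<phi> j) - ip (s n) (\<phi> j) = ip w (\<phi> j) - c j"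
        unfolding s_def[abs_def] by (simp add: combination_coeff)
    qed
    ultimately show ?thesis using LIMSEQ_unique by fastforce
  qed
  have "\<forall>n. ip (\<lambda>p. u p - w p) (\<phi> n) = 0"
    by (simp add: ip_diff_left u wL basis_L2 wc c_def)
  then have ae: "AE p in area S T. u p - w p = 0"
    using basis L2_diff[OF u wL] unfolding bv_orthonormal_basis_def by blast
  have "ip u u = ip w w"
    unfolding l2_inner_def using ae u
    by (intro integral_cong_AE borel_measurable_times L2_measurable u wL) (auto elim!: eventually_mono)
  have d: "ip u u - (\<Sum>j<n. (c j)\<^sup>2) \<le> tail n" for n
  proof -
    have "ip w w - (\<Sum>j<n. (c j)\<^sup>2) = ip (\<lambda>p. w p - s n p) (\<lambda>p. w p - s n p)"
      using combination_distance[OF wL, of c n] by (simp add: wc s_def)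
    then show ?thesis using wn[of n] \<open>ip u u = ip w w\<close> by simp
  qed
  have "(\<lambda>n. ip u u - (\<Sum>j<n. (c j)\<^sup>2)) \<longlonglongrightarrow> 0"
    by (rule tendsto_sandwich[OF _ _ tendsto_const tail0]) (use le d in auto)
  then have "(\<lambda>n. \<Sum>j<n. (c j)\<^sup>2) \<longlonglongrightarrow> ip u u"
    using tendsto_diff[OF tendsto_const[of "ip u u"]] by fastforce
  then show ?thesis unfolding sums_def c_def .
qed

end

end

section \<open>The Borel sigma-algebra of the function space and its generation by
  coefficients\<close>

context
  fixes S T :: real
begin

definition l2_open :: "plane_fun set set" where
  "l2_open = {U. U \<subseteq> L2 S T \<and> (\<forall>u\<in>U. \<exists>e>0. \<forall>v\<in>L2 S T. l2_norm S T (\<lambda>p. v p - u p) < e \<longrightarrow> v \<in> U)}"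

lemma l2_open_Pow: "l2_open \<subseteq> Pow (L2 S T)"
  by (auto simp: l2_open_def)

lemma space_borel_L2 [simp]: "space (borel_L2 S T) = L2 S T"
  unfolding borel_L2_def l2_open_def[symmetric] using l2_open_Pow by (rule space_measure_of)

lemma sets_borel_L2: "sets (borel_L2 S T) = sigma_sets (L2 S T) l2_open"
  unfolding borel_L2_def l2_open_def[symmetric] using l2_open_Pow by (rule sets_measure_of)

lemma measurable_ip:
  assumes v: "v \<in> L2 S T"
  shows "(\<lambda>u. ip S T u v) \<in> borel_measurable (borel_L2 S T)"
  unfolding borel_measurable_iff_greater space_borel_L2
proof
  fix a
  have "{u \<in> L2 S T. a < ip S T u v} \<in> l2_open"
    unfolding l2_open_def
  proof (intro CollectI conjI ballI)
    fix u assume u: "u \<in> {u \<in> L2 S T. a < ip S T u v}"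
    define e where "e = (ip S T u v - a) / (sqrt (ip S T v v) + 1)"
    have p: "0 < sqrt (ip S T v v) + 1" using ip_nonneg[of S T v] by (simp add: add_nonneg_pos)
    then have "e > 0" using u by (simp add: e_def)
    moreover have "z \<in> {u \<in> L2 S T. a < ip S T u v}" if z: "z \<in> L2 S T" "l2_norm S T (\<lambda>p. z p - u p) < e" for z
    proof -
      have "\<bar>ip S T z v - ip S T u v\<bar> = \<bar>ip S T (\<lambda>p. z p - u p) v\<bar>"
        using u z v by (simp add: ip_diff_left)
      also have "\<dots> \<le> l2_norm S T (\<lambda>p. z p - u p) * sqrt (ip S T v v)"
        unfolding l2_norm_def using u z v by (intro ip_abs_le L2_diff) auto
      also have "\<dots> \<le> e * sqrt (ip S T v v)" using z ip_nonneg[of S T v] by (intro mult_right_mono) auto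
      also have "\<dots> < e * (sqrt (ip S T v v) + 1)" using \<open>e > 0\<close> by simp
      also have "\<dots> = ip S T u v - a" using p by (simp add: e_def)
      finally show ?thesis using z by auto
    qed
    ultimately show "\<exists>e>0. \<forall>z\<in>L2 S T. l2_norm S T (\<lambda>p. z p - u p) < e \<longrightarrow> z \<in> {u \<in> L2 S T. a < ip S T u v}" by blast
  qed auto
  then show "{u \<in> L2 S T. a < ip S T u v} \<in> sets (borel_L2 S T)"
    unfolding sets_borel_L2 by blast
qed

text \<open>A triangle inequality free of square roots: the discarded term is the square of
  \<open>(u - w) + (v - w)\<close>, whence the factors 2.\<close>

lemma ip_diff_triangle:
  assumes "u \<in> L2 S T" "v \<in> L2 S T" "w \<in> L2 S T"
  shows "ip S T (\<lambda>p. u p - v p) (\<lambda>p. u p - v p) \<le> 2 * ip S T (\<lambda>p. u p - w p) (\<lambda>p. u p - w p) + 2 * ip S T (\<lambda>p. v p - w p) (\<lambda>p. v p - w p)"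
proof -
  have i: "integrable (area S T) (\<lambda>p. (x p - y p) * (x p - y p))" if "x \<in> L2 S T" "y \<in> L2 S T" for x y
    by (intro L2_product L2_diff that)
  have "ip S T (\<lambda>p. u p - v p) (\<lambda>p. u p - v p) \<le>
    (LINT p|area S T. 2 * ((u p - w p) * (u p - w p)) + 2 * ((v p - w p) * (v p - w p)))"
    unfolding l2_inner_def
  proof (rule integral_mono)
    show "integrable (area S T) (\<lambda>p. 2 * ((u p - w p) * (u p - w p)) + 2 * ((v p - w p) * (v p - w p)))"
      using i assms by (intro Bochner_Integration.integrable_add Bochner_Integration.integrable_mult_right) auto
    fix p
    have "0 \<le> ((u p - w p) + (v p - w p))\<^sup>2" by simp
    then show "(u p - v p) * (u p - v p) \<le> 2 * ((u p - w p) * (u p - w p)) + 2 * ((v p - w p) * (v p - w p))"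
      by (simp add: power2_eq_square algebra_simps)
  qed (use i assms in auto)
  also have "\<dots> = 2 * ip S T (\<lambda>p. u p - w p) (\<lambda>p. u p - w p) + 2 * ip S T (\<lambda>p. v p - w p) (\<lambda>p. v p - w p)"
    unfolding l2_inner_def using i assms by simp
  finally show ?thesis .
qed

context
  fixes \<phi> :: "nat \<Rightarrow> plane_fun"
  assumes basis: "bv_orthonormal_basis S T \<phi>"
begin

lemma rational_approximation:
  assumes u: "u \<in> L2 S T" and e: "e > 0"
  shows "\<exists>cs :: rat list. ip S T (\<lambda>p. u p - (\<Sum>j<length cs. of_rat (cs ! j) * \<phi> j p))
      (\<lambda>p. u p - (\<Sum>j<length cs. of_rat (cs ! j) * \<phi> j p)) < e"
proof -
  have "(\<lambda>n. \<Sum>j<n. (ip S T u (\<phi> j))\<^sup>2) \<longlonglongrightarrow> ip S T u u"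
    using parseval[OF basis u] by (simp add: sums_def)
  then have "\<forall>\<^sub>F n in sequentially. \<bar>(\<Sum>j<n. (ip S T u (\<phi> j))\<^sup>2) - ip S T u u\<bar> < e / 2"
    using e unfolding tendsto_iff dist_real_def by (meson half_gt_zero)
  then obtain n where n: "\<bar>(\<Sum>j<n. (ip S T u (\<phi> j))\<^sup>2) - ip S T u u\<bar> < e / 2"
    using eventually_happens'[OF sequentially_bot] by blast
  \<comment> \<open>Chosen so that \<open>n\<close> squares of \<delta> amount to at most e / 2, for
    \<open>n = 0\<close> as well.\<close>
  define \<delta> where "\<delta> = sqrt (e / (2 * (real n + 1)))"
  have d: "\<delta> > 0" using e by (simp add: \<delta>_def)
  have "\<exists>q. \<bar>ip S T u (\<phi> j) - of_rat q\<bar> < \<delta>" for j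
  proof -
    obtain q where "ip S T u (\<phi> j) - \<delta> < of_rat q" "of_rat q < ip S T u (\<phi> j)"
      using of_rat_dense[of "ip S T u (\<phi> j) - \<delta>" "ip S T u (\<phi> j)"] d by auto
    then show ?thesis by (intro exI[of _ q]) auto
  qed
  then obtain q where q: "\<And>j. \<bar>ip S T u (\<phi> j) - of_rat (q j)\<bar> < \<delta>" by metis
  define cs where "cs = map q [0..<n]"
  have cs: "length cs = n" "\<And>j. j < n \<Longrightarrow> cs ! j = q j" by (simp_all add: cs_def)
  have "(\<Sum>j<n. (ip S T u (\<phi> j) - of_rat (cs ! j))\<^sup>2) \<le> (\<Sum>j<n. \<delta>\<^sup>2)"
  proof (intro sum_mono)
    fix j assume "j \<in> {..<n}"
    then have "\<bar>ip S T u (\<phi> j) - of_rat (cs ! j)\<bar> \<le> \<bar>\<delta>\<bar>" using q[of j] cs(2)[of j] d by simp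
    then show "(ip S T u (\<phi> j) - of_rat (cs ! j))\<^sup>2 \<le> \<delta>\<^sup>2" by (simp only: abs_le_square_iff)
  qed
  also have "\<dots> = real n * (e / (2 * (real n + 1)))" using e by (simp add: \<delta>_def)
  also have "\<dots> \<le> e / 2" using e by (simp add: field_simps)
  finally have "ip S T u u - (\<Sum>j<n. (ip S T u (\<phi> j))\<^sup>2) + (\<Sum>j<n. (ip S T u (\<phi> j) - of_rat (cs ! j))\<^sup>2) < e"
    using n by linarith
  then have "ip S T (\<lambda>p. u p - (\<Sum>j<n. of_rat (cs ! j) * \<phi> j p)) (\<lambda>p. u p - (\<Sum>j<n. of_rat (cs ! j) * \<phi> j p)) < e"
    using combination_distance[OF basis u, of "\<lambda>j. of_rat (cs ! j)" n] by simp
  then show ?thesis using cs(1) by blast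
qed

text \<open>By separability an open set is a countable union of balls about finite rational
  combinations of the basis, and by Parseval's identity the squared distance to such a centre is a
  series in the coefficients.\<close>

lemma measurable_borel_L2I:
  assumes \<theta>: "\<And>\<omega>. \<omega> \<in> space \<Omega> \<Longrightarrow> \<theta> \<omega> \<in> L2 S T"
    and [measurable]: "\<And>j. (\<lambda>\<omega>. ip S T (\<theta> \<omega>) (\<phi> j)) \<in> borel_measurable \<Omega>"
  shows "\<theta> \<in> \<Omega> \<rightarrow>\<^sub>M borel_L2 S T"
  unfolding borel_L2_def l2_open_def[symmetric]
proof (rule measurable_measure_of[OF l2_open_Pow])
  show "\<theta> \<in> space \<Omega> \<rightarrow> L2 S T" using \<theta> by auto
  fix U assume U: "U \<in> l2_open"
  define w where "w cs p = (\<Sum>j<length cs. of_rat (cs ! j) * \<phi> j p)" for cs :: "rat list" and p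
  have wL: "w cs \<in> L2 S T" for cs unfolding w_def[abs_def] by (rule combination_L2[OF basis])
  define dd where "dd u cs = ip S T (\<lambda>p. u p - w cs p) (\<lambda>p. u p - w cs p)" for u cs
  define K where "K = {(cs, k). \<forall>v\<in>L2 S T. dd v cs < 1 / real (Suc k) \<longrightarrow> v \<in> U}"
  have cover: "u \<in> U \<longleftrightarrow> (\<exists>(cs, k)\<in>K. dd u cs < 1 / real (Suc k))" if u: "u \<in> L2 S T" for u
  proof
    assume "u \<in> U"
    then obtain e where e: "e > 0" "\<And>v. v \<in> L2 S T \<Longrightarrow> l2_norm S T (\<lambda>p. v p - u p) < e \<Longrightarrow> v \<in> U"
      using U unfolding l2_open_def by blast
    \<comment> \<open>Squared distances below e^2 / 4 from the common centre give a squared distance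
      below e^2 by \<open>ip_diff_triangle\<close>.\<close>
    obtain k where k: "1 / real (Suc k) < e\<^sup>2 / 4"
      using reals_Archimedean[of "e\<^sup>2 / 4"] e(1) by (auto simp: inverse_eq_divide)
    obtain cs where cs: "dd u cs < 1 / real (Suc k)"
      using rational_approximation[OF u, of "1 / real (Suc k)"] unfolding dd_def w_def by auto
    have "v \<in> U" if v: "v \<in> L2 S T" "dd v cs < 1 / real (Suc k)" for v
    proof -
      have "ip S T (\<lambda>p. v p - u p) (\<lambda>p. v p - u p) \<le> 2 * dd v cs + 2 * dd u cs"
        unfolding dd_def by (rule ip_diff_triangle[OF v(1) u wL])
      also have "\<dots> < e\<^sup>2" using v(2) cs k by simp
      finally have "l2_norm S T (\<lambda>p. v p - u p) < e"
        unfolding l2_norm_def using e(1) real_sqrt_less_mono by fastforce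
      then show ?thesis using e(2) v(1) by blast
    qed
    then have "(cs, k) \<in> K" by (auto simp: K_def)
    then show "\<exists>(cs, k)\<in>K. dd u cs < 1 / real (Suc k)" using cs by blast
  next
    assume "\<exists>(cs, k)\<in>K. dd u cs < 1 / real (Suc k)"
    then show "u \<in> U" using u by (auto simp: K_def)
  qed
  have "dd (\<theta> \<omega>) cs = (\<Sum>j. (ip S T (\<theta> \<omega>) (\<phi> j) - ip S T (w cs) (\<phi> j))\<^sup>2)" if "\<omega> \<in> space \<Omega>" for \<omega> cs
  proof -
    have "(\<lambda>j. (ip S T (\<lambda>p. \<theta> \<omega> p - w cs p) (\<phi> j))\<^sup>2) sums dd (\<theta> \<omega>) cs"
      unfolding dd_def by (intro parseval[OF basis] L2_diff \<theta> that wL)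
    then show ?thesis
      using \<theta>[OF that] by (simp add: ip_diff_left wL basis_L2[OF basis] sums_unique)
  qed
  then have m: "(\<lambda>\<omega>. dd (\<theta> \<omega>) cs) \<in> borel_measurable \<Omega>" for cs
    by (subst measurable_cong) (assumption, measurable)
  have "\<theta> -` U \<inter> space \<Omega> = (\<Union>(cs, k)\<in>K. {\<omega> \<in> space \<Omega>. dd (\<theta> \<omega>) cs < 1 / real (Suc k)})"
    using cover \<theta> by auto
  also have "\<dots> \<in> sets \<Omega>"
    using m by (intro sets.countable_UN') (auto simp: countable_subset[OF subset_UNIV])
  finally show "\<theta> -` U \<inter> space \<Omega> \<in> sets \<Omega>" .
qed

end

end

subsection \<open>Gaussian series\<close>

text \<open>The functions n sin(x / n) approximate x, are dominated by |x| and are combinations of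
  characters. They carry identities for characteristic functions over to moments and to
  measurability.\<close>

lemma tendsto_n_sin: "(\<lambda>n. real (Suc n) * sin (x / real (Suc n))) \<longlonglongrightarrow> x"
proof -
  have "((\<lambda>h. sin (x * h)) has_real_derivative x) (at 0)"
    by (auto intro!: derivative_eq_intros)
  then have "((\<lambda>h. sin (x * h) / h) \<longlongrightarrow> x) (at 0)"
    by (simp add: DERIV_def)
  moreover have "filterlim (\<lambda>n. 1 / real (Suc n)) (at 0) sequentially"
    using LIMSEQ_Suc[OF lim_1_over_n] unfolding filterlim_at by (auto simp del: of_nat_Suc)
  ultimately have "(\<lambda>n. sin (x * (1 / real (Suc n))) / (1 / real (Suc n))) \<longlonglongrightarrow> x"
    by (rule filterlim_compose)
  then show ?thesis by (simp add: mult.commute)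
qed

lemma n_sin_bound: "\<bar>real (Suc n) * sin (x / real (Suc n))\<bar> \<le> \<bar>x\<bar>"
proof -
  have "\<bar>sin (x / real (Suc n))\<bar> \<le> \<bar>x / real (Suc n)\<bar>" by (rule abs_sin_x_le_abs_x)
  then have "real (Suc n) * \<bar>sin (x / real (Suc n))\<bar> \<le> real (Suc n) * \<bar>x / real (Suc n)\<bar>"
    by (intro mult_left_mono) auto
  then show ?thesis by (simp add: abs_mult)
qed

lemma exp_ii_sin:
  "exp (\<i> * complex_of_real s) * complex_of_real (sin t) =
    (exp (\<i> * complex_of_real (s + t)) - exp (\<i> * complex_of_real (s - t))) / (2 * \<i>)"
  by (simp add: sin_of_real[symmetric] sin_exp_eq distrib_left right_diff_distrib exp_add exp_diff exp_minus field_simps)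

text \<open>Independent standard normal variables, given by their joint characteristic functions.\<close>

locale gaussian_sequence = prob_space M for M :: "'a measure" +
  fixes X :: "nat \<Rightarrow> 'a \<Rightarrow> real"
  assumes X_measurable [measurable]: "X j \<in> borel_measurable M"
    and X_char: "\<And>a n. (LINT x|M. exp (\<i> * complex_of_real (\<Sum>j<n. a j * X j x))) = complex_of_real (exp (- (\<Sum>j<n. (a j)\<^sup>2) / 2))"
begin

lemma X_law: "distr M borel (X j) = std_normal_distribution"
proof (rule Levy_uniqueness)
  show "real_distribution (distr M borel (X j))" by simp
  show "real_distribution std_normal_distribution" by (rule real_dist_normal_dist)
  show "char (distr M borel (X j)) = char std_normal_distribution"
  proof
    fix t :: real
    define a :: "nat \<Rightarrow> real" where "a i = (if i = j then t else 0)" for i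
    have s: "(\<Sum>i<Suc j. a i * X i x) = t * X j x" "(\<Sum>i<Suc j. (a i)\<^sup>2) = t\<^sup>2" for x
      by (simp_all add: a_def)
    have "char (distr M borel (X j)) t = (LINT x|M. exp (\<i> * complex_of_real (t * X j x)))"
      unfolding char_def by (subst integral_distr) auto
    also have "\<dots> = complex_of_real (exp (- t\<^sup>2 / 2))"
      using X_char[of a "Suc j"] unfolding s .
    finally show "char (distr M borel (X j)) t = char std_normal_distribution t"
      by (simp add: char_std_normal_distribution)
  qed
qed

lemma X_square: "integrable M (\<lambda>x. (X j x)\<^sup>2)" "(LINT x|M. (X j x)\<^sup>2) = 1"
proof -
  have h: "has_bochner_integral lborel (\<lambda>x. std_normal_density x * x ^ (2 * 1)) (fact (2 * 1) / (2 ^ 1 * fact 1))"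
    by (rule std_normal_moment_even)
  then have "integrable std_normal_distribution (\<lambda>x. x\<^sup>2)" "(LINT x|std_normal_distribution. x\<^sup>2) = 1"
    by (simp_all add: integrable_density integral_density has_bochner_integral_iff)
  then have "integrable (distr M borel (X j)) (\<lambda>x. x\<^sup>2)" "(LINT x|distr M borel (X j). x\<^sup>2) = 1"
    unfolding X_law by simp_all
  then show "integrable M (\<lambda>x. (X j x)\<^sup>2)" "(LINT x|M. (X j x)\<^sup>2) = 1"
    by (simp_all add: integrable_distr_eq integral_distr)
qed

lemma X_product: "integrable M (\<lambda>x. X i x * X j x)"
proof (rule Bochner_Integration.integrable_bound)
  show "integrable M (\<lambda>x. (X i x)\<^sup>2 + (X j x)\<^sup>2)" using X_square by simp
  show "AE x in M. norm (X i x * X j x) \<le> norm ((X i x)\<^sup>2 + (X j x)\<^sup>2)"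
  proof (rule AE_I2)
    fix x
    have "0 \<le> (\<bar>X i x\<bar> - \<bar>X j x\<bar>)\<^sup>2" by simp
    then have "2 * \<bar>X i x * X j x\<bar> \<le> (X i x)\<^sup>2 + (X j x)\<^sup>2" by (simp add: power2_diff abs_mult)
    then have "\<bar>X i x * X j x\<bar> \<le> (X i x)\<^sup>2 + (X j x)\<^sup>2"
      using abs_ge_zero[of "X i x * X j x"] by linarith
    then show "norm (X i x * X j x) \<le> norm ((X i x)\<^sup>2 + (X j x)\<^sup>2)" by simp
  qed
qed measurable

section \<open>Orthogonality derived from joint characteristic functions\<close>

definition cexp :: "nat \<Rightarrow> (nat \<Rightarrow> real) \<Rightarrow> 'a \<Rightarrow> complex" where
  "cexp m c x = exp (\<i> * complex_of_real (\<Sum>l<m. c l * X l x))"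

lemma cexp_measurable [measurable]: "cexp m c \<in> borel_measurable M"
  unfolding cexp_def[abs_def] by measurable

lemma norm_cexp [simp]: "norm (cexp m c x) = 1"
  unfolding cexp_def by simp

lemma cexp_sin:
  assumes "l < m"
  shows "cexp m c x * complex_of_real (sin (a * X l x)) =
    (cexp m (c(l := c l + a)) x - cexp m (c(l := c l - a)) x) / (2 * \<i>)"
proof -
  have "(\<Sum>k<m. (c(l := c l + b)) k * X k x) = (\<Sum>k<m. c k * X k x) + b * X l x" for b
  proof -
    have "(\<Sum>k<m. (c(l := c l + b)) k * X k x) = (\<Sum>k<m. c k * X k x + (if k = l then b * X k x else 0))"
      by (intro sum.cong refl) (simp add: distrib_right)
    then show ?thesis using assms by (simp add: sum.distrib)
  qed
  from this[of a] this[of "-a"] show ?thesis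
    unfolding cexp_def exp_ii_sin by simp
qed

lemma bounded_integrable:
  fixes D :: "'a \<Rightarrow> complex"
  assumes "integrable M D" "f \<in> borel_measurable M" "\<And>x. norm (f x) \<le> B"
  shows "integrable M (\<lambda>x. f x * D x)"
proof (rule Bochner_Integration.integrable_bound)
  show "integrable M (\<lambda>x. B * norm (D x))" using assms by auto
  have "0 \<le> B" using assms(3) norm_ge_zero order_trans by blast
  then show "AE x in M. norm (f x * D x) \<le> norm (B * norm (D x))"
    using assms(3) by (intro AE_I2) (simp add: norm_mult mult_right_mono)
  show "(\<lambda>x. f x * D x) \<in> borel_measurable M" using assms by measurable
qed

lemma bounded_integrable1:
  assumes "f \<in> borel_measurable M" "\<And>x. norm (f x) \<le> B"
  shows "integrable M (f :: 'a \<Rightarrow> complex)"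
  using bounded_integrable[of "\<lambda>x. 1" f B] assms by simp

text \<open>Only the first \<open>m\<close> variables occur in \<open>cexp m c\<close>, so the joint
  characteristic function is even in the coefficient of \<open>X m\<close>, while the sine is
  odd.\<close>

lemma cexp_sin_zero: "(LINT x|M. cexp m c x * complex_of_real (sin (t * X m x))) = 0"
proof -
  have s: "(\<Sum>l<Suc m. (c(m := b)) l * X l x) = (\<Sum>l<m. c l * X l x) + b * X m x"
    "(\<Sum>l<Suc m. ((c(m := b)) l)\<^sup>2) = (\<Sum>l<m. (c l)\<^sup>2) + b\<^sup>2" for b x
    by simp_all
  have i: "integrable M (cexp k d)" for k d
    by (rule bounded_integrable1[where B=1]) auto
  have "(LINT x|M. cexp m c x * complex_of_real (sin (t * X m x))) =
    (LINT x|M. (cexp (Suc m) (c(m := t)) x - cexp (Suc m) (c(m := - t)) x) / (2 * \<i>))"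
    unfolding cexp_def s exp_ii_sin by simp
  also have "\<dots> = ((LINT x|M. cexp (Suc m) (c(m := t)) x) - (LINT x|M. cexp (Suc m) (c(m := - t)) x)) / (2 * \<i>)"
    using i by simp
  also have "\<dots> = 0"
  proof -
    have "(LINT x|M. cexp (Suc m) (c(m := b)) x) = complex_of_real (exp (- ((\<Sum>l<m. (c l)\<^sup>2) + b\<^sup>2) / 2))" for b
      unfolding cexp_def by (subst X_char) (simp only: s)
    then show ?thesis by (simp only: power2_minus) simp
  qed
  finally show ?thesis .
qed

lemma cexp_sin_sin_zero:
  assumes "j < m"
  shows "(LINT x|M. cexp m c x * complex_of_real (sin (s * X j x)) * complex_of_real (sin (t * X m x))) = 0"
proof -
  have i: "integrable M (\<lambda>x. cexp k d x * complex_of_real (sin (t * X m x)))" for k d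
    by (rule bounded_integrable1[where B=1]) (auto simp: norm_mult)
  show ?thesis
  proof -
    have "cexp m c x * complex_of_real (sin (s * X j x)) * complex_of_real (sin (t * X m x)) =
      (cexp m (c(j := c j + s)) x * complex_of_real (sin (t * X m x)) -
       cexp m (c(j := c j - s)) x * complex_of_real (sin (t * X m x))) / (2 * \<i>)" for x
      unfolding cexp_sin[OF assms] by (simp only: times_divide_eq_left left_diff_distrib)
    then show ?thesis
      using i by (simp only: integral_divide_zero Bochner_Integration.integral_diff cexp_sin_zero) simp
  qed
qed

text \<open>Differentiation of \<open>cexp_sin_sin_zero\<close> in both parameters at 0, carried out
  through the dominated limits of n sin(y / n).\<close>

lemma cexp_product_zero:
  assumes j: "j < m"
  shows "(LINT x|M. cexp m c x * complex_of_real (X j x * X m x)) = 0"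
proof -
  define q where "q n y = real (Suc n) * sin (y / real (Suc n))" for n y
  have [measurable]: "q n \<in> borel_measurable borel" for n unfolding q_def[abs_def] by measurable
  have "(\<lambda>n. LINT x|M. cexp m c x * complex_of_real (q n (X j x) * q n (X m x))) \<longlonglongrightarrow>
    (LINT x|M. cexp m c x * complex_of_real (X j x * X m x))"
  proof (rule integral_dominated_convergence[where w="\<lambda>x. norm (X j x * X m x)"])
    show "integrable M (\<lambda>x. norm (X j x * X m x))" using X_product by simp
    show "AE x in M. (\<lambda>n. cexp m c x * complex_of_real (q n (X j x) * q n (X m x))) \<longlonglongrightarrow> cexp m c x * complex_of_real (X j x * X m x)"
      unfolding q_def by (intro AE_I2 tendsto_intros tendsto_n_sin)
    show "AE x in M. norm (cexp m c x * complex_of_real (q n (X j x) * q n (X m x))) \<le> norm (X j x * X m x)" for n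
      unfolding q_def norm_mult norm_of_real norm_cexp abs_mult real_norm_def mult_1_left
      using n_sin_bound[of n] by (intro AE_I2 mult_mono) (auto simp: abs_mult)
  qed measurable
  moreover have "(LINT x|M. cexp m c x * complex_of_real (q n (X j x) * q n (X m x))) = 0" for n
  proof -
    have "(LINT x|M. cexp m c x * complex_of_real (q n (X j x) * q n (X m x))) =
      (LINT x|M. complex_of_real ((real (Suc n))\<^sup>2) * (cexp m c x * complex_of_real (sin (1 / real (Suc n) * X j x)) * complex_of_real (sin (1 / real (Suc n) * X m x))))"
      by (intro Bochner_Integration.integral_cong refl) (simp add: q_def power2_eq_square)
    then show ?thesis
      by (simp only: integral_mult_right_zero cexp_sin_sin_zero[OF j] mult_zero_right)
  qed
  ultimately show ?thesis by (simp add: LIMSEQ_const_iff)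
qed

text \<open>What Kolmogorov's inequality needs of independence; \<open>N\<close> may be larger than the sigma-algebra
  generated by the \<open>X l\<close> with \<open>l < m\<close>.\<close>

lemma product_orthogonal:
  assumes j: "j < m"
  shows "\<exists>N. space N = space M \<and> sets N \<subseteq> sets M \<and> (\<forall>l<m. X l \<in> borel_measurable N) \<and>
     (\<forall>A\<in>sets N. (LINT x|M. indicator A x * (X j x * X m x)) = 0)"
proof -
  define D where "D x = complex_of_real (X j x * X m x)" for x
  have D: "integrable M D" unfolding D_def[abs_def] using X_product by (intro integrable_of_real)
  \<comment> \<open>Shifted sines have values in the unit interval, determine the variables
    \<open>X l\<close> with \<open>l < m\<close>, and turn a character into a combination of
    characters with shifted coefficients.\<close>
  define G where "G = (\<lambda>(a, l) x. (1 + sin (a * X l x)) / 2) ` (UNIV \<times> {..<m})"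
  have pm: "(\<lambda>x. complex_of_real (\<Prod>g\<leftarrow>gs. g x)) \<in> borel_measurable M \<and> (\<forall>x. norm (complex_of_real (\<Prod>g\<leftarrow>gs. g x)) \<le> 1)"
    if "set gs \<subseteq> G" for gs
    using that
  proof (induct gs)
    case (Cons g gs)
    then obtain a l where g: "g = (\<lambda>x. (1 + sin (a * X l x)) / 2)" by (auto simp: G_def)
    have gm: "(\<lambda>x. complex_of_real (g x)) \<in> borel_measurable M" unfolding g by measurable
    have "\<bar>g x\<bar> \<le> 1" for x
    proof -
      have "\<bar>(1 + s) / 2\<bar> \<le> 1" if "s \<le> 1" "- 1 \<le> s" for s :: real using that by (simp add: abs_le_iff)
      from this[OF sin_le_one sin_ge_minus_one] show ?thesis unfolding g .
    qed
    with Cons gm show ?case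
      by (auto simp: norm_mult intro!: mult_le_one)
  qed simp
  \<comment> \<open>The induction runs over all \<open>c\<close>, because a sine factor in
    \<open>X l\<close> changes coefficient \<open>l\<close> of the character.\<close>
  have zero: "(LINT x|M. cexp m c x * complex_of_real (\<Prod>g\<leftarrow>gs. g x) * D x) = 0" if "set gs \<subseteq> G" for gs c
    using that
  proof (induct gs arbitrary: c)
    case Nil
    show ?case using cexp_product_zero[OF j] by (simp add: D_def)
  next
    case (Cons g gs)
    then obtain a l where g: "g = (\<lambda>x. (1 + sin (a * X l x)) / 2)" and l: "l < m" by (auto simp: G_def)
    have gs: "set gs \<subseteq> G" using Cons by simp
    define P where "P x = complex_of_real (\<Prod>g\<leftarrow>gs. g x)" for x
    have i: "integrable M (\<lambda>x. cexp m c x * P x * D x)" for c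
      by (rule bounded_integrable[OF D, where B=1])
        (use pm[OF gs] in \<open>auto simp: P_def[abs_def] norm_mult\<close>)
    have "cexp m c x * complex_of_real (\<Prod>g\<leftarrow>g # gs. g x) * D x =
      (cexp m c x * P x * D x) / 2 +
      (cexp m (c(l := c l + a)) x * P x * D x - cexp m (c(l := c l - a)) x * P x * D x) / (4 * \<i>)" for x
    proof -
      have "cexp m c x * complex_of_real (\<Prod>g\<leftarrow>g # gs. g x) * D x =
        (cexp m c x * P x * D x) / 2 + (cexp m c x * complex_of_real (sin (a * X l x))) * (P x * D x) / 2"
        by (simp add: g P_def field_simps)
      then show ?thesis unfolding cexp_sin[OF l] by (simp add: field_simps)
    qed
    then have "(LINT x|M. cexp m c x * complex_of_real (\<Prod>g\<leftarrow>g # gs. g x) * D x) =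
      (LINT x|M. cexp m c x * P x * D x) / 2 +
      ((LINT x|M. cexp m (c(l := c l + a)) x * P x * D x) - (LINT x|M. cexp m (c(l := c l - a)) x * P x * D x)) / (4 * \<i>)"
      using i by simp
    also have "\<dots> = 0" using Cons(1)[OF gs] by (simp add: P_def)
    finally show ?case .
  qed
  have "\<exists>N. space N = space M \<and> sets N \<subseteq> sets M \<and> (\<forall>g\<in>G. g \<in> borel_measurable N) \<and>
     (\<forall>A\<in>sets N. (LINT x|M. indicator A x * D x) = 0)"
  proof (rule monotone_class_vanishing[OF D])
    fix g assume "g \<in> G"
    then obtain a l where g: "g = (\<lambda>x. (1 + sin (a * X l x)) / 2)" by (auto simp: G_def)
    show "g \<in> borel_measurable M" unfolding g by measurable
    have "(1 + s) / 2 \<in> {0..1}" if "s \<le> 1" "- 1 \<le> s" for s :: real using that by simp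
    from this[OF sin_le_one sin_ge_minus_one] show "g x \<in> {0..1}" for x unfolding g .
  next
    fix gs assume "set gs \<subseteq> G"
    from zero[OF this, of "\<lambda>_. 0"] show "(LINT x|M. complex_of_real (\<Prod>g\<leftarrow>gs. g x) * D x) = 0"
      by (simp add: cexp_def)
  qed
  then obtain N where N: "space N = space M" "sets N \<subseteq> sets M" "\<forall>g\<in>G. g \<in> borel_measurable N"
     "\<forall>A\<in>sets N. (LINT x|M. indicator A x * D x) = 0" by blast
  \<comment> \<open>\<open>X l\<close> is recovered from the members of \<open>G\<close> by undoing
    the affine map and letting the frequency \<open>a\<close> tend to 0.\<close>
  have "X l \<in> borel_measurable N" if l: "l < m" for l
  proof (rule borel_measurable_LIMSEQ_real)
    show "(\<lambda>n. real (Suc n) * sin (X l x / real (Suc n))) \<longlonglongrightarrow> X l x" for x by (rule tendsto_n_sin)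
    fix n
    have "(\<lambda>x. (1 + sin (1 / real (Suc n) * X l x)) / 2) \<in> G"
      unfolding G_def using l by (intro image_eqI[of _ _ "(1 / real (Suc n), l)"]) auto
    then have "(\<lambda>x. (1 + sin (1 / real (Suc n) * X l x)) / 2) \<in> borel_measurable N"
      using N(3) by blast
    then have "(\<lambda>x. real (Suc n) * (2 * ((1 + sin (1 / real (Suc n) * X l x)) / 2) - 1)) \<in> borel_measurable N"
      by (intro borel_measurable_times borel_measurable_diff borel_measurable_const)
    moreover have "real (Suc n) * (2 * ((1 + sin (1 / real (Suc n) * X l x)) / 2) - 1) = real (Suc n) * sin (X l x / real (Suc n))" for x
    proof -
      have "2 * ((1 + s) / 2) - 1 = s" for s :: real by (simp add: field_simps)
      then show ?thesis by (simp only: times_divide_eq_left mult_1_left)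
    qed
    ultimately show "(\<lambda>x. real (Suc n) * sin (X l x / real (Suc n))) \<in> borel_measurable N"
      by (simp only:)
  qed
  moreover have "(LINT x|M. indicator A x * (X j x * X m x)) = 0" if "A \<in> sets N" for A
  proof -
    have "complex_of_real (LINT x|M. indicator A x * (X j x * X m x)) = (LINT x|M. indicator A x * D x)"
      unfolding integral_complex_of_real[symmetric] D_def
      by (intro Bochner_Integration.integral_cong refl) (auto simp: indicator_def)
    then show ?thesis using N(4) that by simp
  qed
  ultimately show ?thesis using N(1,2) by blast
qed

text \<open>\<open>B k\<close> is the event that the partial sums up to index \<open>k\<close> stay
  below \<open>e\<close> in modulus, so \<open>R\<close> is the sequence of partial sums stopped at
  its first exit. New terms are orthogonal to the past, hence the second moment of
  \<open>R n\<close> is at most the sum of the squares, and Markov's inequality applies to the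
  stopped value.\<close>

lemma kolmogorov_inequality:
  assumes e: "e > 0"
  shows "measure M {x \<in> space M. \<exists>k\<le>n. e \<le> \<bar>\<Sum>j<k. v j * X j x\<bar>} \<le> (\<Sum>j<n. (v j)\<^sup>2) / e\<^sup>2"
proof -
  define P where "P k x = (\<Sum>j<k. v j * X j x)" for k x
  define B where "B k = {x \<in> space M. \<forall>i\<le>k. \<bar>P i x\<bar> < e}" for k
  define R where "R k x = (\<Sum>j<k. v j * (X j x * indicator (B j) x))" for k x
  have B_N: "B k \<in> sets N" if "space N = space M" "\<And>l. l < k \<Longrightarrow> X l \<in> borel_measurable N" for N k
  proof -
    have [measurable]: "P i \<in> borel_measurable N" if "i \<le> k" for i
      unfolding P_def[abs_def] using \<open>i \<le> k\<close> \<open>\<And>l. l < k \<Longrightarrow> X l \<in> borel_measurable N\<close>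
      by (intro borel_measurable_sum borel_measurable_times borel_measurable_const) auto
    have "B k = space N \<inter> (\<Inter>i\<in>{..k}. {x \<in> space N. \<bar>P i x\<bar> < e})"
      using that(1) by (auto simp: B_def)
    also have "\<dots> \<in> sets N"
      by (intro sets.Int sets.top sets.finite_INT) auto
    finally show ?thesis .
  qed
  have [measurable]: "B k \<in> sets M" for k using B_N[of M] by simp
  have [measurable]: "P k \<in> borel_measurable M" "R k \<in> borel_measurable M" for k
    unfolding P_def[abs_def] R_def[abs_def] by measurable
  have BX: "integrable M (\<lambda>x. indicator A x * (X i x * X j x))" if [measurable]: "A \<in> sets M" for A i j
    by (rule Bochner_Integration.integrable_bound[OF X_product[of i j]]) (auto simp: indicator_def)
  have cross: "(LINT x|M. R k x * (X k x * indicator (B k) x)) = 0"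
    and crossi: "integrable M (\<lambda>x. R k x * (X k x * indicator (B k) x))" for k
  proof -
    have z: "(LINT x|M. indicator (B k) x * (X j x * X k x)) = 0" if j: "j < k" for j
    proof -
      obtain N where "space N = space M" "\<forall>l<k. X l \<in> borel_measurable N"
        "\<forall>A\<in>sets N. (LINT x|M. indicator A x * (X j x * X k x)) = 0"
        using product_orthogonal[OF j] by blast
      then show ?thesis using B_N[of N k] by blast
    qed
    \<comment> \<open>\<open>B k\<close> is contained in \<open>B j\<close> for
      \<open>j < k\<close>, so one indicator absorbs the other and \<open>product_orthogonal\<close>
      applies term by term.\<close>
    have e: "R k x * (X k x * indicator (B k) x) = (\<Sum>j<k. v j * (indicator (B k) x * (X j x * X k x)))" for x
      unfolding R_def sum_distrib_right
    proof (intro sum.cong refl)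
      fix j assume "j \<in> {..<k}"
      then have "B k \<subseteq> B j" by (auto simp: B_def)
      then show "v j * (X j x * indicator (B j) x) * (X k x * indicator (B k) x) = v j * (indicator (B k) x * (X j x * X k x))"
        by (auto simp: indicator_def)
    qed
    show "integrable M (\<lambda>x. R k x * (X k x * indicator (B k) x))"
      unfolding e by (intro Bochner_Integration.integrable_sum Bochner_Integration.integrable_mult_right BX) auto
    show "(LINT x|M. R k x * (X k x * indicator (B k) x)) = 0"
      unfolding e using BX z
      by (subst Bochner_Integration.integral_sum) (auto intro!: Bochner_Integration.integrable_mult_right sum.neutral)
  qed
  have R2: "integrable M (\<lambda>x. (R k x)\<^sup>2) \<and> (LINT x|M. (R k x)\<^sup>2) \<le> (\<Sum>j<k. (v j)\<^sup>2)" for k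
  proof (induct k)
    case 0
    show ?case by (simp add: R_def)
  next
    case (Suc k)
    have e: "(R (Suc k) x)\<^sup>2 = (R k x)\<^sup>2 + (2 * v k) * (R k x * (X k x * indicator (B k) x)) + (v k)\<^sup>2 * (indicator (B k) x * (X k x * X k x))" for x
    proof -
      have "R (Suc k) x = R k x + v k * (X k x * indicator (B k) x)" by (simp add: R_def)
      then show ?thesis by (simp add: power2_eq_square algebra_simps indicator_def)
    qed
    have "(LINT x|M. indicator (B k) x * (X k x * X k x)) \<le> (LINT x|M. (X k x)\<^sup>2)"
      using BX X_square by (intro integral_mono) (auto simp: indicator_def power2_eq_square)
    then have "(v k)\<^sup>2 * (LINT x|M. indicator (B k) x * (X k x * X k x)) \<le> (v k)\<^sup>2"
      using X_square(2)[of k] mult_left_mono[of _ 1 "(v k)\<^sup>2"] by simp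
    moreover have "integrable M (\<lambda>x. (R (Suc k) x)\<^sup>2)"
      unfolding e using Suc crossi BX by (intro Bochner_Integration.integrable_add Bochner_Integration.integrable_mult_right) auto
    moreover have "(LINT x|M. (R (Suc k) x)\<^sup>2) = (LINT x|M. (R k x)\<^sup>2) + (v k)\<^sup>2 * (LINT x|M. indicator (B k) x * (X k x * X k x))"
      unfolding e using Suc crossi[of k] BX[of "B k" k k] cross[of k] by simp
    ultimately show ?case using Suc by simp
  qed
  have sub: "{x \<in> space M. \<exists>k\<le>n. e \<le> \<bar>P k x\<bar>} \<subseteq> {x \<in> space M. e\<^sup>2 \<le> (R n x)\<^sup>2}"
  proof safe
    fix x k assume x: "x \<in> space M" and k: "k \<le> n" "e \<le> \<bar>P k x\<bar>"
    define k0 where "k0 = (LEAST k. e \<le> \<bar>P k x\<bar>)"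
    have k0: "e \<le> \<bar>P k0 x\<bar>" "k0 \<le> k" unfolding k0_def using k by (auto intro: LeastI Least_le)
    have less: "\<bar>P i x\<bar> < e" if "i < k0" for i
      using not_less_Least[of i "\<lambda>k. e \<le> \<bar>P k x\<bar>"] that unfolding k0_def by simp
    have "indicator (B j) x = (if j < k0 then 1 else 0 :: real)" for j
      using less k0(1) x by (auto simp: B_def indicator_def not_less)
    then have "R n x = (\<Sum>j<n. if j < k0 then v j * X j x else 0)"
      unfolding R_def by (intro sum.cong refl) auto
    also have "\<dots> = P k0 x"
      unfolding P_def using k0(2) k(1) by (intro sum.mono_neutral_cong_right) auto
    finally show "e\<^sup>2 \<le> (R n x)\<^sup>2"
      using k0(1) e by (simp add: abs_le_square_iff[symmetric])
  qed
  have "measure M {x \<in> space M. \<exists>k\<le>n. e \<le> \<bar>P k x\<bar>} \<le> measure M {x \<in> space M. e\<^sup>2 \<le> (R n x)\<^sup>2}"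
    using sub by (rule finite_measure_mono) measurable
  also have "\<dots> \<le> (LINT x|M. (R n x)\<^sup>2) / e\<^sup>2"
    using R2[of n] e by (intro integral_Markov_inequality_measure[where A="space M"]) auto
  also have "\<dots> \<le> (\<Sum>j<n. (v j)\<^sup>2) / e\<^sup>2"
    using R2[of n] e by (intro divide_right_mono) auto
  finally show ?thesis unfolding P_def .
qed

definition Y :: "(nat \<Rightarrow> real) \<Rightarrow> 'a \<Rightarrow> real" where
  "Y v x = lim (\<lambda>n. \<Sum>j<n. v j * X j x)"

lemma Y_measurable [measurable]: "Y v \<in> borel_measurable M"
  unfolding Y_def[abs_def] by measurable

text \<open>Kolmogorov's inequality for the coefficients from \<open>N\<close> on bounds the
  probability that the partial sums ever move by \<open>e\<close> after \<open>N\<close>, uniformly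
  in the number of terms, by \<open>tail N\<close> over the square of \<open>e\<close>. This tends
  to 0, so the partial sums are almost surely Cauchy.\<close>

lemma series_converges:
  assumes v: "summable (\<lambda>j. (v j)\<^sup>2)"
  shows "AE x in M. convergent (\<lambda>n. \<Sum>j<n. v j * X j x)"
proof -
  define P where "P n x = (\<Sum>j<n. v j * X j x)" for n x
  have [measurable]: "P n \<in> borel_measurable M" for n unfolding P_def[abs_def] by measurable
  define tail where "tail N = (\<Sum>j. (v j)\<^sup>2) - (\<Sum>j<N. (v j)\<^sup>2)" for N
  have tail0: "tail \<longlonglongrightarrow> 0"
    using tendsto_diff[OF tendsto_const[of "\<Sum>j. (v j)\<^sup>2"] summable_LIMSEQ[OF v]] by (simp add: tail_def[abs_def])
  have fin: "measure M {x \<in> space M. \<exists>k\<le>n. e \<le> \<bar>P (N + k) x - P N x\<bar>} \<le> tail N / e\<^sup>2" if e: "e > 0" for e N n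
  proof -
    \<comment> \<open>Zeroing the first \<open>N\<close> coefficients turns increments after
      \<open>N\<close> into partial sums.\<close>
    define v' where "v' j = (if j < N then 0 else v j)" for j
    have s: "(\<Sum>j<N + k. v' j * X j x) = P (N + k) x - P N x" for k x
      unfolding P_def by (induct k) (simp_all add: v'_def)
    have s2: "(\<Sum>j<N + k. (v' j)\<^sup>2) = (\<Sum>j<N + k. (v j)\<^sup>2) - (\<Sum>j<N. (v j)\<^sup>2)" for k
      by (induct k) (simp_all add: v'_def)
    have "measure M {x \<in> space M. \<exists>k\<le>n. e \<le> \<bar>P (N + k) x - P N x\<bar>} \<le>
      measure M {x \<in> space M. \<exists>k\<le>N + n. e \<le> \<bar>\<Sum>j<k. v' j * X j x\<bar>}"
    proof (rule finite_measure_mono)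
      show "{x \<in> space M. \<exists>k\<le>n. e \<le> \<bar>P (N + k) x - P N x\<bar>} \<subseteq> {x \<in> space M. \<exists>k\<le>N + n. e \<le> \<bar>\<Sum>j<k. v' j * X j x\<bar>}"
      proof safe
        fix x k assume "k \<le> n" "e \<le> \<bar>P (N + k) x - P N x\<bar>"
        then show "\<exists>k\<le>N + n. e \<le> \<bar>\<Sum>j<k. v' j * X j x\<bar>"
          using s[of _ k] by (intro exI[of _ "N + k"]) simp
      qed
    qed measurable
    also have "\<dots> \<le> (\<Sum>j<N + n. (v' j)\<^sup>2) / e\<^sup>2" by (rule kolmogorov_inequality[OF e])
    also have "\<dots> \<le> tail N / e\<^sup>2"
      unfolding s2 tail_def using sum_le_suminf[OF v, of "{..<N + n}"] by (intro divide_right_mono) auto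
    finally show ?thesis .
  qed
  have inf: "measure M {x \<in> space M. \<exists>k. e \<le> \<bar>P (N + k) x - P N x\<bar>} \<le> tail N / e\<^sup>2" if e: "e > 0" for e N
  proof (rule LIMSEQ_le_const2)
    have "(\<lambda>n. measure M {x \<in> space M. \<exists>k\<le>n. e \<le> \<bar>P (N + k) x - P N x\<bar>}) \<longlonglongrightarrow>
      measure M (\<Union>n. {x \<in> space M. \<exists>k\<le>n. e \<le> \<bar>P (N + k) x - P N x\<bar>})"
    proof (rule finite_Lim_measure_incseq)
      show "incseq (\<lambda>n. {x \<in> space M. \<exists>k\<le>n. e \<le> \<bar>P (N + k) x - P N x\<bar>})"
        by (intro incseq_SucI) (auto intro: le_SucI)
      have "{x \<in> space M. \<exists>k\<le>n. e \<le> \<bar>P (N + k) x - P N x\<bar>} \<in> sets M" for n by measurable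
      then show "range (\<lambda>n. {x \<in> space M. \<exists>k\<le>n. e \<le> \<bar>P (N + k) x - P N x\<bar>}) \<subseteq> sets M" by blast
    qed
    moreover have "(\<Union>n. {x \<in> space M. \<exists>k\<le>n. e \<le> \<bar>P (N + k) x - P N x\<bar>}) = {x \<in> space M. \<exists>k. e \<le> \<bar>P (N + k) x - P N x\<bar>}"
      by auto
    ultimately show "(\<lambda>n. measure M {x \<in> space M. \<exists>k\<le>n. e \<le> \<bar>P (N + k) x - P N x\<bar>}) \<longlonglongrightarrow>
      measure M {x \<in> space M. \<exists>k. e \<le> \<bar>P (N + k) x - P N x\<bar>}" by simp
  qed (use fin[OF e] in blast)
  have bad: "AE x in M. \<exists>N. \<forall>k. \<bar>P (N + k) x - P N x\<bar> < e" if e: "e > 0" for e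
  proof -
    define E where "E = {x \<in> space M. \<forall>N. \<exists>k. e \<le> \<bar>P (N + k) x - P N x\<bar>}"
    have [measurable]: "E \<in> sets M" unfolding E_def by measurable
    have "measure M E \<le> tail N / e\<^sup>2" for N
    proof -
      have "measure M E \<le> measure M {x \<in> space M. \<exists>k. e \<le> \<bar>P (N + k) x - P N x\<bar>}"
        unfolding E_def by (rule finite_measure_mono) (blast, measurable)
      then show ?thesis using inf[OF e, of N] by simp
    qed
    moreover have "(\<lambda>N. tail N / e\<^sup>2) \<longlonglongrightarrow> 0 / e\<^sup>2" using e by (intro tendsto_divide tail0 tendsto_const) simp
    ultimately have "measure M E \<le> 0 / e\<^sup>2" by (intro LIMSEQ_le_const) auto
    then have "measure M E = 0" using measure_nonneg[of M E] by simp
    then have "AE x in M. x \<notin> E"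
      by (intro AE_not_in) (simp add: null_sets_def emeasure_eq_measure)
    then show ?thesis by (rule AE_mp) (auto intro!: AE_I2 simp: E_def not_le)
  qed
  have "AE x in M. \<forall>m. \<exists>N. \<forall>k. \<bar>P (N + k) x - P N x\<bar> < 1 / real (Suc m)"
    using bad by (simp add: AE_all_countable)
  then show ?thesis
  proof eventually_elim
    case (elim x)
    have "Cauchy (\<lambda>n. P n x)"
    proof (rule metric_CauchyI)
      fix e :: real assume "e > 0"
      then obtain m where m: "1 / real (Suc m) < e / 2"
        using reals_Archimedean[of "e / 2"] by (auto simp: inverse_eq_divide)
      obtain N where N: "\<And>k. \<bar>P (N + k) x - P N x\<bar> < 1 / real (Suc m)" using elim by blast
      show "\<exists>N. \<forall>i\<ge>N. \<forall>j\<ge>N. dist (P i x) (P j x) < e"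
      proof (intro exI[of _ N] allI impI)
        fix i j assume "N \<le> i" "N \<le> j"
        then have "\<bar>P i x - P N x\<bar> < e / 2" "\<bar>P j x - P N x\<bar> < e / 2"
          using N[of "i - N"] N[of "j - N"] m by simp_all
        then show "dist (P i x) (P j x) < e" unfolding dist_real_def by linarith
      qed
    qed
    then show ?case unfolding P_def by (simp add: Cauchy_convergent_iff)
  qed
qed

lemma Y_limit: "convergent (\<lambda>n. \<Sum>j<n. v j * X j x) \<Longrightarrow> (\<lambda>n. \<Sum>j<n. v j * X j x) \<longlonglongrightarrow> Y v x"
  unfolding Y_def by (simp add: convergent_LIMSEQ_iff)

lemma Y_char:
  assumes v: "summable (\<lambda>j. (v j)\<^sup>2)"
  shows "(LINT x|M. exp (\<i> * complex_of_real (Y v x))) = complex_of_real (exp (- (\<Sum>j. (v j)\<^sup>2) / 2))"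
proof (rule LIMSEQ_unique)
  show "(\<lambda>n. LINT x|M. exp (\<i> * complex_of_real (\<Sum>j<n. v j * X j x))) \<longlonglongrightarrow> (LINT x|M. exp (\<i> * complex_of_real (Y v x)))"
  proof (rule integral_dominated_convergence[where w="\<lambda>x. 1"])
    show "AE x in M. (\<lambda>n. exp (\<i> * complex_of_real (\<Sum>j<n. v j * X j x))) \<longlonglongrightarrow> exp (\<i> * complex_of_real (Y v x))"
      using series_converges[OF v] by eventually_elim (intro tendsto_intros Y_limit)
  qed (auto simp: norm_exp_i_times)
  show "(\<lambda>n. LINT x|M. exp (\<i> * complex_of_real (\<Sum>j<n. v j * X j x))) \<longlonglongrightarrow> complex_of_real (exp (- (\<Sum>j. (v j)\<^sup>2) / 2))"
    unfolding X_char by (intro tendsto_of_real tendsto_exp tendsto_divide tendsto_minus summable_LIMSEQ v tendsto_const) simp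
qed

end

subsection \<open>Analytic limits of Gaussian averages\<close>

lemma boundary_islimpt: "(- \<i> * complex_of_real q) islimpt {z. Re z > 0}"
  unfolding islimpt_approachable
proof (intro allI impI)
  fix e :: real assume "e > 0"
  then show "\<exists>x'\<in>{z. Re z > 0}. x' \<noteq> - \<i> * complex_of_real q \<and> dist x' (- \<i> * complex_of_real q) < e"
    by (intro bexI[of _ "complex_of_real (e / 2) - \<i> * complex_of_real q"]) (auto simp: dist_norm)
qed

text \<open>The positive axis accumulates at 1, so the identity theorem fixes the continuation on
  the whole half-plane; the boundary point is a limit point of the half-plane, so the limit is
  unique too. This justifies the definite description in \<open>transform\<close>.\<close>

lemma has_analytic_limit_unique:
  assumes "has_analytic_limit W q \<Phi> c" "has_analytic_limit W q \<Phi> c'"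
  shows "c = c'"
proof -
  obtain A where A: "A holomorphic_on {z. Re z > 0}" "\<forall>r>0. A (complex_of_real r) = (LINT x|W. \<Phi> r x)"
    "(A \<longlongrightarrow> c) (at (- \<i> * complex_of_real q) within {z. Re z > 0})"
    using assms(1) unfolding has_analytic_limit_def by blast
  obtain A' where A': "A' holomorphic_on {z. Re z > 0}" "\<forall>r>0. A' (complex_of_real r) = (LINT x|W. \<Phi> r x)"
    "(A' \<longlongrightarrow> c') (at (- \<i> * complex_of_real q) within {z. Re z > 0})"
    using assms(2) unfolding has_analytic_limit_def by blast
  have eq: "A z = A' z" if z: "Re z > 0" for z
  proof -
    have "(\<lambda>z. A z - A' z) z = 0"
    proof (rule analytic_continuation[where f="\<lambda>z. A z - A' z" and U="complex_of_real ` {0<..}" and \<xi>=1])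
      show "(\<lambda>z. A z - A' z) holomorphic_on {z. Re z > 0}" by (intro holomorphic_on_diff A A')
      show "open {z. Re z > 0}" by (rule open_halfspace_Re_gt)
      show "connected {z. Re z > 0}" by (intro convex_connected convex_halfspace_Re_gt)
      show "1 islimpt complex_of_real ` {0<..}"
        unfolding islimpt_approachable
      proof (intro allI impI)
        fix e :: real assume "e > 0"
        then have "complex_of_real (1 + e / 2) \<in> complex_of_real ` {0<..}" by (intro imageI) simp
        moreover have "complex_of_real (1 + e / 2) \<noteq> 1 \<and> dist (complex_of_real (1 + e / 2)) 1 < e"
          using \<open>e > 0\<close> by (simp add: dist_norm)
        ultimately show "\<exists>x'\<in>complex_of_real ` {0<..}. x' \<noteq> 1 \<and> dist x' 1 < e" by blast
      qed
    qed (use A(2) A'(2) z in auto)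
    then show ?thesis by simp
  qed
  have "(A \<longlongrightarrow> c') (at (- \<i> * complex_of_real q) within {z. Re z > 0})"
    by (rule Lim_transform_within[OF A'(3), of 1]) (simp_all add: eq)
  moreover have "at (- \<i> * complex_of_real q) within {z. Re z > 0} \<noteq> bot"
    using boundary_islimpt by (simp add: trivial_limit_within)
  ultimately show ?thesis using tendsto_unique[OF _ A(3)] by blast
qed

text \<open>The derivative is at most m exp(- m \<sigma>) in modulus, which is bounded by 1 /
  \<sigma> whatever \<open>m\<close> is. This uniformity dominates difference quotients under an
  integral in which \<open>m\<close> may be unbounded.\<close>

lemma exp_minus_lipschitz:
  assumes \<sigma>: "\<sigma> > 0" and m: "m \<ge> 0" and z: "Re z > \<sigma>" "Re w > \<sigma>"
  shows "norm (exp (- complex_of_real m * z) - exp (- complex_of_real m * w)) \<le> (1 / \<sigma>) * norm (z - w)"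
proof (rule field_differentiable_bound[of "{z. Re z > \<sigma>}"])
  show "convex {z. Re z > \<sigma>}" by (rule convex_halfspace_Re_gt)
  show "((\<lambda>z. exp (- complex_of_real m * z)) has_field_derivative exp (- complex_of_real m * z) * (- complex_of_real m)) (at z within {z. Re z > \<sigma>})" for z
    by (auto intro!: derivative_eq_intros)
  show "norm (exp (- complex_of_real m * z) * (- complex_of_real m)) \<le> 1 / \<sigma>" if "z \<in> {z. Re z > \<sigma>}" for z
  proof -
    have "m * \<sigma> \<le> exp (m * \<sigma>)" using exp_ge_add_one_self[of "m * \<sigma>"] by linarith
    then have "exp (- (m * \<sigma>)) * m \<le> 1 / \<sigma>" using \<sigma> by (simp add: exp_minus field_simps)
    moreover have "exp (- (m * Re z)) \<le> exp (- (m * \<sigma>))" using that m by (auto intro!: mult_left_mono)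
    ultimately have "exp (- (m * Re z)) * m \<le> 1 / \<sigma>"
      using mult_right_mono[of "exp (- (m * Re z))" "exp (- (m * \<sigma>))" m] m by linarith
    then show ?thesis using m by (simp add: norm_mult)
  qed
qed (use z in auto)

context
  fixes \<Omega> :: "'b measure" and D :: "'b \<Rightarrow> complex" and m :: "'b \<Rightarrow> real"
  assumes D: "integrable \<Omega> D" and m[measurable]: "m \<in> borel_measurable \<Omega>"
    and m0: "\<And>\<omega>. \<omega> \<in> space \<Omega> \<Longrightarrow> 0 \<le> m \<omega>"
begin

lemma exp_integrand_integrable:
  assumes "Re w \<ge> 0"
  shows "integrable \<Omega> (\<lambda>\<omega>. exp (- complex_of_real (m \<omega>) * w) * D \<omega>)"
proof (rule Bochner_Integration.integrable_bound[OF D])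
  show "AE \<omega> in \<Omega>. norm (exp (- complex_of_real (m \<omega>) * w) * D \<omega>) \<le> norm (D \<omega>)"
    using m0 assms by (intro AE_I2) (auto simp: norm_mult intro!: mult_left_le_one_le)
  show "(\<lambda>\<omega>. exp (- complex_of_real (m \<omega>) * w) * D \<omega>) \<in> borel_measurable \<Omega>"
    using borel_measurable_integrable[OF D] by measurable
qed

lemma exp_integral_holomorphic:
  "(\<lambda>w. LINT \<omega>|\<Omega>. exp (- complex_of_real (m \<omega>) * w) * D \<omega>) holomorphic_on {w. Re w > 0}"
  unfolding holomorphic_on_open[OF open_halfspace_Re_gt]
proof (intro ballI)
  have [measurable]: "D \<in> borel_measurable \<Omega>" using D by auto
  fix w assume "w \<in> {w. Re w > 0}"
  then have w: "Re w > 0" by simp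
  \<comment> \<open>The half-plane to the right of \<sigma> contains \<open>w\<close> and keeps away
    from the imaginary axis.\<close>
  define \<sigma> where "\<sigma> = Re w / 2"
  have \<sigma>: "\<sigma> > 0" "Re w > \<sigma>" using w by (auto simp: \<sigma>_def)
  define F where "F w \<omega> = exp (- complex_of_real (m \<omega>) * w)" for w \<omega>
  have [measurable]: "F w \<in> borel_measurable \<Omega>" for w unfolding F_def[abs_def] by measurable
  have int: "integrable \<Omega> (\<lambda>\<omega>. F z \<omega> * D \<omega>)" if "Re z > \<sigma>" for z
    unfolding F_def using that \<sigma> by (intro exp_integrand_integrable) simp
  let ?I = "\<lambda>w. LINT \<omega>|\<Omega>. F w \<omega> * D \<omega>"
  let ?L = "LINT \<omega>|\<Omega>. (F w \<omega> * (- complex_of_real (m \<omega>))) * D \<omega>"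
  have "(?I has_field_derivative ?L) (at w within {z. Re z > \<sigma>})"
    unfolding has_field_derivative_iff tendsto_at_iff_sequentially comp_def
  proof (intro allI impI)
    fix X :: "nat \<Rightarrow> complex" assume X: "\<forall>i. X i \<in> {z. Re z > \<sigma>} - {w}" and Xw: "X \<longlonglongrightarrow> w"
    have e: "(?I (X n) - ?I w) / (X n - w) = (LINT \<omega>|\<Omega>. (F (X n) \<omega> - F w \<omega>) / (X n - w) * D \<omega>)" for n
    proof -
      have "?I (X n) - ?I w = (LINT \<omega>|\<Omega>. F (X n) \<omega> * D \<omega> - F w \<omega> * D \<omega>)"
        using X \<sigma> by (intro Bochner_Integration.integral_diff[symmetric] int) auto
      then have "(?I (X n) - ?I w) / (X n - w) = (LINT \<omega>|\<Omega>. (F (X n) \<omega> * D \<omega> - F w \<omega> * D \<omega>) / (X n - w))"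
        by simp
      then show ?thesis by (simp only: left_diff_distrib[symmetric] times_divide_eq_left)
    qed
    show "(\<lambda>n. (?I (X n) - ?I w) / (X n - w)) \<longlonglongrightarrow> ?L"
      unfolding e
    proof (rule integral_dominated_convergence[where w="\<lambda>\<omega>. (1 / \<sigma>) * norm (D \<omega>)"])
      show "integrable \<Omega> (\<lambda>\<omega>. (1 / \<sigma>) * norm (D \<omega>))" using D by simp
      show "AE \<omega> in \<Omega>. (\<lambda>n. (F (X n) \<omega> - F w \<omega>) / (X n - w) * D \<omega>) \<longlonglongrightarrow> (F w \<omega> * (- complex_of_real (m \<omega>))) * D \<omega>"
      proof (intro AE_I2 tendsto_mult_right)
        fix \<omega>
        have "((\<lambda>z. F z \<omega>) has_field_derivative F w \<omega> * (- complex_of_real (m \<omega>))) (at w within {z. Re z > \<sigma>})"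
          unfolding F_def by (auto intro!: derivative_eq_intros)
        then show "(\<lambda>n. (F (X n) \<omega> - F w \<omega>) / (X n - w)) \<longlonglongrightarrow> F w \<omega> * (- complex_of_real (m \<omega>))"
          unfolding has_field_derivative_iff tendsto_at_iff_sequentially comp_def using X Xw by blast
      qed
      show "AE \<omega> in \<Omega>. norm ((F (X n) \<omega> - F w \<omega>) / (X n - w) * D \<omega>) \<le> (1 / \<sigma>) * norm (D \<omega>)" for n
      proof (rule AE_I2)
        fix \<omega> assume "\<omega> \<in> space \<Omega>"
        then have "norm (F (X n) \<omega> - F w \<omega>) \<le> (1 / \<sigma>) * norm (X n - w)"
          unfolding F_def using X \<sigma> m0 by (intro exp_minus_lipschitz) auto
        moreover have "norm (X n - w) > 0" using X by auto
        ultimately have "norm ((F (X n) \<omega> - F w \<omega>) / (X n - w)) \<le> 1 / \<sigma>"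
          unfolding norm_divide by (simp only: pos_divide_le_eq)
        then show "norm ((F (X n) \<omega> - F w \<omega>) / (X n - w) * D \<omega>) \<le> (1 / \<sigma>) * norm (D \<omega>)"
          unfolding norm_mult by (rule mult_right_mono) simp
      qed
    qed measurable
  qed
  then have "(?I has_field_derivative ?L) (at w)"
    using \<sigma> by (subst (asm) at_within_open[OF _ open_halfspace_Re_gt]) auto
  then show "\<exists>f'. ((\<lambda>w. LINT \<omega>|\<Omega>. exp (- complex_of_real (m \<omega>) * w) * D \<omega>) has_field_derivative f') (at w)"
    unfolding F_def by blast
qed

text \<open>On the half-plane Re (1 / z) is positive, so the integrands stay below
  \<open>norm (D \<omega>)\<close> up to the boundary; at z = - i q the factor 1 / z becomes i /
  q.\<close>

lemma exp_integral_limit: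
  assumes q: "q \<noteq> 0"
  shows "((\<lambda>z. LINT \<omega>|\<Omega>. exp (- complex_of_real (m \<omega>) * (1 / z)) * D \<omega>) \<longlongrightarrow>
    (LINT \<omega>|\<Omega>. exp (- \<i> * complex_of_real (m \<omega> / q)) * D \<omega>)) (at (- \<i> * complex_of_real q) within {z. Re z > 0})"
  unfolding tendsto_at_iff_sequentially comp_def
proof (intro allI impI)
  have [measurable]: "D \<in> borel_measurable \<Omega>" using D by auto
  fix X :: "nat \<Rightarrow> complex" assume X: "\<forall>i. X i \<in> {z. Re z > 0} - {- \<i> * complex_of_real q}"
    and lim: "X \<longlonglongrightarrow> - \<i> * complex_of_real q"
  show "(\<lambda>n. LINT \<omega>|\<Omega>. exp (- complex_of_real (m \<omega>) * (1 / X n)) * D \<omega>) \<longlonglongrightarrow>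
    (LINT \<omega>|\<Omega>. exp (- \<i> * complex_of_real (m \<omega> / q)) * D \<omega>)"
  proof (rule integral_dominated_convergence[where w="\<lambda>\<omega>. norm (D \<omega>)"])
    show "integrable \<Omega> (\<lambda>\<omega>. norm (D \<omega>))" using D by simp
    show "AE \<omega> in \<Omega>. (\<lambda>n. exp (- complex_of_real (m \<omega>) * (1 / X n)) * D \<omega>) \<longlonglongrightarrow> exp (- \<i> * complex_of_real (m \<omega> / q)) * D \<omega>"
    proof (rule AE_I2)
      fix \<omega>
      have "(\<lambda>n. exp (- complex_of_real (m \<omega>) * (1 / X n)) * D \<omega>) \<longlonglongrightarrow>
        exp (- complex_of_real (m \<omega>) * (1 / (- \<i> * complex_of_real q))) * D \<omega>"
        using q by (intro tendsto_intros lim) auto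
      also have "- complex_of_real (m \<omega>) * (1 / (- \<i> * complex_of_real q)) = - \<i> * complex_of_real (m \<omega> / q)"
        using q by (simp add: field_simps)
      finally show "(\<lambda>n. exp (- complex_of_real (m \<omega>) * (1 / X n)) * D \<omega>) \<longlonglongrightarrow> exp (- \<i> * complex_of_real (m \<omega> / q)) * D \<omega>" .
    qed
    show "AE \<omega> in \<Omega>. norm (exp (- complex_of_real (m \<omega>) * (1 / X n)) * D \<omega>) \<le> norm (D \<omega>)" for n
    proof (rule AE_I2)
      fix \<omega> assume "\<omega> \<in> space \<Omega>"
      moreover have "0 \<le> Re (1 / X n)"
      proof -
        have "Re (X n) > 0" using X by simp
        then show ?thesis by (simp add: Re_divide)
      qed
      moreover have "norm (exp (- complex_of_real (m \<omega>) * z)) \<le> 1" if "0 \<le> m \<omega>" "0 \<le> Re z" for z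
        using that by simp
      ultimately have "norm (exp (- complex_of_real (m \<omega>) * (1 / X n))) \<le> 1"
        using m0 by blast
      then show "norm (exp (- complex_of_real (m \<omega>) * (1 / X n)) * D \<omega>) \<le> norm (D \<omega>)"
        unfolding norm_mult by (rule mult_left_le_one_le[rotated -1]) auto
    qed
  qed measurable
qed

end

text \<open>For positive \<open>r\<close>, Fubini's theorem and \<open>char\<close> with
  \<open>c = 1 / sqrt r\<close> turn the average into an integral of exp(- m / r). Replacing
  \<open>r\<close> by \<open>z\<close> continues it, as 1 / z preserves the half-plane. Here
  \<open>m\<close> is half the variance of \<open>K \<omega>\<close>.\<close>

lemma analytic_limit_of_gaussian_kernel:
  fixes D :: "'b \<Rightarrow> complex" and m :: "'b \<Rightarrow> real" and K :: "'b \<Rightarrow> plane_fun \<Rightarrow> real"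
  assumes W: "prob_space W" and \<Omega>: "finite_measure \<Omega>" and D: "integrable \<Omega> D"
    and m: "m \<in> borel_measurable \<Omega>" and m0: "\<And>\<omega>. \<omega> \<in> space \<Omega> \<Longrightarrow> 0 \<le> m \<omega>"
    and K[measurable]: "(\<lambda>z. K (fst z) (snd z)) \<in> borel_measurable (\<Omega> \<Otimes>\<^sub>M W)"
    and char: "\<And>\<omega> c. \<omega> \<in> space \<Omega> \<Longrightarrow> (LINT x|W. exp (\<i> * complex_of_real (c * K \<omega> x))) = complex_of_real (exp (- c\<^sup>2 * m \<omega>))"
    and \<Phi>: "\<And>r x. r > 0 \<Longrightarrow> x \<in> space W \<Longrightarrow> \<Phi> r x = (LINT \<omega>|\<Omega>. exp (\<i> * complex_of_real (1 / sqrt r * K \<omega> x)) * D \<omega>)"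
    and q: "q \<noteq> 0"
  shows "has_analytic_limit W q \<Phi> (LINT \<omega>|\<Omega>. exp (- \<i> * complex_of_real (m \<omega> / q)) * D \<omega>)"
proof -
  interpret W: prob_space W by fact
  interpret \<Omega>: finite_measure \<Omega> by fact
  interpret P: pair_sigma_finite \<Omega> W ..
  have Dm[measurable]: "D \<in> borel_measurable \<Omega>" using D by auto
  define A where "A z = (LINT \<omega>|\<Omega>. exp (- complex_of_real (m \<omega>) * (1 / z)) * D \<omega>)" for z
  have "A holomorphic_on {z. Re z > 0}"
  proof -
    have "((\<lambda>w. LINT \<omega>|\<Omega>. exp (- complex_of_real (m \<omega>) * w) * D \<omega>) \<circ> (\<lambda>z. 1 / z)) holomorphic_on {z. Re z > 0}"
    proof (rule holomorphic_on_compose_gen[OF _ exp_integral_holomorphic[OF D m m0]])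
      show "(\<lambda>z. 1 / z) holomorphic_on {z. Re z > 0}" by (intro holomorphic_intros) auto
      show "(\<lambda>z. 1 / z) ` {z. Re z > 0} \<subseteq> {w. Re w > 0}"
        by (auto simp: Re_divide intro!: divide_pos_pos add_pos_nonneg)
    qed
    then show ?thesis by (simp add: A_def[abs_def] comp_def)
  qed
  moreover have "integrable W (\<Phi> r) \<and> A (complex_of_real r) = (LINT x|W. \<Phi> r x)" if r: "r > 0" for r
  proof -
    define f where "f \<omega> x = exp (\<i> * complex_of_real (1 / sqrt r * K \<omega> x)) * D \<omega>" for \<omega> x
    have fm: "(\<lambda>z. f (fst z) (snd z)) \<in> borel_measurable (\<Omega> \<Otimes>\<^sub>M W)"
      unfolding f_def by measurable
    have nf: "norm (f \<omega> x) = norm (D \<omega>)" for \<omega> x by (simp add: f_def norm_mult)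
    have fi: "integrable (\<Omega> \<Otimes>\<^sub>M W) (\<lambda>z. f (fst z) (snd z))"
    proof (rule P.Fubini_integrable[OF fm])
      show "integrable \<Omega> (\<lambda>\<omega>. LINT x|W. norm (f (fst (\<omega>, x)) (snd (\<omega>, x))))"
        using D by (simp add: nf W.prob_space)
      show "AE \<omega> in \<Omega>. integrable W (\<lambda>x. f (fst (\<omega>, x)) (snd (\<omega>, x)))"
      proof (rule AE_I2)
        fix \<omega> assume \<omega>: "\<omega> \<in> space \<Omega>"
        have "(\<lambda>x. f \<omega> x) \<in> borel_measurable W"
          using measurable_compose[OF measurable_Pair1'[OF \<omega>] fm] by simp
        then show "integrable W (\<lambda>x. f (fst (\<omega>, x)) (snd (\<omega>, x)))"
          by (intro W.integrable_const_bound[where B="norm (D \<omega>)"]) (auto simp: nf)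
      qed
    qed
    then have fi': "integrable (\<Omega> \<Otimes>\<^sub>M W) (case_prod f)" by (simp add: case_prod_unfold)
    have "integrable W (\<lambda>x. LINT \<omega>|\<Omega>. f \<omega> x)" using P.integrable_snd[OF fi'] .
    then have "integrable W (\<Phi> r)"
      by (subst Bochner_Integration.integrable_cong[OF refl, of _ _ "\<lambda>x. LINT \<omega>|\<Omega>. f \<omega> x"]) (auto simp: \<Phi> r f_def)
    moreover have "(LINT x|W. \<Phi> r x) = (LINT x|W. LINT \<omega>|\<Omega>. f \<omega> x)"
      by (intro Bochner_Integration.integral_cong refl) (simp add: \<Phi> r f_def)
    moreover have "\<dots> = (LINT \<omega>|\<Omega>. LINT x|W. f \<omega> x)" by (rule P.Fubini_integral[OF fi'])
    moreover have "\<dots> = A (complex_of_real r)"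
      unfolding A_def
    proof (rule Bochner_Integration.integral_cong[OF refl])
      fix \<omega> assume \<omega>: "\<omega> \<in> space \<Omega>"
      have "(LINT x|W. f \<omega> x) = complex_of_real (exp (- (1 / sqrt r)\<^sup>2 * m \<omega>)) * D \<omega>"
        unfolding f_def integral_mult_left_zero char[OF \<omega>] ..
      also have "complex_of_real (exp (- (1 / sqrt r)\<^sup>2 * m \<omega>)) = exp (- complex_of_real (m \<omega>) * (1 / complex_of_real r))"
        using r by (simp add: exp_of_real[symmetric] power_divide)
      finally show "(LINT x|W. f \<omega> x) = exp (- complex_of_real (m \<omega>) * (1 / complex_of_real r)) * D \<omega>" .
    qed
    ultimately show ?thesis by simp
  qed
  moreover have "(A \<longlongrightarrow> (LINT \<omega>|\<Omega>. exp (- \<i> * complex_of_real (m \<omega> / q)) * D \<omega>)) (at (- \<i> * complex_of_real q) within {z. Re z > 0})"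
    unfolding A_def[abs_def] by (rule exp_integral_limit[OF D m m0 q])
  ultimately show ?thesis unfolding has_analytic_limit_def by blast
qed

subsection \<open>The Paley--Wiener--Zygmund integral\<close>

locale yeh_wiener_space =
  fixes S T :: real and \<phi> :: "nat \<Rightarrow> plane_fun" and W :: "plane_fun measure"
  assumes S: "S > 0" and T: "T > 0" and yw: "yeh_wiener S T W" and basis: "bv_orthonormal_basis S T \<phi>"
begin

lemma base_measure:
  assumes "\<And>W0. W = completion W0 \<Longrightarrow> prob_space W0 \<Longrightarrow>
        sets W0 = sets (restrict_space (Pi\<^sub>M UNIV (\<lambda>_. borel)) (C0 S T)) \<Longrightarrow>
        (\<forall>I a. finite I \<longrightarrow> I \<subseteq> rect S T \<longrightarrow>
           (\<exists>\<sigma>\<ge>0. distr W0 borel (\<lambda>x. \<Sum>p\<in>I. a p * x p) =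
                   distr std_normal_distribution borel (\<lambda>z. \<sigma> * z))) \<Longrightarrow>
        (\<forall>s\<in>{0..S}. \<forall>s'\<in>{0..S}. \<forall>t\<in>{0..T}. \<forall>t'\<in>{0..T}.
           (LINT x|W0. x (s, t) * x (s', t')) = min s s' * min t t') \<Longrightarrow> thesis"
  shows thesis
  using yw unfolding yeh_wiener_def by (elim exE conjE) (rule assms)

lemma product_evaluation_measurable:
  assumes "sets W0 = sets (restrict_space (Pi\<^sub>M UNIV (\<lambda>_. borel)) (C0 S T))"
  shows "(\<lambda>x. x p) \<in> borel_measurable W0"
  unfolding measurable_cong_sets[OF assms refl]
  by (intro measurable_restrict_space1 measurable_component_singleton) simp

lemma prob_space_W: "prob_space W"
  by (rule base_measure) (simp add: prob_space.prob_space_completion)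

lemma space_W: "space W = C0 S T"
proof (rule base_measure)
  fix W0 assume "W = completion W0" and s: "sets W0 = sets (restrict_space (Pi\<^sub>M UNIV (\<lambda>_. borel)) (C0 S T))"
  then show ?thesis
    using sets_eq_imp_space_eq[OF s] by (simp add: space_restrict_space space_PiM)
qed

lemma evaluation_measurable: "(\<lambda>x. x p) \<in> borel_measurable W"
proof (rule base_measure)
  fix W0 assume W: "W = completion W0" and s: "sets W0 = sets (restrict_space (Pi\<^sub>M UNIV (\<lambda>_. borel)) (C0 S T))"
  show ?thesis unfolding W by (rule measurable_completion[OF product_evaluation_measurable[OF s]])
qed

text \<open>The functionals that \<open>yeh_wiener\<close> declares to be Gaussian. Closure under
  linear combinations brings in rectangular increments and Riemann--Stieltjes sums without
  bookkeeping of index sets.\<close>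

definition lin :: "(plane_fun \<Rightarrow> real) \<Rightarrow> bool" where
  "lin L \<longleftrightarrow> (\<exists>I a. finite I \<and> I \<subseteq> rect S T \<and> (\<forall>x. L x = (\<Sum>p\<in>I. a p * x p)))"

lemma lin_eval: "p \<in> rect S T \<Longrightarrow> lin (\<lambda>x. x p)"
  unfolding lin_def by (intro exI[of _ "{p}"] exI[of _ "\<lambda>_. 1"]) auto

lemma lin_zero: "lin (\<lambda>x. 0)"
  unfolding lin_def by (intro exI[of _ "{}"]) auto

lemma lin_scale: "lin L \<Longrightarrow> lin (\<lambda>x. c * L x)"
proof -
  assume "lin L"
  then obtain I a where "finite I" "I \<subseteq> rect S T" "\<And>x. L x = (\<Sum>p\<in>I. a p * x p)" unfolding lin_def by blast
  then show ?thesis unfolding lin_def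
    by (intro exI[of _ I] exI[of _ "\<lambda>p. c * a p"]) (simp add: sum_distrib_left mult.assoc)
qed

lemma lin_add:
  assumes "lin L" "lin L'"
  shows "lin (\<lambda>x. L x + L' x)"
proof -
  obtain I a where I: "finite I" "I \<subseteq> rect S T" "\<And>x. L x = (\<Sum>p\<in>I. a p * x p)"
    using assms(1) unfolding lin_def by blast
  obtain J b where J: "finite J" "J \<subseteq> rect S T" "\<And>x. L' x = (\<Sum>p\<in>J. b p * x p)"
    using assms(2) unfolding lin_def by blast
  have "L x + L' x = (\<Sum>p\<in>I \<union> J. ((if p \<in> I then a p else 0) + (if p \<in> J then b p else 0)) * x p)" for x
  proof -
    have "L x = (\<Sum>p\<in>I \<union> J. (if p \<in> I then a p else 0) * x p)"
      unfolding I(3) using I J by (intro sum.mono_neutral_cong_left) auto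
    moreover have "L' x = (\<Sum>p\<in>I \<union> J. (if p \<in> J then b p else 0) * x p)"
      unfolding J(3) using I J by (intro sum.mono_neutral_cong_left) auto
    ultimately show ?thesis by (simp only: distrib_right sum.distrib)
  qed
  moreover have "finite (I \<union> J)" "I \<union> J \<subseteq> rect S T" using I J by auto
  ultimately show ?thesis unfolding lin_def
    by (intro exI[of _ "I \<union> J"] exI[of _ "\<lambda>p. (if p \<in> I then a p else 0) + (if p \<in> J then b p else 0)"] conjI allI)
qed

lemma lin_diff: "lin L \<Longrightarrow> lin L' \<Longrightarrow> lin (\<lambda>x. L x - L' x)"
  using lin_add[OF _ lin_scale[of L' "-1"], of L] by simp

lemma lin_sum:
  assumes "\<And>i. i \<in> A \<Longrightarrow> lin (L i)"
  shows "lin (\<lambda>x. \<Sum>i\<in>A. L i x)"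
proof (cases "finite A")
  case True
  then show ?thesis using assms
  proof induct
    case (insert i A)
    have "lin (\<lambda>x. L i x + (\<Sum>i\<in>A. L i x))"
      by (rule lin_add) (simp_all add: insert)
    then show ?case using insert by simp
  qed (simp add: lin_zero)
qed (simp add: lin_zero)

lemma lin_measurable: "lin L \<Longrightarrow> L \<in> borel_measurable W"
proof -
  assume "lin L"
  then obtain I a where "\<And>x. L x = (\<Sum>p\<in>I. a p * x p)" unfolding lin_def by blast
  note L0 = this
  have L: "L = (\<lambda>x. \<Sum>p\<in>I. a p * x p)" by (rule ext) (rule L0)
  show ?thesis unfolding L
    by (intro borel_measurable_sum borel_measurable_times borel_measurable_const evaluation_measurable)
qed

lemma lin_gaussian:
  assumes "lin L"
  shows "integrable W (\<lambda>x. (L x)\<^sup>2)"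
    and "(LINT x|W. exp (\<i> * complex_of_real (L x))) = complex_of_real (exp (- (LINT x|W. (L x)\<^sup>2) / 2))"
proof -
  obtain I a where I: "finite I" "I \<subseteq> rect S T" and L0: "\<And>x. L x = (\<Sum>p\<in>I. a p * x p)"
    using assms unfolding lin_def by blast
  have L: "L = (\<lambda>x. \<Sum>p\<in>I. a p * x p)" by (rule ext) (rule L0)
  have "integrable W (\<lambda>x. (L x)\<^sup>2) \<and>
    (LINT x|W. exp (\<i> * complex_of_real (L x))) = complex_of_real (exp (- (LINT x|W. (L x)\<^sup>2) / 2))"
  proof (rule base_measure)
  fix W0 assume W: "W = completion W0" and s: "sets W0 = sets (restrict_space (Pi\<^sub>M UNIV (\<lambda>_. borel)) (C0 S T))"
    and g: "\<forall>I a. finite I \<longrightarrow> I \<subseteq> rect S T \<longrightarrow>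
           (\<exists>\<sigma>\<ge>0. distr W0 borel (\<lambda>x. \<Sum>p\<in>I. a p * x p) =
                   distr std_normal_distribution borel (\<lambda>z. \<sigma> * z))"
  note m = product_evaluation_measurable[OF s]
  have [measurable]: "L \<in> borel_measurable W0"
    unfolding L by (intro borel_measurable_sum borel_measurable_times m) auto
  obtain \<sigma> where \<sigma>: "distr W0 borel L = distr std_normal_distribution borel (\<lambda>z. \<sigma> * z)"
    using g[rule_format, OF I, of a] unfolding L by blast
  have sq: "integrable std_normal_distribution (\<lambda>z. z\<^sup>2)" "(LINT z|std_normal_distribution. z\<^sup>2) = 1"
  proof -
    have "has_bochner_integral lborel (\<lambda>x. std_normal_density x * x ^ (2 * 1)) (fact (2 * 1) / (2 ^ 1 * fact 1))"
      by (rule std_normal_moment_even)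
    then show "integrable std_normal_distribution (\<lambda>z. z\<^sup>2)" "(LINT z|std_normal_distribution. z\<^sup>2) = 1"
      by (simp_all add: integrable_density integral_density has_bochner_integral_iff)
  qed
  have "integrable (distr std_normal_distribution borel (\<lambda>z. \<sigma> * z)) (\<lambda>y. y\<^sup>2)"
    "(LINT y|distr std_normal_distribution borel (\<lambda>z. \<sigma> * z). y\<^sup>2) = \<sigma>\<^sup>2"
    using sq by (simp_all add: integrable_distr_eq integral_distr power_mult_distrib)
  then have i0: "integrable W0 (\<lambda>x. (L x)\<^sup>2)" and v0: "(LINT x|W0. (L x)\<^sup>2) = \<sigma>\<^sup>2"
    unfolding \<sigma>[symmetric] by (simp_all add: integrable_distr_eq integral_distr)
  have i: "integrable W (\<lambda>x. (L x)\<^sup>2)"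
    unfolding W using i0 by (subst integrable_completion) auto
  have v: "(LINT x|W. (L x)\<^sup>2) = \<sigma>\<^sup>2"
    unfolding W using v0 by (subst integral_completion) auto
  have "(LINT x|W. exp (\<i> * complex_of_real (L x))) = (LINT x|W0. exp (\<i> * complex_of_real (L x)))"
    unfolding W by (subst integral_completion) auto
  also have "\<dots> = (LINT y|distr W0 borel L. exp (\<i> * complex_of_real y))"
    by (subst integral_distr) auto
  also have "\<dots> = (LINT z|std_normal_distribution. exp (\<i> * complex_of_real (\<sigma> * z)))"
    unfolding \<sigma> by (subst integral_distr) auto
  also have "\<dots> = char std_normal_distribution \<sigma>" by (simp add: char_def)
  also have "\<dots> = complex_of_real (exp (- \<sigma>\<^sup>2 / 2))" by (simp add: char_std_normal_distribution)
  finally have "(LINT x|W. exp (\<i> * complex_of_real (L x))) = complex_of_real (exp (- (LINT x|W. (L x)\<^sup>2) / 2))"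
    unfolding v .
  with i show ?thesis by blast
  qed
  then show "integrable W (\<lambda>x. (L x)\<^sup>2)"
    "(LINT x|W. exp (\<i> * complex_of_real (L x))) = complex_of_real (exp (- (LINT x|W. (L x)\<^sup>2) / 2))" by blast+
qed

lemma lin_product:
  assumes "lin L" "lin L'"
  shows "integrable W (\<lambda>x. L x * L' x)"
proof (rule Bochner_Integration.integrable_bound)
  show "integrable W (\<lambda>x. (L x)\<^sup>2 + (L' x)\<^sup>2)" using assms lin_gaussian(1) by simp
  show "(\<lambda>x. L x * L' x) \<in> borel_measurable W"
    using assms by (intro borel_measurable_times lin_measurable)
  show "AE x in W. norm (L x * L' x) \<le> norm ((L x)\<^sup>2 + (L' x)\<^sup>2)"
  proof (rule AE_I2)
    fix x
    have "0 \<le> (\<bar>L x\<bar> - \<bar>L' x\<bar>)\<^sup>2" by simp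
    then have "2 * \<bar>L x * L' x\<bar> \<le> (L x)\<^sup>2 + (L' x)\<^sup>2" by (simp add: power2_diff abs_mult)
    then have "\<bar>L x * L' x\<bar> \<le> (L x)\<^sup>2 + (L' x)\<^sup>2"
      using abs_ge_zero[of "L x * L' x"] by linarith
    then show "norm (L x * L' x) \<le> norm ((L x)\<^sup>2 + (L' x)\<^sup>2)" by simp
  qed
qed

lemma covariance:
  assumes "s \<in> {0..S}" "s' \<in> {0..S}" "t \<in> {0..T}" "t' \<in> {0..T}"
  shows "(LINT x|W. x (s, t) * x (s', t')) = min s s' * min t t'"
proof (rule base_measure)
  fix W0 assume W: "W = completion W0" and s: "sets W0 = sets (restrict_space (Pi\<^sub>M UNIV (\<lambda>_. borel)) (C0 S T))"
    and c: "\<forall>s\<in>{0..S}. \<forall>s'\<in>{0..S}. \<forall>t\<in>{0..T}. \<forall>t'\<in>{0..T}.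
           (LINT x|W0. x (s, t) * x (s', t')) = min s s' * min t t'"
  have "(LINT x|W. x (s, t) * x (s', t')) = (LINT x|W0. x (s, t) * x (s', t'))"
    unfolding W by (rule integral_completion) (intro borel_measurable_times product_evaluation_measurable[OF s])
  then show ?thesis using c assms by simp
qed

text \<open>For \<open>a \<le> b\<close> and \<open>a' \<le> b'\<close> this is the length of the
  intersection of the two intervals. The covariance of two rectangular increments is a product of
  two such lengths.\<close>

definition overlap :: "real \<Rightarrow> real \<Rightarrow> real \<Rightarrow> real \<Rightarrow> real" where
  "overlap a b a' b' = min b b' - min a b' - min b a' + min a a'"

lemma lin_rect_diff:
  assumes "a \<in> {0..S}" "b \<in> {0..S}" "c \<in> {0..T}" "d \<in> {0..T}"
  shows "lin (\<lambda>x. rect_diff x a b c d)"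
  unfolding rect_diff_def using assms by (intro lin_add lin_diff lin_eval) (auto simp: rect_def)

lemma covariance_increment_point:
  assumes "a \<in> {0..S}" "b \<in> {0..S}" "c \<in> {0..T}" "d \<in> {0..T}" "s \<in> {0..S}" "t \<in> {0..T}"
  shows "(LINT x|W. rect_diff x a b c d * x (s, t)) = (min b s - min a s) * (min d t - min c t)"
proof -
  have i: "integrable W (\<lambda>x. x (u, v) * x (s, t))" if "u \<in> {0..S}" "v \<in> {0..T}" for u v
    using assms that by (intro lin_product lin_eval) (auto simp: rect_def)
  have "(LINT x|W. rect_diff x a b c d * x (s, t)) =
    (LINT x|W. x (b, d) * x (s, t) - x (a, d) * x (s, t) - x (b, c) * x (s, t) + x (a, c) * x (s, t))"
    by (simp add: rect_diff_def algebra_simps)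
  also have "\<dots> = (LINT x|W. x (b, d) * x (s, t)) - (LINT x|W. x (a, d) * x (s, t)) - (LINT x|W. x (b, c) * x (s, t)) + (LINT x|W. x (a, c) * x (s, t))"
    using i assms by simp
  also have "\<dots> = (min b s - min a s) * (min d t - min c t)"
    using assms by (subst (1 2 3 4) covariance) (auto simp: algebra_simps)
  finally show ?thesis .
qed

lemma covariance_increments:
  assumes "a \<in> {0..S}" "b \<in> {0..S}" "c \<in> {0..T}" "d \<in> {0..T}"
    "a' \<in> {0..S}" "b' \<in> {0..S}" "c' \<in> {0..T}" "d' \<in> {0..T}"
  shows "(LINT x|W. rect_diff x a b c d * rect_diff x a' b' c' d') = overlap a b a' b' * overlap c d c' d'"
proof -
  have i: "integrable W (\<lambda>x. rect_diff x a b c d * x (u, v))" if "u \<in> {0..S}" "v \<in> {0..T}" for u v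
    using assms that by (intro lin_product lin_rect_diff lin_eval) (auto simp: rect_def)
  have "(LINT x|W. rect_diff x a b c d * rect_diff x a' b' c' d') =
    (LINT x|W. rect_diff x a b c d * x (b', d') - rect_diff x a b c d * x (a', d') - rect_diff x a b c d * x (b', c') + rect_diff x a b c d * x (a', c'))"
    by (simp only: rect_diff_def[of _ a' b' c' d'] distrib_left right_diff_distrib)
  also have "\<dots> = (LINT x|W. rect_diff x a b c d * x (b', d')) - (LINT x|W. rect_diff x a b c d * x (a', d')) -
      (LINT x|W. rect_diff x a b c d * x (b', c')) + (LINT x|W. rect_diff x a b c d * x (a', c'))"
    using i assms by simp
  also have "\<dots> = (min b b' - min a b') * (min d d' - min c d') - (min b a' - min a a') * (min d d' - min c d') -
      (min b b' - min a b') * (min d c' - min c c') + (min b a' - min a a') * (min d c' - min c c')"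
    using assms by (simp only: covariance_increment_point)
  also have "\<dots> = overlap a b a' b' * overlap c d c' d'"
    unfolding overlap_def by (simp add: algebra_simps)
  finally show ?thesis .
qed

lemma overlap_cases:
  "a \<le> b \<Longrightarrow> overlap a b a b = b - a"
  "a \<le> b \<Longrightarrow> b \<le> a' \<Longrightarrow> a' \<le> b' \<Longrightarrow> overlap a b a' b' = 0"
  "a' \<le> b' \<Longrightarrow> b' \<le> a \<Longrightarrow> a \<le> b \<Longrightarrow> overlap a b a' b' = 0"
  by (simp_all add: overlap_def)

lemma overlap_grid:
  assumes L: "L > 0"
  shows "overlap (real i * L / real (Suc N)) (real (Suc i) * L / real (Suc N)) (real k * L / real (Suc N)) (real (Suc k) * L / real (Suc N)) =
    (if i = k then L / real (Suc N) else 0)"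
proof -
  have mono: "real i * L / real (Suc N) \<le> real j * L / real (Suc N)" if "i \<le> j" for i j
    using that L by (intro divide_right_mono mult_right_mono) auto
  consider "i = k" | "Suc i \<le> k" | "Suc k \<le> i" by linarith
  then show ?thesis
  proof cases
    case 1
    then show ?thesis using overlap_cases(1)[OF mono[of k "Suc k"]] uniform_mesh[of k L N] by simp
  next
    case 2
    then show ?thesis using overlap_cases(2)[OF mono mono mono, of i "Suc i" k "Suc k"] by simp
  next
    case 3
    then show ?thesis using overlap_cases(3)[OF mono mono mono, of k "Suc k" i "Suc i"] by simp
  qed
qed

lemma grid_range: "i \<le> Suc N \<Longrightarrow> L > 0 \<Longrightarrow> real i * L / real (Suc N) \<in> {0..L}"
  using weak_seq_range[OF partition_weak_seq[OF partition_uniform[of L N]]] by auto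

lemma lin_uniform_rs_sum: "lin (\<lambda>x. uniform_rs_sum S T g x N)"
  unfolding uniform_rs_sum_def rs_sum_def
proof (intro lin_sum lin_scale lin_rect_diff)
  show "real i * S / real (Suc N) \<in> {0..S}" "real (Suc i) * S / real (Suc N) \<in> {0..S}"
    "real j * T / real (Suc N) \<in> {0..T}" "real (Suc j) * T / real (Suc N) \<in> {0..T}"
    if "i \<in> {..<Suc N}" "j \<in> {..<Suc N}" for i j
    using that S T by (intro grid_range; simp)+
qed

text \<open>Increments over distinct cells of the grid are uncorrelated, and the variance of each is
  the area of its cell, so the double sum reduces to its diagonal.\<close>

lemma uniform_rs_sum_variance:
  "(LINT x|W. (uniform_rs_sum S T g x N)\<^sup>2) =
   (\<Sum>i<Suc N. \<Sum>j<Suc N. (g (real i * S / real (Suc N), real j * T / real (Suc N)))\<^sup>2 * (S / real (Suc N) * (T / real (Suc N))))"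
proof -
  define \<xi> where "\<xi> L i = real i * L / real (Suc N)" for L i
  define Q where "Q = {..<Suc N} \<times> {..<Suc N}"
  define R where "R q x = rect_diff x (\<xi> S (fst q)) (\<xi> S (Suc (fst q))) (\<xi> T (snd q)) (\<xi> T (Suc (snd q)))" for q :: "nat \<times> nat" and x
  define c where "c q = g (\<xi> S (fst q), \<xi> T (snd q))" for q :: "nat \<times> nat"
  have r: "\<xi> L i \<in> {0..L}" if "i \<le> Suc N" "L > 0" for i L
    unfolding \<xi>_def using that by (rule grid_range)
  have rS: "\<xi> S (fst q) \<in> {0..S}" "\<xi> S (Suc (fst q)) \<in> {0..S}" "\<xi> T (snd q) \<in> {0..T}" "\<xi> T (Suc (snd q)) \<in> {0..T}"
    if "q \<in> Q" for q
    using that S T by (auto simp: Q_def intro!: r simp del: atLeastAtMost_iff)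
  have u: "uniform_rs_sum S T g x N = (\<Sum>q\<in>Q. c q * R q x)" for x
    unfolding uniform_rs_sum_def rs_sum_def Q_def c_def R_def \<xi>_def
    by (simp only: sum.cartesian_product case_prod_unfold)
  have iR: "integrable W (\<lambda>x. R q x * R q' x)" if "q \<in> Q" "q' \<in> Q" for q q'
    unfolding R_def using rS[OF that(1)] rS[OF that(2)] by (intro lin_product lin_rect_diff)
  have cov: "(LINT x|W. R q x * R q' x) = (if q = q' then S / real (Suc N) * (T / real (Suc N)) else 0)"
    if "q \<in> Q" "q' \<in> Q" for q q'
  proof -
    have "(LINT x|W. R q x * R q' x) = overlap (\<xi> S (fst q)) (\<xi> S (Suc (fst q))) (\<xi> S (fst q')) (\<xi> S (Suc (fst q'))) *
       overlap (\<xi> T (snd q)) (\<xi> T (Suc (snd q))) (\<xi> T (snd q')) (\<xi> T (Suc (snd q')))"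
      unfolding R_def by (intro covariance_increments rS that)
    also have "\<dots> = (if fst q = fst q' then S / real (Suc N) else 0) * (if snd q = snd q' then T / real (Suc N) else 0)"
      unfolding \<xi>_def overlap_grid[OF S] overlap_grid[OF T] ..
    also have "\<dots> = (if q = q' then S / real (Suc N) * (T / real (Suc N)) else 0)"
      by (auto simp: prod_eq_iff)
    finally show ?thesis .
  qed
  have "(LINT x|W. (uniform_rs_sum S T g x N)\<^sup>2) = (LINT x|W. (\<Sum>q\<in>Q. \<Sum>q'\<in>Q. (c q * c q') * (R q x * R q' x)))"
    unfolding u power2_eq_square sum_product by (simp only: mult_ac)
  also have "\<dots> = (\<Sum>q\<in>Q. \<Sum>q'\<in>Q. (c q * c q') * (LINT x|W. R q x * R q' x))"
    using iR by (simp add: Bochner_Integration.integral_sum)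
  also have "\<dots> = (\<Sum>q\<in>Q. \<Sum>q'\<in>Q. if q = q' then (c q)\<^sup>2 * (S / real (Suc N) * (T / real (Suc N))) else 0)"
    using cov by (intro sum.cong refl) (simp add: power2_eq_square del: of_nat_Suc)
  also have "\<dots> = (\<Sum>q\<in>Q. (c q)\<^sup>2 * (S / real (Suc N) * (T / real (Suc N))))"
    by (intro sum.cong refl) (simp add: Q_def del: of_nat_Suc)
  also have "\<dots> = (\<Sum>i<Suc N. \<Sum>j<Suc N. (g (real i * S / real (Suc N), real j * T / real (Suc N)))\<^sup>2 * (S / real (Suc N) * (T / real (Suc N))))"
    unfolding Q_def c_def \<xi>_def by (simp only: sum.cartesian_product case_prod_unfold)
  finally show ?thesis .
qed

lemma C0_continuous: "x \<in> C0 S T \<Longrightarrow> continuous_on (rect S T) x"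
  by (simp add: C0_def)

definition X :: "nat \<Rightarrow> plane_fun \<Rightarrow> real" where
  "X j x = rs_integral S T (\<phi> j) x"

lemma X_measurable: "X j \<in> borel_measurable W"
proof (rule borel_measurable_LIMSEQ_real)
  show "(\<lambda>N. uniform_rs_sum S T (\<phi> j) x N) \<longlonglongrightarrow> X j x" if "x \<in> space W" for x
    unfolding X_def using that basis_bv[OF basis]
    by (intro has_rs_integral_limit[OF S T] has_rs_integral_rs_integral[OF S T] C0_continuous) (auto simp: space_W)
  show "(\<lambda>x. uniform_rs_sum S T (\<phi> j) x N) \<in> borel_measurable W" for N
    by (intro lin_measurable lin_uniform_rs_sum)
qed

text \<open>A combination of the \<open>X j\<close> is the limit of Gaussian sums with integrand
  \<open>g\<close>, whose variances tend to the squared norm of \<open>g\<close>; by orthonormality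
  that is the sum of the squares of the coefficients.\<close>

lemma X_char:
  "(LINT x|W. exp (\<i> * complex_of_real (\<Sum>j<n. a j * X j x))) = complex_of_real (exp (- (\<Sum>j<n. (a j)\<^sup>2) / 2))"
proof -
  interpret prob_space W by (rule prob_space_W)
  define g where "g p = (\<Sum>j<n. a j * \<phi> j p)" for p
  obtain w where w: "majorant S T g w"
    using majorant_sum[where \<phi>=\<phi> and n=n and c=a, OF S T basis_bv[OF basis]] unfolding g_def[abs_def] by blast
  have var: "(LINT p|area S T. (g p)\<^sup>2) = (\<Sum>j<n. (a j)\<^sup>2)"
    using combination_norm[OF basis, of a n] by (simp add: g_def l2_inner_def power2_eq_square)
  have lim: "(\<lambda>N. uniform_rs_sum S T g x N) \<longlonglongrightarrow> (\<Sum>j<n. a j * X j x)" if "x \<in> space W" for x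
    unfolding g_def[abs_def] X_def using that
    by (intro has_rs_integral_limit[OF S T] has_rs_integral_sum[OF S T basis_bv[OF basis]] C0_continuous) (simp add: space_W)
  show ?thesis
  proof (rule LIMSEQ_unique)
    show "(\<lambda>N. LINT x|W. exp (\<i> * complex_of_real (uniform_rs_sum S T g x N))) \<longlonglongrightarrow>
      (LINT x|W. exp (\<i> * complex_of_real (\<Sum>j<n. a j * X j x)))"
    proof (rule integral_dominated_convergence[where w="\<lambda>x. 1"])
      show "AE x in W. (\<lambda>N. exp (\<i> * complex_of_real (uniform_rs_sum S T g x N))) \<longlonglongrightarrow> exp (\<i> * complex_of_real (\<Sum>j<n. a j * X j x))"
        using lim by (intro AE_I2 tendsto_intros)
      have [measurable]: "X j \<in> borel_measurable W" "(\<lambda>x. uniform_rs_sum S T g x N) \<in> borel_measurable W" for j N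
        using X_measurable lin_measurable[OF lin_uniform_rs_sum] by auto
      show "(\<lambda>x. exp (\<i> * complex_of_real (\<Sum>j<n. a j * X j x))) \<in> borel_measurable W"
        "(\<lambda>x. exp (\<i> * complex_of_real (uniform_rs_sum S T g x N))) \<in> borel_measurable W" for N
        by measurable
    qed (auto simp: norm_exp_i_times)
    show "(\<lambda>N. LINT x|W. exp (\<i> * complex_of_real (uniform_rs_sum S T g x N))) \<longlonglongrightarrow> complex_of_real (exp (- (\<Sum>j<n. (a j)\<^sup>2) / 2))"
      unfolding lin_gaussian(2)[OF lin_uniform_rs_sum] uniform_rs_sum_variance var[symmetric]
      by (intro tendsto_of_real tendsto_exp tendsto_divide tendsto_minus riemann_sum_square_limit[OF S T w] tendsto_const) simp
  qed
qed

sublocale gaussian_sequence W X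
proof -
  interpret prob_space W by (rule prob_space_W)
  show "gaussian_sequence W X"
    by unfold_locales (rule X_measurable, rule X_char)
qed

text \<open>Linearity of the Riemann--Stieltjes integral in the integrand turns the defining limit
  into a series in the independent variables \<open>X j\<close>.\<close>

lemma pwz_eq:
  assumes "x \<in> C0 S T"
  shows "pwz S T \<phi> v x = Y (\<lambda>j. l2_inner S T v (\<phi> j)) x"
  unfolding pwz_def Y_def X_def
  by (subst rs_integral_eq[OF S T has_rs_integral_sum[OF S T basis_bv[OF basis] C0_continuous[OF assms]]]) simp

section \<open>Measurability, linearity and scaling of the Paley--Wiener--Zygmund integral\<close>

abbreviation "LB \<equiv> borel_L2 S T"
abbreviation "pw \<equiv> pwz S T \<phi>"
abbreviation "nsq u \<equiv> l2_inner S T u u"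

lemma measurable_ip_LB:
  assumes "\<theta> \<in> \<Omega> \<rightarrow>\<^sub>M LB" "v \<in> L2 S T"
  shows "(\<lambda>\<omega>. l2_inner S T (\<theta> \<omega>) v) \<in> borel_measurable \<Omega>"
  using measurable_compose[OF assms(1) measurable_ip[OF assms(2)]] .

lemma measurable_LB_space: "\<theta> \<in> \<Omega> \<rightarrow>\<^sub>M LB \<Longrightarrow> \<omega> \<in> space \<Omega> \<Longrightarrow> \<theta> \<omega> \<in> L2 S T"
  using measurable_space[of \<theta> \<Omega> LB \<omega>] by simp

lemma measurable_nsq:
  assumes \<theta>: "\<theta> \<in> \<Omega> \<rightarrow>\<^sub>M LB"
  shows "(\<lambda>\<omega>. nsq (\<theta> \<omega>)) \<in> borel_measurable \<Omega>"
proof (subst measurable_cong)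
  show "nsq (\<theta> \<omega>) = (\<Sum>j. (l2_inner S T (\<theta> \<omega>) (\<phi> j))\<^sup>2)" if "\<omega> \<in> space \<Omega>" for \<omega>
    using parseval[OF basis measurable_LB_space[OF \<theta> that]] by (rule sums_unique)
  have [measurable]: "(\<lambda>\<omega>. l2_inner S T (\<theta> \<omega>) (\<phi> j)) \<in> borel_measurable \<Omega>" for j
    by (rule measurable_ip_LB[OF \<theta> basis_L2[OF basis]])
  show "(\<lambda>\<omega>. \<Sum>j. (l2_inner S T (\<theta> \<omega>) (\<phi> j))\<^sup>2) \<in> borel_measurable \<Omega>" by measurable
qed

lemma measurable_LB_mult:
  assumes \<theta>: "\<theta> \<in> \<Omega> \<rightarrow>\<^sub>M LB" and h: "h \<in> borel_measurable (area S T)" "\<And>p. p \<in> rect S T \<Longrightarrow> \<bar>h p\<bar> \<le> B"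
  shows "(\<lambda>\<omega> p. \<theta> \<omega> p * h p) \<in> \<Omega> \<rightarrow>\<^sub>M LB"
proof (rule measurable_borel_L2I[OF basis])
  show "(\<lambda>p. \<theta> \<omega> p * h p) \<in> L2 S T" if "\<omega> \<in> space \<Omega>" for \<omega>
    by (rule L2_bounded[OF h measurable_LB_space[OF \<theta> that]])
  fix j
  have "l2_inner S T (\<lambda>p. \<theta> \<omega> p * h p) (\<phi> j) = l2_inner S T (\<theta> \<omega>) (\<lambda>p. \<phi> j p * h p)" for \<omega>
    by (simp add: l2_inner_def mult_ac)
  then show "(\<lambda>\<omega>. l2_inner S T (\<lambda>p. \<theta> \<omega> p * h p) (\<phi> j)) \<in> borel_measurable \<Omega>"
    using measurable_ip_LB[OF \<theta> L2_bounded[OF h basis_L2[OF basis]]] by simp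
qed

lemma measurable_LB_combination:
  assumes \<theta>: "\<theta> \<in> \<Omega> \<rightarrow>\<^sub>M LB" and \<eta>: "\<eta> \<in> \<Omega> \<rightarrow>\<^sub>M LB"
  shows "(\<lambda>\<omega> p. a * \<theta> \<omega> p + b * \<eta> \<omega> p) \<in> \<Omega> \<rightarrow>\<^sub>M LB"
proof (rule measurable_borel_L2I[OF basis])
  show "(\<lambda>p. a * \<theta> \<omega> p + b * \<eta> \<omega> p) \<in> L2 S T" if "\<omega> \<in> space \<Omega>" for \<omega>
    by (intro L2_add L2_scale measurable_LB_space[OF \<theta> that] measurable_LB_space[OF \<eta> that])
  fix j
  have m: "(\<lambda>\<omega>. a * l2_inner S T (\<theta> \<omega>) (\<phi> j) + b * l2_inner S T (\<eta> \<omega>) (\<phi> j)) \<in> borel_measurable \<Omega>"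
    by (intro borel_measurable_add borel_measurable_times borel_measurable_const measurable_ip_LB \<theta> \<eta> basis_L2[OF basis])
  have e: "l2_inner S T (\<lambda>p. a * \<theta> \<omega> p + b * \<eta> \<omega> p) (\<phi> j) = a * l2_inner S T (\<theta> \<omega>) (\<phi> j) + b * l2_inner S T (\<eta> \<omega>) (\<phi> j)"
    if "\<omega> \<in> space \<Omega>" for \<omega>
    using measurable_LB_space[OF \<theta> that] measurable_LB_space[OF \<eta> that]
    by (simp add: ip_add_left L2_scale basis_L2[OF basis] ip_scale_left)
  show "(\<lambda>\<omega>. l2_inner S T (\<lambda>p. a * \<theta> \<omega> p + b * \<eta> \<omega> p) (\<phi> j)) \<in> borel_measurable \<Omega>"
    using m by (subst measurable_cong[OF e])
qed

text \<open>Where this fails, \<open>pw u x\<close> is an unspecified value of \<open>lim\<close>;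
  additivity and homogeneity are asserted only where it holds.\<close>

definition conv :: "plane_fun \<Rightarrow> plane_fun \<Rightarrow> bool" where
  "conv u x \<longleftrightarrow> convergent (\<lambda>n. \<Sum>j<n. l2_inner S T u (\<phi> j) * X j x)"

lemma pw_limit:
  assumes "x \<in> C0 S T" "conv u x"
  shows "(\<lambda>n. \<Sum>j<n. l2_inner S T u (\<phi> j) * X j x) \<longlonglongrightarrow> pw u x"
  unfolding pwz_eq[OF assms(1)] using assms(2) unfolding conv_def by (rule Y_limit)

lemma pwI:
  assumes "x \<in> C0 S T" "(\<lambda>n. \<Sum>j<n. l2_inner S T u (\<phi> j) * X j x) \<longlonglongrightarrow> l"
  shows "conv u x" "pw u x = l"
proof -
  show c: "conv u x" unfolding conv_def using assms(2) by (rule convergentI)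
  show "pw u x = l" using LIMSEQ_unique[OF pw_limit[OF assms(1) c] assms(2)] .
qed

lemma AE_conv:
  assumes "u \<in> L2 S T"
  shows "AE x in W. conv u x"
  unfolding conv_def by (rule series_converges) (rule sums_summable[OF parseval[OF basis assms]])

lemma pw_combination:
  assumes x: "x \<in> C0 S T" and u: "u \<in> L2 S T" "conv u x" and v: "v \<in> L2 S T" "conv v x"
  shows "conv (\<lambda>p. a * u p + b * v p) x" "pw (\<lambda>p. a * u p + b * v p) x = a * pw u x + b * pw v x"
proof -
  have e: "(\<Sum>j<n. l2_inner S T (\<lambda>p. a * u p + b * v p) (\<phi> j) * X j x) =
    a * (\<Sum>j<n. l2_inner S T u (\<phi> j) * X j x) + b * (\<Sum>j<n. l2_inner S T v (\<phi> j) * X j x)" for n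
    by (simp add: ip_add_left L2_scale u v basis_L2[OF basis] ip_scale_left sum_distrib_left sum.distrib algebra_simps)
  have "(\<lambda>n. \<Sum>j<n. l2_inner S T (\<lambda>p. a * u p + b * v p) (\<phi> j) * X j x) \<longlonglongrightarrow> a * pw u x + b * pw v x"
    unfolding e by (intro tendsto_intros pw_limit x u v)
  from pwI[OF x this] show "conv (\<lambda>p. a * u p + b * v p) x" "pw (\<lambda>p. a * u p + b * v p) x = a * pw u x + b * pw v x" .
qed

lemma C0_scale: "x \<in> C0 S T \<Longrightarrow> (\<lambda>p. \<rho> * x p) \<in> C0 S T"
  by (auto simp: C0_def intro!: continuous_intros)

lemma X_scale: "x \<in> C0 S T \<Longrightarrow> X j (\<lambda>p. \<rho> * x p) = \<rho> * X j x"
  unfolding X_def by (intro rs_integral_scale_path S T basis_bv[OF basis] C0_continuous)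

lemma pw_scale:
  assumes x: "x \<in> C0 S T" and c: "conv u x"
  shows "conv u (\<lambda>p. \<rho> * x p)" "pw u (\<lambda>p. \<rho> * x p) = \<rho> * pw u x"
proof -
  have e: "(\<Sum>j<n. l2_inner S T u (\<phi> j) * X j (\<lambda>p. \<rho> * x p)) = \<rho> * (\<Sum>j<n. l2_inner S T u (\<phi> j) * X j x)" for n
    using X_scale[OF x] by (simp add: sum_distrib_left mult_ac)
  have "(\<lambda>n. \<Sum>j<n. l2_inner S T u (\<phi> j) * X j (\<lambda>p. \<rho> * x p)) \<longlonglongrightarrow> \<rho> * pw u x"
    unfolding e by (intro tendsto_intros pw_limit x c)
  from pwI[OF C0_scale[OF x] this] show "conv u (\<lambda>p. \<rho> * x p)" "pw u (\<lambda>p. \<rho> * x p) = \<rho> * pw u x" .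
qed

text \<open>Joint measurability is what Fubini's theorem requires: the coefficients depend
  measurably on \<omega>, the variables \<open>X j\<close> on \<open>x\<close>, and the rest is a
  limit of finite sums.\<close>

lemma pw_measurable_pair:
  assumes \<theta>: "\<theta> \<in> \<Omega> \<rightarrow>\<^sub>M LB"
  shows "(\<lambda>z. pw (\<theta> (fst z)) (snd z)) \<in> borel_measurable (\<Omega> \<Otimes>\<^sub>M W)"
    and "{z \<in> space (\<Omega> \<Otimes>\<^sub>M W). conv (\<theta> (fst z)) (snd z)} \<in> sets (\<Omega> \<Otimes>\<^sub>M W)"
proof -
  have [measurable]: "(\<lambda>z. l2_inner S T (\<theta> (fst z)) (\<phi> j)) \<in> borel_measurable (\<Omega> \<Otimes>\<^sub>M W)" for j
    using measurable_compose[OF measurable_fst measurable_ip_LB[OF \<theta> basis_L2[OF basis]]] .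
  have [measurable]: "(\<lambda>z. X j (snd z)) \<in> borel_measurable (\<Omega> \<Otimes>\<^sub>M W)" for j
    using measurable_compose[OF measurable_snd X_measurable] .
  show "(\<lambda>z. pw (\<theta> (fst z)) (snd z)) \<in> borel_measurable (\<Omega> \<Otimes>\<^sub>M W)"
  proof (subst measurable_cong)
    show "pw (\<theta> (fst z)) (snd z) = lim (\<lambda>n. \<Sum>j<n. l2_inner S T (\<theta> (fst z)) (\<phi> j) * X j (snd z))"
      if "z \<in> space (\<Omega> \<Otimes>\<^sub>M W)" for z
      using that by (simp add: pwz_eq space_W space_pair_measure mem_Times_iff Y_def)
  qed measurable
  show "{z \<in> space (\<Omega> \<Otimes>\<^sub>M W). conv (\<theta> (fst z)) (snd z)} \<in> sets (\<Omega> \<Otimes>\<^sub>M W)"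
    unfolding conv_def Cauchy_convergent_iff[symmetric] by measurable
qed

lemma pw_measurable:
  assumes \<theta>: "\<theta> \<in> \<Omega> \<rightarrow>\<^sub>M LB" and x: "x \<in> C0 S T"
  shows "(\<lambda>\<omega>. pw (\<theta> \<omega>) x) \<in> borel_measurable \<Omega>"
  using measurable_compose[OF measurable_Pair2'[of x W \<Omega>] pw_measurable_pair(1)[OF \<theta>]] x by (simp add: space_W)

lemma pw_char:
  assumes u: "u \<in> L2 S T"
  shows "(LINT x|W. exp (\<i> * complex_of_real (pw u x))) = complex_of_real (exp (- nsq u / 2))"
proof -
  have "(LINT x|W. exp (\<i> * complex_of_real (pw u x))) = (LINT x|W. exp (\<i> * complex_of_real (Y (\<lambda>j. l2_inner S T u (\<phi> j)) x)))"
    by (intro Bochner_Integration.integral_cong refl) (simp add: pwz_eq space_W)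
  also have "\<dots> = complex_of_real (exp (- nsq u / 2))"
    using Y_char[OF sums_summable[OF parseval[OF basis u]]] sums_unique[OF parseval[OF basis u]] by simp
  finally show ?thesis .
qed

lemma pw_measurable_W: "u \<in> L2 S T \<Longrightarrow> (\<lambda>x. pw u x) \<in> borel_measurable W"
proof (subst measurable_cong)
  show "pw u x = Y (\<lambda>j. l2_inner S T u (\<phi> j)) x" if "x \<in> space W" for x
    using that by (simp add: pwz_eq space_W)
qed (rule Y_measurable)

lemma pw_combination_char:
  assumes u: "u \<in> L2 S T" and v: "v \<in> L2 S T"
  shows "(LINT x|W. exp (\<i> * complex_of_real (a * pw u x + b * pw v x))) =
    complex_of_real (exp (- nsq (\<lambda>p. a * u p + b * v p) / 2))"
proof -
  have "(LINT x|W. exp (\<i> * complex_of_real (a * pw u x + b * pw v x))) =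
    (LINT x|W. exp (\<i> * complex_of_real (pw (\<lambda>p. a * u p + b * v p) x)))"
  proof (rule integral_cong_AE)
    have [measurable]: "pw u \<in> borel_measurable W" "pw v \<in> borel_measurable W" "pw (\<lambda>p. a * u p + b * v p) \<in> borel_measurable W"
      using pw_measurable_W L2_add[OF L2_scale L2_scale] u v by blast+
    show "(\<lambda>x. exp (\<i> * complex_of_real (a * pw u x + b * pw v x))) \<in> borel_measurable W"
      "(\<lambda>x. exp (\<i> * complex_of_real (pw (\<lambda>p. a * u p + b * v p) x))) \<in> borel_measurable W" by measurable
    show "AE x in W. exp (\<i> * complex_of_real (a * pw u x + b * pw v x)) = exp (\<i> * complex_of_real (pw (\<lambda>p. a * u p + b * v p) x))"
      using AE_conv[OF u] AE_conv[OF v] AE_space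
    proof eventually_elim
      case (elim x)
      then show ?case using pw_combination(2)[OF _ u _ v, of x a b] by (simp add: space_W)
    qed
  qed
  also have "\<dots> = complex_of_real (exp (- nsq (\<lambda>p. a * u p + b * v p) / 2))"
    by (rule pw_char) (intro L2_add L2_scale u v)
  finally show ?thesis .
qed

lemma s_ae_scaled:
  assumes "s_ae W P" "\<rho> > 0"
  shows "AE x in W. P (\<lambda>p. \<rho> * x p)"
proof -
  obtain N where N: "scale_null W N" "\<And>x. x \<in> space W - N \<Longrightarrow> P x" using assms(1) unfolding s_ae_def by blast
  have "1 / \<rho> > 0" using assms(2) by simp
  then have "(\<lambda>x p. (1 / \<rho>) * x p) ` N \<in> null_sets W" using N(1) unfolding scale_null_def by blast
  from AE_not_in[OF this] AE_space show ?thesis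
  proof eventually_elim
    case (elim x)
    have "(\<lambda>p. \<rho> * x p) \<notin> N"
    proof
      assume "(\<lambda>p. \<rho> * x p) \<in> N"
      then have "(\<lambda>p. (1 / \<rho>) * (\<rho> * x p)) \<in> (\<lambda>x p. (1 / \<rho>) * x p) ` N" by (rule imageI)
      then show False using elim(1) assms(2) by simp
    qed
    moreover have "(\<lambda>p. \<rho> * x p) \<in> space W" using C0_scale elim(2) by (simp add: space_W)
    ultimately show ?case by (intro N(2)) blast
  qed
qed

lemma complete_W: "A \<in> null_sets W \<Longrightarrow> B \<subseteq> A \<Longrightarrow> B \<in> null_sets W"
proof (rule base_measure)
  fix W0 assume W: "W = completion W0"
  show "A \<in> null_sets W \<Longrightarrow> B \<subseteq> A \<Longrightarrow> B \<in> null_sets W"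
    unfolding W by (rule completion.complete2[rotated])
qed

text \<open>For each \<omega> convergence holds almost surely, and Fubini's theorem exchanges the
  two quantifiers. The exceptional set \<open>N\<close> is mapped into itself by dilations, since
  \<open>conv\<close> is invariant under them; completeness of \<open>W\<close> makes its dilates
  null as subsets of a null set.\<close>

lemma s_ae_conv:
  assumes \<Omega>: "finite_measure \<Omega>" and \<theta>: "\<theta> \<in> \<Omega> \<rightarrow>\<^sub>M LB"
  shows "s_ae W (\<lambda>x. AE \<omega> in \<Omega>. conv (\<theta> \<omega>) x)"
proof -
  interpret \<Omega>: finite_measure \<Omega> by fact
  interpret P: pair_sigma_finite \<Omega> W ..
  define N where "N = {x \<in> space W. \<not> (AE \<omega> in \<Omega>. conv (\<theta> \<omega>) x)}"
  have "AE x in W. conv (\<theta> \<omega>) x" if "\<omega> \<in> space \<Omega>" for \<omega>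
    by (rule AE_conv[OF measurable_LB_space[OF \<theta> that]])
  then have "AE \<omega> in \<Omega>. AE x in W. conv (\<theta> \<omega>) x" by (rule AE_I2)
  then have "AE x in W. AE \<omega> in \<Omega>. conv (\<theta> \<omega>) x"
    using P.AE_commute[where P="\<lambda>\<omega> x. conv (\<theta> \<omega>) x", OF pw_measurable_pair(2)[OF \<theta>]] by (rule iffD1[rotated])
  then obtain N' where N': "{x \<in> space W. \<not> (AE \<omega> in \<Omega>. conv (\<theta> \<omega>) x)} \<subseteq> N'" "emeasure W N' = 0" "N' \<in> sets W"
    by (rule AE_E)
  have null: "N \<in> null_sets W"
    using complete_W[OF null_setsI[OF N'(2,3)] N'(1)] unfolding N_def .
  have "(\<lambda>x p. \<rho> * x p) ` N \<subseteq> N" if "\<rho> > 0" for \<rho>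
  proof
    fix y assume "y \<in> (\<lambda>x p. \<rho> * x p) ` N"
    then obtain x where x: "x \<in> C0 S T" "\<not> (AE \<omega> in \<Omega>. conv (\<theta> \<omega>) x)" and y: "y = (\<lambda>p. \<rho> * x p)"
      by (auto simp: N_def space_W)
    have yC: "y \<in> C0 S T" unfolding y by (rule C0_scale[OF x(1)])
    have xy: "x = (\<lambda>p. (1 / \<rho>) * y p)" using that by (simp add: y)
    have "\<not> (AE \<omega> in \<Omega>. conv (\<theta> \<omega>) y)"
    proof
      assume "AE \<omega> in \<Omega>. conv (\<theta> \<omega>) y"
      then have "AE \<omega> in \<Omega>. conv (\<theta> \<omega>) x"
        by eventually_elim (subst xy, rule pw_scale(1)[OF yC])
      then show False using x(2) by blast
    qed
    then show "y \<in> N" using yC by (simp add: N_def space_W)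
  qed
  then have "scale_null W N"
    unfolding scale_null_def using complete_W[OF null] by (auto simp: N_def)
  then show ?thesis unfolding s_ae_def by (intro exI[of _ N]) (auto simp: N_def)
qed

end

subsection \<open>Uniqueness of the representing measure\<close>

text \<open>The measure chosen by \<open>SOME\<close> in \<open>path_eval\<close> is determined on
  the sigma-algebra only, and \<open>positive_variation\<close> looks at nothing else.\<close>

lemma complex_integral_cong_measure:
  assumes "\<And>A. A \<in> sets M \<Longrightarrow> f A = g A"
  shows "complex_integral M f = complex_integral M g"
proof -
  have pv: "positive_variation M \<mu> = positive_variation M \<nu>" if "\<And>A. A \<in> sets M \<Longrightarrow> \<mu> A = \<nu> A" for \<mu> \<nu>
  proof -
    have "(\<lambda>E. SUP A\<in>{A \<in> sets M. A \<subseteq> E}. ennreal (\<mu> A)) = (\<lambda>E. SUP A\<in>{A \<in> sets M. A \<subseteq> E}. ennreal (\<nu> A))"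
      by (intro ext SUP_cong refl) (simp add: that)
    then show ?thesis unfolding positive_variation_def by simp
  qed
  have "positive_variation M (\<lambda>A. Re (f A)) = positive_variation M (\<lambda>A. Re (g A))"
    "positive_variation M (\<lambda>A. - Re (f A)) = positive_variation M (\<lambda>A. - Re (g A))"
    "positive_variation M (\<lambda>A. Im (f A)) = positive_variation M (\<lambda>A. Im (g A))"
    "positive_variation M (\<lambda>A. - Im (f A)) = positive_variation M (\<lambda>A. - Im (g A))"
    by (intro pv; simp add: assms)+
  then show ?thesis unfolding complex_integral_def[abs_def] signed_integral_def[abs_def] by simp
qed

context yeh_wiener_space
begin

text \<open>Multiplying by exp(i \<langle>w, x\<rangle>) and averaging over \<open>x\<close> turns
  plane waves into Gaussians: by Fubini's theorem the average of exp(i \<langle>\<rho> u + w,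
  x\<rangle>) appears, which is known.\<close>

lemma gaussian_integral_zero:
  assumes \<Omega>: "finite_measure \<Omega>" "sets \<Omega> = sets LB" and D: "integrable \<Omega> D" and \<rho>: "\<rho> > 0" and w: "w \<in> L2 S T"
    and zero: "AE x in W. (LINT u|\<Omega>. exp (\<i> * complex_of_real (pw u (\<lambda>p. \<rho> * x p))) * D u) = 0"
  shows "(LINT u|\<Omega>. complex_of_real (exp (- nsq (\<lambda>p. \<rho> * u p + 1 * w p) / 2)) * D u) = 0"
proof -
  interpret \<Omega>: finite_measure \<Omega> by fact
  interpret P: pair_sigma_finite \<Omega> W ..
  have sp: "space \<Omega> = L2 S T" using sets_eq_imp_space_eq[OF \<Omega>(2)] by simp
  have id: "(\<lambda>u. u) \<in> \<Omega> \<rightarrow>\<^sub>M LB" using measurable_ident_sets[OF \<Omega>(2)] by simp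
  have [measurable]: "D \<in> borel_measurable \<Omega>" using D by auto
  have [measurable]: "(\<lambda>z. pw (fst z) (snd z)) \<in> borel_measurable (\<Omega> \<Otimes>\<^sub>M W)"
    using pw_measurable_pair(1)[OF id] .
  have [measurable]: "pw w \<in> borel_measurable W" using pw_measurable_W[OF w] .
  define f where "f u x = exp (\<i> * complex_of_real (\<rho> * pw u x + 1 * pw w x)) * D u" for u x
  have fm: "(\<lambda>z. f (fst z) (snd z)) \<in> borel_measurable (\<Omega> \<Otimes>\<^sub>M W)" unfolding f_def by measurable
  have nf: "norm (f u x) = norm (D u)" for u x by (simp add: f_def norm_mult)
  have "integrable (\<Omega> \<Otimes>\<^sub>M W) (\<lambda>z. f (fst z) (snd z))"
  proof (rule P.Fubini_integrable[OF fm])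
    show "integrable \<Omega> (\<lambda>u. LINT x|W. norm (f (fst (u, x)) (snd (u, x))))"
      using D by (simp add: nf prob_space)
    show "AE u in \<Omega>. integrable W (\<lambda>x. f (fst (u, x)) (snd (u, x)))"
    proof (rule AE_I2)
      fix u assume u: "u \<in> space \<Omega>"
      have "(\<lambda>x. f u x) \<in> borel_measurable W"
        using measurable_compose[OF measurable_Pair1'[OF u] fm] by simp
      then show "integrable W (\<lambda>x. f (fst (u, x)) (snd (u, x)))"
        by (intro integrable_const_bound[where B="norm (D u)"]) (auto simp: nf)
    qed
  qed
  then have fi: "integrable (\<Omega> \<Otimes>\<^sub>M W) (case_prod f)" by (simp add: case_prod_unfold)
  have "s_ae W (\<lambda>x. AE u in \<Omega>. conv u x)" by (rule s_ae_conv[OF \<Omega>(1) id])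
  from s_ae_scaled[OF this zero_less_one] have cv: "AE x in W. AE u in \<Omega>. conv u x" by simp
  have "(LINT u|\<Omega>. complex_of_real (exp (- nsq (\<lambda>p. \<rho> * u p + 1 * w p) / 2)) * D u) = (LINT u|\<Omega>. LINT x|W. f u x)"
  proof (rule Bochner_Integration.integral_cong[OF refl])
    fix u assume "u \<in> space \<Omega>"
    then have u: "u \<in> L2 S T" by (simp add: sp)
    show "complex_of_real (exp (- nsq (\<lambda>p. \<rho> * u p + 1 * w p) / 2)) * D u = (LINT x|W. f u x)"
      unfolding f_def integral_mult_left_zero pw_combination_char[OF u w] ..
  qed
  also have "\<dots> = (LINT x|W. LINT u|\<Omega>. f u x)" by (rule P.Fubini_integral[OF fi, symmetric])
  also have "\<dots> = (LINT x|W. 0)"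
  proof (rule integral_cong_AE)
    show "(\<lambda>x. LINT u|\<Omega>. f u x) \<in> borel_measurable W"
      using P.integrable_snd[OF fi] by auto
    show "AE x in W. (LINT u|\<Omega>. f u x) = 0"
      using zero cv AE_space
    proof eventually_elim
      case (elim x)
      then have x: "x \<in> C0 S T" by (simp add: space_W)
      have [measurable]: "(\<lambda>u. pw u y) \<in> borel_measurable \<Omega>" if "y \<in> C0 S T" for y
        using pw_measurable[OF id that] .
      note [measurable] = this[OF x] this[OF C0_scale[OF x]]
      have "(LINT u|\<Omega>. f u x) = (LINT u|\<Omega>. exp (\<i> * complex_of_real (pw w x)) * (exp (\<i> * complex_of_real (pw u (\<lambda>p. \<rho> * x p))) * D u))"
      proof (rule integral_cong_AE)
        show "(\<lambda>u. f u x) \<in> borel_measurable \<Omega>" unfolding f_def by measurable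
        show "AE u in \<Omega>. f u x = exp (\<i> * complex_of_real (pw w x)) * (exp (\<i> * complex_of_real (pw u (\<lambda>p. \<rho> * x p))) * D u)"
          using elim(2)
        proof eventually_elim
          case (elim u)
          show ?case unfolding f_def pw_scale(2)[OF x elim]
            by (simp add: distrib_left exp_add)
        qed
      qed measurable
      then show ?case using elim(1) by simp
    qed
  qed simp
  finally show ?thesis by simp
qed

lemma nsq_combination:
  assumes "u \<in> L2 S T" "v \<in> L2 S T"
  shows "nsq (\<lambda>p. a * u p + b * v p) = a\<^sup>2 * nsq u + 2 * a * b * l2_inner S T u v + b\<^sup>2 * nsq v"
proof -
  have "nsq (\<lambda>p. a * u p + b * v p) = (LINT p|area S T. a\<^sup>2 * (u p * u p) + (2 * a * b) * (u p * v p) + b\<^sup>2 * (v p * v p))"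
    unfolding l2_inner_def by (intro Bochner_Integration.integral_cong refl) (simp add: power2_eq_square algebra_simps)
  also have "\<dots> = a\<^sup>2 * nsq u + 2 * a * b * l2_inner S T u v + b\<^sup>2 * nsq v"
    unfolding l2_inner_def using L2_product[OF assms(1) assms(1)] L2_product[OF assms] L2_product[OF assms(2) assms(2)] by simp
  finally show ?thesis .
qed

text \<open>By completing the square, \<open>gaussian_integral_zero\<close> at scale
  \<open>sqrt \<tau>\<close> covers the functions \<open>\<gamma> \<tau> w\<close>. Multiplying two
  of them adds the parameters \<tau> and the vectors \<open>w\<close>, so products of members of
  \<open>G\<close> stay within reach. The members of \<open>G\<close> in turn determine all
  coefficients of \<open>u\<close>, so the sigma-algebra on which the density integrates to 0
  contains all Borel sets.\<close>

lemma complex_measure_zeroI: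
  assumes \<Omega>: "finite_measure \<Omega>" "sets \<Omega> = sets LB" and D: "integrable \<Omega> D"
    and zero: "\<And>\<rho>. \<rho> > 0 \<Longrightarrow> AE x in W. (LINT u|\<Omega>. exp (\<i> * complex_of_real (pw u (\<lambda>p. \<rho> * x p))) * D u) = 0"
    and A: "A \<in> sets LB"
  shows "(LINT u|\<Omega>. indicator A u * D u) = 0"
proof -
  interpret \<Omega>: finite_measure \<Omega> by fact
  have sp: "space \<Omega> = L2 S T" using sets_eq_imp_space_eq[OF \<Omega>(2)] by simp
  have id: "(\<lambda>u. u) \<in> \<Omega> \<rightarrow>\<^sub>M LB" using measurable_ident_sets[OF \<Omega>(2)] by simp
  have Dm[measurable]: "D \<in> borel_measurable \<Omega>" using D by auto
  have ns[measurable]: "(\<lambda>u. nsq u) \<in> borel_measurable \<Omega>" using measurable_nsq[OF id] .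
  define \<gamma> where "\<gamma> \<tau> w u = exp (- \<tau> / 2 * nsq u + l2_inner S T u w)" for \<tau> w u
  have exponent: "- \<tau> / 2 * a + b = c / 2 + - (\<tau> * a - 2 * b + c) / 2" for \<tau> a b c :: real
    by (simp add: field_simps)
  \<comment> \<open>Squares are completed so that the values lie in the unit interval, as
    \<open>monotone_class_vanishing\<close> requires; up to a constant factor these are the
    functions \<open>\<gamma> 1 w\<close>.\<close>
  define G where "G = (\<lambda>w u. exp (- nsq (\<lambda>p. 1 * u p + (- 1) * w p) / 2)) ` L2 S T"
  have \<gamma>0: "(LINT u|\<Omega>. complex_of_real (\<gamma> \<tau> w u) * D u) = 0" if \<tau>: "\<tau> > 0" and w: "w \<in> L2 S T" for \<tau> w
  proof -
    \<comment> \<open>Makes the cross term in the squared norm of sqrt \<tau> u + v equal to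
      \<open>- 2 * l2_inner S T u w\<close>.\<close>
    define v where "v p = (- 1 / sqrt \<tau>) * w p" for p
    have v: "v \<in> L2 S T" unfolding v_def[abs_def] by (rule L2_scale[OF w])
    have nv: "nsq (\<lambda>p. sqrt \<tau> * u p + 1 * v p) = \<tau> * nsq u - 2 * l2_inner S T u w + nsq v" if u: "u \<in> L2 S T" for u
    proof -
      have "l2_inner S T u v = (- 1 / sqrt \<tau>) * l2_inner S T u w"
        unfolding v_def[abs_def] by (simp only: ip_commute[of S T u] ip_scale_left)
      then show ?thesis unfolding nsq_combination[OF u v] using \<tau> by simp
    qed
    have e: "\<gamma> \<tau> w u = exp (nsq v / 2) * exp (- nsq (\<lambda>p. sqrt \<tau> * u p + 1 * v p) / 2)" if "u \<in> L2 S T" for u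
      unfolding \<gamma>_def exp_add[symmetric] nv[OF that] by (rule arg_cong[OF exponent])
    have "(LINT u|\<Omega>. complex_of_real (\<gamma> \<tau> w u) * D u) =
      (LINT u|\<Omega>. complex_of_real (exp (nsq v / 2)) * (complex_of_real (exp (- nsq (\<lambda>p. sqrt \<tau> * u p + 1 * v p) / 2)) * D u))"
      by (intro Bochner_Integration.integral_cong refl) (simp only: sp e of_real_mult mult.assoc)
    also have "\<dots> = 0"
      using gaussian_integral_zero[OF \<Omega> D _ v zero, of "sqrt \<tau>"] \<tau> by simp
    finally show ?thesis .
  qed
  \<comment> \<open>The empty product is the constant 1, the case \<tau> = 0 and
    \<open>w = 0\<close>, reached as \<tau> tends to 0.\<close>
  have \<gamma>00: "(LINT u|\<Omega>. D u) = 0"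
  proof -
    have "(\<lambda>n. LINT u|\<Omega>. complex_of_real (exp (- (1 / real (Suc n)) / 2 * nsq u)) * D u) \<longlonglongrightarrow> (LINT u|\<Omega>. D u)"
    proof (rule integral_dominated_convergence[where w="\<lambda>u. norm (D u)"])
      show "integrable \<Omega> (\<lambda>u. norm (D u))" using D by simp
      show "AE u in \<Omega>. (\<lambda>n. complex_of_real (exp (- (1 / real (Suc n)) / 2 * nsq u)) * D u) \<longlonglongrightarrow> D u"
      proof (rule AE_I2)
        fix u
        have "(\<lambda>n. complex_of_real (exp (- (1 / real (Suc n)) / 2 * nsq u)) * D u) \<longlonglongrightarrow> complex_of_real (exp (- 0 / 2 * nsq u)) * D u"
          by (intro tendsto_mult tendsto_of_real tendsto_exp tendsto_divide tendsto_minus tendsto_const LIMSEQ_Suc[OF lim_1_over_n]) simp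
        then show "(\<lambda>n. complex_of_real (exp (- (1 / real (Suc n)) / 2 * nsq u)) * D u) \<longlonglongrightarrow> D u" by simp
      qed
      show "AE u in \<Omega>. norm (complex_of_real (exp (- (1 / real (Suc n)) / 2 * nsq u)) * D u) \<le> norm (D u)" for n
      proof (rule AE_I2)
        fix u
        have "- (1 / real (Suc n)) / 2 * nsq u \<le> 0" using ip_nonneg[of S T u] by (intro mult_nonpos_nonneg) auto
        then have "norm (complex_of_real (exp (- (1 / real (Suc n)) / 2 * nsq u))) \<le> 1" by (simp del: of_nat_Suc)
        then show "norm (complex_of_real (exp (- (1 / real (Suc n)) / 2 * nsq u)) * D u) \<le> norm (D u)"
          unfolding norm_mult by (rule mult_left_le_one_le[rotated -1]) auto
      qed
    qed measurable
    moreover have "(LINT u|\<Omega>. complex_of_real (exp (- (1 / real (Suc n)) / 2 * nsq u)) * D u) = 0" for n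
    proof -
      have "l2_inner S T u (\<lambda>p. 0) = 0" for u by (simp add: l2_inner_def)
      then show ?thesis
        using \<gamma>0[of "1 / real (Suc n)" "\<lambda>p. 0"] L2_zero by (simp add: \<gamma>_def del: of_nat_Suc)
    qed
    ultimately show ?thesis by (simp add: LIMSEQ_const_iff)
  qed
  have g\<gamma>: "exp (- nsq (\<lambda>p. 1 * u p + (- 1) * w p) / 2) = exp (- nsq w / 2) * \<gamma> 1 w u"
    if "u \<in> L2 S T" "w \<in> L2 S T" for u w
    unfolding nsq_combination[OF that] \<gamma>_def by (simp add: exp_add[symmetric] field_simps)
  have list: "\<exists>C \<tau> w. \<tau> > 0 \<and> w \<in> L2 S T \<and> (\<forall>u\<in>L2 S T. (\<Prod>g\<leftarrow>gs. g u) = C * \<gamma> \<tau> w u)"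
    if "set gs \<subseteq> G" "gs \<noteq> []" for gs
    using that
  proof (induct gs)
    case (Cons g gs)
    then obtain w where w: "w \<in> L2 S T" "g = (\<lambda>u. exp (- nsq (\<lambda>p. 1 * u p + (- 1) * w p) / 2))" by (auto simp: G_def)
    show ?case
    proof (cases "gs = []")
      case True
      have "\<forall>u\<in>L2 S T. (\<Prod>g\<leftarrow>g # gs. g u) = exp (- nsq w / 2) * \<gamma> 1 w u"
        using True g\<gamma>[OF _ w(1)] by (simp add: w(2))
      then show ?thesis using w(1) zero_less_one by blast
    next
      case False
      then obtain C \<tau> v where v: "\<tau> > 0" "v \<in> L2 S T" "\<forall>u\<in>L2 S T. (\<Prod>g\<leftarrow>gs. g u) = C * \<gamma> \<tau> v u"
        using Cons by auto
      have "\<forall>u\<in>L2 S T. (\<Prod>g\<leftarrow>g # gs. g u) = (exp (- nsq w / 2) * C) * \<gamma> (1 + \<tau>) (\<lambda>p. w p + v p) u"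
      proof
        fix u assume u: "u \<in> L2 S T"
        have "\<gamma> (1 + \<tau>) (\<lambda>p. w p + v p) u = \<gamma> 1 w u * \<gamma> \<tau> v u"
          unfolding \<gamma>_def exp_add[symmetric] ip_add_right[OF w(1) v(2) u] by (simp add: field_simps)
        then show "(\<Prod>g\<leftarrow>g # gs. g u) = (exp (- nsq w / 2) * C) * \<gamma> (1 + \<tau>) (\<lambda>p. w p + v p) u"
          using v(3) u g\<gamma>[OF u w(1)] by (simp add: w(2))
      qed
      moreover have "1 + \<tau> > 0" using v(1) by simp
      ultimately show ?thesis using L2_add[OF w(1) v(2)] by blast
    qed
  qed simp
  have "\<exists>N. space N = space \<Omega> \<and> sets N \<subseteq> sets \<Omega> \<and> (\<forall>g\<in>G. g \<in> borel_measurable N) \<and>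
     (\<forall>A\<in>sets N. (LINT u|\<Omega>. indicator A u * D u) = 0)"
  proof (rule monotone_class_vanishing[OF D])
    fix g assume "g \<in> G"
    then obtain w where w: "w \<in> L2 S T" and g: "g = (\<lambda>u. exp (- nsq (\<lambda>p. 1 * u p + (- 1) * w p) / 2))" by (auto simp: G_def)
    have "(\<lambda>u. w) \<in> \<Omega> \<rightarrow>\<^sub>M LB" using w by simp
    from measurable_nsq[OF measurable_LB_combination[OF id this, of 1 "-1"]]
    show "g \<in> borel_measurable \<Omega>" unfolding g by measurable
    show "g u \<in> {0..1}" for u
      unfolding g using ip_nonneg[of S T "\<lambda>p. 1 * u p + (- 1) * w p"] by simp
  next
    fix gs assume gs: "set gs \<subseteq> G"
    show "(LINT u|\<Omega>. complex_of_real (\<Prod>g\<leftarrow>gs. g u) * D u) = 0"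
    proof (cases "gs = []")
      case True
      then show ?thesis using \<gamma>00 by simp
    next
      case False
      then obtain C \<tau> w where c: "\<tau> > 0" "w \<in> L2 S T" "\<forall>u\<in>L2 S T. (\<Prod>g\<leftarrow>gs. g u) = C * \<gamma> \<tau> w u"
        using list[OF gs] by blast
      have "(LINT u|\<Omega>. complex_of_real (\<Prod>g\<leftarrow>gs. g u) * D u) = (LINT u|\<Omega>. complex_of_real C * (complex_of_real (\<gamma> \<tau> w u) * D u))"
        using c(3) by (intro Bochner_Integration.integral_cong refl) (simp add: sp)
      then show ?thesis using \<gamma>0[OF c(1,2)] by simp
    qed
  qed
  then obtain N where N: "space N = space \<Omega>" "\<forall>g\<in>G. g \<in> borel_measurable N"
     "\<forall>A\<in>sets N. (LINT u|\<Omega>. indicator A u * D u) = 0" by blast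
  have nN: "(\<lambda>u. nsq (\<lambda>p. 1 * u p + (- 1) * w p)) \<in> borel_measurable N" if w: "w \<in> L2 S T" for w
  proof -
    have "(\<lambda>u. exp (- nsq (\<lambda>p. 1 * u p + (- 1) * w p) / 2)) \<in> borel_measurable N"
      using N(2) w unfolding G_def by blast
    then have "(\<lambda>u. - 2 * ln (exp (- nsq (\<lambda>p. 1 * u p + (- 1) * w p) / 2))) \<in> borel_measurable N"
      by (intro borel_measurable_times borel_measurable_const borel_measurable_ln)
    then show ?thesis by simp
  qed
  have "(\<lambda>u. u) \<in> N \<rightarrow>\<^sub>M LB"
  proof (rule measurable_borel_L2I[OF basis])
    show "u \<in> L2 S T" if "u \<in> space N" for u using that N(1) sp by simp
    fix j
    \<comment> \<open>Polarization recovers the coefficients from squared distances, which are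
      measurable for \<open>N\<close> as logarithms of members of \<open>G\<close>.\<close>
    have e: "l2_inner S T u (\<phi> j) = (nsq (\<lambda>p. 1 * u p + (- 1) * 0) - nsq (\<lambda>p. 1 * u p + (- 1) * \<phi> j p) + nsq (\<phi> j)) / 2"
      if "u \<in> space N" for u
    proof -
      have u: "u \<in> L2 S T" using that N(1) sp by simp
      show ?thesis unfolding nsq_combination[OF u basis_L2[OF basis]] by simp
    qed
    have "(\<lambda>u. (nsq (\<lambda>p. 1 * u p + (- 1) * 0) - nsq (\<lambda>p. 1 * u p + (- 1) * \<phi> j p) + nsq (\<phi> j)) / 2) \<in> borel_measurable N"
      by (intro borel_measurable_add borel_measurable_diff borel_measurable_divide borel_measurable_const nN L2_zero basis_L2[OF basis])
    then show "(\<lambda>u. l2_inner S T u (\<phi> j)) \<in> borel_measurable N"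
      by (subst measurable_cong[OF e])
  qed
  from measurable_sets[OF this A] have "A \<in> sets N"
    using sets.sets_into_space[OF A] N(1) sp by (simp add: Int_absorb2)
  then show ?thesis using N(3) by blast
qed

end

section \<open>Statements holding s-a.e., bounded multipliers, and functionals as averages of plane
  waves\<close>

lemma s_ae_mono: "s_ae W P \<Longrightarrow> (\<And>x. x \<in> space W \<Longrightarrow> P x \<Longrightarrow> Q x) \<Longrightarrow> s_ae W Q"
  unfolding s_ae_def by blast

lemma s_aeI: "(\<And>x. x \<in> space W \<Longrightarrow> P x) \<Longrightarrow> s_ae W P"
  unfolding s_ae_def by (intro exI[of _ "{}"]) (auto simp: scale_null_def)

lemma s_ae_conj:
  assumes "s_ae W P" "s_ae W Q"
  shows "s_ae W (\<lambda>x. P x \<and> Q x)"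
proof -
  obtain N where N: "scale_null W N" "\<And>x. x \<in> space W - N \<Longrightarrow> P x" using assms(1) unfolding s_ae_def by blast
  obtain N' where N': "scale_null W N'" "\<And>x. x \<in> space W - N' \<Longrightarrow> Q x" using assms(2) unfolding s_ae_def by blast
  have "scale_null W (N \<union> N')" using N(1) N'(1) by (auto simp: scale_null_def image_Un)
  then show ?thesis using N(2) N'(2) unfolding s_ae_def by (intro exI[of _ "N \<union> N'"]) auto
qed

text \<open>Multiplication by such a function maps \<open>L2 S T\<close> to itself and is measurable
  for \<open>borel_L2\<close>; members of \<open>Supp_BV\<close> and their quotients by sqrt 2 are
  of this kind.\<close>

definition bounded_multiplier :: "real \<Rightarrow> real \<Rightarrow> plane_fun \<Rightarrow> bool" where
  "bounded_multiplier S T h \<longleftrightarrow> h \<in> borel_measurable (area S T) \<and> (\<exists>B. \<forall>p\<in>rect S T. \<bar>h p\<bar> \<le> B)"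

lemma bounded_multiplier_Supp_BV:
  assumes S: "S > 0" and T: "T > 0" and h: "h \<in> Supp_BV S T"
  shows "bounded_multiplier S T h"
proof -
  have "bv_hardy_krause S T h" using h by (simp add: Supp_BV_def)
  from bv_hardy_krause_majorant[OF S T this] obtain w where w: "majorant S T h w" by blast
  show ?thesis
    unfolding bounded_multiplier_def using majorant_measurable[OF S T w] majorant_bounded[OF w] by blast
qed

lemma bounded_multiplier_over_sqrt2:
  assumes "bounded_multiplier S T h"
  shows "bounded_multiplier S T (over_sqrt2 h)"
proof -
  obtain B where B: "\<forall>p\<in>rect S T. \<bar>h p\<bar> \<le> B" using assms unfolding bounded_multiplier_def by blast
  then have "\<forall>p\<in>rect S T. \<bar>h p / sqrt 2\<bar> \<le> B / sqrt 2" by (simp add: abs_divide divide_right_mono)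
  moreover have "over_sqrt2 h \<in> borel_measurable (area S T)"
    using assms unfolding bounded_multiplier_def by (intro borel_measurable_divide) auto
  ultimately show ?thesis unfolding bounded_multiplier_def by blast
qed

context yeh_wiener_space
begin

lemma L2_multiplier: "bounded_multiplier S T h \<Longrightarrow> u \<in> L2 S T \<Longrightarrow> (\<lambda>p. u p * h p) \<in> L2 S T"
  unfolding bounded_multiplier_def using L2_bounded by blast

lemma measurable_LB_multiplier:
  assumes "\<theta> \<in> \<Omega> \<rightarrow>\<^sub>M LB" "bounded_multiplier S T h"
  shows "(\<lambda>\<omega> p. \<theta> \<omega> p * h p) \<in> \<Omega> \<rightarrow>\<^sub>M LB"
  using assms measurable_LB_mult unfolding bounded_multiplier_def by blast

text \<open>Over a common \<open>\<Omega>\<close> the difference of the two densities has vanishing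
  Fourier transform at almost every dilated path, for each dilation, and
  \<open>complex_measure_zeroI\<close> applies.\<close>

lemma representing_measure_unique:
  assumes f: "corresponds S T \<phi> W F f1" "corresponds S T \<phi> W F f2" and A: "A \<in> sets LB"
  shows "f1 A = f2 A"
proof -
  have cm: "complex_measure LB f1" "complex_measure LB f2" using f by (auto simp: corresponds_def)
  obtain \<Omega> D1 D2 where \<Omega>: "sets \<Omega> = sets LB" and r1: "represents LB f1 \<Omega> (\<lambda>x. x) D1" and r2: "represents LB f2 \<Omega> (\<lambda>x. x) D2"
    by (rule complex_measure_represents[OF cm])
  have fin: "finite_measure \<Omega>" and D1: "integrable \<Omega> D1" and D2: "integrable \<Omega> D2"
    using r1 r2 by (auto simp: represents_def)
  have id: "(\<lambda>u. u) \<in> LB \<rightarrow>\<^sub>M LB" by simp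
  have id\<Omega>: "(\<lambda>u. u) \<in> \<Omega> \<rightarrow>\<^sub>M LB" using measurable_ident_sets[OF \<Omega>] by simp
  have bd: "integrable \<Omega> (\<lambda>u. g u * E u)" if "integrable \<Omega> E" "g \<in> borel_measurable \<Omega>" "\<And>u. norm (g u) \<le> 1" for E g :: "_ \<Rightarrow> complex"
  proof (rule Bochner_Integration.integrable_bound[OF that(1)])
    show "(\<lambda>u. g u * E u) \<in> borel_measurable \<Omega>" using that(1,2) by measurable
    show "AE u in \<Omega>. norm (g u * E u) \<le> norm (E u)"
      using that(3) by (intro AE_I2) (simp add: norm_mult mult_left_le_one_le)
  qed
  have "(LINT u|\<Omega>. indicator A u * (D1 u - D2 u)) = 0"
  proof (rule complex_measure_zeroI[OF fin \<Omega> _ _ A])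
    show "integrable \<Omega> (\<lambda>u. D1 u - D2 u)" using D1 D2 by simp
    fix \<rho> :: real assume \<rho>: "\<rho> > 0"
    have "s_ae W (\<lambda>x. F x = complex_integral LB f1 (\<lambda>u. exp (\<i> * complex_of_real (pw u x))))"
      "s_ae W (\<lambda>x. F x = complex_integral LB f2 (\<lambda>u. exp (\<i> * complex_of_real (pw u x))))"
      using f by (auto simp: corresponds_def)
    from s_ae_scaled[OF this(1) \<rho>] s_ae_scaled[OF this(2) \<rho>] AE_space
    show "AE x in W. (LINT u|\<Omega>. exp (\<i> * complex_of_real (pw u (\<lambda>p. \<rho> * x p))) * (D1 u - D2 u)) = 0"
    proof eventually_elim
      case (elim x)
      define y where "y p = \<rho> * x p" for p
      have y: "y \<in> C0 S T" unfolding y_def[abs_def] using C0_scale elim(3) by (simp add: space_W)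
      have m: "(\<lambda>u. exp (\<i> * complex_of_real (pw u y))) \<in> borel_measurable LB"
        using pw_measurable[OF id y] by measurable
      have m\<Omega>: "(\<lambda>u. exp (\<i> * complex_of_real (pw u y))) \<in> borel_measurable \<Omega>"
        using pw_measurable[OF id\<Omega> y] by measurable
      have "complex_integral LB f1 (\<lambda>u. exp (\<i> * complex_of_real (pw u y))) = complex_integral LB f2 (\<lambda>u. exp (\<i> * complex_of_real (pw u y)))"
        using elim(1,2) unfolding y_def[abs_def] by (rule trans[OF sym])
      then have "(LINT u|\<Omega>. exp (\<i> * complex_of_real (pw u y)) * D1 u) = (LINT u|\<Omega>. exp (\<i> * complex_of_real (pw u y)) * D2 u)"
        using represents_complex_integral[OF r1 m, of 1] represents_complex_integral[OF r2 m, of 1] by simp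
      moreover have "(LINT u|\<Omega>. exp (\<i> * complex_of_real (pw u y)) * (D1 u - D2 u)) =
         (LINT u|\<Omega>. exp (\<i> * complex_of_real (pw u y)) * D1 u) - (LINT u|\<Omega>. exp (\<i> * complex_of_real (pw u y)) * D2 u)"
        unfolding right_diff_distrib
        by (intro Bochner_Integration.integral_diff bd D1 D2 m\<Omega>) simp_all
      ultimately show ?case by (simp add: y_def[abs_def])
    qed
  qed
  moreover have "(LINT u|\<Omega>. indicator A u * (D1 u - D2 u)) = (LINT u|\<Omega>. indicator A u * D1 u) - (LINT u|\<Omega>. indicator A u * D2 u)"
    unfolding right_diff_distrib
    using A \<Omega> by (intro Bochner_Integration.integral_diff bd D1 D2) (auto simp: indicator_def)
  moreover have "f1 A = (LINT u|\<Omega>. indicator A u * D1 u)" "f2 A = (LINT u|\<Omega>. indicator A u * D2 u)"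
    using r1 r2 A unfolding represents_def by blast+
  ultimately show ?thesis by simp
qed

text \<open>\<open>\<Omega>\<close> and \<open>\<theta>\<close> are kept through all transforms, which change only \<open>D\<close>.\<close>

definition fourier_rep :: "(plane_fun \<Rightarrow> complex) \<Rightarrow> 'b measure \<Rightarrow> ('b \<Rightarrow> plane_fun) \<Rightarrow> ('b \<Rightarrow> complex) \<Rightarrow> bool" where
  "fourier_rep F \<Omega> \<theta> D \<longleftrightarrow> finite_measure \<Omega> \<and> \<theta> \<in> \<Omega> \<rightarrow>\<^sub>M LB \<and> integrable \<Omega> D \<and>
     s_ae W (\<lambda>x. F x = (LINT \<omega>|\<Omega>. exp (\<i> * complex_of_real (pw (\<theta> \<omega>) x)) * D \<omega>))"

lemma fourier_repD:
  assumes "fourier_rep F \<Omega> \<theta> D"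
  shows "finite_measure \<Omega>" "\<theta> \<in> \<Omega> \<rightarrow>\<^sub>M LB" "integrable \<Omega> D"
    "s_ae W (\<lambda>x. F x = (LINT \<omega>|\<Omega>. exp (\<i> * complex_of_real (pw (\<theta> \<omega>) x)) * D \<omega>))"
  using assms by (auto simp: fourier_rep_def)

lemma fourier_rep_corresponds:
  assumes "fourier_rep F \<Omega> \<theta> D"
  defines "f \<equiv> \<lambda>A. LINT \<omega>|\<Omega>. indicator A (\<theta> \<omega>) * D \<omega>"
  shows "represents LB f \<Omega> \<theta> D" "corresponds S T \<phi> W F f"
proof -
  note r = fourier_repD[OF assms(1)]
  show R: "represents LB f \<Omega> \<theta> D" unfolding represents_def f_def using r(1-3) by blast
  have id: "(\<lambda>u. u) \<in> LB \<rightarrow>\<^sub>M LB" by simp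
  have "s_ae W (\<lambda>x. F x = complex_integral LB f (\<lambda>u. exp (\<i> * complex_of_real (pw u x))))"
  proof (rule s_ae_mono[OF r(4)])
    fix x assume x: "x \<in> space W" and e: "F x = (LINT \<omega>|\<Omega>. exp (\<i> * complex_of_real (pw (\<theta> \<omega>) x)) * D \<omega>)"
    have "(\<lambda>u. exp (\<i> * complex_of_real (pw u x))) \<in> borel_measurable LB"
      using pw_measurable[OF id x[unfolded space_W]] by measurable
    from represents_complex_integral[OF R this, of 1] show "F x = complex_integral LB f (\<lambda>u. exp (\<i> * complex_of_real (pw u x)))"
      by (simp add: e)
  qed
  then show "corresponds S T \<phi> W F f"
    using represents_complex_measure[OF R] by (simp add: corresponds_def)
qed

lemma corresponds_fourier_rep:
  assumes "corresponds S T \<phi> W F f"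
  shows "\<exists>\<Omega> D. fourier_rep F \<Omega> (\<lambda>u. u) D"
proof -
  have cm: "complex_measure LB f" using assms by (simp add: corresponds_def)
  obtain \<Omega> D where \<Omega>: "sets \<Omega> = sets LB" and R: "represents LB f \<Omega> (\<lambda>x. x) D"
    by (rule complex_measure_represents[OF cm cm])
  have id: "(\<lambda>u. u) \<in> LB \<rightarrow>\<^sub>M LB" by simp
  have "s_ae W (\<lambda>x. F x = complex_integral LB f (\<lambda>u. exp (\<i> * complex_of_real (pw u x))))"
    using assms by (simp add: corresponds_def)
  then have "s_ae W (\<lambda>x. F x = (LINT \<omega>|\<Omega>. exp (\<i> * complex_of_real (pw \<omega> x)) * D \<omega>))"
  proof (rule s_ae_mono)
    fix x assume x: "x \<in> space W" and e: "F x = complex_integral LB f (\<lambda>u. exp (\<i> * complex_of_real (pw u x)))"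
    have "(\<lambda>u. exp (\<i> * complex_of_real (pw u x))) \<in> borel_measurable LB"
      using pw_measurable[OF id x[unfolded space_W]] by measurable
    from represents_complex_integral[OF R this, of 1] show "F x = (LINT \<omega>|\<Omega>. exp (\<i> * complex_of_real (pw \<omega> x)) * D \<omega>)"
      by (simp add: e)
  qed
  then have "fourier_rep F \<Omega> (\<lambda>u. u) D"
    using R by (simp add: fourier_rep_def represents_def)
  then show ?thesis by blast
qed

text \<open>The measure chosen inside \<open>path_eval\<close> agrees on Borel sets with the one
  that \<open>\<theta>\<close> and \<open>D\<close> induce, so the value can be computed from
  whichever representation of \<open>F\<close> is at hand.\<close>

lemma path_eval_fourier_rep:
  assumes F: "fourier_rep F \<Omega> \<theta> D" and h: "bounded_multiplier S T h" and y: "y \<in> C0 S T" and x: "x \<in> C0 S T"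
  shows "path_eval S T \<phi> W F b y c h x =
    (LINT \<omega>|\<Omega>. exp (\<i> * complex_of_real (b * pw (\<theta> \<omega>) y + c * pw (\<lambda>p. \<theta> \<omega> p * h p) x)) * D \<omega>)"
proof -
  define f where "f A = (LINT \<omega>|\<Omega>. indicator A (\<theta> \<omega>) * D \<omega>)" for A
  have R: "represents LB f \<Omega> \<theta> D" and C: "corresponds S T \<phi> W F f"
    using fourier_rep_corresponds[OF F] unfolding f_def[abs_def] by blast+
  have id: "(\<lambda>u. u) \<in> LB \<rightarrow>\<^sub>M LB" by simp
  have m: "(\<lambda>u. exp (\<i> * complex_of_real (b * pw u y + c * pw (\<lambda>p. u p * h p) x))) \<in> borel_measurable LB"
    using pw_measurable[OF id y] pw_measurable[OF measurable_LB_multiplier[OF id h] x] by measurable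
  have "F \<in> SL2 S T \<phi> W" using C unfolding SL2_def by blast
  then have "path_eval S T \<phi> W F b y c h x = complex_integral LB (SOME f. corresponds S T \<phi> W F f)
    (\<lambda>u. exp (\<i> * complex_of_real (b * pw u y + c * pw (\<lambda>p. u p * h p) x)))"
    unfolding path_eval_def by (rule if_P)
  also have "complex_integral LB (SOME f. corresponds S T \<phi> W F f) = complex_integral LB f"
    by (rule complex_integral_cong_measure) (rule representing_measure_unique[OF someI[of "corresponds S T \<phi> W F", OF C] C])
  also have "complex_integral LB f (\<lambda>u. exp (\<i> * complex_of_real (b * pw u y + c * pw (\<lambda>p. u p * h p) x))) =
    (LINT \<omega>|\<Omega>. exp (\<i> * complex_of_real (b * pw (\<theta> \<omega>) y + c * pw (\<lambda>p. \<theta> \<omega> p * h p) x)) * D \<omega>)"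
    by (rule represents_complex_integral[OF R m, of 1]) simp
  finally show ?thesis .
qed

end

subsection \<open>Transforms and convolution products\<close>

lemma integral_pair_product:
  fixes f :: "'a \<Rightarrow> complex" and g :: "'b \<Rightarrow> complex"
  assumes fin: "finite_measure M" "finite_measure N" and f: "integrable M f" and g: "integrable N g"
  shows "integrable (M \<Otimes>\<^sub>M N) (\<lambda>z. f (fst z) * g (snd z))"
    and "(LINT z|(M \<Otimes>\<^sub>M N). f (fst z) * g (snd z)) = (LINT x|M. f x) * (LINT y|N. g y)"
proof -
  interpret M: finite_measure M by fact
  interpret N: finite_measure N by fact
  interpret P: pair_sigma_finite M N ..
  have [measurable]: "f \<in> borel_measurable M" "g \<in> borel_measurable N" using f g by auto
  show i: "integrable (M \<Otimes>\<^sub>M N) (\<lambda>z. f (fst z) * g (snd z))"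
  proof (rule P.Fubini_integrable)
    show "(\<lambda>z. f (fst z) * g (snd z)) \<in> borel_measurable (M \<Otimes>\<^sub>M N)" by measurable
    show "integrable M (\<lambda>x. LINT y|N. norm (f (fst (x, y)) * g (snd (x, y))))"
      using f by (simp add: norm_mult)
    show "AE x in M. integrable N (\<lambda>y. f (fst (x, y)) * g (snd (x, y)))"
      using g by simp
  qed
  have "(LINT z|(M \<Otimes>\<^sub>M N). f (fst z) * g (snd z)) = (LINT x|M. LINT y|N. f (fst (x, y)) * g (snd (x, y)))"
    by (rule P.integral_fst'[OF i, symmetric])
  then show "(LINT z|(M \<Otimes>\<^sub>M N). f (fst z) * g (snd z)) = (LINT x|M. f x) * (LINT y|N. g y)"
    by simp
qed

text \<open>The sign is that of the boundary values exp(- i m / q) of Gaussian averages. Unimodular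
  factors are written in this form so that products turn into sums of exponents.\<close>

definition phase :: "real \<Rightarrow> complex" where
  "phase t = exp (- \<i> * complex_of_real t)"

lemma norm_phase: "norm (phase t) = 1"
  by (simp add: phase_def)

lemma phase_add: "phase (s + t) = phase s * phase t"
  by (simp add: phase_def exp_add[symmetric] algebra_simps)

lemma phase_mult_left: "phase s * (phase t * z) = phase (s + t) * z"
  by (simp add: phase_add mult.assoc)

lemma phase_0: "phase 0 = 1"
  by (simp add: phase_def)

lemma exp_imaginary: "exp (\<i> * complex_of_real t) = phase (- t)"
  by (simp add: phase_def)

lemma measurable_phase: "t \<in> borel_measurable M \<Longrightarrow> (\<lambda>x. phase (t x)) \<in> borel_measurable M"
  unfolding phase_def by measurable

lemma integrable_phase:
  fixes D :: "'a \<Rightarrow> complex"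
  assumes D: "integrable M D" and t: "t \<in> borel_measurable M"
  shows "integrable M (\<lambda>x. phase (t x) * D x)"
proof (rule Bochner_Integration.integrable_bound[OF D])
  show "(\<lambda>x. phase (t x) * D x) \<in> borel_measurable M"
    by (intro borel_measurable_times measurable_phase t borel_measurable_integrable D)
qed (simp add: norm_mult norm_phase)

lemma s_ae_scale:
  assumes "s_ae W P" "\<rho> > 0" "\<And>x c. x \<in> space W \<Longrightarrow> (\<lambda>p. c * x p) \<in> space W"
  shows "s_ae W (\<lambda>x. P (\<lambda>p. \<rho> * x p))"
proof -
  obtain N where N: "scale_null W N" "\<And>x. x \<in> space W - N \<Longrightarrow> P x" using assms(1) unfolding s_ae_def by blast
  define N' where "N' = (\<lambda>x p. (1 / \<rho>) * x p) ` N"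
  have Ns: "N \<subseteq> space W" using N(1) by (simp add: scale_null_def)
  have "scale_null W N'"
    unfolding scale_null_def
  proof (intro conjI allI impI)
    show "N' \<subseteq> space W" using Ns assms(3) unfolding N'_def by blast
    fix r :: real assume "r > 0"
    then have "r / \<rho> > 0" using assms(2) by simp
    moreover have "(\<lambda>x p. r * x p) ` N' = (\<lambda>x p. (r / \<rho>) * x p) ` N"
      unfolding N'_def image_image by simp
    ultimately show "(\<lambda>x p. r * x p) ` N' \<in> null_sets W" using N(1) by (simp only: scale_null_def)
  qed
  moreover have "P (\<lambda>p. \<rho> * x p)" if "x \<in> space W - N'" for x
  proof (rule N(2))
    have "(\<lambda>p. \<rho> * x p) \<notin> N"
    proof
      assume "(\<lambda>p. \<rho> * x p) \<in> N"
      then have "(\<lambda>p. (1 / \<rho>) * (\<rho> * x p)) \<in> N'" unfolding N'_def by (rule imageI)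
      then show False using that assms(2) by simp
    qed
    then show "(\<lambda>p. \<rho> * x p) \<in> space W - N" using that assms(3) by blast
  qed
  ultimately show ?thesis unfolding s_ae_def by blast
qed

context yeh_wiener_space
begin

lemma s_ae_rescale: "s_ae W P \<Longrightarrow> \<rho> > 0 \<Longrightarrow> s_ae W (\<lambda>x. P (\<lambda>p. \<rho> * x p))"
  by (erule s_ae_scale) (simp_all add: space_W C0_scale)

lemma fourier_rep_iff_phase:
  "fourier_rep F \<Omega> \<theta> D \<longleftrightarrow> finite_measure \<Omega> \<and> \<theta> \<in> \<Omega> \<rightarrow>\<^sub>M LB \<and> integrable \<Omega> D \<and>
     s_ae W (\<lambda>x. F x = (LINT \<omega>|\<Omega>. phase (- pw (\<theta> \<omega>) x) * D \<omega>))"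
  unfolding fourier_rep_def exp_imaginary ..

lemma analytic_limit_phase:
  fixes \<Omega> :: "'b measure"
  assumes fin: "finite_measure \<Omega>" and D: "integrable \<Omega> D" and \<theta>: "\<theta> \<in> \<Omega> \<rightarrow>\<^sub>M LB" and \<eta>: "\<eta> \<in> \<Omega> \<rightarrow>\<^sub>M LB"
    and \<Phi>: "\<And>r x. r > 0 \<Longrightarrow> x \<in> C0 S T \<Longrightarrow>
      \<Phi> r x = (LINT \<omega>|\<Omega>. phase (- (1 / sqrt r * (a * pw (\<theta> \<omega>) x + b * pw (\<eta> \<omega>) x))) * D \<omega>)"
    and q: "q \<noteq> 0"
  shows "has_analytic_limit W q \<Phi> (LINT \<omega>|\<Omega>. phase (nsq (\<lambda>p. a * \<theta> \<omega> p + b * \<eta> \<omega> p) / 2 / q) * D \<omega>)"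
  unfolding phase_def
proof (rule analytic_limit_of_gaussian_kernel[OF prob_space_W fin D _ _ _ _ _ q])
  show "(\<lambda>\<omega>. nsq (\<lambda>p. a * \<theta> \<omega> p + b * \<eta> \<omega> p) / 2) \<in> borel_measurable \<Omega>"
    using measurable_nsq[OF measurable_LB_combination[OF \<theta> \<eta>]] by (intro borel_measurable_divide) auto
  show "0 \<le> nsq (\<lambda>p. a * \<theta> \<omega> p + b * \<eta> \<omega> p) / 2" for \<omega>
    using ip_nonneg by simp
  show "(\<lambda>z. a * pw (\<theta> (fst z)) (snd z) + b * pw (\<eta> (fst z)) (snd z)) \<in> borel_measurable (\<Omega> \<Otimes>\<^sub>M W)"
    by (intro borel_measurable_add borel_measurable_times borel_measurable_const pw_measurable_pair(1) \<theta> \<eta>)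
  show "\<Phi> r x = (LINT \<omega>|\<Omega>. exp (\<i> * complex_of_real (1 / sqrt r * (a * pw (\<theta> \<omega>) x + b * pw (\<eta> \<omega>) x))) * D \<omega>)"
    if "r > 0" "x \<in> space W" for r x
    unfolding exp_imaginary by (rule \<Phi>[OF that(1) that(2)[unfolded space_W]])
  fix \<omega> c assume \<omega>: "\<omega> \<in> space \<Omega>"
  have u: "\<theta> \<omega> \<in> L2 S T" "\<eta> \<omega> \<in> L2 S T"
    using measurable_LB_space[OF \<theta> \<omega>] measurable_LB_space[OF \<eta> \<omega>] by auto
  have "c * (a * s + b * t) = (c * a) * s + (c * b) * t" for s t by (simp add: algebra_simps)
  then have "(LINT x|W. exp (\<i> * complex_of_real (c * (a * pw (\<theta> \<omega>) x + b * pw (\<eta> \<omega>) x)))) =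
    (LINT x|W. exp (\<i> * complex_of_real ((c * a) * pw (\<theta> \<omega>) x + (c * b) * pw (\<eta> \<omega>) x)))" by (simp only:)
  also have "\<dots> = complex_of_real (exp (- nsq (\<lambda>p. (c * a) * \<theta> \<omega> p + (c * b) * \<eta> \<omega> p) / 2))"
    by (rule pw_combination_char[OF u])
  also have "- nsq (\<lambda>p. (c * a) * \<theta> \<omega> p + (c * b) * \<eta> \<omega> p) / 2 = - c\<^sup>2 * (nsq (\<lambda>p. a * \<theta> \<omega> p + b * \<eta> \<omega> p) / 2)"
    unfolding nsq_combination[OF u] by (simp add: field_simps power2_eq_square)
  finally show "(LINT x|W. exp (\<i> * complex_of_real (c * (a * pw (\<theta> \<omega>) x + b * pw (\<eta> \<omega>) x)))) =
    complex_of_real (exp (- c\<^sup>2 * (nsq (\<lambda>p. a * \<theta> \<omega> p + b * \<eta> \<omega> p) / 2)))" .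
qed

lemma has_transform_fourier_rep:
  assumes F: "fourier_rep F \<Omega> \<theta> D" and h: "bounded_multiplier S T h" and q: "q \<noteq> 0" and y: "y \<in> C0 S T"
  shows "has_transform S T \<phi> W q h F y
    (LINT \<omega>|\<Omega>. phase (nsq (\<lambda>p. \<theta> \<omega> p * h p) / 2 / q) * (phase (- pw (\<theta> \<omega>) y) * D \<omega>))"
proof -
  note r = fourier_repD[OF F]
  have m: "(\<lambda>\<omega> p. \<theta> \<omega> p * h p) \<in> \<Omega> \<rightarrow>\<^sub>M LB" by (rule measurable_LB_multiplier[OF r(2) h])
  have i: "integrable \<Omega> (\<lambda>\<omega>. phase (- pw (\<theta> \<omega>) y) * D \<omega>)"
    by (intro integrable_phase r(3) borel_measurable_uminus pw_measurable r(2) y)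
  have "has_analytic_limit W q (\<lambda>r x. path_eval S T \<phi> W F 1 y (1 / sqrt r) h x)
    (LINT \<omega>|\<Omega>. phase (nsq (\<lambda>p. 1 * (\<theta> \<omega> p * h p) + 0 * (\<theta> \<omega> p * h p)) / 2 / q) * (phase (- pw (\<theta> \<omega>) y) * D \<omega>))"
  proof (rule analytic_limit_phase[OF r(1) i m m _ q])
    show "path_eval S T \<phi> W F 1 y (1 / sqrt t) h x = (LINT \<omega>|\<Omega>. phase (- (1 / sqrt t * (1 * pw (\<lambda>p. \<theta> \<omega> p * h p) x +
       0 * pw (\<lambda>p. \<theta> \<omega> p * h p) x))) * (phase (- pw (\<theta> \<omega>) y) * D \<omega>))" if "x \<in> C0 S T" for t x
      unfolding path_eval_fourier_rep[OF F h y that] exp_imaginary phase_mult_left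
      by (intro Bochner_Integration.integral_cong refl arg_cong2[where f=times] arg_cong[where f=phase]) simp
  qed
  then show ?thesis unfolding has_transform_def by simp
qed

lemma transform_eq:
  assumes "has_transform S T \<phi> W q h F y c"
  shows "transform S T \<phi> W q h F y = c"
  unfolding transform_def
proof (rule the_equality)
  show "has_transform S T \<phi> W q h F y c" by (rule assms)
  show "c' = c" if "has_transform S T \<phi> W q h F y c'" for c'
    using has_analytic_limit_unique that assms unfolding has_transform_def by blast
qed

text \<open>The analytic limit exists at every path of \<open>C0 S T\<close>, so no exceptional set
  arises; the plane waves stay the same and only the density acquires a phase.\<close>

lemma fourier_rep_transform:
  assumes F: "fourier_rep F \<Omega> \<theta> D" and h: "bounded_multiplier S T h" and q: "q \<noteq> 0"
  shows "fourier_rep (transform S T \<phi> W q h F) \<Omega> \<theta> (\<lambda>\<omega>. phase (nsq (\<lambda>p. \<theta> \<omega> p * h p) / 2 / q) * D \<omega>)"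
  unfolding fourier_rep_iff_phase
proof (intro conjI)
  note r = fourier_repD[OF F]
  have m: "(\<lambda>\<omega>. nsq (\<lambda>p. \<theta> \<omega> p * h p) / 2 / q) \<in> borel_measurable \<Omega>"
    by (intro borel_measurable_divide borel_measurable_const measurable_nsq measurable_LB_multiplier r(2) h)
  show "finite_measure \<Omega>" "\<theta> \<in> \<Omega> \<rightarrow>\<^sub>M LB" using r by blast+
  show "integrable \<Omega> (\<lambda>\<omega>. phase (nsq (\<lambda>p. \<theta> \<omega> p * h p) / 2 / q) * D \<omega>)"
    by (rule integrable_phase[OF r(3) m])
  show "s_ae W (\<lambda>x. transform S T \<phi> W q h F x =
     (LINT \<omega>|\<Omega>. phase (- pw (\<theta> \<omega>) x) * (phase (nsq (\<lambda>p. \<theta> \<omega> p * h p) / 2 / q) * D \<omega>)))"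
    by (rule s_aeI) (simp add: transform_eq[OF has_transform_fourier_rep[OF F h q]] space_W mult_ac)
qed

lemma fourier_rep_iterated_transform:
  assumes F: "fourier_rep F \<Omega> \<theta> D" and q: "q \<noteq> 0"
    and hs: "\<forall>h\<in>set hs. bounded_multiplier S T h"
  shows "fourier_rep (iterated_transform S T \<phi> W q hs F) \<Omega> \<theta>
    (\<lambda>\<omega>. phase ((\<Sum>h\<leftarrow>hs. nsq (\<lambda>p. \<theta> \<omega> p * h p)) / 2 / q) * D \<omega>)"
  using F hs
proof (induct hs arbitrary: F D)
  case Nil
  then show ?case by (simp add: iterated_transform_def phase_0)
next
  case (Cons h hs)
  have "fourier_rep (transform S T \<phi> W q h F) \<Omega> \<theta> (\<lambda>\<omega>. phase (nsq (\<lambda>p. \<theta> \<omega> p * h p) / 2 / q) * D \<omega>)"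
    using Cons.prems by (intro fourier_rep_transform q) auto
  from Cons.hyps[OF this] Cons.prems(2)
  show ?case by (simp add: iterated_transform_def phase_mult_left add_divide_distrib add.commute)
qed

text \<open>The product of two averages is an average over pairs. The random path enters the second
  factor with a minus sign, hence the difference of the multiplied frequencies in the phase.\<close>

lemma has_convolution_fourier_rep:
  assumes E1: "fourier_rep E1 \<Omega>1 \<theta>1 D1" and E2: "fourier_rep E2 \<Omega>2 \<theta>2 D2"
    and k1: "bounded_multiplier S T k1" and k2: "bounded_multiplier S T k2" and q: "q \<noteq> 0" and y: "y \<in> C0 S T"
  shows "has_convolution S T \<phi> W q k1 k2 E1 E2 y
    (LINT z|(\<Omega>1 \<Otimes>\<^sub>M \<Omega>2).
       phase (nsq (\<lambda>p. (1 / sqrt 2) * (\<theta>1 (fst z) p * k1 p) + (- 1 / sqrt 2) * (\<theta>2 (snd z) p * k2 p)) / 2 / q) *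
       (phase (- (1 / sqrt 2 * pw (\<theta>1 (fst z)) y + 1 / sqrt 2 * pw (\<theta>2 (snd z)) y)) * (D1 (fst z) * D2 (snd z))))"
  unfolding has_convolution_def
proof -
  note r1 = fourier_repD[OF E1] and r2 = fourier_repD[OF E2]
  let ?\<Omega> = "\<Omega>1 \<Otimes>\<^sub>M \<Omega>2"
  have fin: "finite_measure ?\<Omega>" by (rule finite_measure_pair_measure[OF r2(1) r1(1)])
  have t1: "(\<lambda>z. \<theta>1 (fst z)) \<in> ?\<Omega> \<rightarrow>\<^sub>M LB" by (rule measurable_compose[OF measurable_fst r1(2)])
  have t2: "(\<lambda>z. \<theta>2 (snd z)) \<in> ?\<Omega> \<rightarrow>\<^sub>M LB" by (rule measurable_compose[OF measurable_snd r2(2)])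
  have m1: "(\<lambda>z p. \<theta>1 (fst z) p * k1 p) \<in> ?\<Omega> \<rightarrow>\<^sub>M LB" by (rule measurable_LB_multiplier[OF t1 k1])
  have m2: "(\<lambda>z p. \<theta>2 (snd z) p * k2 p) \<in> ?\<Omega> \<rightarrow>\<^sub>M LB" by (rule measurable_LB_multiplier[OF t2 k2])
  have i: "integrable ?\<Omega> (\<lambda>z. phase (- (1 / sqrt 2 * pw (\<theta>1 (fst z)) y + 1 / sqrt 2 * pw (\<theta>2 (snd z)) y)) * (D1 (fst z) * D2 (snd z)))"
    by (intro integrable_phase integral_pair_product(1) r1 r2 borel_measurable_uminus borel_measurable_add
      borel_measurable_times borel_measurable_const pw_measurable t1 t2 y)
  show "has_analytic_limit W q
       (\<lambda>r x. path_eval S T \<phi> W E1 (1 / sqrt 2) y (1 / sqrt r / sqrt 2) k1 x *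
              path_eval S T \<phi> W E2 (1 / sqrt 2) y (- (1 / sqrt r / sqrt 2)) k2 x)
    (LINT z|?\<Omega>.
       phase (nsq (\<lambda>p. (1 / sqrt 2) * (\<theta>1 (fst z) p * k1 p) + (- 1 / sqrt 2) * (\<theta>2 (snd z) p * k2 p)) / 2 / q) *
       (phase (- (1 / sqrt 2 * pw (\<theta>1 (fst z)) y + 1 / sqrt 2 * pw (\<theta>2 (snd z)) y)) * (D1 (fst z) * D2 (snd z))))"
  proof (rule analytic_limit_phase[OF fin i m1 m2 _ q])
    fix t :: real and x assume x: "x \<in> C0 S T"
    define a where "a \<omega> = - (1 / sqrt 2 * pw (\<theta>1 \<omega>) y + 1 / sqrt t / sqrt 2 * pw (\<lambda>p. \<theta>1 \<omega> p * k1 p) x)" for \<omega>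
    define b where "b \<omega> = - (1 / sqrt 2 * pw (\<theta>2 \<omega>) y + - (1 / sqrt t / sqrt 2) * pw (\<lambda>p. \<theta>2 \<omega> p * k2 p) x)" for \<omega>
    have "integrable \<Omega>1 (\<lambda>\<omega>. phase (a \<omega>) * D1 \<omega>)" unfolding a_def
      by (intro integrable_phase r1 borel_measurable_uminus borel_measurable_add
        borel_measurable_times borel_measurable_const pw_measurable measurable_LB_multiplier k1 x y)
    moreover have "integrable \<Omega>2 (\<lambda>\<omega>. phase (b \<omega>) * D2 \<omega>)" unfolding b_def
      by (intro integrable_phase r2 borel_measurable_uminus borel_measurable_add
        borel_measurable_times borel_measurable_const pw_measurable measurable_LB_multiplier k2 x y)
    ultimately have "(LINT z|?\<Omega>. (phase (a (fst z)) * D1 (fst z)) * (phase (b (snd z)) * D2 (snd z))) =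
      (LINT \<omega>|\<Omega>1. phase (a \<omega>) * D1 \<omega>) * (LINT \<omega>|\<Omega>2. phase (b \<omega>) * D2 \<omega>)"
      by (rule integral_pair_product(2)[OF r1(1) r2(1)])
    moreover have "path_eval S T \<phi> W E1 (1 / sqrt 2) y (1 / sqrt t / sqrt 2) k1 x = (LINT \<omega>|\<Omega>1. phase (a \<omega>) * D1 \<omega>)"
      unfolding path_eval_fourier_rep[OF E1 k1 y x] exp_imaginary a_def ..
    moreover have "path_eval S T \<phi> W E2 (1 / sqrt 2) y (- (1 / sqrt t / sqrt 2)) k2 x = (LINT \<omega>|\<Omega>2. phase (b \<omega>) * D2 \<omega>)"
      unfolding path_eval_fourier_rep[OF E2 k2 y x] exp_imaginary b_def ..
    moreover have "(phase (a (fst z)) * D1 (fst z)) * (phase (b (snd z)) * D2 (snd z)) =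
      phase (- (1 / sqrt t * (1 / sqrt 2 * pw (\<lambda>p. \<theta>1 (fst z) p * k1 p) x + - 1 / sqrt 2 * pw (\<lambda>p. \<theta>2 (snd z) p * k2 p) x))) *
      (phase (- (1 / sqrt 2 * pw (\<theta>1 (fst z)) y + 1 / sqrt 2 * pw (\<theta>2 (snd z)) y)) * (D1 (fst z) * D2 (snd z)))" for z
    proof -
      have "(phase (a (fst z)) * D1 (fst z)) * (phase (b (snd z)) * D2 (snd z)) = phase (a (fst z) + b (snd z)) * (D1 (fst z) * D2 (snd z))"
        by (simp add: phase_add mult_ac)
      also have "a (fst z) + b (snd z) = - (1 / sqrt t * (1 / sqrt 2 * pw (\<lambda>p. \<theta>1 (fst z) p * k1 p) x + - 1 / sqrt 2 * pw (\<lambda>p. \<theta>2 (snd z) p * k2 p) x))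
        + - (1 / sqrt 2 * pw (\<theta>1 (fst z)) y + 1 / sqrt 2 * pw (\<theta>2 (snd z)) y)"
        unfolding a_def b_def by (simp add: algebra_simps)
      finally show ?thesis by (simp only: phase_mult_left)
    qed
    ultimately show "path_eval S T \<phi> W E1 (1 / sqrt 2) y (1 / sqrt t / sqrt 2) k1 x *
              path_eval S T \<phi> W E2 (1 / sqrt 2) y (- (1 / sqrt t / sqrt 2)) k2 x =
      (LINT z|?\<Omega>. phase (- (1 / sqrt t * (1 / sqrt 2 * pw (\<lambda>p. \<theta>1 (fst z) p * k1 p) x + - 1 / sqrt 2 * pw (\<lambda>p. \<theta>2 (snd z) p * k2 p) x))) *
      (phase (- (1 / sqrt 2 * pw (\<theta>1 (fst z)) y + 1 / sqrt 2 * pw (\<theta>2 (snd z)) y)) * (D1 (fst z) * D2 (snd z))))"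
      by simp
  qed
qed

lemma s_ae_pw_combination:
  assumes fin: "finite_measure \<Omega>" and \<theta>: "\<theta> \<in> \<Omega> \<rightarrow>\<^sub>M LB" and \<eta>: "\<eta> \<in> \<Omega> \<rightarrow>\<^sub>M LB"
  shows "s_ae W (\<lambda>x. AE \<omega> in \<Omega>. pw (\<lambda>p. a * \<theta> \<omega> p + b * \<eta> \<omega> p) x = a * pw (\<theta> \<omega>) x + b * pw (\<eta> \<omega>) x)"
proof (rule s_ae_mono[OF s_ae_conj[OF s_ae_conv[OF fin \<theta>] s_ae_conv[OF fin \<eta>]]], elim conjE)
  fix x assume x: "x \<in> space W" and c: "AE \<omega> in \<Omega>. conv (\<theta> \<omega>) x" "AE \<omega> in \<Omega>. conv (\<eta> \<omega>) x"
  show "AE \<omega> in \<Omega>. pw (\<lambda>p. a * \<theta> \<omega> p + b * \<eta> \<omega> p) x = a * pw (\<theta> \<omega>) x + b * pw (\<eta> \<omega>) x"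
    using c AE_space
  proof eventually_elim
    case (elim \<omega>)
    then show ?case using x measurable_LB_space[OF \<theta>] measurable_LB_space[OF \<eta>]
      by (intro pw_combination(2)) (auto simp: space_W)
  qed
qed

text \<open>The pair (u, v) contributes the frequency (u + v) / sqrt 2. Exceptional sets enter
  through dilation of the path and through additivity of \<open>pw\<close> in its first argument; an
  s-a.e. representation of \<open>F\<close> and \<open>G\<close> permits the dilation by
  \<open>1 / sqrt 2\<close>.\<close>

lemma fourier_rep_product:
  assumes F: "fourier_rep F \<Omega>1 \<theta>1 D1" and G: "fourier_rep G \<Omega>2 \<theta>2 D2"
  shows "fourier_rep (\<lambda>x. F (\<lambda>p. x p / sqrt 2) * G (\<lambda>p. x p / sqrt 2)) (\<Omega>1 \<Otimes>\<^sub>M \<Omega>2)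
    (\<lambda>z p. 1 / sqrt 2 * \<theta>1 (fst z) p + 1 / sqrt 2 * \<theta>2 (snd z) p) (\<lambda>z. D1 (fst z) * D2 (snd z))"
  unfolding fourier_rep_iff_phase
proof (intro conjI)
  note r1 = fourier_repD(1-3)[OF F] and r2 = fourier_repD(1-3)[OF G]
  let ?\<Omega> = "\<Omega>1 \<Otimes>\<^sub>M \<Omega>2"
  show fin: "finite_measure ?\<Omega>" by (rule finite_measure_pair_measure[OF r2(1) r1(1)])
  have t1: "(\<lambda>z. \<theta>1 (fst z)) \<in> ?\<Omega> \<rightarrow>\<^sub>M LB" by (rule measurable_compose[OF measurable_fst r1(2)])
  have t2: "(\<lambda>z. \<theta>2 (snd z)) \<in> ?\<Omega> \<rightarrow>\<^sub>M LB" by (rule measurable_compose[OF measurable_snd r2(2)])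
  show t: "(\<lambda>z p. 1 / sqrt 2 * \<theta>1 (fst z) p + 1 / sqrt 2 * \<theta>2 (snd z) p) \<in> ?\<Omega> \<rightarrow>\<^sub>M LB"
    by (rule measurable_LB_combination[OF t1 t2])
  show D: "integrable ?\<Omega> (\<lambda>z. D1 (fst z) * D2 (snd z))"
    by (rule integral_pair_product(1)[OF r1(1) r2(1) r1(3) r2(3)])
  have pos: "1 / sqrt 2 > (0::real)" by simp
  have "s_ae W (\<lambda>x. F x = (LINT \<omega>|\<Omega>1. phase (- pw (\<theta>1 \<omega>) x) * D1 \<omega>))"
    "s_ae W (\<lambda>x. G x = (LINT \<omega>|\<Omega>2. phase (- pw (\<theta>2 \<omega>) x) * D2 \<omega>))"
    using F G by (auto simp: fourier_rep_iff_phase)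
  note FG = s_ae_conj[OF s_ae_rescale[OF this(1) pos] s_ae_rescale[OF this(2) pos]]
  note cv = s_ae_conj[OF s_ae_conv[OF r1(1,2)] s_ae_conv[OF r2(1,2)]]
  show "s_ae W (\<lambda>x. F (\<lambda>p. x p / sqrt 2) * G (\<lambda>p. x p / sqrt 2) =
    (LINT z|?\<Omega>. phase (- pw (\<lambda>p. 1 / sqrt 2 * \<theta>1 (fst z) p + 1 / sqrt 2 * \<theta>2 (snd z) p) x) * (D1 (fst z) * D2 (snd z))))"
    using s_ae_conj[OF s_ae_conj[OF FG cv] s_ae_pw_combination[OF fin t1 t2, of "1 / sqrt 2" "1 / sqrt 2"]]
  proof (rule s_ae_mono, elim conjE)
    fix x assume xW: "x \<in> space W"
      and FGx: "F (\<lambda>p. (1 / sqrt 2) * x p) = (LINT \<omega>|\<Omega>1. phase (- pw (\<theta>1 \<omega>) (\<lambda>p. (1 / sqrt 2) * x p)) * D1 \<omega>)"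
        "G (\<lambda>p. (1 / sqrt 2) * x p) = (LINT \<omega>|\<Omega>2. phase (- pw (\<theta>2 \<omega>) (\<lambda>p. (1 / sqrt 2) * x p)) * D2 \<omega>)"
      and c1: "AE \<omega> in \<Omega>1. conv (\<theta>1 \<omega>) x" and c2: "AE \<omega> in \<Omega>2. conv (\<theta>2 \<omega>) x"
      and comb: "AE z in ?\<Omega>. pw (\<lambda>p. 1 / sqrt 2 * \<theta>1 (fst z) p + 1 / sqrt 2 * \<theta>2 (snd z) p) x =
        1 / sqrt 2 * pw (\<theta>1 (fst z)) x + 1 / sqrt 2 * pw (\<theta>2 (snd z)) x"
    have x: "x \<in> C0 S T" using xW by (simp add: space_W)
    have scaled: "(LINT \<omega>|\<Omega>. phase (- pw (\<theta> \<omega>) (\<lambda>p. (1 / sqrt 2) * x p)) * D \<omega>) = (LINT \<omega>|\<Omega>. phase (- (1 / sqrt 2 * pw (\<theta> \<omega>) x)) * D \<omega>)"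
      if r: "\<theta> \<in> \<Omega> \<rightarrow>\<^sub>M LB" "integrable \<Omega> D" and c: "AE \<omega> in \<Omega>. conv (\<theta> \<omega>) x" for \<Omega> :: "'z measure" and \<theta> D
    proof (rule integral_cong_AE)
      show "(\<lambda>\<omega>. phase (- pw (\<theta> \<omega>) (\<lambda>p. (1 / sqrt 2) * x p)) * D \<omega>) \<in> borel_measurable \<Omega>"
        by (intro borel_measurable_times measurable_phase borel_measurable_uminus pw_measurable C0_scale x r borel_measurable_integrable)
      show "(\<lambda>\<omega>. phase (- (1 / sqrt 2 * pw (\<theta> \<omega>) x)) * D \<omega>) \<in> borel_measurable \<Omega>"
        by (intro borel_measurable_times measurable_phase borel_measurable_uminus borel_measurable_const pw_measurable x r borel_measurable_integrable)
      show "AE \<omega> in \<Omega>. phase (- pw (\<theta> \<omega>) (\<lambda>p. (1 / sqrt 2) * x p)) * D \<omega> = phase (- (1 / sqrt 2 * pw (\<theta> \<omega>) x)) * D \<omega>"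
        using c
      proof eventually_elim
        case (elim \<omega>)
        show ?case unfolding pw_scale(2)[OF x elim] ..
      qed
    qed
    have i: "integrable \<Omega> (\<lambda>\<omega>. phase (- (1 / sqrt 2 * pw (\<theta> \<omega>) x)) * D \<omega>)"
      if r: "\<theta> \<in> \<Omega> \<rightarrow>\<^sub>M LB" "integrable \<Omega> D" for \<Omega> :: "'z measure" and \<theta> D
      by (intro integrable_phase r borel_measurable_uminus borel_measurable_times borel_measurable_const pw_measurable x)
    have "F (\<lambda>p. (1 / sqrt 2) * x p) * G (\<lambda>p. (1 / sqrt 2) * x p) =
      (LINT \<omega>|\<Omega>1. phase (- (1 / sqrt 2 * pw (\<theta>1 \<omega>) x)) * D1 \<omega>) * (LINT \<omega>|\<Omega>2. phase (- (1 / sqrt 2 * pw (\<theta>2 \<omega>) x)) * D2 \<omega>)"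
      unfolding FGx by (intro arg_cong2[where f=times] scaled r1 r2 c1 c2)
    also have "\<dots> = (LINT z|?\<Omega>. (phase (- (1 / sqrt 2 * pw (\<theta>1 (fst z)) x)) * D1 (fst z)) * (phase (- (1 / sqrt 2 * pw (\<theta>2 (snd z)) x)) * D2 (snd z)))"
      by (rule integral_pair_product(2)[symmetric, OF r1(1) r2(1)]) (intro i r1 r2)+
    also have "\<dots> = (LINT z|?\<Omega>. phase (- pw (\<lambda>p. 1 / sqrt 2 * \<theta>1 (fst z) p + 1 / sqrt 2 * \<theta>2 (snd z) p) x) * (D1 (fst z) * D2 (snd z)))"
    proof (rule integral_cong_AE)
      show "(\<lambda>z. (phase (- (1 / sqrt 2 * pw (\<theta>1 (fst z)) x)) * D1 (fst z)) * (phase (- (1 / sqrt 2 * pw (\<theta>2 (snd z)) x)) * D2 (snd z))) \<in> borel_measurable ?\<Omega>"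
        by (intro borel_measurable_integrable integral_pair_product(1) i r1 r2)
      show "(\<lambda>z. phase (- pw (\<lambda>p. 1 / sqrt 2 * \<theta>1 (fst z) p + 1 / sqrt 2 * \<theta>2 (snd z) p) x) * (D1 (fst z) * D2 (snd z))) \<in> borel_measurable ?\<Omega>"
        by (intro borel_measurable_integrable integrable_phase D borel_measurable_uminus pw_measurable t x)
      show "AE z in ?\<Omega>. (phase (- (1 / sqrt 2 * pw (\<theta>1 (fst z)) x)) * D1 (fst z)) * (phase (- (1 / sqrt 2 * pw (\<theta>2 (snd z)) x)) * D2 (snd z)) =
        phase (- pw (\<lambda>p. 1 / sqrt 2 * \<theta>1 (fst z) p + 1 / sqrt 2 * \<theta>2 (snd z) p) x) * (D1 (fst z) * D2 (snd z))"
        using comb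
      proof eventually_elim
        case (elim z)
        show ?case unfolding elim minus_add_distrib phase_add by (simp only: mult_ac)
      qed
    qed
    finally show "F (\<lambda>p. x p / sqrt 2) * G (\<lambda>p. x p / sqrt 2) =
      (LINT z|?\<Omega>. phase (- pw (\<lambda>p. 1 / sqrt 2 * \<theta>1 (fst z) p + 1 / sqrt 2 * \<theta>2 (snd z) p) x) * (D1 (fst z) * D2 (snd z)))"
      by simp
  qed
qed

section \<open>The identity of the phases\<close>

lemma ip_multiplier_sum_squares:
  assumes u: "u \<in> L2 S T" and hs: "\<forall>h\<in>set hs. bounded_multiplier S T h"
    and ae: "AE p in area S T. (s p)\<^sup>2 = (\<Sum>h\<leftarrow>hs. (h p)\<^sup>2)" and s: "bounded_multiplier S T s"
  shows "nsq (\<lambda>p. u p * s p) = (\<Sum>h\<leftarrow>hs. nsq (\<lambda>p. u p * h p))"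
proof -
  have meas: "(\<lambda>p. (u p * s p) * (u p * s p)) \<in> borel_measurable (area S T)"
    by (intro borel_measurable_integrable L2_product L2_multiplier u s)
  have sum: "integrable (area S T) (\<lambda>p. \<Sum>h\<leftarrow>hs. (u p * h p) * (u p * h p)) \<and>
    (LINT p|area S T. (\<Sum>h\<leftarrow>hs. (u p * h p) * (u p * h p))) = (\<Sum>h\<leftarrow>hs. nsq (\<lambda>p. u p * h p))"
    using hs
  proof (induct hs)
    case (Cons h hs)
    have "integrable (area S T) (\<lambda>p. (u p * h p) * (u p * h p))"
      using Cons.prems by (intro L2_product L2_multiplier u) auto
    with Cons show ?case by (simp add: l2_inner_def)
  qed simp
  have "nsq (\<lambda>p. u p * s p) = (LINT p|area S T. (\<Sum>h\<leftarrow>hs. (u p * h p) * (u p * h p)))"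
    unfolding l2_inner_def
  proof (rule integral_cong_AE[OF meas])
    show "(\<lambda>p. \<Sum>h\<leftarrow>hs. (u p * h p) * (u p * h p)) \<in> borel_measurable (area S T)"
      using sum by (intro borel_measurable_integrable) simp
    show "AE p in area S T. (u p * s p) * (u p * s p) = (\<Sum>h\<leftarrow>hs. (u p * h p) * (u p * h p))"
      using ae
    proof eventually_elim
      case (elim p)
      have "(u p * s p) * (u p * s p) = (u p)\<^sup>2 * (s p)\<^sup>2" by (simp add: power2_eq_square mult_ac)
      also have "\<dots> = (\<Sum>h\<leftarrow>hs. (u p * h p) * (u p * h p))"
        unfolding elim sum_list_const_mult[symmetric]
        by (intro arg_cong[where f=sum_list] map_cong refl) (simp add: power2_eq_square mult_ac)
      finally show ?case .
    qed
  qed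
  with sum show ?thesis by simp
qed

lemma nsq_over_sqrt2: "nsq (\<lambda>p. u p * over_sqrt2 h p) = nsq (\<lambda>p. u p * h p) / 2"
proof -
  have "nsq (\<lambda>p. u p * over_sqrt2 h p) = (LINT p|area S T. (1 / 2) * ((u p * h p) * (u p * h p)))"
    unfolding l2_inner_def by (intro Bochner_Integration.integral_cong refl) (simp add: field_simps)
  then show ?thesis by (simp add: l2_inner_def)
qed

lemma nsq_map_over_sqrt2:
  "(\<Sum>h\<leftarrow>map over_sqrt2 hs. nsq (\<lambda>p. u p * h p)) = (\<Sum>h\<leftarrow>hs. nsq (\<lambda>p. u p * h p)) / 2"
  by (induct hs) (simp_all only: list.map sum_list.Nil sum_list.Cons nsq_over_sqrt2 add_divide_distrib div_0)

text \<open>Since \<open>s\<^sup>2 = k\<^sub>1 k\<^sub>2\<close>, the cross term of the convolution product is the cross term of the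
  transform of the product.\<close>

lemma phase_exponent:
  assumes u: "u \<in> L2 S T" and v: "v \<in> L2 S T" and hs: "\<forall>h\<in>set hs. bounded_multiplier S T h"
    and bm: "bounded_multiplier S T s" "bounded_multiplier S T k1" "bounded_multiplier S T k2"
    and ss: "AE p in area S T. (s p)\<^sup>2 = (\<Sum>h\<leftarrow>hs. (h p)\<^sup>2)" and sk: "AE p in area S T. (s p)\<^sup>2 = k1 p * k2 p"
  shows "nsq (\<lambda>p. (1 / sqrt 2 * u p + 1 / sqrt 2 * v p) * s p) / 2 =
    ((\<Sum>h\<leftarrow>hs. nsq (\<lambda>p. u p * h p)) + nsq (\<lambda>p. u p * k1 p)) / 4 +
    ((\<Sum>h\<leftarrow>hs. nsq (\<lambda>p. v p * h p)) + nsq (\<lambda>p. v p * k2 p)) / 4 -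
    nsq (\<lambda>p. 1 / sqrt 2 * (u p * k1 p) + (- 1 / sqrt 2) * (v p * k2 p)) / 2"
proof -
  have L: "(\<lambda>p. u p * s p) \<in> L2 S T" "(\<lambda>p. v p * s p) \<in> L2 S T" "(\<lambda>p. u p * k1 p) \<in> L2 S T" "(\<lambda>p. v p * k2 p) \<in> L2 S T"
    by (intro L2_multiplier bm u v)+
  have e: "(\<lambda>p. (1 / sqrt 2 * u p + 1 / sqrt 2 * v p) * s p) = (\<lambda>p. 1 / sqrt 2 * (u p * s p) + 1 / sqrt 2 * (v p * s p))"
    by (simp add: algebra_simps)
  have cross: "l2_inner S T (\<lambda>p. u p * s p) (\<lambda>p. v p * s p) = l2_inner S T (\<lambda>p. u p * k1 p) (\<lambda>p. v p * k2 p)"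
    unfolding l2_inner_def
  proof (rule integral_cong_AE)
    show "(\<lambda>p. u p * s p * (v p * s p)) \<in> borel_measurable (area S T)"
      "(\<lambda>p. u p * k1 p * (v p * k2 p)) \<in> borel_measurable (area S T)"
      by (intro borel_measurable_integrable L2_product L)+
    show "AE p in area S T. u p * s p * (v p * s p) = u p * k1 p * (v p * k2 p)"
      using sk
    proof eventually_elim
      case (elim p)
      have "u p * s p * (v p * s p) = u p * v p * (s p)\<^sup>2" by (simp add: power2_eq_square mult_ac)
      then show ?case by (simp add: elim mult_ac)
    qed
  qed
  have half: "(1 / sqrt 2)\<^sup>2 = (1 / 2 :: real)" "(- 1 / sqrt 2)\<^sup>2 = (1 / 2 :: real)"
    "2 * (1 / sqrt 2) * (1 / sqrt 2) = (1::real)" "2 * (1 / sqrt 2) * (- 1 / sqrt 2) = (- 1::real)"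
    by (simp_all add: power_divide)
  show ?thesis
    unfolding e nsq_combination[OF L(1,2)] nsq_combination[OF L(3,4)] half cross
      ip_multiplier_sum_squares[OF u hs ss bm(1)] ip_multiplier_sum_squares[OF v hs ss bm(1)]
    by (simp add: field_simps)
qed

text \<open>The convolution product is taken at \<open>- q\<close>, so its phase is subtracted from
  the exponents \<open>a\<close> and \<open>b\<close> of the two factors. These are left general in
  order to cover both the iterated and the combined transforms.\<close>

lemma convolution_of_transforms:
  assumes F: "fourier_rep F \<Omega>1 \<theta>1 D1" and G: "fourier_rep G \<Omega>2 \<theta>2 D2"
    and E: "fourier_rep E \<Omega>1 \<theta>1 (\<lambda>\<omega>. phase (a \<omega> / q) * D1 \<omega>)" and E': "fourier_rep E' \<Omega>2 \<theta>2 (\<lambda>\<omega>. phase (b \<omega> / q) * D2 \<omega>)"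
    and k1: "bounded_multiplier S T k1" and k2: "bounded_multiplier S T k2" and s: "bounded_multiplier S T s"
    and q: "q \<noteq> 0" and y: "y \<in> C0 S T"
    and exponent: "\<And>\<omega>1 \<omega>2. \<omega>1 \<in> space \<Omega>1 \<Longrightarrow> \<omega>2 \<in> space \<Omega>2 \<Longrightarrow>
      nsq (\<lambda>p. (1 / sqrt 2 * \<theta>1 \<omega>1 p + 1 / sqrt 2 * \<theta>2 \<omega>2 p) * s p) / 2 =
      a \<omega>1 + b \<omega>2 - nsq (\<lambda>p. 1 / sqrt 2 * (\<theta>1 \<omega>1 p * k1 p) + (- 1 / sqrt 2) * (\<theta>2 \<omega>2 p * k2 p)) / 2"
  shows "has_convolution S T \<phi> W (- q) k1 k2 E E' y
    (LINT z|(\<Omega>1 \<Otimes>\<^sub>M \<Omega>2). phase (nsq (\<lambda>p. (1 / sqrt 2 * \<theta>1 (fst z) p + 1 / sqrt 2 * \<theta>2 (snd z) p) * s p) / 2 / q) *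
       (phase (- (1 / sqrt 2 * pw (\<theta>1 (fst z)) y + 1 / sqrt 2 * pw (\<theta>2 (snd z)) y)) * (D1 (fst z) * D2 (snd z))))"
proof -
  have "- q \<noteq> 0" using q by simp
  note c = has_convolution_fourier_rep[OF E E' k1 k2 this y]
  have "(LINT z|(\<Omega>1 \<Otimes>\<^sub>M \<Omega>2).
       phase (nsq (\<lambda>p. (1 / sqrt 2) * (\<theta>1 (fst z) p * k1 p) + (- 1 / sqrt 2) * (\<theta>2 (snd z) p * k2 p)) / 2 / - q) *
       (phase (- (1 / sqrt 2 * pw (\<theta>1 (fst z)) y + 1 / sqrt 2 * pw (\<theta>2 (snd z)) y)) *
        ((phase (a (fst z) / q) * D1 (fst z)) * (phase (b (snd z) / q) * D2 (snd z))))) =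
    (LINT z|(\<Omega>1 \<Otimes>\<^sub>M \<Omega>2). phase (nsq (\<lambda>p. (1 / sqrt 2 * \<theta>1 (fst z) p + 1 / sqrt 2 * \<theta>2 (snd z) p) * s p) / 2 / q) *
       (phase (- (1 / sqrt 2 * pw (\<theta>1 (fst z)) y + 1 / sqrt 2 * pw (\<theta>2 (snd z)) y)) * (D1 (fst z) * D2 (snd z))))"
  proof (rule Bochner_Integration.integral_cong[OF refl])
    fix z assume "z \<in> space (\<Omega>1 \<Otimes>\<^sub>M \<Omega>2)"
    then have z: "fst z \<in> space \<Omega>1" "snd z \<in> space \<Omega>2" by (auto simp: space_pair_measure)
    define m where "m = nsq (\<lambda>p. (1 / sqrt 2) * (\<theta>1 (fst z) p * k1 p) + (- 1 / sqrt 2) * (\<theta>2 (snd z) p * k2 p))"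
    define w where "w = phase (- (1 / sqrt 2 * pw (\<theta>1 (fst z)) y + 1 / sqrt 2 * pw (\<theta>2 (snd z)) y))"
    have x: "(a (fst z) + b (snd z) - m / 2) / q = m / 2 / - q + (a (fst z) / q + b (snd z) / q)"
      by (simp add: diff_divide_distrib add_divide_distrib)
    show "phase (nsq (\<lambda>p. (1 / sqrt 2) * (\<theta>1 (fst z) p * k1 p) + (- 1 / sqrt 2) * (\<theta>2 (snd z) p * k2 p)) / 2 / - q) *
       (phase (- (1 / sqrt 2 * pw (\<theta>1 (fst z)) y + 1 / sqrt 2 * pw (\<theta>2 (snd z)) y)) *
        ((phase (a (fst z) / q) * D1 (fst z)) * (phase (b (snd z) / q) * D2 (snd z)))) =
      phase (nsq (\<lambda>p. (1 / sqrt 2 * \<theta>1 (fst z) p + 1 / sqrt 2 * \<theta>2 (snd z) p) * s p) / 2 / q) *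
       (phase (- (1 / sqrt 2 * pw (\<theta>1 (fst z)) y + 1 / sqrt 2 * pw (\<theta>2 (snd z)) y)) * (D1 (fst z) * D2 (snd z)))"
      unfolding exponent[OF z] m_def[symmetric] w_def[symmetric] x phase_add by (simp only: mult_ac)
  qed
  with c show ?thesis by (simp only:)
qed

text \<open>The common value is the integral \<open>c y\<close> over pairs of frequencies. Both
  convolution products attain it at every path; for the transform of the product, \<open>y\<close>
  is restricted to paths at which \<open>pw\<close> is additive for almost every pair.\<close>

lemma convolution_transform_identity:
  assumes F: "F \<in> SL2 S T \<phi> W" and G: "G \<in> SL2 S T \<phi> W" and q: "q \<noteq> 0"
    and hs: "\<forall>h\<in>set hs. bounded_multiplier S T h"
    and s: "bounded_multiplier S T s" and k1: "bounded_multiplier S T k1" and k2: "bounded_multiplier S T k2"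
    and s1: "bounded_multiplier S T s1" and s2: "bounded_multiplier S T s2"
    and ss: "AE p in area S T. (s p)\<^sup>2 = (\<Sum>h\<leftarrow>hs. (h p)\<^sup>2)" and sk: "AE p in area S T. (s p)\<^sup>2 = k1 p * k2 p"
    and s1k: "AE p in area S T. (s1 p)\<^sup>2 = (\<Sum>h\<leftarrow>hs. (h p)\<^sup>2) + (k1 p)\<^sup>2"
    and s2k: "AE p in area S T. (s2 p)\<^sup>2 = (\<Sum>h\<leftarrow>hs. (h p)\<^sup>2) + (k2 p)\<^sup>2"
  shows "s_ae W (\<lambda>y. \<exists>c.
    has_convolution S T \<phi> W (- q) k1 k2
      (transform S T \<phi> W q (over_sqrt2 k1) (iterated_transform S T \<phi> W q (map over_sqrt2 hs) F))
      (transform S T \<phi> W q (over_sqrt2 k2) (iterated_transform S T \<phi> W q (map over_sqrt2 hs) G))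
      y c \<and>
    has_convolution S T \<phi> W (- q) k1 k2
      (transform S T \<phi> W q (over_sqrt2 s1) F)
      (transform S T \<phi> W q (over_sqrt2 s2) G)
      y c \<and>
    has_transform S T \<phi> W q s
      (\<lambda>x. F (\<lambda>p. x p / sqrt 2) * G (\<lambda>p. x p / sqrt 2)) y c)"
proof -
  obtain f g where "corresponds S T \<phi> W F f" "corresponds S T \<phi> W G g" using F G unfolding SL2_def by blast
  then obtain \<Omega>1 D1 \<Omega>2 D2 where rF: "fourier_rep F \<Omega>1 (\<lambda>u. u) D1" and rG: "fourier_rep G \<Omega>2 (\<lambda>u. u) D2"
    using corresponds_fourier_rep by meson
  note r1 = fourier_repD(1-3)[OF rF] and r2 = fourier_repD(1-3)[OF rG]
  let ?\<Omega> = "\<Omega>1 \<Otimes>\<^sub>M \<Omega>2"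
  \<comment> \<open>The divisor 4 is 2 from the variance of the Gaussian average and 2 from the
    quotients by sqrt 2.\<close>
  define A where "A k u = ((\<Sum>h\<leftarrow>hs. nsq (\<lambda>p. u p * h p)) + nsq (\<lambda>p. u p * k p)) / 4" for k u
  have iterated: "fourier_rep (transform S T \<phi> W q (over_sqrt2 k) (iterated_transform S T \<phi> W q (map over_sqrt2 hs) H)) \<Omega> (\<lambda>u. u) (\<lambda>u. phase (A k u / q) * D u)"
    if H: "fourier_rep H \<Omega> (\<lambda>u. u) D" and k: "bounded_multiplier S T k" for H \<Omega> D k
  proof -
    have "\<forall>h\<in>set (map over_sqrt2 hs). bounded_multiplier S T h"
      using hs bounded_multiplier_over_sqrt2 by auto
    from fourier_rep_transform[OF fourier_rep_iterated_transform[OF H q this] bounded_multiplier_over_sqrt2[OF k] q]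
    have "fourier_rep (transform S T \<phi> W q (over_sqrt2 k) (iterated_transform S T \<phi> W q (map over_sqrt2 hs) H)) \<Omega> (\<lambda>u. u)
      (\<lambda>u. phase (nsq (\<lambda>p. u p * k p) / 2 / 2 / q + (\<Sum>h\<leftarrow>hs. nsq (\<lambda>p. u p * h p)) / 2 / 2 / q) * D u)"
      unfolding nsq_over_sqrt2 nsq_map_over_sqrt2 phase_mult_left .
    moreover have "nsq (\<lambda>p. u p * k p) / 2 / 2 / q + (\<Sum>h\<leftarrow>hs. nsq (\<lambda>p. u p * h p)) / 2 / 2 / q = A k u / q" for u
      by (simp add: A_def add_divide_distrib)
    ultimately show ?thesis by simp
  qed
  have combined: "fourier_rep (transform S T \<phi> W q (over_sqrt2 t) H) \<Omega> (\<lambda>u. u) (\<lambda>u. phase (B u / q) * D u)"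
    if H: "fourier_rep H \<Omega> (\<lambda>u. u) D" and t: "bounded_multiplier S T t" and B: "B = (\<lambda>u. nsq (\<lambda>p. u p * t p) / 4)" for H \<Omega> D t B
    using fourier_rep_transform[OF H bounded_multiplier_over_sqrt2[OF t] q] unfolding nsq_over_sqrt2 B by simp
  have A: "A k u = nsq (\<lambda>p. u p * t p) / 4"
    if u: "u \<in> L2 S T" and t: "bounded_multiplier S T t" and k: "bounded_multiplier S T k"
      and ae: "AE p in area S T. (t p)\<^sup>2 = (\<Sum>h\<leftarrow>hs. (h p)\<^sup>2) + (k p)\<^sup>2" for k t u
  proof -
    \<comment> \<open>Appending \<open>k\<close> to \<open>hs\<close> brings the hypothesis on
      \<open>t\<close> into the form of \<open>ip_multiplier_sum_squares\<close>.\<close>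
    have "AE p in area S T. (t p)\<^sup>2 = (\<Sum>h\<leftarrow>hs @ [k]. (h p)\<^sup>2)" using ae by simp
    then have "nsq (\<lambda>p. u p * t p) = (\<Sum>h\<leftarrow>hs @ [k]. nsq (\<lambda>p. u p * h p))"
      using hs k by (intro ip_multiplier_sum_squares u t) auto
    then show ?thesis by (simp add: A_def)
  qed
  have L1: "u \<in> L2 S T" if "u \<in> space \<Omega>1" for u by (rule measurable_LB_space[OF r1(2) that])
  have L2: "u \<in> L2 S T" if "u \<in> space \<Omega>2" for u by (rule measurable_LB_space[OF r2(2) that])
  note ex = phase_exponent[OF L1 L2 hs s k1 k2 ss sk, folded A_def]
  have fin: "finite_measure ?\<Omega>" by (rule finite_measure_pair_measure[OF r2(1) r1(1)])
  have t1: "(\<lambda>z. fst z) \<in> ?\<Omega> \<rightarrow>\<^sub>M LB" by (rule measurable_compose[OF measurable_fst r1(2)])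
  have t2: "(\<lambda>z. snd z) \<in> ?\<Omega> \<rightarrow>\<^sub>M LB" by (rule measurable_compose[OF measurable_snd r2(2)])
  note t = measurable_LB_combination[OF t1 t2, of "1 / sqrt 2" "1 / sqrt 2"]
  have D: "integrable ?\<Omega> (\<lambda>z. D1 (fst z) * D2 (snd z))"
    by (rule integral_pair_product(1)[OF r1(1) r2(1) r1(3) r2(3)])
  define m where "m z = nsq (\<lambda>p. (1 / sqrt 2 * fst z p + 1 / sqrt 2 * snd z p) * s p) / 2 / q" for z
  have mm: "m \<in> borel_measurable ?\<Omega>" unfolding m_def[abs_def]
    by (intro borel_measurable_divide borel_measurable_const measurable_nsq measurable_LB_multiplier t s)
  define c where "c y = (LINT z|?\<Omega>. phase (m z) * (phase (- (1 / sqrt 2 * pw (fst z) y + 1 / sqrt 2 * pw (snd z) y)) * (D1 (fst z) * D2 (snd z))))" for y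
  show ?thesis
    using s_ae_pw_combination[OF fin t1 t2, of "1 / sqrt 2" "1 / sqrt 2"]
  proof (rule s_ae_mono)
    fix y assume "y \<in> space W"
      and comb: "AE z in ?\<Omega>. pw (\<lambda>p. 1 / sqrt 2 * fst z p + 1 / sqrt 2 * snd z p) y = 1 / sqrt 2 * pw (fst z) y + 1 / sqrt 2 * pw (snd z) y"
    then have y: "y \<in> C0 S T" by (simp add: space_W)
    have 1: "has_convolution S T \<phi> W (- q) k1 k2
      (transform S T \<phi> W q (over_sqrt2 k1) (iterated_transform S T \<phi> W q (map over_sqrt2 hs) F))
      (transform S T \<phi> W q (over_sqrt2 k2) (iterated_transform S T \<phi> W q (map over_sqrt2 hs) G)) y (c y)"
      unfolding c_def m_def
      by (rule convolution_of_transforms[OF rF rG iterated[OF rF k1] iterated[OF rG k2] k1 k2 s q y ex])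
    have ex': "nsq (\<lambda>p. (1 / sqrt 2 * u p + 1 / sqrt 2 * v p) * s p) / 2 =
      nsq (\<lambda>p. u p * s1 p) / 4 + nsq (\<lambda>p. v p * s2 p) / 4 -
      nsq (\<lambda>p. 1 / sqrt 2 * (u p * k1 p) + (- 1 / sqrt 2) * (v p * k2 p)) / 2"
      if "u \<in> space \<Omega>1" "v \<in> space \<Omega>2" for u v
      using ex[OF that] unfolding A[OF L1[OF that(1)] s1 k1 s1k] A[OF L2[OF that(2)] s2 k2 s2k] .
    have 2: "has_convolution S T \<phi> W (- q) k1 k2
      (transform S T \<phi> W q (over_sqrt2 s1) F) (transform S T \<phi> W q (over_sqrt2 s2) G) y (c y)"
      unfolding c_def m_def
      by (rule convolution_of_transforms[OF rF rG combined[OF rF s1 refl] combined[OF rG s2 refl] k1 k2 s q y ex'])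
    have "(LINT z|?\<Omega>. phase (m z) * (phase (- pw (\<lambda>p. 1 / sqrt 2 * fst z p + 1 / sqrt 2 * snd z p) y) * (D1 (fst z) * D2 (snd z)))) = c y"
      unfolding c_def
    proof (rule integral_cong_AE)
      show "(\<lambda>z. phase (m z) * (phase (- pw (\<lambda>p. 1 / sqrt 2 * fst z p + 1 / sqrt 2 * snd z p) y) * (D1 (fst z) * D2 (snd z)))) \<in> borel_measurable ?\<Omega>"
        by (intro borel_measurable_integrable integrable_phase D mm borel_measurable_uminus pw_measurable t y)
      show "(\<lambda>z. phase (m z) * (phase (- (1 / sqrt 2 * pw (fst z) y + 1 / sqrt 2 * pw (snd z) y)) * (D1 (fst z) * D2 (snd z)))) \<in> borel_measurable ?\<Omega>"
        by (intro borel_measurable_integrable integrable_phase D mm borel_measurable_uminus borel_measurable_add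
          borel_measurable_times borel_measurable_const pw_measurable t1 t2 y)
      show "AE z in ?\<Omega>. phase (m z) * (phase (- pw (\<lambda>p. 1 / sqrt 2 * fst z p + 1 / sqrt 2 * snd z p) y) * (D1 (fst z) * D2 (snd z))) =
        phase (m z) * (phase (- (1 / sqrt 2 * pw (fst z) y + 1 / sqrt 2 * pw (snd z) y)) * (D1 (fst z) * D2 (snd z)))"
        using comb by eventually_elim (simp only:)
    qed
    with has_transform_fourier_rep[OF fourier_rep_product[OF rF rG] s q y]
    have 3: "has_transform S T \<phi> W q s (\<lambda>x. F (\<lambda>p. x p / sqrt 2) * G (\<lambda>p. x p / sqrt 2)) y (c y)"
      unfolding m_def by simp
    show "\<exists>c.
      has_convolution S T \<phi> W (- q) k1 k2
        (transform S T \<phi> W q (over_sqrt2 k1) (iterated_transform S T \<phi> W q (map over_sqrt2 hs) F))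
        (transform S T \<phi> W q (over_sqrt2 k2) (iterated_transform S T \<phi> W q (map over_sqrt2 hs) G))
        y c \<and>
      has_convolution S T \<phi> W (- q) k1 k2
        (transform S T \<phi> W q (over_sqrt2 s1) F)
        (transform S T \<phi> W q (over_sqrt2 s2) G)
        y c \<and>
      has_transform S T \<phi> W q s
        (\<lambda>x. F (\<lambda>p. x p / sqrt 2) * G (\<lambda>p. x p / sqrt 2)) y c"
      using 1 2 3 by (intro exI[of _ "c y"] conjI)
  qed
qed

end

theorem theorem6p12:
  fixes S T q :: real
    and \<phi> :: "nat \<Rightarrow> plane_fun"
    and W :: "plane_fun measure"
    and k1 k2 sH sHk1 sHk2 :: plane_fun
    and hs :: "plane_fun list"
    and F G :: "plane_fun \<Rightarrow> complex"
    and f g :: "plane_fun set \<Rightarrow> complex"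
  assumes "S > 0" "T > 0"
    and "yeh_wiener S T W"
    and "bv_orthonormal_basis S T \<phi>"
    and "k1 \<in> Supp_BV S T" "k2 \<in> Supp_BV S T"
    and "F \<in> SL2 S T \<phi> W" "corresponds S T \<phi> W F f"
    and "G \<in> SL2 S T \<phi> W" "corresponds S T \<phi> W G g"
    and "hs \<noteq> []" "set hs \<subseteq> Supp_BV S T"
    and "sH \<in> Supp_BV S T"
    and "AE p in lebesgue_on (rect S T). (sH p)\<^sup>2 = (\<Sum>h\<leftarrow>hs. (h p)\<^sup>2)"
    and "AE p in lebesgue_on (rect S T). (sH p)\<^sup>2 = k1 p * k2 p"
    and "sHk1 \<in> Supp_BV S T"
    and "AE p in lebesgue_on (rect S T). (sHk1 p)\<^sup>2 = (\<Sum>h\<leftarrow>hs. (h p)\<^sup>2) + (k1 p)\<^sup>2"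
    and "sHk2 \<in> Supp_BV S T"
    and "AE p in lebesgue_on (rect S T). (sHk2 p)\<^sup>2 = (\<Sum>h\<leftarrow>hs. (h p)\<^sup>2) + (k2 p)\<^sup>2"
    and "q \<noteq> 0"
  shows "s_ae W (\<lambda>y. \<exists>c.
    has_convolution S T \<phi> W (- q) k1 k2
      (transform S T \<phi> W q (over_sqrt2 k1) (iterated_transform S T \<phi> W q (map over_sqrt2 hs) F))
      (transform S T \<phi> W q (over_sqrt2 k2) (iterated_transform S T \<phi> W q (map over_sqrt2 hs) G))
      y c \<and>
    has_convolution S T \<phi> W (- q) k1 k2
      (transform S T \<phi> W q (over_sqrt2 sHk1) F)
      (transform S T \<phi> W q (over_sqrt2 sHk2) G)
      y c \<and>
    has_transform S T \<phi> W q sH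
      (\<lambda>x. F (\<lambda>p. x p / sqrt 2) * G (\<lambda>p. x p / sqrt 2)) y c)"
proof -
  interpret yeh_wiener_space S T \<phi> W by (unfold_locales; fact)
  have b: "bounded_multiplier S T h" if "h \<in> Supp_BV S T" for h
    using bounded_multiplier_Supp_BV assms(1,2) that .
  have "\<forall>h\<in>set hs. bounded_multiplier S T h" using assms(12) b by blast
  then show ?thesis
    using assms b by (intro convolution_transform_identity) simp_all
qed

end
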